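(* Let $b>0$ and $\Gamma>0$ be constants, and write $m:=\pi\int_{\mathbb{R}\times\{x_2=\pi\}}\big|\frac{\partial\rho}{\partial\mathbf n}\big|\,dS_x$. (i) If $\Gamma/b\ge m$, then the set $\mathcal Q$ of all global minimum points of $\mathcal H$ on $\bar\Omega$ is a non-empty bounded set and $\operatorname{dist}(\mathcal Q,\partial\Omega)>0$. Moreover, there exist constants $\theta_2>\theta_1>0$ (independent of $b,\Gamma$) such that, setting $$D_{b,\Gamma}:=\Big\{x\in\Omega:\ \frac{\theta_1}{b+\lambda_{b,\Gamma}}<\operatorname{dist}(x,\partial O_0)<\frac{\theta_2}{b+\lambda_{b,\Gamma}}\Big\}$$ and letting $\mathcal Q_1$ be the set of all minimum points of $\mathcal H$ on $\overline{D}_{b,\Gamma}$, the following (ii) and (iii) hold. (ii) There exists a large constant $b_0>0$ such that if $b>b_0$ and $\Gamma/b\ge m$, then $\mathcal Q_1$ is non-empty and $\operatorname{dist}(\mathcal Q_1,\partial D_{b,\Gamma})>0$. (iii) There exist small constants $\sigma>0$ and $\delta>0$ and a large constant $b_0>0$ such that if $b>b_0$ and $$m\ \le\ \Gamma/b\ \le\ m+\sigma\int_{\partial O_0}\Big|\frac{\partial\rho}{\partial\mathbf n}\Big|\,dS_x ,$$ then $\mathcal Q_1$ and $\mathcal Q_2$ are two non-empty bounded sets and $$\operatorname{dist}(\mathcal Q_1,\partial D_{b,\Gamma})>0,\qquad \operatorname{dist}(\mathcal Q_2,\partial\Omega_\delta)>0,$$ where $\Omega_\delta:=\{x\in\Omega:\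 \operatorname{dist}(x,\partial O_0)>\delta\}$ and $\mathcal Q_2$ is the set of all minimum points of $\mathcal H$ on $\overline{\Omega}_\delta$.
   Context: $S=\mathbb{R}\times(0,\pi)$; $O_0\subset\mathbb{R}^2$ is a bounded, simply connected open set with $C^3$ boundary and $\bar O_0\subset S$; $\Omega=S\setminus\bar O_0$. $\mathbf n$ is the unit outward normal of $\partial\Omega$ (on $\partial O_0$ it points into $O_0$). $\rho\in C^2(\bar\Omega)$ is the unique solution of $\Delta\rho=0$ in $\Omega$, $\rho=1$ on $\partial O_0$, $\rho=0$ on $\partial S$, $\rho,|\nabla\rho|\to0$ as $|x|\to\infty$, and $\lambda_0=\big(\int_{\partial O_0}\frac{\partial\rho}{\partial\mathbf n}dS_x\big)^{-1}>0$. $G_0(y,x)$ is the Green function of $-\Delta$ in $\Omega$ with zero Dirichlet boundary condition (tending to $0$ at infinity), $G(y,x)=G_0(y,x)+\lambda_0\rho(x)\rho(y)$, and $H(y,x)$ is the regular part of $G$: $G(y,x)=\frac1{2\pi}\ln\frac1{|y-x|}-H(y,x)$ (with $H$ extended continuously to $y=x$). For given $b,\Gamma$, the pair $(\eta,\lambda)$ is the unique solution of: $\Delta\eta=0$ in $\Omega$; $\eta=-\lambda$ on $\partial O_0$ ($\lambda$ an unknown constant); $\eta=0$ on $\{x_2=0\}$; $\eta=b\pi$ on $\{x_2=\pi\}$; $\nabla\eta\to(0,b)$ as $|x|\to\infty$; $\int_{\partial O_0}\frac{\partial\eta}{\partial\mathbf n}dS_x=-\Gamma$. The constant is denoted $\lambda_{b,\Gamma}$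 and equals $$\lambda_{b,\Gamma}=\frac{\Gamma-b\pi\int_{\mathbb{R}\times\{x_2=\pi\}}|\frac{\partial\rho}{\partial\mathbf n}|dS_x}{\int_{\partial O_0}\frac{\partial\rho}{\partial\mathbf n}dS_x}.$$ The Kirchhoff–Routh function is $\mathcal H(x)=H(x,x)+2\eta(x)$, $x\in\Omega$ (it depends on $b,\Gamma$), with the convention $\mathcal H=+\infty$ on $\partial\Omega$. *)

theory Defs
  imports "HOL-Analysis.Analysis"
begin

type_synonym plane = "real ^ 2"

definition strip :: "plane set" where
  "strip = {x. 0 < x $ 2 \<and> x $ 2 < pi}"

definition fluid_domain :: "plane set \<Rightarrow> plane set" where
  "fluid_domain O0 = strip - closure O0"


section \<open>\<open>C\<^sup>3\<close> boundaries and boundary integrals\<close>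

definition boundary_param :: "plane set \<Rightarrow> (real \<Rightarrow> plane) \<Rightarrow> bool" where
  "boundary_param U \<gamma> \<longleftrightarrow>
     (\<forall>t. \<gamma> (t + 1) = \<gamma> t) \<and> inj_on \<gamma> {0..<1} \<and> \<gamma> ` {0..<1} = frontier U \<and>
     (\<exists>\<gamma>1 \<gamma>2 \<gamma>3.
        (\<forall>t. (\<gamma> has_vector_derivative \<gamma>1 t) (at t) \<and>
             (\<gamma>1 has_vector_derivative \<gamma>2 t) (at t) \<and>
             (\<gamma>2 has_vector_derivative \<gamma>3 t) (at t) \<and>
             \<gamma>1 t \<noteq> 0) \<and>
        continuous_on UNIV \<gamma>3)"

text \<open>
  The boundary of a bounded simply connected plane domain is connected, so such a domain has
  \<open>C\<^sup>3\<close> boundary precisely when its boundary is a regular simple closed \<open>C\<^sup>3\<close> curve. That the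
  domain lies locally on one side of the curve is then the Jordan curve theorem.
\<close>

definition C3_boundary :: "plane set \<Rightarrow> bool" where
  "C3_boundary U \<longleftrightarrow> (\<exists>\<gamma>. boundary_param U \<gamma>)"

definition obstacle :: "plane set \<Rightarrow> bool" where
  "obstacle O0 \<longleftrightarrow>
     O0 \<noteq> {} \<and> open O0 \<and> bounded O0 \<and> simply_connected O0 \<and> C3_boundary O0 \<and>
     closure O0 \<subseteq> strip"

text \<open>Arc length integral over the boundary; it does not depend on the chosen parametrization.\<close>

definition boundary_integral :: "plane set \<Rightarrow> (plane \<Rightarrow> real) \<Rightarrow> real" where
  "boundary_integral U f =
     (let \<gamma> = (SOME \<gamma>. boundary_param U \<gamma>)
      in LINT t:{0..1}|lborel. f (\<gamma> t) * norm (vector_derivative \<gamma> (at t)))"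

definition top_integral :: "(plane \<Rightarrow> real) \<Rightarrow> real" where
  "top_integral f = (LINT t|lborel. f (vector [t, pi]))"

text \<open>
  At a boundary point \<open>x\<close> where \<open>U\<close> has \<open>C\<^sup>1\<close> boundary, the directions in which \<open>U\<close> can be
  approached from \<open>x\<close> fill a half plane, and the condition below (to first order, \<open>U\<close> lies on
  the non-positive side of \<open>\<nu>\<close>) has the outward unit normal as its only solution.
\<close>

definition outward_normal :: "plane set \<Rightarrow> plane \<Rightarrow> plane" where
  "outward_normal U x =
     (THE \<nu>. norm \<nu> = 1 \<and>
        (\<forall>e>0. eventually (\<lambda>y. (y - x) \<bullet> \<nu> \<le> e * norm (y - x)) (at x within U)))"

text \<open>
  The derivative at a boundary point is taken within the closure of \<open>U\<close>, i.e. it is one-sided;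
  at points with \<open>C\<^sup>1\<close> boundary it is unique.
\<close>

definition normal_deriv :: "plane set \<Rightarrow> (plane \<Rightarrow> real) \<Rightarrow> plane \<Rightarrow> real" where
  "normal_deriv U u x =
     frechet_derivative u (at x within closure U) (outward_normal U x)"


section \<open>Function classes\<close>

text \<open>
  \<open>g\<close> is the gradient and \<open>h\<close> the Hessian matrix of \<open>u\<close>. For \<open>X\<close> open this describes \<open>C\<^sup>2(X)\<close>;
  for the closure of a domain it describes functions all of whose derivatives up to order two
  exist (one-sidedly on the boundary) and are continuous up to the boundary.
\<close>

definition C2_derivs ::
  "plane set \<Rightarrow> (plane \<Rightarrow> real) \<Rightarrow> (plane \<Rightarrow> plane) \<Rightarrow> (plane \<Rightarrow> real ^ 2 ^ 2) \<Rightarrow> bool" where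
  "C2_derivs X u g h \<longleftrightarrow>
     (\<forall>x\<in>X. (u has_derivative (\<lambda>v. g x \<bullet> v)) (at x within X) \<and>
            (g has_derivative (\<lambda>v. h x *v v)) (at x within X)) \<and>
     continuous_on X h"

definition C2_on :: "plane set \<Rightarrow> (plane \<Rightarrow> real) \<Rightarrow> bool" where
  "C2_on X u \<longleftrightarrow> (\<exists>g h. C2_derivs X u g h)"

definition harmonic_on :: "plane set \<Rightarrow> (plane \<Rightarrow> real) \<Rightarrow> bool" where
  "harmonic_on U u \<longleftrightarrow> (\<exists>g h. C2_derivs U u g h \<and> (\<forall>x\<in>U. trace (h x) = 0))"

definition grad :: "(plane \<Rightarrow> real) \<Rightarrow> plane \<Rightarrow> plane" where
  "grad u x = (\<chi> i. frechet_derivative u (at x) (axis i 1))"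

text \<open>The filter \<open>|x| \<rightarrow> \<infinity>\<close> with \<open>x\<close> staying in \<open>U\<close>.\<close>

definition far :: "plane set \<Rightarrow> plane filter" where
  "far U = inf at_infinity (principal U)"


section \<open>The functions \<open>\<rho>\<close>, \<open>G\<close>, \<open>H\<close> and \<open>\<eta>\<close>\<close>

definition is_rho :: "plane set \<Rightarrow> (plane \<Rightarrow> real) \<Rightarrow> bool" where
  "is_rho O0 \<rho> \<longleftrightarrow>
     C2_on (closure (fluid_domain O0)) \<rho> \<and>
     harmonic_on (fluid_domain O0) \<rho> \<and>
     (\<forall>x\<in>frontier O0. \<rho> x = 1) \<and>
     (\<forall>x\<in>frontier strip. \<rho> x = 0) \<and>
     (\<rho> \<longlongrightarrow> 0) (far (fluid_domain O0)) \<and>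
     ((\<lambda>x. norm (grad \<rho> x)) \<longlongrightarrow> 0) (far (fluid_domain O0))"

definition lambda0 :: "plane set \<Rightarrow> (plane \<Rightarrow> real) \<Rightarrow> real" where
  "lambda0 O0 \<rho> = inverse (boundary_integral O0 (normal_deriv (fluid_domain O0) \<rho>))"

text \<open>
  The equation \<open>-\<Delta> G0(\<cdot>, x) = \<delta>\<^sub>x\<close> is expressed by splitting off the fundamental solution
  \<open>ln (1 / |y - x|) / (2 * pi)\<close>, the remainder being harmonic in all of \<open>U\<close>.
\<close>

definition is_green :: "plane set \<Rightarrow> (plane \<Rightarrow> plane \<Rightarrow> real) \<Rightarrow> bool" where
  "is_green U G0 \<longleftrightarrow>
     (\<forall>x\<in>U.
        (\<exists>w. harmonic_on U w \<and>
             (\<forall>y\<in>U - {x}. G0 y x = 1 / (2 * pi) * ln (1 / dist y x) - w y)) \<and>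
        continuous_on (closure U - {x}) (\<lambda>y. G0 y x) \<and>
        (\<forall>y\<in>frontier U. G0 y x = 0) \<and>
        ((\<lambda>y. G0 y x) \<longlongrightarrow> 0) (far U))"

definition green ::
  "plane set \<Rightarrow> (plane \<Rightarrow> real) \<Rightarrow> (plane \<Rightarrow> plane \<Rightarrow> real) \<Rightarrow> plane \<Rightarrow> plane \<Rightarrow> real" where
  "green O0 \<rho> G0 y x = G0 y x + lambda0 O0 \<rho> * \<rho> x * \<rho> y"

definition regular_part :: "(plane \<Rightarrow> plane \<Rightarrow> real) \<Rightarrow> plane \<Rightarrow> plane \<Rightarrow> real" where
  "regular_part G y x =
     (if y = x then Lim (at x) (\<lambda>z. 1 / (2 * pi) * ln (1 / dist z x) - G z x)
      else 1 / (2 * pi) * ln (1 / dist y x) - G y x)"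

text \<open>The pair \<open>(\<eta>, lam)\<close> solves the problem with data \<open>b\<close>, \<open>\<Gamma>\<close>; both are unknowns.\<close>

definition is_eta :: "plane set \<Rightarrow> real \<Rightarrow> real \<Rightarrow> (plane \<Rightarrow> real) \<Rightarrow> real \<Rightarrow> bool" where
  "is_eta O0 b \<Gamma> \<eta> lam \<longleftrightarrow>
     C2_on (closure (fluid_domain O0)) \<eta> \<and>
     harmonic_on (fluid_domain O0) \<eta> \<and>
     (\<forall>x\<in>frontier O0. \<eta> x = - lam) \<and>
     (\<forall>x. x $ 2 = 0 \<longrightarrow> \<eta> x = 0) \<and>
     (\<forall>x. x $ 2 = pi \<longrightarrow> \<eta> x = b * pi) \<and>
     (grad \<eta> \<longlongrightarrow> vector [0, b]) (far (fluid_domain O0)) \<and>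
     boundary_integral O0 (normal_deriv (fluid_domain O0) \<eta>) = - \<Gamma>"


section \<open>The Kirchhoff--Routh function and its minimum points\<close>

definition kirchhoff_routh ::
  "plane set \<Rightarrow> (plane \<Rightarrow> real) \<Rightarrow> (plane \<Rightarrow> plane \<Rightarrow> real) \<Rightarrow> (plane \<Rightarrow> real) \<Rightarrow> plane \<Rightarrow> ereal" where
  "kirchhoff_routh O0 \<rho> G0 \<eta> x =
     (if x \<in> fluid_domain O0
      then ereal (regular_part (green O0 \<rho> G0) x x + 2 * \<eta> x)
      else \<infinity>)"

definition min_points :: "(plane \<Rightarrow> ereal) \<Rightarrow> plane set \<Rightarrow> plane set" where
  "min_points f X = {x \<in> X. \<forall>y\<in>X. f x \<le> f y}"

definition top_flux :: "plane set \<Rightarrow> (plane \<Rightarrow> real) \<Rightarrow> real" where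
  "top_flux O0 \<rho> = pi * top_integral (\<lambda>x. \<bar>normal_deriv (fluid_domain O0) \<rho> x\<bar>)"

definition layer :: "plane set \<Rightarrow> real \<Rightarrow> real \<Rightarrow> real \<Rightarrow> real \<Rightarrow> plane set" where
  "layer O0 \<theta>1 \<theta>2 b lam =
     {x \<in> fluid_domain O0.
        \<theta>1 / (b + lam) < infdist x (frontier O0) \<and> infdist x (frontier O0) < \<theta>2 / (b + lam)}"

definition away :: "plane set \<Rightarrow> real \<Rightarrow> plane set" where
  "away O0 \<delta> = {x \<in> fluid_domain O0. infdist x (frontier O0) > \<delta>}"

end

theory Submission
  imports Defs
begin

text \<open>
  Write \<open>R\<close> for the Robin function, i.e. the regular part of \<open>G0\<close> on the diagonal. Then
  \<open>H = R - \<lambda>0 \<rho>\<^sup>2 + 2 \<eta>\<close>, where the middle term is bounded. This function is called \<open>energy\<close>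
  below. All estimates come from the maximum principle and explicit comparison
  functions.

  Sign of \<open>lam\<close>. The field \<open>\<rho> \<nabla>\<eta> - \<eta> \<nabla>\<rho>\<close> is divergence free. Integrating its normal component
  over the boundary gives \<open>\<Gamma> = lam A + b m\<close> with \<open>A\<close> the integral of \<open>\<bar>\<partial>\<rho>/\<partial>n\<bar>\<close> over the boundary
  of the obstacle (\<open>circulation_identity\<close>). By Hopf's lemma \<open>A > 0\<close>, so that \<open>\<Gamma>/b \<ge> m\<close> says
  \<open>lam \<ge> 0\<close>, and the upper bound on \<open>\<Gamma>/b\<close> says \<open>lam \<le> \<sigma> b\<close>.

  Near the obstacle, at distance \<open>d\<close>, interior and exterior tangent balls of uniform radius
  (\<open>obstacle_tangent_balls\<close>) provide logarithmic barriers. They give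
  \<open>R = - ln d / (2\<pi>) + O(1)\<close> (\<open>robin_upper\<close>, \<open>robin_lower_J\<close>), and \<open>\<eta> + lam\<close> is comparable to
  \<open>(b + lam) d\<close> with constants that do not depend on \<open>b\<close> and \<open>\<Gamma>\<close> (\<open>eta_layer_bounds\<close>). With
  \<open>t = (b + lam) d\<close> the energy is, up to a bounded error and constants that do not depend on the
  point, between \<open>- ln t / (2\<pi>) + 2 c t\<close> and \<open>- ln t / (2\<pi>) + 2 C t\<close>. The lower bound tends to
  infinity both for small and for large \<open>t\<close>. Hence the energy at \<open>t = 1\<close> lies below its values at
  \<open>t = \<theta>1\<close> and \<open>t = \<theta>2\<close> if \<open>\<theta>1\<close> is small and \<open>\<theta>2\<close> is large, which makes the minimum over the layer
  interior.

  Far away the energy approaches the strip profile \<open>f(h) = - ln (2 sin h) / (2\<pi>) + 2 b h\<close>, because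
  \<open>- ln (2 sin h) / (2\<pi>)\<close> is the Robin function of the whole strip. To get compactness of
  minimizing sequences, one needs a point where the energy is below \<open>min f\<close>. Such a point exists
  far out on the line where \<open>f\<close> is minimal: there \<open>b h - \<eta>\<close> is at least of order \<open>exp (- \<bar>x\<^sub>1\<bar>)\<close>,
  whereas the Robin function exceeds that of the strip, and \<open>\<rho>\<^sup>2\<close> exceeds 0, by at most order
  \<open>exp (- 2 \<bar>x\<^sub>1\<bar>)\<close> (\<open>far_low_point\<close>). Below that energy level only a compact part of the fluid
  domain remains (\<open>sublevel_compact\<close>), since the energy tends to infinity at the obstacle and at
  the walls. This gives the global minimum. For the region away from the obstacle it remains to
  see that the inner boundary \<open>d = \<delta>\<close> is too high: there the energy grows at least linearly in \<open>b\<close>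
  if \<open>lam \<le> \<sigma> b\<close> with \<open>\<sigma>\<close> small, whereas \<open>min f \<le> f(1/b) \<le> ln b / (2\<pi>) + 2\<close>.
\<close>

section \<open>Harmonic functions in the plane\<close>

lemma C2_derivs_add:
  assumes "C2_derivs X u g h" "C2_derivs X u' g' h'"
  shows "C2_derivs X (\<lambda>x. u x + u' x) (\<lambda>x. g x + g' x) (\<lambda>x. h x + h' x)"
  using assms unfolding C2_derivs_def
  by (auto intro!: continuous_intros derivative_eq_intros
      simp: inner_add_left matrix_vector_mult_add_rdistrib)

lemma C2_derivs_cmult:
  assumes "C2_derivs X u g h"
  shows "C2_derivs X (\<lambda>x. c * u x) (\<lambda>x. c *\<^sub>R g x) (\<lambda>x. c *\<^sub>R h x)"
  using assms unfolding C2_derivs_def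
  by (auto intro!: continuous_intros derivative_eq_intros
      simp: scaleR_matrix_vector_assoc)

lemma C2_derivs_sq_dist:
  "C2_derivs X (\<lambda>x. c * ((x - a) \<bullet> (x - a))) (\<lambda>x. (2 * c) *\<^sub>R (x - a)) (\<lambda>x. mat (2 * c))"
  unfolding C2_derivs_def
  apply (auto intro!: continuous_intros derivative_eq_intros)
   apply (simp add: fun_eq_iff inner_commute inner_diff_left inner_diff_right algebra_simps)
  by (auto simp: vec_eq_iff matrix_vector_mult_def mat_def if_distrib [of "\<lambda>x. x * _"] cong: if_cong)

lemma C2_derivs_at:
  assumes "C2_derivs U u g h" "open U" "x \<in> U"
  shows "(u has_derivative (\<lambda>v. g x \<bullet> v)) (at x)" "(g has_derivative (\<lambda>v. h x *v v)) (at x)"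
  using assms(1,3) at_within_open [OF assms(3,2)] unfolding C2_derivs_def by auto

lemma trace_cmult: "trace (c *\<^sub>R (A :: real^2^2)) = c * trace A"
  by (simp add: trace_def sum_2 algebra_simps)

lemma harmonic_on_add:
  assumes "harmonic_on U u" "harmonic_on U v"
  shows "harmonic_on U (\<lambda>x. u x + v x)"
proof -
  obtain g h g' h' where "C2_derivs U u g h" "\<forall>x\<in>U. trace (h x) = 0"
    "C2_derivs U v g' h'" "\<forall>x\<in>U. trace (h' x) = 0"
    using assms unfolding harmonic_on_def by blast
  then have "C2_derivs U (\<lambda>x. u x + v x) (\<lambda>x. g x + g' x) (\<lambda>x. h x + h' x)"
    "\<forall>x\<in>U. trace (h x + h' x) = 0"
    by (simp_all add: C2_derivs_add trace_add)
  then show ?thesis unfolding harmonic_on_def by blast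
qed

lemma harmonic_on_cmult:
  assumes "harmonic_on U u"
  shows "harmonic_on U (\<lambda>x. c * u x)"
proof -
  obtain g h where "C2_derivs U u g h" "\<forall>x\<in>U. trace (h x) = 0"
    using assms unfolding harmonic_on_def by blast
  then have "C2_derivs U (\<lambda>x. c * u x) (\<lambda>x. c *\<^sub>R g x) (\<lambda>x. c *\<^sub>R h x)"
    "\<forall>x\<in>U. trace (c *\<^sub>R h x) = 0"
    by (simp_all add: C2_derivs_cmult trace_cmult)
  then show ?thesis unfolding harmonic_on_def by blast
qed

lemma harmonic_on_diff:
  assumes "harmonic_on U u" "harmonic_on U v"
  shows "harmonic_on U (\<lambda>x. u x - v x)"
  using harmonic_on_add [OF assms(1) harmonic_on_cmult [OF assms(2), of "-1"]] by simp

lemma harmonic_on_subset: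
  assumes "harmonic_on U u" "V \<subseteq> U"
  shows "harmonic_on V u"
  using assms unfolding harmonic_on_def C2_derivs_def
  by (blast intro: continuous_on_subset has_derivative_subset)

lemma harmonic_on_cong:
  assumes "harmonic_on U u" "\<And>x. x \<in> U \<Longrightarrow> v x = u x"
  shows "harmonic_on U v"
proof -
  obtain g h where gh: "C2_derivs U u g h" "\<forall>x\<in>U. trace (h x) = 0"
    using assms unfolding harmonic_on_def by blast
  have "C2_derivs U v g h"
    using gh(1) assms(2) unfolding C2_derivs_def
    by (auto intro: has_derivative_transform)
  then show ?thesis using gh(2) unfolding harmonic_on_def by blast
qed

lemma harmonic_on_imp_continuous_on: "harmonic_on U u \<Longrightarrow> continuous_on U u"
  unfolding harmonic_on_def C2_derivs_def continuous_on_eq_continuous_within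
  by (blast intro: has_derivative_continuous)

text \<open>
  Derivatives and the Laplace equation are easiest to check coordinatewise. This lemma and the next
  one turn partial derivatives into the gradient and Hessian of the definition.
\<close>

lemma C2_derivs_componentsI:
  assumes u: "\<And>x. x \<in> U \<Longrightarrow> (u has_derivative (\<lambda>v. p x * v$1 + q x * v$2)) (at x within U)"
    and p: "\<And>x. x \<in> U \<Longrightarrow> (p has_derivative (\<lambda>v. A x * v$1 + B x * v$2)) (at x within U)"
    and q: "\<And>x. x \<in> U \<Longrightarrow> (q has_derivative (\<lambda>v. B x * v$1 + C x * v$2)) (at x within U)"
    and cont: "continuous_on U A" "continuous_on U B" "continuous_on U C"
  shows "C2_derivs U u (\<lambda>x. p x *\<^sub>R axis 1 1 + q x *\<^sub>R axis 2 1)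
    (\<lambda>x. (\<chi> i j. if i = j then if i = 1 then A x else C x else B x) :: real^2^2)"
  unfolding C2_derivs_def
proof (intro conjI ballI)
  fix x assume x: "x \<in> U"
  show "(u has_derivative (\<lambda>v. (p x *\<^sub>R axis 1 1 + q x *\<^sub>R axis 2 1) \<bullet> v)) (at x within U)"
    using u [OF x] by (simp add: inner_add_left inner_axis')
  have *: "((\<chi> i j. if i = j then if i = 1 then A x else C x else B x) :: real^2^2) *v v
      = (A x * v$1 + B x * v$2) *\<^sub>R axis 1 1 + (B x * v$1 + C x * v$2) *\<^sub>R axis 2 1" for v :: plane
    by (simp add: vec_eq_iff matrix_vector_mult_def sum_2 axis_def forall_2)
  show "((\<lambda>x. p x *\<^sub>R axis 1 1 + q x *\<^sub>R axis 2 (1::real)) has_derivative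
      (*v) (\<chi> i j. if i = j then if i = 1 then A x else C x else B x)) (at x within U)"
    unfolding * by (intro has_derivative_add has_derivative_scaleR_left p q x)
next
  have "continuous_on U (\<lambda>x. if i = j then if i = 1 then A x else C x else B x)" for i j :: 2
    using cont by (cases "i = j"; cases "i = 1") simp_all
  then show "continuous_on U (\<lambda>x. (\<chi> i j. if i = j then if i = 1 then A x else C x else B x) :: real^2^2)"
    by (intro continuous_on_vec_lambda)
qed

lemma harmonic_onI:
  assumes u: "\<And>x. x \<in> U \<Longrightarrow> (u has_derivative (\<lambda>v. p x * v$1 + q x * v$2)) (at x)"
    and p: "\<And>x. x \<in> U \<Longrightarrow> (p has_derivative (\<lambda>v. A x * v$1 + B x * v$2)) (at x)"
    and q: "\<And>x. x \<in> U \<Longrightarrow> (q has_derivative (\<lambda>v. B x * v$1 + C x * v$2)) (at x)"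
    and cont: "continuous_on U A" "continuous_on U B" "continuous_on U C"
    and tr: "\<And>x. x \<in> U \<Longrightarrow> A x + C x = 0"
  shows "harmonic_on U u"
proof -
  have "C2_derivs U u (\<lambda>x. p x *\<^sub>R axis 1 1 + q x *\<^sub>R axis 2 1)
    (\<lambda>x. (\<chi> i j. if i = j then if i = 1 then A x else C x else B x) :: real^2^2)"
    using has_derivative_at_withinI [OF u] has_derivative_at_withinI [OF p]
      has_derivative_at_withinI [OF q] cont
    by (intro C2_derivs_componentsI)
  moreover have "trace ((\<chi> i j. if i = j then if i = 1 then A x else C x else B x) :: real^2^2) = 0" if "x \<in> U" for x
    using tr [OF that] by (simp add: trace_def sum_2)
  ultimately show ?thesis unfolding harmonic_on_def by blast
qed

lemma harmonic_on_const: "harmonic_on U (\<lambda>x. c)"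
  by (rule harmonic_onI [where p="\<lambda>_. 0" and q="\<lambda>_. 0" and A="\<lambda>_. 0" and B="\<lambda>_. 0" and C="\<lambda>_. 0"])
    simp_all

lemma has_derivative_vec_nth [derivative_intros]:
  "((\<lambda>x::plane. x $ i) has_derivative (\<lambda>v. v $ i)) F"
  by (rule bounded_linear_imp_has_derivative [OF bounded_linear_vec_nth])

lemma harmonic_on_second_coordinate: "harmonic_on U (\<lambda>x. x $ 2)"
  by (rule harmonic_onI [where p="\<lambda>_. 0" and q="\<lambda>_. 1" and A="\<lambda>_. 0" and B="\<lambda>_. 0" and C="\<lambda>_. 0"])
    (simp_all add: has_derivative_vec_nth)

lemma norm_plane_sq: "(norm (x::plane))\<^sup>2 = (x$1)\<^sup>2 + (x$2)\<^sup>2"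
  by (simp add: norm_vec_def L2_set_def sum_2)

lemma norm_plane: "norm (x::plane) = sqrt ((x$1)\<^sup>2 + (x$2)\<^sup>2)"
  by (simp add: norm_vec_def L2_set_def sum_2)

lemma inner_plane: "(x::plane) \<bullet> y = x$1 * y$1 + x$2 * y$2"
  by (simp add: inner_vec_def sum_2)

lemma harmonic_on_ln_norm:
  assumes "c \<notin> U"
  shows "harmonic_on U (\<lambda>x. ln (norm (x - c)))"
proof -
  define r where "r x = (x$1 - c$1)\<^sup>2 + (x$2 - c$2)\<^sup>2" for x :: plane
  have r: "r x > 0" if "x \<in> U" for x
  proof -
    have "x \<noteq> c" using that assms by auto
    then have "0 < (norm (x - c))\<^sup>2" by simp
    then show ?thesis by (simp add: norm_plane_sq r_def)
  qed
  have "harmonic_on U (\<lambda>x. (1/2) * ln (r x))"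
  proof (rule harmonic_onI)
    fix x assume x: "x \<in> U"
    have dr: "(r has_derivative (\<lambda>v. 2 * (x$1 - c$1) * v$1 + 2 * (x$2 - c$2) * v$2)) (at x)"
      unfolding r_def by (auto intro!: derivative_eq_intros simp: algebra_simps)
    have r0: "r x > 0" "r x \<noteq> 0" using r [OF x] by auto
    have r_eq: "r x = (x$1 - c$1) * (x$1 - c$1) + (x$2 - c$2) * (x$2 - c$2)"
      by (simp add: r_def power2_eq_square)
    have d1: "((\<lambda>x. x$i - c$i) has_derivative (\<lambda>v. v$i)) (at x)" for i
      by (auto intro!: derivative_eq_intros)
    show "((\<lambda>x. 1 / 2 * ln (r x)) has_derivative
           (\<lambda>v. (x$1 - c$1) / r x * v $ 1 + (x$2 - c$2) / r x * v $ 2)) (at x)"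
      by (rule has_derivative_eq_rhs [OF has_derivative_mult_right [OF has_derivative_ln [OF r0(1) dr]]])
         (use r0 in \<open>simp add: fun_eq_iff divide_simps\<close>, simp add: algebra_simps)
    show "((\<lambda>x. (x$1 - c$1) / r x) has_derivative
       (\<lambda>v. ((x$2 - c$2)\<^sup>2 - (x$1 - c$1)\<^sup>2) / (r x)\<^sup>2 * v $ 1
          + (- 2 * (x$1 - c$1) * (x$2 - c$2)) / (r x)\<^sup>2 * v $ 2)) (at x)"
      by (rule has_derivative_eq_rhs [OF has_derivative_divide' [OF d1 dr r0(2)]])
         (simp add: fun_eq_iff power2_eq_square r_eq algebra_simps flip: add_divide_distrib diff_divide_distrib)
    show "((\<lambda>x. (x$2 - c$2) / r x) has_derivative
       (\<lambda>v. (- 2 * (x$1 - c$1) * (x$2 - c$2)) / (r x)\<^sup>2 * v $ 1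
         + ((x$1 - c$1)\<^sup>2 - (x$2 - c$2)\<^sup>2) / (r x)\<^sup>2 * v $ 2)) (at x)"
      by (rule has_derivative_eq_rhs [OF has_derivative_divide' [OF d1 dr r0(2)]])
         (simp add: fun_eq_iff power2_eq_square r_eq algebra_simps flip: add_divide_distrib diff_divide_distrib)
    show "((x$2 - c$2)\<^sup>2 - (x$1 - c$1)\<^sup>2) / (r x)\<^sup>2 + ((x$1 - c$1)\<^sup>2 - (x$2 - c$2)\<^sup>2) / (r x)\<^sup>2 = 0"
      by (simp flip: add_divide_distrib)
  next
    have "continuous_on U r" unfolding r_def by (intro continuous_intros)
    moreover have "\<forall>x\<in>U. (r x)\<^sup>2 \<noteq> 0" using r by force
    ultimately show
      "continuous_on U (\<lambda>x. ((x$2 - c$2)\<^sup>2 - (x$1 - c$1)\<^sup>2) / (r x)\<^sup>2)"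
      "continuous_on U (\<lambda>x. (- 2 * (x$1 - c$1) * (x$2 - c$2)) / (r x)\<^sup>2)"
      "continuous_on U (\<lambda>x. ((x$1 - c$1)\<^sup>2 - (x$2 - c$2)\<^sup>2) / (r x)\<^sup>2)"
      by (auto intro!: continuous_intros)
  qed
  then show ?thesis
    by (rule harmonic_on_cong)
      (simp add: norm_plane r_def ln_sqrt)
qed

text \<open>
  The second derivative test along each coordinate line: if a diagonal entry of the Hessian were
  positive, the partial derivative, which vanishes at the maximum, would be positive just beyond it,
  and the function would increase.
\<close>

lemma C2_local_max_imp_trace_nonpos:
  assumes "C2_derivs U u g h" "open U" "x \<in> U" "e > 0"
    and max: "\<And>y. dist x y < e \<Longrightarrow> u y \<le> u x"
  shows "trace (h x) \<le> 0"
proof -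
  obtain d where d: "d > 0" "ball x d \<subseteq> U" and de: "d \<le> e"
  proof -
    obtain d' where "d' > 0" "ball x d' \<subseteq> U" using assms open_contains_ball by blast
    then show ?thesis using \<open>e > 0\<close>
      by (intro that [of "min d' e"]) (auto simp: subset_iff)
  qed
  have "h x $ i $ i \<le> 0" for i
  proof (rule ccontr)
    assume "\<not> h x $ i $ i \<le> 0"
    then have pos: "h x $ i $ i > 0" by simp
    define l where "l t = x + t *\<^sub>R axis i (1::real)" for t
    have l: "(l has_derivative (\<lambda>t. t *\<^sub>R axis i 1)) F" for F
      unfolding l_def by (auto intro!: derivative_eq_intros)
    have lU: "l t \<in> U" if "\<bar>t\<bar> < d" for t
    proof -
      have "l t \<in> ball x d" using that by (simp add: l_def dist_norm)
      then show ?thesis using d by blast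
    qed
    have der1: "((\<lambda>t. u (l t)) has_real_derivative g (l t) $ i) (at t)" if "\<bar>t\<bar> < d" for t
    proof -
      have "(u has_derivative (\<lambda>v. g (l t) \<bullet> v)) (at (l t))"
        by (rule C2_derivs_at [OF assms(1,2) lU [OF that]])
      from has_derivative_compose [where f=l and x=t and s=UNIV, OF l this] show ?thesis
        by (simp add: has_field_derivative_def inner_axis mult_commute_abs)
    qed
    have der2: "((\<lambda>t. g (l t) $ i) has_real_derivative h x $ i $ i) (at 0)"
    proof -
      have "(g has_derivative (\<lambda>v. h x *v v)) (at (l 0))"
        using C2_derivs_at(2) [OF assms(1-3)] by (simp add: l_def)
      from has_derivative_compose [where f=l and x=0 and s=UNIV, OF l this]
      have "((\<lambda>t. g (l t)) has_derivative (\<lambda>t. h x *v (t *\<^sub>R axis i 1))) (at 0)" .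
      from bounded_linear.has_derivative [OF bounded_linear_vec_nth this, of i]
      show ?thesis
        by (simp add: has_field_derivative_def matrix_vector_mult_scaleR mult_commute_abs
            matrix_vector_mult_basis column_def)
    qed
    have l0: "l 0 = x" by (simp add: l_def)
    have "g (l 0) $ i = 0"
    proof (rule DERIV_local_max [OF der1])
      show "\<forall>y. \<bar>0 - y\<bar> < d \<longrightarrow> u (l y) \<le> u (l 0)"
        using max de by (auto simp: l_def dist_norm)
    qed (use d in auto)
    with DERIV_pos_inc_right [OF der2 pos] obtain d' where d': "d' > 0"
      and inc: "\<And>t. 0 < t \<Longrightarrow> t < d' \<Longrightarrow> g (l t) $ i > 0" by auto
    define t where "t = min d d' / 2"
    have t: "0 < t" "t < d" "t < d'" using d d' by (auto simp: t_def)
    obtain z where z: "0 < z" "z < t" "u (l t) - u (l 0) = (t - 0) * g (l z) $ i"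
      using MVT2 [of 0 t "\<lambda>t. u (l t)" "\<lambda>t. g (l t) $ i"] der1 t by force
    have "u (l t) > u (l 0)"
      using z inc [of z] t by (smt (verit) mult_pos_pos)
    moreover have "u (l t) \<le> u (l 0)"
      using max [of "l t"] t de by (auto simp: l_def dist_norm)
    ultimately show False by simp
  qed
  then show ?thesis by (simp add: trace_def sum_2 add_nonpos_nonpos)
qed

text \<open>
  The hypothesis says that \<open>u\<close> is asymptotically nonpositive at the boundary and at infinity; it
  is the form in which all later boundary conditions are fed in. If \<open>u x > 0\<close>, a small multiple of
  \<open>\<bar>y - x\<bar>\<^sup>2\<close> added to \<open>u\<close> makes the Laplacian positive and still leaves an interior maximum, which
  contradicts the second derivative test.
\<close>

theorem maximum_principle:
  assumes "open U" and harm: "harmonic_on U u"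
    and K: "\<And>e. e > 0 \<Longrightarrow> \<exists>K. compact K \<and> K \<subseteq> U \<and> (\<forall>x\<in>U - K. u x \<le> e)"
    and "x \<in> U"
  shows "u x \<le> 0"
proof (rule ccontr)
  assume "\<not> u x \<le> 0"
  then have ux: "u x > 0" by simp
  obtain K where K: "compact K" "K \<subseteq> U" "\<And>y. y \<in> U - K \<Longrightarrow> u y \<le> u x / 2"
    using K [of "u x / 2"] ux by auto
  obtain B where B: "\<And>y. y \<in> K \<Longrightarrow> norm (y - x) \<le> B" "B > 0"
  proof -
    have "bounded ((\<lambda>y. y - x) ` K)" using K(1)
      by (simp add: compact_imp_bounded bounded_translation_minus)
    then show ?thesis using that unfolding bounded_pos by blast
  qed
  (* On the compact set K the added term is at most u x / 4, so a maximum point m of v still has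
     u m > u x / 2 and therefore lies in the interior of K. *)
  define c where "c = u x / (4 * B\<^sup>2)"
  have c: "c > 0" using B ux by (simp add: c_def)
  define v where "v y = u y + c * ((y - x) \<bullet> (y - x))" for y
  obtain g h where gh: "C2_derivs U u g h" "\<And>x. x \<in> U \<Longrightarrow> trace (h x) = 0"
    using harm unfolding harmonic_on_def by blast
  have C2v: "C2_derivs U v (\<lambda>y. g y + (2 * c) *\<^sub>R (y - x)) (\<lambda>y. h y + mat (2 * c))"
    unfolding v_def by (intro C2_derivs_add gh C2_derivs_sq_dist)
  have xK: "x \<in> K" using K(3) \<open>x \<in> U\<close> ux by force
  have contu: "continuous_on U u" by (rule harmonic_on_imp_continuous_on [OF harm])
  have "continuous_on K v"
    unfolding v_def by (intro continuous_intros continuous_on_subset [OF contu K(2)])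
  then obtain m where m: "m \<in> K" "\<And>y. y \<in> K \<Longrightarrow> v y \<le> v m"
    using continuous_attains_sup [OF K(1)] xK by blast
  have vx: "v x = u x" by (simp add: v_def)
  have um: "u m > u x / 2"
  proof -
    have "c * ((m - x) \<bullet> (m - x)) \<le> c * B\<^sup>2"
      using B(1) [OF m(1)] c by (simp add: dot_square_norm power_mono)
    also have "\<dots> = u x / 4" using B by (simp add: c_def)
    finally show ?thesis using m(2) [OF xK] vx ux by (simp add: v_def)
  qed
  have mU: "m \<in> U" using m K by auto
  have "\<forall>\<^sub>F y in at m. u y > u x / 2 \<and> y \<in> U"
    using contu um mU \<open>open U\<close>
    by (intro eventually_conj order_tendstoD [of u "u m"])
       (auto simp: continuous_on_eq_continuous_at isCont_def eventually_at_in_open' eventually_at_topological)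
  then obtain e where e: "e > 0" "\<And>y. y \<noteq> m \<Longrightarrow> dist y m < e \<Longrightarrow> u y > u x / 2 \<and> y \<in> U"
    unfolding eventually_at by auto
  have "v y \<le> v m" if "dist m y < e" for y
  proof (cases "y = m")
    case False
    with e(2) that K(3) have "y \<in> K" by (force simp: dist_commute)
    then show ?thesis by (rule m)
  qed auto
  from C2_local_max_imp_trace_nonpos [OF C2v \<open>open U\<close> mU e(1) this]
  have "trace (mat (2 * c) :: real^2^2) \<le> 0" using gh(2) [OF mU] by (simp add: trace_add)
  then show False using c by (simp add: trace_def mat_def sum_2)
qed

section \<open>Maximum principles and positivity\<close>

lemma eventually_far: "eventually P (far U) \<longleftrightarrow> (\<exists>b. \<forall>x\<in>U. b \<le> norm x \<longrightarrow> P x)"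
  unfolding far_def eventually_inf_principal eventually_at_infinity by auto

text \<open>
  The closed set \<open>P\<close> consists of singularities; it suffices to know the sign of \<open>u\<close> in the
  neighbourhood \<open>V\<close> of \<open>P\<close>. For Green functions \<open>P\<close> is the pole, and \<open>P = {}\<close> gives the usual
  maximum principle.
\<close>

lemma maximum_principle_poles:
  assumes "open U" "closed P" "open V" "P \<subseteq> V"
    and harm: "harmonic_on (U - P) u" and cont: "continuous_on (closure U - P) u"
    and bdry: "\<And>x. x \<in> frontier U - P \<Longrightarrow> u x \<le> 0"
    and V: "\<And>x. x \<in> V \<inter> U - P \<Longrightarrow> u x \<le> 0"
    and far: "\<And>e. e > 0 \<Longrightarrow> eventually (\<lambda>x. u x \<le> e) (far U)"
    and x: "x \<in> U - P"
  shows "u x \<le> 0"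
proof (rule maximum_principle [OF _ harm _ x])
  show "open (U - P)" using assms by auto
  fix e :: real assume e: "e > 0"
  have "e/2 > 0" using e by simp
  from far [OF this] obtain b where b: "\<And>x. x \<in> U \<Longrightarrow> b \<le> norm x \<Longrightarrow> u x \<le> e/2"
    unfolding eventually_far by auto
  define K where "K = {x \<in> closure U - V. u x \<ge> e}"
  have sub: "closure U - V \<subseteq> closure U - P" using \<open>P \<subseteq> V\<close> by auto
  have "closed (closure U - V)" using \<open>open V\<close> by auto
  moreover have "K = (closure U - V) \<inter> u -` {e..}" by (auto simp: K_def)
  ultimately have "closed K"
    using continuous_closed_preimage [OF continuous_on_subset [OF cont sub]] by simp
  have KU: "K \<subseteq> U - P"
  proof
    fix y assume y: "y \<in> K"
    then have "y \<notin> frontier U - P" using bdry [of y] e by (auto simp: K_def)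
    then show "y \<in> U - P" using y sub \<open>open U\<close>
      by (auto simp: K_def frontier_def interior_open)
  qed
  have "K \<subseteq> cball 0 \<bar>b\<bar>"
  proof
    fix y assume y: "y \<in> K"
    then have "u y \<ge> e" "y \<in> U" using KU by (auto simp: K_def)
    then show "y \<in> cball 0 \<bar>b\<bar>" using b [of y] e by force
  qed
  then have "compact K" using \<open>closed K\<close> bounded_cball bounded_subset
    by (metis compact_eq_bounded_closed)
  moreover have "u y \<le> e" if "y \<in> U - P - K" for y
  proof (cases "y \<in> V")
    case True
    then show ?thesis using V [of y] that e by auto
  next
    case False
    then show ?thesis using that closure_subset [of U] by (auto simp: K_def)
  qed
  ultimately show "\<exists>K. compact K \<and> K \<subseteq> U - P \<and> (\<forall>x\<in>U - P - K. u x \<le> e)"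
    using KU by blast
qed

lemma maximum_principle_closure:
  assumes "open U" and harm: "harmonic_on U u" and cont: "continuous_on (closure U) u"
    and bdry: "\<And>x. x \<in> frontier U \<Longrightarrow> u x \<le> 0"
    and far: "\<And>e. e > 0 \<Longrightarrow> eventually (\<lambda>x. u x \<le> e) (far U)"
    and x: "x \<in> closure U"
  shows "u x \<le> 0"
proof (cases "x \<in> U")
  case True
  then show ?thesis
    using maximum_principle_poles [of U "{}" "{}" u x] \<open>open U\<close> harm cont bdry far by simp
next
  case False
  then have "x \<in> frontier U" using x \<open>open U\<close> by (simp add: frontier_def interior_open)
  then show ?thesis by (rule bdry)
qed

lemma far_bounded: "bounded U \<Longrightarrow> eventually P (far U)"
proof -
  assume "bounded U"
  then obtain b where "\<forall>x\<in>U. norm x < b" unfolding bounded_pos_less by blast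
  then show ?thesis unfolding eventually_far by (intro exI [of _ b]) fastforce
qed

text \<open>
  The left-hand side is the radial harmonic function with values \<open>a\<close> and \<open>0\<close> on the two circles, so
  this is a comparison with the fundamental solution. It is the barrier behind strong positivity and
  Hopf's lemma.
\<close>

lemma annulus_lower_bound:
  fixes c :: plane
  assumes r: "0 < r" "r < R"
    and harm: "harmonic_on {x. r < dist c x \<and> dist c x < R} u"
    and cont: "continuous_on {x. r \<le> dist c x \<and> dist c x \<le> R} u"
    and inner: "\<And>x. dist c x = r \<Longrightarrow> a \<le> u x"
    and outer: "\<And>x. dist c x = R \<Longrightarrow> 0 \<le> u x"
    and x: "r \<le> dist c x" "dist c x \<le> R"
  shows "a / ln (R / r) * ln (R / dist c x) \<le> u x"
proof -
  define A where "A = {x. r < dist c x \<and> dist c x < R}"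
  define C where "C = {x. r \<le> dist c x \<and> dist c x \<le> R}"
  have lnpos: "ln (R / r) > 0" using r by simp
  define k where "k = a / ln (R / r)"
  define v where "v y = (k * ln R - k * ln (norm (y - c))) - u y" for y
  have openA: "open A" unfolding A_def by (intro open_Collect_conj open_Collect_less continuous_intros)
  have closedC: "closed C" unfolding C_def by (intro closed_Collect_conj closed_Collect_le continuous_intros)
  have clA: "closure A \<subseteq> C" by (rule closure_minimal [OF _ closedC]) (auto simp: A_def C_def)
  have "c \<notin> A" using r by (auto simp: A_def)
  then have harmv: "harmonic_on A v" unfolding v_def
    using harm unfolding A_def
    by (intro harmonic_on_diff harmonic_on_const harmonic_on_cmult harmonic_on_ln_norm)
  have "continuous_on C v" unfolding v_def
    using cont r by (auto intro!: continuous_intros simp: C_def)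
  then have contv: "continuous_on (closure A) v" using clA continuous_on_subset by blast
  have bdry: "v y \<le> 0" if "y \<in> C" "y \<notin> A" for y
  proof -
    from that consider "dist c y = r" | "dist c y = R" by (auto simp: A_def C_def)
    then show ?thesis
    proof cases
      case 1
      then have "v y = k * ln (R / r) - u y" using r
        by (simp add: v_def ln_div algebra_simps dist_norm norm_minus_commute)
      also have "\<dots> = a - u y" using lnpos by (simp add: k_def)
      finally show ?thesis using inner [OF 1] by simp
    next
      case 2
      then show ?thesis using outer [OF 2] by (simp add: v_def dist_norm norm_minus_commute)
    qed
  qed
  have v_le: "v y \<le> 0" if "y \<in> C" for y
  proof (cases "y \<in> closure A")
    case True
    show ?thesis
    proof (rule maximum_principle_closure [OF openA harmv contv _ _ True])
      show "v y \<le> 0" if "y \<in> frontier A" for y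
        using that clA openA by (intro bdry) (auto simp: frontier_def interior_open)
      have "bounded A" by (rule bounded_subset [OF bounded_cball [of c R]]) (auto simp: A_def)
      then show "eventually (\<lambda>x. v x \<le> e) (far A)" for e by (rule far_bounded)
    qed
  next
    case False
    then show ?thesis using bdry [OF that] closure_subset by blast
  qed
  have "x \<in> C" using x by (simp add: C_def)
  from v_le [OF this] have "k * (ln R - ln (norm (x - c))) \<le> u x"
    by (simp add: v_def algebra_simps)
  moreover have "ln (R / dist c x) = ln R - ln (norm (x - c))"
  proof -
    have "dist c x > 0" "R > 0" using r x by linarith+
    then show ?thesis by (simp add: ln_div dist_norm norm_minus_commute)
  qed
  ultimately show ?thesis by (simp add: k_def)
qed

text \<open>
  The zero set of \<open>u\<close> is relatively closed. It is also open: if \<open>u x = 0\<close> and \<open>u c > 0\<close> for some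
  \<open>c\<close> near \<open>x\<close>, then the barrier in an annulus around \<open>c\<close> that contains \<open>x\<close> gives \<open>u x > 0\<close>. So
  connectedness rules out a zero.
\<close>

lemma harmonic_nonneg_imp_pos:
  assumes "open U" "connected U" and harm: "harmonic_on U u"
    and nonneg: "\<And>x. x \<in> U \<Longrightarrow> 0 \<le> u x" and x0: "x0 \<in> U" "0 < u x0" and "x \<in> U"
  shows "0 < u x"
proof -
  define S where "S = {x \<in> U. 0 < u x}"
  have cont: "continuous_on U u" by (rule harmonic_on_imp_continuous_on [OF harm])
  have "S = U \<inter> u -` {0<..}" by (auto simp: S_def)
  then have openS: "open S" using cont \<open>open U\<close> by (auto intro: continuous_open_preimage)
  have "open (U - S)"
    unfolding open_contains_ball
  proof
    fix x assume x: "x \<in> U - S"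
    then have ux: "u x = 0" using nonneg [of x] by (auto simp: S_def)
    obtain R where R: "R > 0" "ball x R \<subseteq> U"
      using x \<open>open U\<close> open_contains_ball by blast
    have "ball x (R/4) \<inter> S = {}"
    proof (rule ccontr)
      assume "ball x (R/4) \<inter> S \<noteq> {}"
      then obtain c where c: "dist x c < R/4" "c \<in> S" by auto
      have "open {y \<in> U. u c / 2 < u y}"
      proof -
        have "{y \<in> U. u c / 2 < u y} = U \<inter> u -` {u c / 2<..}" by auto
        then show ?thesis using cont \<open>open U\<close> by (auto intro: continuous_open_preimage)
      qed
      moreover have "c \<in> {y \<in> U. u c / 2 < u y}" using c by (auto simp: S_def)
      ultimately obtain r' where r': "r' > 0" "cball c r' \<subseteq> {y \<in> U. u c / 2 < u y}"
        using open_contains_cball by blast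
      define r where "r = min r' (R/4)"
      have r: "0 < r" "r < R/2" "cball c r \<subseteq> {y \<in> U. u c / 2 < u y}"
        using r' R by (auto simp: r_def subset_iff)
      have sub: "cball c (R/2) \<subseteq> U"
      proof
        fix y assume "y \<in> cball c (R/2)"
        then have "dist x y < R" using c(1) R(1) dist_triangle [of x y c] by simp
        then show "y \<in> U" using R by auto
      qed
      have uc: "u c > 0" using c by (simp add: S_def)
      have "x \<notin> cball c r" using r(3) ux uc by auto
      then have rx: "r \<le> dist c x" by simp
      have "u c / 2 / ln (R / 2 / r) * ln (R / 2 / dist c x) \<le> u x"
      proof (rule annulus_lower_bound [OF r(1,2)])
        show "harmonic_on {x. r < dist c x \<and> dist c x < R / 2} u"
          by (rule harmonic_on_subset [OF harm]) (use sub in auto)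
        show "continuous_on {x. r \<le> dist c x \<and> dist c x \<le> R / 2} u"
          by (rule continuous_on_subset [OF cont]) (use sub in auto)
        show "u c / 2 \<le> u y" if "dist c y = r" for y using r(3) that by force
        show "0 \<le> u y" if "dist c y = R/2" for y using sub nonneg that by force
      qed (use rx c R zero_le_dist [of c x] in \<open>auto simp: dist_commute simp del: zero_le_dist\<close>)
      moreover have "ln (R / 2 / dist c x) > 0" "ln (R/2/r) > 0"
      proof -
        have "0 < dist c x" "dist c x < R/2" using r rx c(1) R by (auto simp: dist_commute)
        then have "R / 2 / dist c x > 1" by (simp add: field_simps)
        then show "ln (R / 2 / dist c x) > 0" by simp
        have "R / 2 / r > 1" using r by (simp add: field_simps)
        then show "ln (R / 2 / r) > 0" by simp
      qed
      ultimately show False using uc ux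
        by (smt (verit) divide_pos_pos mult_pos_pos half_gt_zero)
    qed
    then have "ball x (min R (R/4)) \<subseteq> U - S" using R by (auto simp: subset_iff disjoint_iff)
    then show "\<exists>e>0. ball x e \<subseteq> U - S" using R by (intro exI [of _ "min R (R/4)"]) auto
  qed
  with \<open>connected U\<close> openS x0 have "U - S = {}"
    using connectedD [of U S "U - S"] by (auto simp: S_def)
  then show ?thesis using \<open>x \<in> U\<close> by (auto simp: S_def)
qed

section \<open>The strip and the exterior of the obstacle\<close>

lemma vector2_nth [simp]: "(vector [a, b] :: plane) $ 1 = a" "(vector [a, b] :: plane) $ 2 = b"
  by (simp_all add: vector_2)

lemma plane_eqI: "x $ 1 = y $ 1 \<Longrightarrow> x $ 2 = y $ 2 \<Longrightarrow> x = (y :: plane)"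
  by (simp add: vec_eq_iff forall_2)

lemma vector_nth_plane [simp]: "vector [x $ 1, x $ 2] = (x :: plane)"
  by (rule plane_eqI) simp_all

lemma continuous_on_vector2 [continuous_intros]:
  assumes "continuous_on S f" "continuous_on S g"
  shows "continuous_on S (\<lambda>t. vector [f t, g t] :: plane)"
proof -
  have "(\<lambda>t. vector [f t, g t] :: plane) = (\<lambda>t. f t *\<^sub>R axis 1 1 + g t *\<^sub>R axis 2 1)"
    by (auto simp: vec_eq_iff forall_2 axis_def)
  then show ?thesis using assms by (simp only:) (intro continuous_intros)
qed

lemma open_strip: "open strip"
  unfolding strip_def by (intro open_Collect_conj open_Collect_less continuous_intros)

lemma convex_strip: "convex strip"
proof -
  have "strip = {x. axis 2 1 \<bullet> x > 0} \<inter> {x. axis 2 1 \<bullet> x < pi}"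
    by (auto simp: strip_def inner_axis')
  then show ?thesis
    by (metis convex_Int convex_halfspace_gt convex_halfspace_lt)
qed

lemma closure_strip: "closure strip = {x. 0 \<le> x $ 2 \<and> x $ 2 \<le> pi}"
proof
  have "closed {x :: plane. 0 \<le> x $ 2 \<and> x $ 2 \<le> pi}"
    by (intro closed_Collect_conj closed_Collect_le continuous_intros)
  then show "closure strip \<subseteq> {x. 0 \<le> x $ 2 \<and> x $ 2 \<le> pi}"
    by (intro closure_minimal) (auto simp: strip_def)
  show "{x. 0 \<le> x $ 2 \<and> x $ 2 \<le> pi} \<subseteq> closure strip"
  proof
    fix x :: plane assume x: "x \<in> {x. 0 \<le> x $ 2 \<and> x $ 2 \<le> pi}"
    show "x \<in> closure strip"
      unfolding closure_approachable
    proof (intro allI impI)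
      fix e :: real assume e: "e > 0"
      define s where "s = min (1/2) (e / (2 * pi))"
      have s: "0 < s" "s < 1" "s * pi < e" using e
        by (auto simp: s_def min_def field_simps)
      define y :: plane where "y = vector [x $ 1, x $ 2 + s * (pi/2 - x $ 2)]"
      have "y $ 2 = (1 - s) * x $ 2 + s * (pi / 2)" by (simp add: y_def algebra_simps)
      moreover have "(1 - s) * x $ 2 \<ge> 0" "(1 - s) * x $ 2 \<le> (1 - s) * pi"
        using s x by auto
      moreover have "s * (pi/2) > 0" "(1 - s) * pi + s * (pi/2) < pi" using s by (auto simp: algebra_simps)
      ultimately have "y \<in> strip" unfolding strip_def by (smt (verit) mem_Collect_eq)
      moreover have "dist y x < e"
      proof -
        have "dist y x = \<bar>s * (pi/2 - x $ 2)\<bar>"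
          by (simp add: dist_norm norm_plane y_def)
        also have "\<dots> = s * \<bar>pi/2 - x $ 2\<bar>" using s by (simp add: abs_mult)
        also have "\<dots> \<le> s * pi" using x s by (intro mult_left_mono) auto
        finally show ?thesis using s by simp
      qed
      ultimately show "\<exists>y\<in>strip. dist y x < e" by blast
    qed
  qed
qed

lemma frontier_strip: "frontier strip = {x. x $ 2 = 0 \<or> x $ 2 = pi}"
  using pi_gt_zero unfolding frontier_def interior_open [OF open_strip] closure_strip
  by (auto simp: strip_def)

text \<open>
  The Jordan curve theorem and Janiszewski's theorem concern the complex plane; these two maps
  transport them.
\<close>

definition to_complex :: "plane \<Rightarrow> complex" where
  "to_complex v = Complex (v $ 1) (v $ 2)"

definition of_complex :: "complex \<Rightarrow> plane" where
  "of_complex z = vector [Re z, Im z]"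

lemma of_to_complex [simp]: "of_complex (to_complex v) = v"
  by (simp add: of_complex_def to_complex_def)

lemma to_of_complex [simp]: "to_complex (of_complex z) = z"
  by (simp add: of_complex_def to_complex_def)

lemma continuous_on_of_complex: "continuous_on S of_complex"
  unfolding of_complex_def by (intro continuous_intros)

lemma continuous_on_to_complex: "continuous_on S to_complex"
  unfolding to_complex_def Complex_eq by (intro continuous_intros)

lemma to_complex_image_Compl: "to_complex ` (- S) = - to_complex ` S"
  by (rule bij_image_Compl_eq) (auto intro!: bij_betwI [of _ _ _ of_complex])

lemma to_complex_image_eq_vimage: "to_complex ` S = of_complex -` S"
  by (auto simp: image_iff) (metis to_of_complex)

lemma open_to_complex_image: "open S \<Longrightarrow> open (to_complex ` S)"
  unfolding to_complex_image_eq_vimage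
  by (rule open_vimage) (auto simp: continuous_on_of_complex)

lemma boundary_param_continuous:
  assumes "boundary_param U \<gamma>" shows "continuous_on S \<gamma>"
proof -
  obtain \<gamma>1 where "\<And>t. (\<gamma> has_vector_derivative \<gamma>1 t) (at t)"
    using assms unfolding boundary_param_def by blast
  then have "isCont \<gamma> t" for t by (rule has_vector_derivative_continuous)
  then show ?thesis by (simp add: continuous_at_imp_continuous_on)
qed

lemma boundary_param_image:
  assumes "boundary_param U \<gamma>" shows "\<gamma> ` {0..1} = frontier U"
proof -
  have "\<gamma> 1 = \<gamma> 0" using assms unfolding boundary_param_def by (metis add_0)
  moreover have "{0..1} = insert 1 {0..<1::real}" by auto
  ultimately have "\<gamma> ` {0..1} = \<gamma> ` {0..<1}" by auto
  then show ?thesis using assms by (simp add: boundary_param_def)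
qed

text \<open>
  The obstacle is the inside of its boundary curve: it is a bounded set with that curve as frontier,
  so each of the two connected components of the complement of the curve is either contained in it or
  disjoint from it. Hence its exterior is the outside of the curve, which is connected and has every
  point of the curve in its closure. Removing the compact obstacle from the strip keeps the strip
  connected by Janiszewski's theorem.
\<close>

lemma obstacle_exterior:
  assumes "obstacle O0"
  shows "connected (fluid_domain O0)" "frontier O0 \<subseteq> closure (- closure O0)"
proof -
  obtain \<gamma> where \<gamma>: "boundary_param O0 \<gamma>"
    using assms unfolding obstacle_def C3_boundary_def by blast
  have O0: "O0 \<noteq> {}" "open O0" "bounded O0" "closure O0 \<subseteq> strip"
    using assms by (auto simp: obstacle_def)
  define c where "c = to_complex \<circ> \<gamma>"
  have per: "\<gamma> 1 = \<gamma> 0" using \<gamma> unfolding boundary_param_def by (metis add_0)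
  have inj: "inj_on \<gamma> {0..<1}" using \<gamma> by (simp add: boundary_param_def)
  have inj_c: "to_complex u = to_complex v \<longleftrightarrow> u = v" for u v
    by (metis of_to_complex)
  have simple: "simple_path c"
    unfolding simple_path_def loop_free_def
  proof (intro conjI ballI impI)
    show "path c" unfolding path_def c_def
      by (intro continuous_on_compose boundary_param_continuous [OF \<gamma>] continuous_on_to_complex)
    fix x y :: real assume xy: "x \<in> {0..1}" "y \<in> {0..1}" "c x = c y"
    then have eq: "\<gamma> x = \<gamma> y" by (simp add: c_def inj_c)
    (* Injectivity is given on the half-open interval only; m identifies the two end points. *)
    define m where "m t = (if t = 1 then 0 else t)" for t :: real
    have "m x \<in> {0..<1}" "m y \<in> {0..<1}" "\<gamma> (m x) = \<gamma> (m y)"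
      using xy eq per by (auto simp: m_def)
    then have "m x = m y" using inj by (auto dest: inj_onD)
    then show "x = y \<or> x = 0 \<and> y = 1 \<or> x = 1 \<and> y = 0"
      by (auto simp: m_def split: if_splits)
  qed
  have closed_c: "pathfinish c = pathstart c" by (simp add: pathfinish_def pathstart_def c_def per)
  have img: "path_image c = to_complex ` frontier O0"
    unfolding path_image_def c_def image_comp [symmetric] boundary_param_image [OF \<gamma>] ..
  define A where "A = to_complex ` O0"
  have openA: "open A" unfolding A_def by (rule open_to_complex_image [OF O0(2)])
  have cpt: "compact (to_complex ` closure O0)"
    by (intro compact_continuous_image continuous_on_to_complex) (use O0 in auto)
  have clA: "closure A = to_complex ` closure O0"
  proof
    show "closure A \<subseteq> to_complex ` closure O0" unfolding A_def
      by (intro closure_minimal compact_imp_closed [OF cpt] image_mono closure_subset)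
    show "to_complex ` closure O0 \<subseteq> closure A" unfolding A_def
      by (intro image_closure_subset continuous_on_to_complex closed_closure closure_subset)
  qed
  have "bounded A"
    using cpt clA by (metis bounded_closure_image bounded_subset closure_subset compact_imp_bounded)
  have frA: "frontier A = path_image c"
    unfolding frontier_def interior_open [OF openA] clA img frontier_def interior_open [OF O0(2)]
    using inj_c by (auto simp: A_def)
  have con_in: "connected (inside (path_image c))" and con_out: "connected (outside (path_image c))"
    and unbdd: "\<not> bounded (outside (path_image c))"
    and un: "inside (path_image c) \<union> outside (path_image c) = - path_image c"
    and int: "inside (path_image c) \<inter> outside (path_image c) = {}"
    and fr_out: "frontier (outside (path_image c)) = path_image c"
    using Jordan_inside_outside [OF simple closed_c] by blast+
  have sub_or: "B \<subseteq> A" if "connected B" "B \<inter> A \<noteq> {}" "B \<inter> path_image c = {}" for B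
    using connected_Int_frontier [of B A] that frA by blast
  have disj: "inside (path_image c) \<inter> path_image c = {}" "outside (path_image c) \<inter> path_image c = {}"
    using un by blast+
  have "outside (path_image c) \<inter> A = {}"
  proof (rule ccontr)
    assume "outside (path_image c) \<inter> A \<noteq> {}"
    then have "outside (path_image c) \<subseteq> A" by (intro sub_or con_out disj)
    then show False using \<open>bounded A\<close> bounded_subset unbdd by blast
  qed
  moreover have "A \<inter> path_image c = {}"
    using frA openA by (auto simp: frontier_def interior_open)
  ultimately have "A \<subseteq> inside (path_image c)" using un by blast
  moreover have "A \<noteq> {}" using O0 by (simp add: A_def)
  ultimately have "A = inside (path_image c)"
    using sub_or [OF con_in _ disj(1)] by blast
  then have clA2: "closure A = inside (path_image c) \<union> path_image c"
    using frA closure_Un_frontier by blast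
  then have ext: "- closure A = outside (path_image c)" using un int by blast
  have strip_c: "- (- to_complex ` strip) = to_complex ` strip" by simp
  have "connected (- (closure A \<union> (- to_complex ` strip)))"
  proof (rule Janiszewski_connected)
    show "compact (closure A)" by (simp add: clA cpt)
    show "closed (- to_complex ` strip)" using open_to_complex_image [OF open_strip] by auto
    have "closure A \<inter> - to_complex ` strip = {}" using O0 by (auto simp: clA)
    then show "connected (closure A \<inter> - to_complex ` strip)" by simp
    show "connected (- closure A)" using ext con_out by simp
    show "connected (- (- to_complex ` strip))" unfolding strip_c
      by (intro connected_continuous_image continuous_on_to_complex convex_connected convex_strip)
  qed
  moreover have "- (closure A \<union> (- to_complex ` strip)) = to_complex ` fluid_domain O0"
    unfolding clA fluid_domain_def using inj_c by auto
  ultimately have "connected (to_complex ` fluid_domain O0)" by simp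
  then have "connected (of_complex ` to_complex ` fluid_domain O0)"
    by (rule connected_continuous_image [OF continuous_on_of_complex])
  then show "connected (fluid_domain O0)" by (simp add: image_comp o_def)
  have ext': "to_complex ` (- closure O0) = outside (path_image c)"
    using ext by (simp add: to_complex_image_Compl clA)
  show "frontier O0 \<subseteq> closure (- closure O0)"
  proof
    fix y assume "y \<in> frontier O0"
    then have "to_complex y \<in> frontier (outside (path_image c))" using fr_out img by auto
    then have "to_complex y \<in> closure (to_complex ` (- closure O0))"
      by (simp add: ext' frontier_def)
    moreover have "of_complex ` closure (to_complex ` (- closure O0)) \<subseteq> closure (- closure O0)"
      by (intro image_closure_subset continuous_on_of_complex closed_closure)
         (auto simp: closure_def)
    ultimately show "y \<in> closure (- closure O0)" by (metis image_subset_iff of_to_complex)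
  qed
qed

lemma open_fluid_domain: "open (fluid_domain O0)"
  unfolding fluid_domain_def using open_strip by auto

lemma
  assumes "obstacle O0"
  shows closure_fluid_domain: "closure (fluid_domain O0) = closure strip - O0"
    and frontier_fluid_domain: "frontier (fluid_domain O0) = frontier O0 \<union> frontier strip"
    and frontier_obstacle_subset_strip: "frontier O0 \<subseteq> strip"
proof -
  have O0: "open O0" "closure O0 \<subseteq> strip" using assms by (auto simp: obstacle_def)
  show fs: "frontier O0 \<subseteq> strip" using O0 by (auto simp: frontier_def)
  have cl: "closure (fluid_domain O0) = closure strip - O0"
  proof
    have "closed (closure strip - O0)" using O0 by auto
    then show "closure (fluid_domain O0) \<subseteq> closure strip - O0"
      using closure_subset [of O0] closure_subset [of strip]
      by (intro closure_minimal) (auto simp: fluid_domain_def)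
    show "closure strip - O0 \<subseteq> closure (fluid_domain O0)"
    proof
      fix x assume x: "x \<in> closure strip - O0"
      show "x \<in> closure (fluid_domain O0)"
      proof (cases "x \<in> closure O0")
        case True
        then have xf: "x \<in> frontier O0" using x O0 by (simp add: frontier_def interior_open)
        then have "x \<in> closure (- closure O0)" "x \<in> strip" using obstacle_exterior [OF assms] fs by auto
        then have "x \<in> strip \<inter> closure (- closure O0)" by blast
        then have "x \<in> closure (strip \<inter> (- closure O0))"
          using open_Int_closure_subset [OF open_strip] by blast
        then show ?thesis by (simp add: fluid_domain_def Diff_eq)
      next
        case False
        then have "x \<in> (- closure O0) \<inter> closure strip" using x by blast
        then have "x \<in> closure ((- closure O0) \<inter> strip)"
          using open_Int_closure_subset [of "- closure O0" strip] by auto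
        then show ?thesis by (simp add: fluid_domain_def Diff_eq Int_commute)
      qed
    qed
  qed
  then show "closure (fluid_domain O0) = closure strip - O0" .
  show "frontier (fluid_domain O0) = frontier O0 \<union> frontier strip"
    unfolding frontier_def [of "fluid_domain O0"] cl interior_open [OF open_fluid_domain]
    using O0 closure_subset [of O0] closure_subset [of strip]
    by (auto simp: fluid_domain_def frontier_def interior_open open_strip)
qed

lemma obstacle_wall_distance:
  assumes "obstacle O0"
  obtains D where "D > 0" "\<And>x y. x \<in> closure O0 \<Longrightarrow> y \<notin> strip \<Longrightarrow> D \<le> dist x y"
proof -
  have "(0 :: plane) \<notin> strip" by (simp add: strip_def)
  then have ne: "- strip \<noteq> {}" by blast
  have "setdist (closure O0) (- strip) > 0"
    using setdist_gt_0_compact_closed [of "closure O0" "- strip"] assms open_strip ne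
    by (auto simp: obstacle_def)
  then show thesis
  proof (rule that)
    show "setdist (closure O0) (- strip) \<le> dist x y" if "x \<in> closure O0" "y \<notin> strip" for x y
      using that by (intro setdist_le_dist) auto
  qed
qed

section \<open>Tangent balls along the boundary curve\<close>

definition rot :: "plane \<Rightarrow> plane" where
  "rot v = vector [- v $ 2, v $ 1]"

lemma rot_nth [simp]: "rot v $ 1 = - v $ 2" "rot v $ 2 = v $ 1"
  by (simp_all add: rot_def)

lemma norm_rot [simp]: "norm (rot v) = norm v"
  by (simp add: norm_plane add.commute)

lemma inner_rot_self [simp]: "v \<bullet> rot v = 0" "rot v \<bullet> v = 0"
  by (simp_all add: inner_plane)

lemma bounded_linear_rot: "bounded_linear rot"
proof -
  have "linear rot"
    by (rule linearI) (auto simp: vec_eq_iff forall_2)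
  then show ?thesis by (simp add: linear_conv_bounded_linear)
qed

lemmas continuous_on_rot [continuous_intros] = bounded_linear.continuous_on [OF bounded_linear_rot]

lemma orthogonal_plane:
  assumes "v \<bullet> w = 0" "w \<noteq> 0"
  shows "v = ((v \<bullet> rot w) / (norm w)\<^sup>2) *\<^sub>R rot w"
proof -
  have n: "(norm w)\<^sup>2 \<noteq> 0" using assms by simp
  have e: "v $ 1 * w $ 1 + v $ 2 * w $ 2 = 0" using assms by (simp add: inner_plane)
  have "v $ 1 * (norm w)\<^sup>2 = (v \<bullet> rot w) * (- w $ 2)"
       "v $ 2 * (norm w)\<^sup>2 = (v \<bullet> rot w) * (w $ 1)"
    using e unfolding norm_plane_sq inner_plane by (simp_all add: power2_eq_square) algebra+
  then show ?thesis using n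
    by (intro plane_eqI) (simp_all add: divide_simps)
qed

lemma vector_derivative_imp_continuous_on:
  assumes "\<And>t. (f has_vector_derivative f' t) (at t)"
  shows "continuous_on S f"
proof -
  have "isCont f t" for t by (rule has_vector_derivative_continuous [OF assms])
  then show ?thesis by (simp add: continuous_at_imp_continuous_on)
qed

lemma boundary_paramE:
  assumes "boundary_param U \<gamma>"
  obtains \<gamma>1 \<gamma>2 where "\<And>t. (\<gamma> has_vector_derivative \<gamma>1 t) (at t)"
    "\<And>t. (\<gamma>1 has_vector_derivative \<gamma>2 t) (at t)" "\<And>t. \<gamma>1 t \<noteq> 0" "continuous_on UNIV \<gamma>2"
proof -
  have "\<exists>\<gamma>1 \<gamma>2 \<gamma>3. (\<forall>t. (\<gamma> has_vector_derivative \<gamma>1 t) (at t) \<and>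
             (\<gamma>1 has_vector_derivative \<gamma>2 t) (at t) \<and>
             (\<gamma>2 has_vector_derivative \<gamma>3 t) (at t) \<and> \<gamma>1 t \<noteq> 0) \<and>
             continuous_on UNIV \<gamma>3"
    using assms unfolding boundary_param_def by (elim conjE)
  then show thesis
  proof (elim exE conjE)
    fix \<gamma>1 \<gamma>2 \<gamma>3 :: "real \<Rightarrow> plane"
    assume *: "\<forall>t. (\<gamma> has_vector_derivative \<gamma>1 t) (at t) \<and>
             (\<gamma>1 has_vector_derivative \<gamma>2 t) (at t) \<and>
             (\<gamma>2 has_vector_derivative \<gamma>3 t) (at t) \<and> \<gamma>1 t \<noteq> 0"
    have "isCont \<gamma>2 t" for t
      by (rule has_vector_derivative_continuous) (use * in blast)
    then have "continuous_on UNIV \<gamma>2"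
      by (simp add: continuous_at_imp_continuous_on)
    with * show thesis by (intro that [of \<gamma>1 \<gamma>2]) simp_all
  qed
qed

lemma periodic_of_int:
  fixes f :: "real \<Rightarrow> 'a"
  assumes "\<And>t. f (t + 1) = f t"
  shows "f (t + of_int k) = f t"
proof (induction k rule: int_induct [of _ 0])
  case (step1 i)
  then show ?case using assms [of "t + of_int i"] by (simp add: algebra_simps)
next
  case (step2 i)
  then show ?case using assms [of "t + of_int (i - 1)"] by (simp add: algebra_simps)
qed auto

lemma boundary_param_in_frontier:
  assumes "boundary_param U \<gamma>"
  shows "\<gamma> t \<in> frontier U"
proof -
  have "\<gamma> t = \<gamma> (frac t)"
    using periodic_of_int [of \<gamma> "frac t" "\<lfloor>t\<rfloor>"] assms by (simp add: frac_def boundary_param_def)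
  moreover have "frac t \<in> {0..1}" using frac_lt_1 [of t] by (simp add: less_imp_le)
  ultimately show ?thesis using boundary_param_image [OF assms] by (metis imageI)
qed

lemma periodic_vector_derivative:
  assumes per: "\<And>t. f (t + 1) = f t" and der: "\<And>t. (f has_vector_derivative f' t) (at t)"
  shows "f' (t + 1) = f' t"
proof -
  have "((\<lambda>s. f (s + 1)) has_vector_derivative f' (t + 1)) (at t)"
  proof -
    have "((\<lambda>s. s + 1) has_vector_derivative 1) (at t)"
      unfolding has_real_derivative_iff_has_vector_derivative [symmetric]
      by (auto intro!: derivative_eq_intros)
    from vector_diff_chain_at [OF this der] show ?thesis by (simp add: o_def)
  qed
  then have "(f has_vector_derivative f' (t + 1)) (at t)" by (simp add: per)
  then show ?thesis using der vector_derivative_unique_at by blast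
qed

lemma periodic_bounded:
  fixes f :: "real \<Rightarrow> 'a::real_normed_vector"
  assumes per: "\<And>t. f (t + 1) = f t" and cont: "continuous_on UNIV f"
  obtains M where "M > 0" "\<And>t. norm (f t) \<le> M"
proof -
  have "bounded (f ` {0..1})"
    by (intro compact_imp_bounded compact_continuous_image continuous_on_subset [OF cont]) auto
  then obtain M where M: "M > 0" "\<And>t. t \<in> {0..1} \<Longrightarrow> norm (f t) \<le> M"
    unfolding bounded_pos by auto
  have "norm (f t) \<le> M" for t
  proof -
    have "f t = f (frac t)" using periodic_of_int [of f "frac t" "\<lfloor>t\<rfloor>"] per by (simp add: frac_def)
    then show ?thesis using M(2) [of "frac t"] frac_lt_1 [of t] by (simp add: less_imp_le)
  qed
  with M show thesis using that by blast
qed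

lemma periodic_bounded_below:
  fixes f :: "real \<Rightarrow> 'a::real_normed_vector"
  assumes per: "\<And>t. f (t + 1) = f t" and cont: "continuous_on UNIV f" and nz: "\<And>t. f t \<noteq> 0"
  obtains m where "m > 0" "\<And>t. m \<le> norm (f t)"
proof -
  have "continuous_on {0..1} (\<lambda>t. norm (f t))"
    by (intro continuous_intros continuous_on_subset [OF cont]) auto
  then obtain t0 where t0: "t0 \<in> {0..1}" "\<And>t. t \<in> {0..1} \<Longrightarrow> norm (f t0) \<le> norm (f t)"
    using continuous_attains_inf [of "{0..1::real}" "\<lambda>t. norm (f t)"] by auto
  have "norm (f t0) \<le> norm (f t)" for t
  proof -
    have "f t = f (frac t)" using periodic_of_int [of f "frac t" "\<lfloor>t\<rfloor>"] per by (simp add: frac_def)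
    then show ?thesis using t0(2) [of "frac t"] frac_lt_1 [of t] by (simp add: less_imp_le)
  qed
  with nz show thesis by (intro that [of "norm (f t0)"]) auto
qed

text \<open>
  The crude constant \<open>M\<close> instead of \<open>M / 2\<close> allows two applications of the mean value inequality
  in place of an integral remainder.
\<close>

lemma taylor_bound_vector:
  fixes f :: "real \<Rightarrow> 'a::real_normed_vector"
  assumes f: "\<And>t. (f has_vector_derivative f1 t) (at t)"
    and f1: "\<And>t. (f1 has_vector_derivative f2 t) (at t)"
    and M: "\<And>t. norm (f2 t) \<le> M"
  shows "norm (f (t + h) - f t - h *\<^sub>R f1 t) \<le> M * h\<^sup>2"
proof -
  have M0: "M \<ge> 0" using M [of 0] norm_ge_zero order_trans by blast
  have b1: "norm (f1 s - f1 t) \<le> M * \<bar>s - t\<bar>" for s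
  proof -
    have "norm (f1 s - f1 t) \<le> M * norm (s - t)"
    proof (rule differentiable_bound [of UNIV f1 "\<lambda>x h. h *\<^sub>R f2 x"])
      show "(f1 has_derivative (\<lambda>h. h *\<^sub>R f2 x)) (at x within UNIV)" for x
        using f1 [of x] by (simp add: has_vector_derivative_def)
      show "onorm (\<lambda>h. h *\<^sub>R f2 x) \<le> M" for x
      proof (rule onorm_le)
        show "norm (k *\<^sub>R f2 x) \<le> M * norm k" for k
          using mult_right_mono [OF M [of x] abs_ge_zero [of k]] by (simp add: mult.commute)
      qed
    qed auto
    then show ?thesis by simp
  qed
  define \<phi> where "\<phi> s = f s - s *\<^sub>R f1 t" for s
  have "norm (\<phi> (t + h) - \<phi> t) \<le> (M * \<bar>h\<bar>) * norm (t + h - t)"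
  proof (rule differentiable_bound [of "closed_segment t (t + h)" \<phi> "\<lambda>s k. k *\<^sub>R (f1 s - f1 t)"])
    fix s assume s: "s \<in> closed_segment t (t + h)"
    show "(\<phi> has_derivative (\<lambda>k. k *\<^sub>R (f1 s - f1 t))) (at s within closed_segment t (t + h))"
      unfolding \<phi>_def
    proof (rule has_derivative_at_withinI)
      have "(f has_derivative (\<lambda>k. k *\<^sub>R f1 s)) (at s)" using f [of s] by (simp add: has_vector_derivative_def)
      moreover have "((\<lambda>s. s *\<^sub>R f1 t) has_derivative (\<lambda>k. k *\<^sub>R f1 t)) (at s)"
        by (intro bounded_linear_imp_has_derivative bounded_linear_scaleR_left)
      ultimately have "((\<lambda>s. f s - s *\<^sub>R f1 t) has_derivative (\<lambda>k. k *\<^sub>R f1 s - k *\<^sub>R f1 t)) (at s)"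
        by (rule has_derivative_diff)
      then show "((\<lambda>s. f s - s *\<^sub>R f1 t) has_derivative (\<lambda>k. k *\<^sub>R (f1 s - f1 t))) (at s)"
        by (simp add: scaleR_diff_right)
    qed
    have "\<bar>s - t\<bar> \<le> \<bar>h\<bar>" using s by (auto simp: closed_segment_eq_real_ivl split: if_splits)
    then have b: "norm (f1 s - f1 t) \<le> M * \<bar>h\<bar>" using b1 [of s] M0 by (meson mult_left_mono order_trans)
    show "onorm (\<lambda>k. k *\<^sub>R (f1 s - f1 t)) \<le> M * \<bar>h\<bar>"
    proof (rule onorm_le)
      show "norm (k *\<^sub>R (f1 s - f1 t)) \<le> M * \<bar>h\<bar> * norm k" for k
        using mult_right_mono [OF b abs_ge_zero [of k]] by (simp add: mult.commute)
    qed
  qed auto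
  moreover have "\<phi> (t + h) - \<phi> t = f (t + h) - f t - h *\<^sub>R f1 t"
    by (simp add: \<phi>_def algebra_simps)
  ultimately show ?thesis by (simp add: power2_eq_square mult.assoc)
qed

lemma boundary_param_eq_imp:
  assumes "boundary_param U \<gamma>" "\<gamma> x = \<gamma> y"
  shows "\<exists>k. x = y + of_int k"
proof -
  have per: "\<And>t. \<gamma> (t + 1) = \<gamma> t" and inj: "inj_on \<gamma> {0..<1}"
    using assms by (auto simp: boundary_param_def)
  have "\<gamma> t = \<gamma> (frac t)" for t
    using periodic_of_int [of \<gamma> "frac t" "\<lfloor>t\<rfloor>"] per by (simp add: frac_def)
  then have "\<gamma> (frac x) = \<gamma> (frac y)" using assms(2) by simp
  then have "frac x = frac y" 
    using inj_onD [OF inj, of "frac x" "frac y"] frac_lt_1 [of x] frac_lt_1 [of y] by simp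
  then have "x = y + of_int (\<lfloor>x\<rfloor> - \<lfloor>y\<rfloor>)" by (simp add: frac_def)
  then show ?thesis by blast
qed

text \<open>
  For small \<open>h\<close> the chord is close to \<open>h\<close> times the nonvanishing derivative; for the other \<open>h\<close>
  injectivity and compactness apply. The restriction to \<open>\<bar>h\<bar> \<le> 1/2\<close> excludes the coincidences that
  come from the period \<open>1\<close>.
\<close>

lemma boundary_param_lower_bound:
  assumes bp: "boundary_param U \<gamma>"
    and d1: "\<And>t. (\<gamma> has_vector_derivative \<gamma>1 t) (at t)" and d2: "\<And>t. (\<gamma>1 has_vector_derivative \<gamma>2 t) (at t)"
    and nz: "\<And>t. \<gamma>1 t \<noteq> 0" and M: "\<And>t. norm (\<gamma>2 t) \<le> M" "M > 0"
  obtains c where "c > 0" "\<And>t h. \<bar>h\<bar> \<le> 1/2 \<Longrightarrow> c * \<bar>h\<bar> \<le> norm (\<gamma> (t + h) - \<gamma> t)"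
proof -
  have per: "\<And>t. \<gamma> (t + 1) = \<gamma> t" using bp by (simp add: boundary_param_def)
  have cont: "continuous_on S \<gamma>" for S by (rule boundary_param_continuous [OF bp])
  have cont1: "continuous_on UNIV \<gamma>1"
    by (rule vector_derivative_imp_continuous_on [OF d2])
  obtain m where m: "m > 0" "\<And>t. m \<le> norm (\<gamma>1 t)"
    using periodic_bounded_below [OF periodic_vector_derivative [OF per d1] cont1 nz] by blast
  define h0 where "h0 = min (1/2) (m / (2 * M))"
  have h0: "0 < h0" "h0 \<le> 1/2" "h0 \<le> m / (2 * M)" using m M by (auto simp: h0_def)
  define D where "D = {0..1::real} \<times> ({- (1/2)..- h0} \<union> {h0..1/2})"
  have "compact D" unfolding D_def by (intro compact_Times compact_Un) auto
  moreover have "D \<noteq> {}" using h0 by (auto simp: D_def intro!: exI [of _ h0])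
  moreover have "continuous_on D (\<lambda>p. norm (\<gamma> (fst p + snd p) - \<gamma> (fst p)))"
    by (intro continuous_intros continuous_on_compose2 [OF cont [of UNIV]]) auto
  ultimately obtain p0 where p0: "p0 \<in> D"
    "\<And>p. p \<in> D \<Longrightarrow> norm (\<gamma> (fst p0 + snd p0) - \<gamma> (fst p0)) \<le> norm (\<gamma> (fst p + snd p) - \<gamma> (fst p))"
    using continuous_attains_inf [of D] by blast
  define c0 where "c0 = norm (\<gamma> (fst p0 + snd p0) - \<gamma> (fst p0))"
  have "c0 > 0"
  proof (rule ccontr)
    assume "\<not> c0 > 0"
    then have "\<gamma> (fst p0 + snd p0) = \<gamma> (fst p0)" by (simp add: c0_def)
    then obtain k where "snd p0 = of_int k" using boundary_param_eq_imp [OF bp] by force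
    moreover have "snd p0 \<noteq> 0" "\<bar>snd p0\<bar> \<le> 1/2" using p0(1) h0 by (auto simp: D_def)
    ultimately have "k \<noteq> 0" "\<bar>of_int k :: real\<bar> < 1" by auto
    then show False by linarith
  qed
  define c where "c = min c0 (m / 2)"
  have "c * \<bar>h\<bar> \<le> norm (\<gamma> (t + h) - \<gamma> t)" if h: "\<bar>h\<bar> \<le> 1/2" for t h
  proof (cases "\<bar>h\<bar> < h0")
    case True
    have "norm (\<gamma> (t + h) - \<gamma> t - h *\<^sub>R \<gamma>1 t) \<le> M * h\<^sup>2" by (rule taylor_bound_vector [OF d1 d2 M(1)])
    moreover have "M * h\<^sup>2 \<le> m / 2 * \<bar>h\<bar>"
    proof -
      have "M * \<bar>h\<bar> \<le> M * (m / (2 * M))" using True h0 M by (intro mult_left_mono) auto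
      then have "M * \<bar>h\<bar> \<le> m / 2" using M by simp
      then have "M * \<bar>h\<bar> * \<bar>h\<bar> \<le> m / 2 * \<bar>h\<bar>" by (intro mult_right_mono) auto
      then show ?thesis by (simp add: power2_eq_square mult.assoc)
    qed
    moreover have "norm (h *\<^sub>R \<gamma>1 t) \<ge> m * \<bar>h\<bar>" 
      using mult_right_mono [OF m(2) [of t] abs_ge_zero [of h]] by (simp add: mult.commute)
    moreover have "norm (h *\<^sub>R \<gamma>1 t) \<le> norm (\<gamma> (t + h) - \<gamma> t) + norm (\<gamma> (t + h) - \<gamma> t - h *\<^sub>R \<gamma>1 t)"
      using norm_triangle_ineq4 [of "\<gamma> (t + h) - \<gamma> t" "\<gamma> (t + h) - \<gamma> t - h *\<^sub>R \<gamma>1 t"] by simp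
    moreover have "c * \<bar>h\<bar> \<le> m / 2 * \<bar>h\<bar>" by (intro mult_right_mono) (auto simp: c_def)
    ultimately show ?thesis by (simp add: field_simps)
  next
    case False
    have "(frac t, h) \<in> D" using False h frac_lt_1 [of t] by (auto simp: D_def less_imp_le abs_if split: if_splits)
    from p0(2) [OF this] have "c0 \<le> norm (\<gamma> (frac t + h) - \<gamma> (frac t))" by (simp add: c0_def)
    moreover have "\<gamma> (frac t + h) = \<gamma> (t + h)" "\<gamma> (frac t) = \<gamma> t"
      using periodic_of_int [of \<gamma> "frac t + h" "\<lfloor>t\<rfloor>"] periodic_of_int [of \<gamma> "frac t" "\<lfloor>t\<rfloor>"] per
      by (auto simp: frac_def algebra_simps)
    moreover have "c * \<bar>h\<bar> \<le> c0 * 1" using h \<open>c0 > 0\<close> m by (intro mult_mono) (auto simp: c_def)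
    ultimately show ?thesis by simp
  qed
  then show thesis using that [of c] \<open>c0 > 0\<close> m by (auto simp: c_def)
qed

text \<open>
  The component of a chord in normal direction is quadratically small. Taylor's formula gives this
  in the parameter difference, and \<open>boundary_param_lower_bound\<close> converts it into the length of the chord, for
  all pairs of points on the curve.
\<close>

lemma boundary_param_normal_bound:
  assumes bp: "boundary_param U \<gamma>" and d1: "\<And>t. (\<gamma> has_vector_derivative \<gamma>1 t) (at t)"
    and d2: "\<And>t. (\<gamma>1 has_vector_derivative \<gamma>2 t) (at t)" and nz: "\<And>t. \<gamma>1 t \<noteq> 0"
    and c2: "continuous_on UNIV \<gamma>2"
  obtains K where "K > 0"
    "\<And>s t. \<bar>(\<gamma> s - \<gamma> t) \<bullet> rot (\<gamma>1 t)\<bar> \<le> K * norm (\<gamma>1 t) * (norm (\<gamma> s - \<gamma> t))\<^sup>2"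
proof -
  have per: "\<And>t. \<gamma> (t + 1) = \<gamma> t" using bp by (simp add: boundary_param_def)
  note per1 = periodic_vector_derivative [OF per d1]
  note per2 = periodic_vector_derivative [OF per1 d2]
  obtain M where M: "M > 0" "\<And>t. norm (\<gamma>2 t) \<le> M" using periodic_bounded [OF per2 c2] by blast
  obtain c where c: "c > 0" "\<And>t h. \<bar>h\<bar> \<le> 1/2 \<Longrightarrow> c * \<bar>h\<bar> \<le> norm (\<gamma> (t + h) - \<gamma> t)"
    using boundary_param_lower_bound [OF bp d1 d2 nz M(2,1)] by blast
  have "\<bar>(\<gamma> s - \<gamma> t) \<bullet> rot (\<gamma>1 t)\<bar> \<le> M / c\<^sup>2 * norm (\<gamma>1 t) * (norm (\<gamma> s - \<gamma> t))\<^sup>2" for s t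
  proof -
    (* Shifting by a period, the parameters may be assumed to differ by at most 1/2. *)
    define h where "h = s - t + of_int (- round (s - t))"
    have h: "\<bar>h\<bar> \<le> 1/2" using of_int_round_abs_le [of "s - t"] by (simp add: h_def abs_minus_commute)
    have s: "\<gamma> s = \<gamma> (t + h)"
      using periodic_of_int [of \<gamma> s "- round (s - t)"] per by (simp add: h_def algebra_simps)
    have "(\<gamma> s - \<gamma> t) \<bullet> rot (\<gamma>1 t) = (\<gamma> (t + h) - \<gamma> t - h *\<^sub>R \<gamma>1 t) \<bullet> rot (\<gamma>1 t)"
      by (simp add: s inner_diff_left)
    also have "\<bar>\<dots>\<bar> \<le> norm (\<gamma> (t + h) - \<gamma> t - h *\<^sub>R \<gamma>1 t) * norm (rot (\<gamma>1 t))"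
      by (rule Cauchy_Schwarz_ineq2)
    also have "\<dots> \<le> M * h\<^sup>2 * norm (\<gamma>1 t)"
      using taylor_bound_vector [OF d1 d2 M(2)] by (simp add: mult_right_mono)
    also have "\<dots> \<le> M / c\<^sup>2 * (norm (\<gamma> s - \<gamma> t))\<^sup>2 * norm (\<gamma>1 t)"
    proof (intro mult_right_mono)
      have "(c * \<bar>h\<bar>)\<^sup>2 \<le> (norm (\<gamma> s - \<gamma> t))\<^sup>2" using c h s by (intro power_mono) auto
      then have "c\<^sup>2 * h\<^sup>2 \<le> (norm (\<gamma> s - \<gamma> t))\<^sup>2" by (simp add: power_mult_distrib)
      then show "M * h\<^sup>2 \<le> M / c\<^sup>2 * (norm (\<gamma> s - \<gamma> t))\<^sup>2"
        using c(1) M(1) by (simp add: field_simps)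
    qed auto
    finally show ?thesis by (simp add: mult_ac)
  qed
  then show thesis using that [of "M / c\<^sup>2"] M c by auto
qed

text \<open>
  One of the two unit normals of a curve with tangent vector \<open>w\<close>. The sign \<open>\<sigma>\<close> records the
  orientation of the curve.
\<close>

definition curve_normal :: "real \<Rightarrow> plane \<Rightarrow> plane" where
  "curve_normal \<sigma> w = (\<sigma> / norm w) *\<^sub>R rot w"

lemma norm_curve_normal: "\<bar>\<sigma>\<bar> = 1 \<Longrightarrow> w \<noteq> 0 \<Longrightarrow> norm (curve_normal \<sigma> w) = 1"
  by (simp add: curve_normal_def)

lemma norm_diff_scaled_unit:
  fixes v n :: "'a::real_inner"
  assumes "norm n = 1"
  shows "(norm (v - r *\<^sub>R n))\<^sup>2 = (norm v)\<^sup>2 - 2 * r * (v \<bullet> n) + r\<^sup>2"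
proof -
  have "n \<bullet> n = 1" using assms by (simp add: norm_eq_1)
  then show ?thesis unfolding power2_norm_eq_inner
    by (simp add: inner_diff_left inner_diff_right inner_commute power2_eq_square)
qed

text \<open>
  By the quadratic bound, both balls of radius at most \<open>1 / (2 K)\<close> tangent to the curve at a point
  miss the whole curve. Each of them therefore lies entirely inside or entirely outside the
  obstacle. Which of the two holds cannot change along the curve, since the centres form a connected
  set that misses the curve. Finally, both sides occur: every point near the curve lies on the normal
  through its nearest point, and there are such points in the obstacle and in its exterior.
\<close>

theorem obstacle_tangent_balls:
  assumes obs: "obstacle O0" and bp: "boundary_param O0 \<gamma>"
    and d1: "\<And>t. (\<gamma> has_vector_derivative \<gamma>1 t) (at t)"
    and d2: "\<And>t. (\<gamma>1 has_vector_derivative \<gamma>2 t) (at t)" and nz: "\<And>t. \<gamma>1 t \<noteq> 0"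
    and c2: "continuous_on UNIV \<gamma>2"
  obtains \<sigma> r where "\<bar>\<sigma>\<bar> = 1" "r > 0"
    "\<And>t. ball (\<gamma> t + r *\<^sub>R curve_normal \<sigma> (\<gamma>1 t)) r \<subseteq> O0"
    "\<And>t. ball (\<gamma> t - r *\<^sub>R curve_normal \<sigma> (\<gamma>1 t)) r \<subseteq> fluid_domain O0"
proof -
  have O0: "O0 \<noteq> {}" "open O0" "bounded O0" "closure O0 \<subseteq> strip"
    using obs by (auto simp: obstacle_def)
  have cont: "continuous_on S \<gamma>" for S by (rule boundary_param_continuous [OF bp])
  have cont1: "continuous_on UNIV \<gamma>1"
    by (rule vector_derivative_imp_continuous_on [OF d2])
  obtain K where K: "K > 0"
    "\<And>s t. \<bar>(\<gamma> s - \<gamma> t) \<bullet> rot (\<gamma>1 t)\<bar> \<le> K * norm (\<gamma>1 t) * (norm (\<gamma> s - \<gamma> t))\<^sup>2"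
    using boundary_param_normal_bound [OF bp d1 d2 nz c2] by blast
  obtain D where D: "D > 0" "\<And>x y. x \<in> closure O0 \<Longrightarrow> y \<notin> strip \<Longrightarrow> D \<le> dist x y"
    using obstacle_wall_distance [OF obs] by blast
  define r where "r = min (1 / (4 * K)) (D / 2)"
  have r: "r > 0" "2 * r * K < 1" "2 * r \<le> D" using K D(1) by (auto simp: r_def min_def field_simps)
  define J where "J = frontier O0"
  have rangeJ: "\<gamma> t \<in> J" for t unfolding J_def by (rule boundary_param_in_frontier [OF bp])
  have Jrange: "\<exists>t. y = \<gamma> t" if "y \<in> J" for y
    using boundary_param_image [OF bp] that unfolding J_def by blast
  define cen where "cen \<sigma> t = \<gamma> t + r *\<^sub>R curve_normal \<sigma> (\<gamma>1 t)" for \<sigma> t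
  have cen_minus: "cen (- \<sigma>) t = \<gamma> t - r *\<^sub>R curve_normal \<sigma> (\<gamma>1 t)" for \<sigma> t
    by (simp add: cen_def curve_normal_def)
  have far: "r \<le> dist (cen \<sigma> t) y" if that: "\<bar>\<sigma>\<bar> = 1" "y \<in> J" for \<sigma> t y
  proof -
    from Jrange [OF that(2)] obtain s where s: "y = \<gamma> s" by blast
    define n where "n = curve_normal \<sigma> (\<gamma>1 t)"
    have n: "norm n = 1" using norm_curve_normal [OF that(1) nz] by (simp add: n_def)
    have "\<bar>(y - \<gamma> t) \<bullet> n\<bar> = \<bar>(y - \<gamma> t) \<bullet> rot (\<gamma>1 t)\<bar> / norm (\<gamma>1 t)"
      using that(1) by (simp add: n_def curve_normal_def abs_mult)
    also have "\<dots> \<le> K * (norm (y - \<gamma> t))\<^sup>2"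
      using K(2) [of s t] nz [of t] by (simp add: s divide_simps mult_ac)
    finally have "2 * r * \<bar>(y - \<gamma> t) \<bullet> n\<bar> \<le> 2 * r * (K * (norm (y - \<gamma> t))\<^sup>2)"
      using r by (intro mult_left_mono) auto
    also have "\<dots> = (2 * r * K) * (norm (y - \<gamma> t))\<^sup>2" by simp
    also have "\<dots> \<le> 1 * (norm (y - \<gamma> t))\<^sup>2" using r by (intro mult_right_mono) auto
    finally have *: "2 * r * ((y - \<gamma> t) \<bullet> n) \<le> (norm (y - \<gamma> t))\<^sup>2"
      using r by (smt (verit) mult_left_mono)
    have "dist (cen \<sigma> t) y = norm ((y - \<gamma> t) - r *\<^sub>R n)"
      unfolding dist_norm cen_def n_def by (metis diff_diff_add norm_minus_commute)
    then have "(dist (cen \<sigma> t) y)\<^sup>2 = (norm (y - \<gamma> t))\<^sup>2 - 2 * r * ((y - \<gamma> t) \<bullet> n) + r\<^sup>2"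
      using norm_diff_scaled_unit [OF n] by simp
    with * have "r\<^sup>2 \<le> (dist (cen \<sigma> t) y)\<^sup>2" by linarith
    then show ?thesis by (rule power2_le_imp_le) simp
  qed
  have side: "B \<subseteq> O0 \<or> B \<inter> O0 = {}" if "connected B" "B \<inter> J = {}" for B
    using connected_Int_frontier [of B O0] that unfolding J_def by blast
  have ballJ: "ball (cen \<sigma> t) r \<inter> J = {}" if "\<bar>\<sigma>\<bar> = 1" for \<sigma> t
    using far [OF that, of _ t] by force
  have cen_ball: "cen \<sigma> t \<in> ball (cen \<sigma> t) r" for \<sigma> t using r by simp
  have ball_in: "ball (cen \<sigma> t) r \<subseteq> O0" if "\<bar>\<sigma>\<bar> = 1" "ball (cen \<sigma> s) r \<inter> O0 \<noteq> {}" for \<sigma> s t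
  proof -
    have "ball (cen \<sigma> s) r \<subseteq> O0" using side [OF connected_ball ballJ] that by blast
    then have "cen \<sigma> s \<in> O0" using cen_ball by blast
    have "continuous_on UNIV (cen \<sigma>)" unfolding cen_def [abs_def] curve_normal_def
      using nz by (intro continuous_intros cont cont1) auto
    then have "connected (range (cen \<sigma>))" by (intro connected_continuous_image) auto
    moreover have "range (cen \<sigma>) \<inter> J = {}" using ballJ [OF that(1)] cen_ball by blast
    ultimately have "range (cen \<sigma>) \<subseteq> O0" using side \<open>cen \<sigma> s \<in> O0\<close> by blast
    then have "cen \<sigma> t \<in> O0" by blast
    then show ?thesis using side [OF connected_ball ballJ [OF that(1)]] cen_ball by blast
  qed
  have near: "\<exists>\<sigma> t. \<bar>\<sigma>\<bar> = 1 \<and> x \<in> ball (cen \<sigma> t) r" if x: "x \<notin> J" "y0 \<in> J" "dist y0 x < r" for x y0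
  proof -
    have "compact J" unfolding J_def using O0 by (simp add: compact_frontier_bounded)
    then obtain y where y: "y \<in> J" "\<And>z. z \<in> J \<Longrightarrow> dist x y \<le> dist x z"
      using distance_attains_inf [of J x] x compact_imp_closed by blast
    obtain t where t: "y = \<gamma> t" using Jrange y by blast
    have "(x - \<gamma> t) \<bullet> \<gamma>1 t = 0"
    proof -
      have "((\<lambda>s. (x - \<gamma> s) \<bullet> (x - \<gamma> s)) has_real_derivative (- 2 * ((x - \<gamma> t) \<bullet> \<gamma>1 t))) (at t)"
        using d1 [of t] unfolding has_vector_derivative_def has_field_derivative_def
        by (auto intro!: derivative_eq_intros simp: fun_eq_iff inner_commute)
      moreover have "(x - \<gamma> t) \<bullet> (x - \<gamma> t) \<le> (x - \<gamma> s) \<bullet> (x - \<gamma> s)" for s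
        using y(2) [OF rangeJ, of s] t by (simp add: dist_norm norm_le)
      ultimately have "- 2 * ((x - \<gamma> t) \<bullet> \<gamma>1 t) = 0"
        by (intro DERIV_local_min [of _ _ t 1]) auto
      then show ?thesis by simp
    qed
    from orthogonal_plane [OF this nz]
    obtain a where a: "x - \<gamma> t = a *\<^sub>R rot (\<gamma>1 t)" by blast
    define \<sigma> :: real where "\<sigma> = (if a \<ge> 0 then 1 else -1)"
    have \<sigma>: "\<bar>\<sigma>\<bar> = 1" by (simp add: \<sigma>_def)
    define d where "d = norm (x - \<gamma> t)"
    have xe: "x = \<gamma> t + d *\<^sub>R curve_normal \<sigma> (\<gamma>1 t)"
      using a nz [of t] by (auto simp: d_def curve_normal_def \<sigma>_def algebra_simps)
    have "d \<noteq> 0" using x y t by (auto simp: d_def)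
    moreover have "d < r" using y(2) [OF x(2)] x(3) by (simp add: d_def t dist_norm norm_minus_commute)
    moreover have "dist (cen \<sigma> t) x = \<bar>r - d\<bar>"
    proof -
      have "cen \<sigma> t - x = (r - d) *\<^sub>R curve_normal \<sigma> (\<gamma>1 t)"
        by (subst xe) (simp add: cen_def algebra_simps)
      then show ?thesis using norm_curve_normal [OF \<sigma> nz] by (simp add: dist_norm)
    qed
    moreover have "d \<ge> 0" by (simp add: d_def)
    ultimately have "x \<in> ball (cen \<sigma> t) r" by simp
    with \<sigma> show ?thesis by blast
  qed
  have y0: "\<gamma> 0 \<in> J" by (rule rangeJ)
  have "\<gamma> 0 \<in> closure O0" using y0 by (simp add: J_def frontier_def)
  then obtain x where x: "x \<in> O0" "dist x (\<gamma> 0) < r" using r closure_approachable by blast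
  have "x \<notin> J" using x O0 by (simp add: J_def frontier_def interior_open)
  with near [OF _ y0] x obtain \<sigma> s where \<sigma>: "\<bar>\<sigma>\<bar> = 1" "x \<in> ball (cen \<sigma> s) r"
    by (metis dist_commute)
  have inO: "ball (cen \<sigma> t) r \<subseteq> O0" for t using ball_in [OF \<sigma>(1), of s t] \<sigma> x by blast
  have "\<gamma> 0 \<in> closure (- closure O0)" using y0 obstacle_exterior(2) [OF obs] by (auto simp: J_def)
  then obtain z where z: "z \<in> - closure O0" "dist z (\<gamma> 0) < r" using r closure_approachable by blast
  have "z \<notin> J" using z by (simp add: J_def frontier_def)
  with near [OF _ y0] z obtain \<tau> s' where \<tau>: "\<bar>\<tau>\<bar> = 1" "z \<in> ball (cen \<tau> s') r"
    by (metis dist_commute)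
  (* The balls on the side of sigma lie in the obstacle, so an exterior point sees the other side. *)
  have "\<tau> \<noteq> \<sigma>" using inO \<tau> z closure_subset by blast
  then have "\<tau> = - \<sigma>" using \<sigma> \<tau> by linarith
  have "ball (cen (- \<sigma>) t) r \<subseteq> fluid_domain O0" for t
  proof -
    have m: "\<bar>- \<sigma>\<bar> = 1" using \<sigma> by simp
    have "ball (cen (- \<sigma>) t) r \<inter> O0 = {}"
    proof (rule ccontr)
      assume "ball (cen (- \<sigma>) t) r \<inter> O0 \<noteq> {}"
      from ball_in [OF m this, of s'] show False using \<tau> z closure_subset \<open>\<tau> = - \<sigma>\<close> by blast
    qed
    then have "ball (cen (- \<sigma>) t) r \<inter> closure O0 = {}"
      by (simp add: open_Int_closure_eq_empty)
    moreover have "ball (cen (- \<sigma>) t) r \<subseteq> strip"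
    proof
      fix u assume u: "u \<in> ball (cen (- \<sigma>) t) r"
      have "dist (\<gamma> t) (cen (- \<sigma>) t) = r"
        using norm_curve_normal [OF m nz] r by (simp add: cen_def dist_norm)
      then have "dist (\<gamma> t) u < D" using u r dist_triangle [of "\<gamma> t" u "cen (- \<sigma>) t"] by simp
      moreover have "\<gamma> t \<in> closure O0" using rangeJ [of t] by (simp add: J_def frontier_def)
      ultimately show "u \<in> strip"
        using D(2) [of "\<gamma> t" u] by force
    qed
    ultimately show ?thesis by (auto simp: fluid_domain_def)
  qed
  then show thesis using that [OF \<sigma>(1) r(1)] inO unfolding cen_minus by (simp add: cen_def)
qed

section \<open>The function \<open>\<rho>\<close> near the obstacle\<close>

lemma C2_on_imp_continuous_on: "C2_on X u \<Longrightarrow> continuous_on X u"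
  unfolding C2_on_def C2_derivs_def continuous_on_eq_continuous_within
  by (blast intro: has_derivative_continuous)

lemma tangent_ball_mono:
  assumes "norm n = 1" "0 \<le> s" "s \<le> r"
  shows "ball (y + s *\<^sub>R n) s \<subseteq> ball (y + r *\<^sub>R n) r"
proof
  fix x assume "x \<in> ball (y + s *\<^sub>R n) s"
  moreover have "dist (y + r *\<^sub>R n) (y + s *\<^sub>R n) = r - s"
    using assms by (simp add: dist_norm flip: scaleR_diff_left)
  ultimately show "x \<in> ball (y + r *\<^sub>R n) r"
    using dist_triangle [of "y + r *\<^sub>R n" x "y + s *\<^sub>R n"] by simp
qed

lemma tangent_ball_mono':
  assumes "norm n = 1" "0 \<le> s" "s \<le> r"
  shows "ball (y - s *\<^sub>R n) s \<subseteq> ball (y - r *\<^sub>R n) r"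
  using tangent_ball_mono [of "- n" s r y] assms by simp

lemma balls_meet:
  fixes x c :: "'a::real_normed_vector"
  assumes "dist x c < d + r" "0 < d" "0 < r"
  shows "ball x d \<inter> ball c r \<noteq> {}"
proof -
  define z where "z = x + (d / (d + r)) *\<^sub>R (c - x)"
  have "dist x z = d / (d + r) * dist x c"
    using assms by (simp add: z_def dist_norm norm_minus_commute)
  also have "\<dots> < d / (d + r) * (d + r)" using assms by (intro mult_strict_left_mono) auto
  also have "\<dots> = d" using assms by simp
  finally have 1: "dist x z < d" .
  have "c - z = (1 - d / (d + r)) *\<^sub>R (c - x)" by (simp add: z_def algebra_simps)
  also have "1 - d / (d + r) = r / (d + r)" using assms by (simp add: field_simps)
  finally have "dist c z = r / (d + r) * dist x c"
    using assms by (simp add: dist_norm norm_minus_commute)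
  also have "\<dots> < r / (d + r) * (d + r)" using assms by (intro mult_strict_left_mono) auto
  also have "\<dots> = r" using assms by simp
  finally have "dist c z < r" .
  with 1 show ?thesis by auto
qed

text \<open>
  The data that stay fixed: the obstacle, \<open>\<rho>\<close>, a parametrization of the boundary curve with its first two
  derivatives, and the radius of the tangent balls. The sign \<open>\<sigma>\<close> is such that \<open>N t\<close> points into
  the obstacle, i.e. it is the outward normal of the fluid domain.
\<close>

locale flow =
  fixes O0 :: "plane set" and \<rho> :: "plane \<Rightarrow> real"
    and \<gamma> \<gamma>1 \<gamma>2 :: "real \<Rightarrow> plane" and \<sigma> r0 :: real
  assumes obs: "obstacle O0" and rho: "is_rho O0 \<rho>"
    and param: "boundary_param O0 \<gamma>"
    and d1: "\<And>t. (\<gamma> has_vector_derivative \<gamma>1 t) (at t)"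
    and d2: "\<And>t. (\<gamma>1 has_vector_derivative \<gamma>2 t) (at t)" and nz: "\<And>t. \<gamma>1 t \<noteq> 0"
    and c2: "continuous_on UNIV \<gamma>2"
    and sigma: "\<bar>\<sigma>\<bar> = 1" and r0: "r0 > 0"
    and inner_ball: "\<And>t. ball (\<gamma> t + r0 *\<^sub>R curve_normal \<sigma> (\<gamma>1 t)) r0 \<subseteq> O0"
    and outer_ball: "\<And>t. ball (\<gamma> t - r0 *\<^sub>R curve_normal \<sigma> (\<gamma>1 t)) r0 \<subseteq> fluid_domain O0"
begin

abbreviation "\<Omega> \<equiv> fluid_domain O0"
abbreviation "J \<equiv> frontier O0"
abbreviation "N t \<equiv> curve_normal \<sigma> (\<gamma>1 t)"

lemma O0: "O0 \<noteq> {}" "open O0" "bounded O0" "closure O0 \<subseteq> strip"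
  using obs by (auto simp: obstacle_def)

lemma norm_N [simp]: "norm (N t) = 1"
  by (rule norm_curve_normal [OF sigma nz])

lemmas wall_distance = obstacle_wall_distance [OF obs]

lemma compact_J: "compact J" using O0 by (simp add: compact_frontier_bounded)

lemma per: "\<gamma> (t + 1) = \<gamma> t" using param by (simp add: boundary_param_def)

lemma per1: "\<gamma>1 (t + 1) = \<gamma>1 t" by (rule periodic_vector_derivative [OF per d1])

lemma in_J: "\<gamma> t \<in> J" by (rule boundary_param_in_frontier [OF param])

lemma J_param: "y \<in> J \<Longrightarrow> \<exists>t\<in>{0..<1}. y = \<gamma> t"
  using param by (auto simp: boundary_param_def)

lemma J_nonempty: "J \<noteq> {}" using in_J by blast

lemma J_strip: "J \<subseteq> strip" by (rule frontier_obstacle_subset_strip [OF obs])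

lemma Omega_not_J: "x \<in> \<Omega> \<Longrightarrow> x \<notin> J" "x \<in> \<Omega> \<Longrightarrow> x \<notin> O0" "x \<in> \<Omega> \<Longrightarrow> x \<in> strip"
  using closure_subset [of O0] by (auto simp: fluid_domain_def frontier_def)

lemma frontier_Omega: "frontier \<Omega> = J \<union> frontier strip"
  by (rule frontier_fluid_domain [OF obs])

lemma closure_Omega_cases:
  assumes "x \<in> closure \<Omega>"
  obtains "x \<in> \<Omega>" | "x \<in> J" | "x \<in> frontier strip" "x \<notin> J"
  using assms frontier_Omega open_fluid_domain [of O0] by (auto simp: frontier_def interior_open)

lemma infdist_pos: "x \<notin> J \<Longrightarrow> infdist x J > 0"
  using compact_J J_nonempty compact_imp_closed
  by (metis in_closed_iff_infdist_zero infdist_nonneg less_eq_real_def)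

lemma inner_ball_le: "0 < r \<Longrightarrow> r \<le> r0 \<Longrightarrow> ball (\<gamma> t + r *\<^sub>R N t) r \<subseteq> O0"
  using tangent_ball_mono [of "N t" r r0 "\<gamma> t"] inner_ball [of t] by auto

lemma outer_ball_le: "0 < r \<Longrightarrow> r \<le> r0 \<Longrightarrow> ball (\<gamma> t - r *\<^sub>R N t) r \<subseteq> \<Omega>"
  using tangent_ball_mono' [of "N t" r r0 "\<gamma> t"] outer_ball [of t] by auto

text \<open>
  The ball around \<open>x\<close> up to the nearest boundary point and the interior tangent ball at that point are
  disjoint and both touch it. So they are tangent to each other, and \<open>x\<close> lies on the normal.
\<close>

lemma nearest_point:
  assumes "x \<in> \<Omega>"
  obtains t where "t \<in> {0..<1}" "x = \<gamma> t - infdist x J *\<^sub>R N t"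
proof -
  define d where "d = infdist x J"
  have "d > 0" using infdist_pos Omega_not_J assms by (auto simp: d_def)
  obtain y where y: "y \<in> J" "infdist x J = dist x y"
    using infdist_attains_inf [of J x] compact_J J_nonempty compact_imp_closed by blast
  obtain t where t: "t \<in> {0..<1}" "y = \<gamma> t" using J_param y by blast
  have "ball x d \<inter> J = {}"
    using infdist_le [of _ J x] by (force simp: d_def)
  then have "ball x d \<inter> O0 = {}"
  proof -
    have "x \<in> ball x d - O0" using Omega_not_J [OF assms] \<open>d > 0\<close> by simp
    then show ?thesis using connected_Int_frontier [OF connected_ball, of x d O0] \<open>ball x d \<inter> J = {}\<close> by blast
  qed
  then have "ball x d \<inter> ball (\<gamma> t + r0 *\<^sub>R N t) r0 = {}" using inner_ball by blast
  then have "d + r0 \<le> dist x (\<gamma> t + r0 *\<^sub>R N t)"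
    using balls_meet [of x "\<gamma> t + r0 *\<^sub>R N t" d r0] \<open>d > 0\<close> r0 by force
  then have "(d + r0)\<^sup>2 \<le> (dist x (\<gamma> t + r0 *\<^sub>R N t))\<^sup>2" using \<open>d > 0\<close> r0 by (intro power_mono) auto
  also have "\<dots> = (norm (x - \<gamma> t))\<^sup>2 - 2 * r0 * ((x - \<gamma> t) \<bullet> N t) + r0\<^sup>2"
    using norm_diff_scaled_unit [of "N t" "x - \<gamma> t" r0] by (simp add: dist_norm diff_diff_add)
  finally have *: "(d + r0)\<^sup>2 \<le> (norm (x - \<gamma> t))\<^sup>2 - 2 * r0 * ((x - \<gamma> t) \<bullet> N t) + r0\<^sup>2" .
  have dn: "norm (x - \<gamma> t) = d" unfolding d_def y(2) t(2) dist_norm ..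
  define W where "W = (x - \<gamma> t) \<bullet> N t"
  have "2 * d * r0 \<le> - (2 * r0 * W)"
    using * unfolding dn power2_sum W_def [symmetric] by linarith
  then have "r0 * d \<le> r0 * (- W)" by (simp add: mult.commute)
  then have w: "W \<le> - d" using r0 by (simp only: mult_le_cancel_left_pos)
  have "(norm ((x - \<gamma> t) - (- d) *\<^sub>R N t))\<^sup>2 = d\<^sup>2 + 2 * d * W + d\<^sup>2"
    using norm_diff_scaled_unit [of "N t" "x - \<gamma> t" "- d"] unfolding dn W_def by simp
  also have "\<dots> \<le> d\<^sup>2 + 2 * d * (- d) + d\<^sup>2" using w \<open>d > 0\<close> by (intro add_mono mult_left_mono) auto
  also have "\<dots> = 0" by (simp add: power2_eq_square)
  finally have "x - \<gamma> t + d *\<^sub>R N t = 0" by simp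
  then have "x = \<gamma> t - d *\<^sub>R N t" by (simp add: algebra_simps)
  then show thesis using that t by (simp add: d_def)
qed

lemma normal_point:
  assumes "0 < s" "s \<le> r0"
  shows "\<gamma> t - s *\<^sub>R N t \<in> \<Omega>" "infdist (\<gamma> t - s *\<^sub>R N t) J = s"
proof -
  let ?x = "\<gamma> t - s *\<^sub>R N t"
  have sub: "ball ?x s \<subseteq> \<Omega>" by (rule outer_ball_le [OF assms])
  then show "?x \<in> \<Omega>" using assms by auto
  have "infdist ?x J \<le> s" using infdist_le [OF in_J [of t], of ?x] assms by (simp add: dist_norm)
  moreover have "s \<le> infdist ?x J"
  proof (rule ccontr)
    assume "\<not> s \<le> infdist ?x J"
    moreover obtain y where "y \<in> J" "infdist ?x J = dist ?x y"
      using infdist_attains_inf [of J ?x] compact_J J_nonempty compact_imp_closed by blast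
    ultimately have "y \<in> ball ?x s" "y \<in> J" by auto
    then show False using sub Omega_not_J by blast
  qed
  ultimately show "infdist ?x J = s" by simp
qed

text \<open>
  Equal points have equal distance \<open>s\<close> to the curve. The sphere of radius \<open>s\<close> around the common
  point is contained in the closed exterior tangent ball of the larger radius \<open>r0\<close> at \<open>\<gamma> t\<close> and
  meets its boundary only in \<open>\<gamma> t\<close>. As \<open>\<gamma> t'\<close> lies on the sphere but not in the open ball, the two
  foot points agree.
\<close>

lemma normal_point_unique:
  assumes eq: "\<gamma> t - s *\<^sub>R N t = \<gamma> t' - s' *\<^sub>R N t'" and s: "0 < s" "s < r0" "0 < s'" "s' < r0"
  shows "s = s'" "\<gamma> t = \<gamma> t'"
proof -
  show ss: "s = s'" using normal_point(2) [of s t] normal_point(2) [of s' t'] eq s by simp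
  define x where "x = \<gamma> t - s *\<^sub>R N t"
  define z where "z = \<gamma> t - r0 *\<^sub>R N t"
  have "\<gamma> t' \<notin> ball z r0" using outer_ball [of t] in_J Omega_not_J(1) unfolding z_def by blast
  then have 1: "r0 \<le> norm (\<gamma> t' - z)" by (simp add: dist_norm norm_minus_commute)
  have w: "\<gamma> t' - x = s *\<^sub>R N t'" using eq ss by (simp add: x_def algebra_simps)
  have e: "\<gamma> t' - z = s *\<^sub>R N t' - (- (r0 - s)) *\<^sub>R N t"
    using w by (simp add: x_def z_def algebra_simps)
  have "(norm (\<gamma> t' - z))\<^sup>2 = (norm (s *\<^sub>R N t'))\<^sup>2
      - 2 * (- (r0 - s)) * ((s *\<^sub>R N t') \<bullet> N t) + (- (r0 - s))\<^sup>2"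
    unfolding e by (rule norm_diff_scaled_unit) simp
  moreover have "r0\<^sup>2 \<le> (norm (\<gamma> t' - z))\<^sup>2" using 1 r0 by (intro power_mono) auto
  ultimately have "2 * (r0 - s) * s * 1 \<le> 2 * (r0 - s) * s * (N t' \<bullet> N t)"
    by (simp add: power2_eq_square algebra_simps)
  moreover have "2 * (r0 - s) * s > 0" using s by simp
  ultimately have "N t' \<bullet> N t \<ge> 1" by (meson mult_le_cancel_left_pos)
  then have "(norm (N t' - N t))\<^sup>2 \<le> 0"
    using norm_diff_scaled_unit [of "N t" "N t'" 1] by simp
  then have "N t' = N t" by simp
  then show "\<gamma> t = \<gamma> t'" using eq ss by simp
qed

lemma rho_C2: "C2_on (closure \<Omega>) \<rho>" and rho_harmonic: "harmonic_on \<Omega> \<rho>"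
  and rho_J: "x \<in> J \<Longrightarrow> \<rho> x = 1" and rho_strip: "x \<in> frontier strip \<Longrightarrow> \<rho> x = 0"
  and rho_far: "(\<rho> \<longlongrightarrow> 0) (far \<Omega>)"
  and grad_rho_far: "((\<lambda>x. norm (grad \<rho> x)) \<longlongrightarrow> 0) (far \<Omega>)"
  using rho by (auto simp: is_rho_def)

lemma rho_cont: "continuous_on (closure \<Omega>) \<rho>"
  by (rule C2_on_imp_continuous_on [OF rho_C2])

lemma rho_far_small: "e > 0 \<Longrightarrow> eventually (\<lambda>x. \<bar>\<rho> x\<bar> < e) (far \<Omega>)"
  using tendstoD [OF rho_far] by (simp add: dist_real_def)

lemma rho_le_1: "x \<in> closure \<Omega> \<Longrightarrow> \<rho> x \<le> 1"
proof -
  assume x: "x \<in> closure \<Omega>"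
  have "\<rho> x - 1 \<le> 0"
  proof (rule maximum_principle_closure [OF open_fluid_domain _ _ _ _ x])
    show "harmonic_on \<Omega> (\<lambda>x. \<rho> x - 1)" by (intro harmonic_on_diff rho_harmonic harmonic_on_const)
    show "continuous_on (closure \<Omega>) (\<lambda>x. \<rho> x - 1)" by (intro continuous_intros rho_cont)
    show "\<rho> x - 1 \<le> 0" if "x \<in> frontier \<Omega>" for x
      using that rho_J rho_strip unfolding frontier_Omega by auto
    show "eventually (\<lambda>x. \<rho> x - 1 \<le> e) (far \<Omega>)" if "e > 0" for e
      using rho_far_small [OF that] by eventually_elim auto
  qed
  then show ?thesis by simp
qed

lemma rho_nonneg: "x \<in> closure \<Omega> \<Longrightarrow> 0 \<le> \<rho> x"
proof -
  assume x: "x \<in> closure \<Omega>"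
  have "0 - \<rho> x \<le> 0"
  proof (rule maximum_principle_closure [OF open_fluid_domain _ _ _ _ x])
    show "harmonic_on \<Omega> (\<lambda>x. 0 - \<rho> x)" by (intro harmonic_on_diff rho_harmonic harmonic_on_const)
    show "continuous_on (closure \<Omega>) (\<lambda>x. 0 - \<rho> x)" by (intro continuous_intros rho_cont)
    show "0 - \<rho> x \<le> 0" if "x \<in> frontier \<Omega>" for x
      using that rho_J rho_strip unfolding frontier_Omega by auto
    show "eventually (\<lambda>x. 0 - \<rho> x \<le> e) (far \<Omega>)" if "e > 0" for e
      using rho_far_small [OF that] by eventually_elim auto
  qed
  then show ?thesis by simp
qed

lemma far_point:
  assumes "0 < h" "h < pi"
  shows "\<exists>R. \<forall>a\<ge>R. vector [a, h] \<in> \<Omega> \<and> b \<le> norm (vector [a, h] :: plane)"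
proof -
  have "bounded (closure O0)" using O0(3) by (rule bounded_closure)
  then obtain B where B: "\<And>x. x \<in> closure O0 \<Longrightarrow> norm x \<le> B"
    unfolding bounded_iff by blast
  have n: "\<bar>a\<bar> \<le> norm (vector [a, h] :: plane)" for a
    using component_le_norm_cart [of "vector [a, h] :: plane" 1] by simp
  have "vector [a, h] \<in> \<Omega> \<and> b \<le> norm (vector [a, h] :: plane)" if "a \<ge> max (B + 1) b" for a
  proof -
    have "(vector [a, h] :: plane) \<notin> closure O0" using B [of "vector [a, h]"] n [of a] that by auto
    moreover have "(vector [a, h] :: plane) \<in> strip" using assms by (simp add: strip_def)
    moreover have "b \<le> norm (vector [a, h] :: plane)" using n [of a] that by linarith
    ultimately show ?thesis by (simp add: fluid_domain_def)
  qed
  then show ?thesis by blast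
qed

lemma rho_less_1: "x \<in> \<Omega> \<Longrightarrow> \<rho> x < 1"
proof -
  assume x: "x \<in> \<Omega>"
  have "eventually (\<lambda>x. \<bar>\<rho> x\<bar> < 1) (far \<Omega>)" by (rule rho_far_small) simp
  then obtain b where b: "\<And>x. x \<in> \<Omega> \<Longrightarrow> b \<le> norm x \<Longrightarrow> \<bar>\<rho> x\<bar> < 1"
    unfolding eventually_far by blast
  obtain x0 where x0: "x0 \<in> \<Omega>" "\<rho> x0 < 1" using far_point [of 1 b] b pi_gt3 by force
  have "0 < 1 - \<rho> x"
  proof (rule harmonic_nonneg_imp_pos [OF open_fluid_domain obstacle_exterior(1) [OF obs] _ _ x0(1) _ x])
    show "harmonic_on \<Omega> (\<lambda>x. 1 - \<rho> x)" by (intro harmonic_on_diff rho_harmonic harmonic_on_const)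
    show "0 \<le> 1 - \<rho> x" if "x \<in> \<Omega>" for x using rho_le_1 [of x] that closure_subset by auto
  qed (use x0 in auto)
  then show ?thesis by simp
qed

lemma one_minus_rho_away:
  assumes "\<delta> > 0"
  obtains a where "a > 0" "\<And>x. x \<in> closure \<Omega> \<Longrightarrow> \<delta> \<le> infdist x J \<Longrightarrow> a \<le> 1 - \<rho> x"
proof -
  have "eventually (\<lambda>x. \<bar>\<rho> x\<bar> < 1/2) (far \<Omega>)" by (rule rho_far_small) simp
  then obtain b where b: "\<And>x. x \<in> \<Omega> \<Longrightarrow> b \<le> norm x \<Longrightarrow> \<bar>\<rho> x\<bar> < 1/2"
    unfolding eventually_far by blast
  define K where "K = closure \<Omega> \<inter> {x. \<delta> \<le> infdist x J} \<inter> cball 0 b"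
  have "closed {x. \<delta> \<le> infdist x J}" by (intro closed_Collect_le continuous_intros)
  then have "compact K" unfolding K_def by (intro closed_Int_compact closed_Int) auto
  have pos: "1 - \<rho> x > 0" if "x \<in> closure \<Omega>" "\<delta> \<le> infdist x J" for x
    using that(1)
  proof (cases rule: closure_Omega_cases)
    case 1 then show ?thesis using rho_less_1 by auto
  next
    case 2 then show ?thesis using that assms by simp
  next
    case 3 then show ?thesis using rho_strip by auto
  qed
  have "\<exists>a>0. \<forall>x\<in>K. a \<le> 1 - \<rho> x"
  proof (cases "K = {}")
    case False
    have "continuous_on K (\<lambda>x. 1 - \<rho> x)"
      by (intro continuous_intros continuous_on_subset [OF rho_cont]) (auto simp: K_def)
    then obtain m where "m \<in> K" "\<And>x. x \<in> K \<Longrightarrow> 1 - \<rho> m \<le> 1 - \<rho> x"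
      using continuous_attains_inf [OF \<open>compact K\<close> False] by blast
    then show ?thesis using pos [of m] by (intro exI [of _ "1 - \<rho> m"]) (auto simp: K_def)
  qed (auto intro: exI [of _ 1])
  then obtain a where a: "a > 0" "\<And>x. x \<in> K \<Longrightarrow> a \<le> 1 - \<rho> x" by blast
  show thesis
  proof (rule that [of "min a (1/2)"])
    fix x assume x: "x \<in> closure \<Omega>" "\<delta> \<le> infdist x J"
    show "min a (1/2) \<le> 1 - \<rho> x"
    proof (cases "norm x \<le> b")
      case True
      then show ?thesis using a(2) [of x] x by (auto simp: K_def)
    next
      case False
      from x(1) show ?thesis
      proof (cases rule: closure_Omega_cases)
        case 1 then show ?thesis using b [of x] False by auto
      next
        case 2 then show ?thesis using x assms by simp
      next
        case 3 then show ?thesis using rho_strip by auto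
      qed
    qed
  qed (use a in auto)
qed

text \<open>
  Hopf's lemma with a uniform constant. At a boundary point compare \<open>u\<close> with the radial barrier in
  the exterior tangent ball, minus the concentric ball of half the radius. The latter balls stay in a
  fixed compact subset of the fluid domain, on which \<open>u\<close> is bounded below by a positive constant.
\<close>

theorem hopf_lower_bound:
  assumes harm: "harmonic_on \<Omega> u" and cont: "continuous_on (closure \<Omega>) u"
    and pos: "\<And>x. x \<in> \<Omega> \<Longrightarrow> 0 < u x"
  obtains c where "c > 0" "\<And>x. x \<in> \<Omega> \<Longrightarrow> infdist x J \<le> r0 / 4 \<Longrightarrow> c * infdist x J \<le> u x"
proof -
  define r where "r = r0 / 2"
  have r: "0 < r" "r < r0" using r0 by (auto simp: r_def)
  define f where "f p = \<gamma> (fst p) - r *\<^sub>R N (fst p) + snd p" for p :: "real \<times> plane"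
  define K where "K = f ` ({0..1} \<times> cball 0 (r/2))"
  have contN: "continuous_on S (\<lambda>t. N t)" for S unfolding curve_normal_def
    using nz by (intro continuous_intros vector_derivative_imp_continuous_on [OF d2]) auto
  have "continuous_on ({0..1} \<times> cball 0 (r/2)) f" unfolding f_def
    by (intro continuous_intros continuous_on_compose2 [OF contN [of UNIV]]
        continuous_on_compose2 [OF boundary_param_continuous [OF param, of UNIV]]) auto
  then have "compact K" unfolding K_def by (intro compact_continuous_image compact_Times) auto
  have KO: "K \<subseteq> \<Omega>"
  proof
    fix x assume "x \<in> K"
    then obtain t v where "x = \<gamma> t - r *\<^sub>R N t + v" "norm v \<le> r/2" by (auto simp: K_def f_def)
    then have "x \<in> ball (\<gamma> t - r *\<^sub>R N t) r" using r by (simp add: dist_norm)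
    then show "x \<in> \<Omega>" using outer_ball_le [of r t] r by auto
  qed
  have "K \<noteq> {}" using r by (auto simp: K_def)
  moreover have "continuous_on K u"
    by (rule continuous_on_subset [OF cont]) (use KO closure_subset in blast)
  ultimately obtain m where m: "m \<in> K" "\<And>x. x \<in> K \<Longrightarrow> u m \<le> u x"
    using continuous_attains_inf [OF \<open>compact K\<close>] by blast
  define a where "a = u m"
  have a: "a > 0" using pos KO m by (auto simp: a_def)
  have nonneg: "0 \<le> u x" if "x \<in> closure \<Omega>" for x
    by (rule continuous_ge_on_closure [OF cont that]) (use pos in \<open>auto intro: less_imp_le\<close>)
  show thesis
  proof (rule that [of "a / ln 2 / r"])
    show "0 < a / ln 2 / r" using a r by simp
    fix x assume x: "x \<in> \<Omega>" "infdist x J \<le> r0 / 4"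
    define s where "s = infdist x J"
    obtain t where t: "t \<in> {0..<1}" "x = \<gamma> t - s *\<^sub>R N t"
      using nearest_point [OF x(1)] unfolding s_def by blast
    have s: "0 < s" "s \<le> r/2" using x infdist_pos Omega_not_J(1) by (auto simp: s_def r_def)
    define z where "z = \<gamma> t - r *\<^sub>R N t"
    have zx: "dist z x = r - s"
    proof -
      have "x - z = (r - s) *\<^sub>R N t" by (simp add: z_def t algebra_simps)
      then show ?thesis using s r by (simp add: dist_norm norm_minus_commute)
    qed
    have sub: "ball z r \<subseteq> \<Omega>" using outer_ball_le [of r t] r by (auto simp: z_def)
    then have "closure (ball z r) \<subseteq> closure \<Omega>" by (rule closure_mono)
    then have csub: "cball z r \<subseteq> closure \<Omega>" using r by simp
    have "a / ln (r / (r/2)) * ln (r / dist z x) \<le> u x"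
    proof (rule annulus_lower_bound)
      show "harmonic_on {x. r/2 < dist z x \<and> dist z x < r} u"
        by (rule harmonic_on_subset [OF harm]) (use sub in auto)
      show "continuous_on {x. r/2 \<le> dist z x \<and> dist z x \<le> r} u"
        by (rule continuous_on_subset [OF cont]) (use csub in auto)
      show "a \<le> u y" if "dist z y = r/2" for y
      proof -
        have "y = f (t, y - z)" by (simp add: f_def z_def)
        moreover have "(t, y - z) \<in> {0..1} \<times> cball 0 (r/2)" using t that
          by (auto simp: dist_norm norm_minus_commute)
        ultimately have "y \<in> K" unfolding K_def by (metis imageI)
        then show ?thesis using m by (simp add: a_def)
      qed
      show "0 \<le> u y" if "dist z y = r" for y using nonneg csub that by auto
    qed (use r s zx in auto)
    then have 1: "a / ln 2 * ln (r / (r - s)) \<le> u x" using r zx by simp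
    have "s / r \<le> ln (r / (r - s))"
    proof -
      have "ln ((r - s) / r) \<le> (r - s) / r - 1" using s r by (intro ln_le_minus_one) auto
      moreover have "ln ((r - s) / r) = - ln (r / (r - s))" using s r by (simp add: ln_div)
      moreover have "(r - s) / r - 1 = - (s / r)" using r by (simp add: field_simps)
      ultimately show ?thesis by linarith
    qed
    then have "a / ln 2 * (s / r) \<le> a / ln 2 * ln (r / (r - s))" using a by (intro mult_left_mono) auto
    with 1 show "a / ln 2 / r * infdist x J \<le> u x" by (simp add: s_def)
  qed
qed

text \<open>
  Barrier from the other side: a logarithm with pole at the centre \<open>c\<close> of the interior tangent ball,
  which vanishes on its boundary sphere and dominates \<open>1 - \<rho>\<close> on the walls and at infinity.
\<close>

theorem one_minus_rho_upper:
  obtains C where "C > 0" "\<And>x. x \<in> \<Omega> \<Longrightarrow> 1 - \<rho> x \<le> C * infdist x J"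
proof -
  obtain D where D: "D > 0" "\<And>x y. x \<in> closure O0 \<Longrightarrow> y \<notin> strip \<Longrightarrow> D \<le> dist x y"
    using wall_distance by blast
  (* The walls are at distance at least r0 + D from c, where M makes the barrier at least 1. *)
  define M where "M = 1 / ln ((r0 + D) / r0)"
  have M: "M > 0" using D r0 by (simp add: M_def)
  show thesis
  proof (rule that [of "M / r0"])
    show "M / r0 > 0" using M r0 by simp
    fix x assume x: "x \<in> \<Omega>"
    define s where "s = infdist x J"
    obtain t where t: "x = \<gamma> t - s *\<^sub>R N t" using nearest_point [OF x] unfolding s_def by blast
    have s: "0 < s" using x infdist_pos Omega_not_J(1) by (auto simp: s_def)
    define c where "c = \<gamma> t + r0 *\<^sub>R N t"
    have cO: "c \<in> O0" using inner_ball [of t] r0 by (auto simp: c_def)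
    have cb: "cball c r0 \<subseteq> closure O0"
      using closure_mono [OF inner_ball [of t]] r0 by (simp add: c_def)
    have wall: "r0 + D \<le> dist c y" if "y \<notin> strip" for y
    proof -
      have cy: "c \<noteq> y" using that cO O0 closure_subset by blast
      define z where "z = c + (r0 / dist c y) *\<^sub>R (y - c)"
      have cz: "dist c z = r0" using cy r0 by (simp add: z_def dist_norm norm_minus_commute)
      then have "z \<in> closure O0" using cb by auto
      then have "D \<le> dist z y" using D that by blast
      moreover have zy: "dist z y = \<bar>dist c y - r0\<bar>"
      proof -
        have "y - z = (1 - r0 / dist c y) *\<^sub>R (y - c)" by (simp add: z_def algebra_simps)
        then have "dist z y = \<bar>1 - r0 / dist c y\<bar> * dist c y" by (simp add: dist_norm norm_minus_commute)
        also have "\<dots> = \<bar>(1 - r0 / dist c y) * dist c y\<bar>" by (simp add: abs_mult)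
        also have "(1 - r0 / dist c y) * dist c y = dist c y - r0" using cy by (simp add: field_simps)
        finally show ?thesis .
      qed
      moreover have "dist c y > r0"
        using that cb O0 by (meson mem_cball not_le subset_iff)
      ultimately show ?thesis by simp
    qed
    define v where "v y = (1 - \<rho> y) - M * (ln (norm (y - c)) - ln r0)" for y
    have cn: "c \<notin> closure \<Omega>" using cO by (simp add: closure_fluid_domain [OF obs])
    have lnM: "1 \<le> M * (ln (norm (y - c)) - ln r0)" if "r0 + D \<le> dist c y" for y
    proof -
      have "ln (r0 + D) \<le> ln (dist c y)" using that r0 D by (subst ln_le_cancel_iff) auto
      then have "ln ((r0 + D) / r0) \<le> ln (norm (y - c)) - ln r0"
        using r0 D by (simp add: ln_div dist_norm norm_minus_commute)
      then have "M * ln ((r0 + D) / r0) \<le> M * (ln (norm (y - c)) - ln r0)"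
        using M by (intro mult_left_mono) auto
      moreover have "M * ln ((r0 + D) / r0) = 1"
        using M by (simp add: M_def)
      ultimately show ?thesis by simp
    qed
    have "v x \<le> 0"
    proof (rule maximum_principle_closure [OF open_fluid_domain])
      show "harmonic_on \<Omega> v" unfolding v_def
        using cn closure_subset
        by (intro harmonic_on_diff harmonic_on_cmult harmonic_on_const rho_harmonic harmonic_on_ln_norm) auto
      have "norm (y - c) \<noteq> 0" if "y \<in> closure \<Omega>" for y using cn that by auto
      then show "continuous_on (closure \<Omega>) v" unfolding v_def
        by (intro continuous_intros rho_cont) auto
      show "v y \<le> 0" if "y \<in> frontier \<Omega>" for y
      proof (cases "y \<in> J")
        case True
        then have "y \<notin> ball c r0" using O0 inner_ball [of t]
          by (auto simp: frontier_def interior_open c_def)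
        then have "ln r0 \<le> ln (norm (y - c))" using r0
          by (subst ln_le_cancel_iff) (auto simp: dist_norm norm_minus_commute)
        then show ?thesis using M True by (simp add: v_def rho_J)
      next
        case False
        then have y: "y \<in> frontier strip" using that frontier_Omega by auto
        then have "y \<notin> strip" using open_strip by (simp add: frontier_def interior_open)
        from lnM [OF wall [OF this]] show ?thesis using rho_strip [OF y] by (simp add: v_def)
      qed
      show "eventually (\<lambda>x. v x \<le> e) (far \<Omega>)" if "e > 0" for e
        unfolding eventually_far
      proof (intro exI [of _ "norm c + (r0 + D)"] ballI impI)
        fix y assume y: "y \<in> \<Omega>" "norm c + (r0 + D) \<le> norm y"
        have "r0 + D \<le> dist c y" using y norm_triangle_ineq2 [of y c] by (simp add: dist_norm norm_minus_commute)
        from lnM [OF this] show "v y \<le> e"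
          using that rho_nonneg [OF subsetD [OF closure_subset y(1)]] by (simp add: v_def)
      qed
      show "x \<in> closure \<Omega>" using x closure_subset by blast
    qed
    moreover have "norm (x - c) = r0 + s"
    proof -
      have "x - c = (- (r0 + s)) *\<^sub>R N t" by (simp add: t c_def algebra_simps)
      then show ?thesis using s r0 by simp
    qed
    moreover have "ln (r0 + s) - ln r0 \<le> s / r0"
    proof -
      have "ln (r0 + s) - ln r0 = ln ((r0 + s) / r0)" using s r0 by (simp add: ln_div)
      also have "\<dots> \<le> (r0 + s) / r0 - 1" using s r0 by (intro ln_le_minus_one) auto
      also have "\<dots> = s / r0" using r0 by (simp add: field_simps)
      finally show ?thesis .
    qed
    ultimately have "1 - \<rho> x \<le> M * (s / r0)"
      using M mult_left_mono [of "ln (r0 + s) - ln r0" "s / r0" M] by (simp add: v_def)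
    then show "1 - \<rho> x \<le> M / r0 * infdist x J" by (simp add: s_def)
  qed
qed

end

section \<open>Normal derivatives on the boundary\<close>

text \<open>
  A ball tangent to a hyperplane contains short segments in every direction that points strictly into its
  half space.
\<close>

lemma tangent_ball_direction:
  fixes x v n :: "'a::real_inner"
  assumes n: "norm n = 1" and r: "r > 0" and v: "v \<bullet> n < 0"
  obtains s0 where "s0 > 0" "\<And>s. 0 < s \<Longrightarrow> s \<le> s0 \<Longrightarrow> x + s *\<^sub>R v \<in> ball (x - r *\<^sub>R n) r"
proof -
  have vn: "v \<noteq> 0" using v by auto
  define s0 where "s0 = r * (- (v \<bullet> n)) / (norm v)\<^sup>2"
  have "s0 > 0" unfolding s0_def by (intro divide_pos_pos mult_pos_pos) (use r v vn in auto)
  moreover have "x + s *\<^sub>R v \<in> ball (x - r *\<^sub>R n) r" if s: "0 < s" "s \<le> s0" for s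
  proof -
    have "s * (norm v)\<^sup>2 \<le> r * (- (v \<bullet> n))" using s vn by (simp add: s0_def field_simps)
    also have "\<dots> < 2 * r * (- (v \<bullet> n))" using r v by simp
    finally have "s * (norm v)\<^sup>2 < 2 * r * (- (v \<bullet> n))" .
    then have "s * (s * (norm v)\<^sup>2) < s * (2 * r * (- (v \<bullet> n)))"
      by (rule mult_strict_left_mono [OF _ s(1)])
    moreover have "(norm (s *\<^sub>R v - (- r) *\<^sub>R n))\<^sup>2 = (norm (s *\<^sub>R v))\<^sup>2 - 2 * (- r) * ((s *\<^sub>R v) \<bullet> n) + (- r)\<^sup>2"
      by (rule norm_diff_scaled_unit [OF n])
    ultimately have "(norm (s *\<^sub>R v - (- r) *\<^sub>R n))\<^sup>2 < r\<^sup>2"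
      by (simp add: power_mult_distrib power2_eq_square [of s] mult_ac)
    then have "norm (s *\<^sub>R v - (- r) *\<^sub>R n) < r" using r by (simp add: power2_less_imp_less)
    moreover have "dist (x - r *\<^sub>R n) (x + s *\<^sub>R v) = norm (s *\<^sub>R v - (- r) *\<^sub>R n)"
    proof -
      have "(x - r *\<^sub>R n) - (x + s *\<^sub>R v) = - (s *\<^sub>R v - (- r) *\<^sub>R n)" by simp
      then show ?thesis by (simp only: dist_norm norm_minus_cancel)
    qed
    ultimately show ?thesis by simp
  qed
  ultimately show thesis using that by blast
qed

text \<open>
  The outer ball shows that \<open>n\<close> satisfies the defining condition. A second solution \<open>\<nu>\<close> is excluded by
  the direction \<open>\<nu> - n\<close>: it points into the inner ball, but has positive component along \<open>\<nu>\<close>.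
\<close>

lemma outward_normal_eqI:
  assumes n: "norm n = 1" and r: "r > 0" and inner: "ball (x - r *\<^sub>R n) r \<subseteq> U"
    and outer: "ball (x + r *\<^sub>R n) r \<inter> U = {}"
  shows "outward_normal U x = n"
  unfolding outward_normal_def
proof (rule the_equality)
  have "eventually (\<lambda>y. (y - x) \<bullet> n \<le> e * norm (y - x)) (at x within U)" if e: "e > 0" for e
    unfolding eventually_at
  proof (intro exI conjI ballI impI)
    show "2 * r * e > 0" using r e by simp
    fix y assume y: "y \<in> U" "y \<noteq> x \<and> dist y x < 2 * r * e"
    then have "y \<notin> ball (x + r *\<^sub>R n) r" using outer by auto
    then have "r \<le> norm ((y - x) - r *\<^sub>R n)" by (simp add: dist_norm norm_minus_commute diff_diff_add)
    then have "r\<^sup>2 \<le> (norm ((y - x) - r *\<^sub>R n))\<^sup>2" using r by (intro power_mono) auto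
    then have "2 * r * ((y - x) \<bullet> n) \<le> (norm (y - x))\<^sup>2"
      using norm_diff_scaled_unit [OF n, of "y - x" r] by simp
    also have "\<dots> \<le> 2 * r * e * norm (y - x)"
      unfolding power2_eq_square using y by (intro mult_right_mono) (auto simp: dist_norm)
    finally have "2 * r * ((y - x) \<bullet> n) \<le> 2 * r * (e * norm (y - x))" by (simp add: mult.assoc)
    moreover have "2 * r > 0" using r by simp
    ultimately show "(y - x) \<bullet> n \<le> e * norm (y - x)" by (simp only: mult_le_cancel_left_pos)
  qed
  with n show "norm n = 1 \<and> (\<forall>e>0. eventually (\<lambda>y. (y - x) \<bullet> n \<le> e * norm (y - x)) (at x within U))"
    by blast
next
  fix \<nu> assume \<nu>: "norm \<nu> = 1 \<and> (\<forall>e>0. eventually (\<lambda>y. (y - x) \<bullet> \<nu> \<le> e * norm (y - x)) (at x within U))"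
  show "\<nu> = n"
  proof (rule ccontr)
    assume "\<nu> \<noteq> n"
    define v where "v = \<nu> - n"
    have "(norm v)\<^sup>2 = 2 - 2 * (\<nu> \<bullet> n)"
      using norm_diff_scaled_unit [OF n, of \<nu> 1] \<nu> by (simp add: v_def)
    moreover have "(norm v)\<^sup>2 > 0" using \<open>\<nu> \<noteq> n\<close> by (simp add: v_def)
    ultimately have lt: "\<nu> \<bullet> n < 1" by linarith
    have nn: "n \<bullet> n = 1" "\<nu> \<bullet> \<nu> = 1" using n \<nu> by (simp_all add: norm_eq_1)
    have vn: "v \<bullet> n < 0" using lt nn by (simp add: v_def inner_diff_left)
    have v\<nu>: "v \<bullet> \<nu> > 0" using lt nn by (simp add: v_def inner_diff_left inner_commute [of n \<nu>])
    have vpos: "norm v > 0" using vn by auto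
    obtain s0 where s0: "s0 > 0" "\<And>s. 0 < s \<Longrightarrow> s \<le> s0 \<Longrightarrow> x + s *\<^sub>R v \<in> ball (x - r *\<^sub>R n) r"
      using tangent_ball_direction [OF n r vn] by blast
    define e where "e = v \<bullet> \<nu> / (2 * norm v)"
    have "e > 0" using v\<nu> vpos by (simp add: e_def)
    with \<nu> have "eventually (\<lambda>y. (y - x) \<bullet> \<nu> \<le> e * norm (y - x)) (at x within U)" by blast
    then obtain d where d: "d > 0" "\<And>y. y \<in> U \<Longrightarrow> y \<noteq> x \<Longrightarrow> dist y x < d \<Longrightarrow> (y - x) \<bullet> \<nu> \<le> e * norm (y - x)"
      unfolding eventually_at by blast
    define s where "s = min s0 (d / (2 * norm v))"
    have s: "0 < s" "s \<le> s0" "s \<le> d / (2 * norm v)" using s0 d vpos by (auto simp: s_def)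
    have "s * norm v < d" using s d vpos by (simp add: field_simps)
    then have "(s *\<^sub>R v) \<bullet> \<nu> \<le> e * norm (s *\<^sub>R v)"
    proof -
      have "x + s *\<^sub>R v \<in> U" using s0(2) [OF s(1,2)] inner by blast
      then show ?thesis using d(2) [of "x + s *\<^sub>R v"] s vpos \<open>s * norm v < d\<close> by (simp add: dist_norm)
    qed
    then have "s * (v \<bullet> \<nu>) \<le> s * (e * norm v)" using s by (simp add: mult_ac)
    then have "v \<bullet> \<nu> \<le> e * norm v" using s by simp
    then show False using v\<nu> vpos by (simp add: e_def)
  qed
qed

text \<open>
  Within an arbitrary set the derivative need not be unique. Here the inner ball provides
  all directions of an open half space, on which any two derivatives agree; these directions span.
\<close>

lemma frechet_derivative_within_tangent_ball:
  fixes u :: "plane \<Rightarrow> real"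
  assumes n: "norm n = 1" and r: "r > 0" and inner: "ball (x - r *\<^sub>R n) r \<subseteq> U"
    and D: "(u has_derivative D) (at x within closure U)"
  shows "frechet_derivative u (at x within closure U) = D"
proof -
  let ?F = "at x within closure U"
  define D' where "D' = frechet_derivative u ?F"
  have D': "(u has_derivative D') ?F"
    unfolding D'_def using D frechet_derivative_works differentiable_def by blast
  have xc: "x \<in> closure U"
  proof -
    have "x \<in> cball (x - r *\<^sub>R n) r" using n r by (simp add: dist_norm)
    then show ?thesis using closure_mono [OF inner] r by auto
  qed
  have eq: "D v = D' v" if v: "v \<bullet> n < 0" for v
  proof -
    obtain s0 where s0: "s0 > 0" "\<And>s. 0 < s \<Longrightarrow> s \<le> s0 \<Longrightarrow> x + s *\<^sub>R v \<in> ball (x - r *\<^sub>R n) r"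
      using tangent_ball_direction [OF n r v] by blast
    define l where "l s = x + s *\<^sub>R v" for s
    have l: "(l has_derivative (\<lambda>s. s *\<^sub>R v)) (at 0 within {0..s0})"
      unfolding l_def by (auto intro!: derivative_eq_intros)
    have lU: "l ` {0..s0} \<subseteq> closure U"
    proof
      fix y assume "y \<in> l ` {0..s0}"
      then obtain s where s: "0 \<le> s" "s \<le> s0" "y = x + s *\<^sub>R v" by (auto simp: l_def)
      show "y \<in> closure U"
      proof (cases "s = 0")
        case True then show ?thesis using s xc by simp
      next
        case False then show ?thesis using s s0(2) [of s] inner closure_subset by fastforce
      qed
    qed
    have "((\<lambda>s. u (l s)) has_vector_derivative E v) (at 0 within {0..s0})"
      if E: "(u has_derivative E) ?F" for E
    proof -
      have l0: "l 0 = x" by (simp add: l_def)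
      have "(u has_derivative E) (at (l 0) within l ` {0..s0})"
        unfolding l0 by (rule has_derivative_subset [OF E lU])
      from has_derivative_in_compose [OF l this]
      have "((\<lambda>s. u (l s)) has_derivative (\<lambda>s. E (s *\<^sub>R v))) (at 0 within {0..s0})" .
      moreover have "E (s *\<^sub>R v) = s *\<^sub>R E v" for s
        using E by (simp add: has_derivative_def bounded_linear.linear linear_cmul)
      ultimately show ?thesis by (simp add: has_vector_derivative_def)
    qed
    from this [OF D] this [OF D'] show ?thesis
      by (rule vector_derivative_unique_within [rotated])
         (use s0 in \<open>simp add: trivial_limit_within islimpt_Icc\<close>)
  qed
  have "D v = D' v" for v
  proof -
    define k where "k = \<bar>v \<bullet> n\<bar> + 1"
    have nn: "n \<bullet> n = 1" using n by (simp add: norm_eq_1)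
    have "(v - k *\<^sub>R n) \<bullet> n < 0" "(- k *\<^sub>R n) \<bullet> n < 0"
      using nn by (auto simp: k_def inner_diff_left)
    then have "D (v - k *\<^sub>R n) = D' (v - k *\<^sub>R n)" "D (- k *\<^sub>R n) = D' (- k *\<^sub>R n)" using eq by blast+
    moreover have "E v = E (v - k *\<^sub>R n) - E (- k *\<^sub>R n)" if "(u has_derivative E) ?F" for E
      using linear_diff [OF bounded_linear.linear [OF has_derivative_bounded_linear [OF that]], of "v - k *\<^sub>R n" "- k *\<^sub>R n"]
      by simp
    ultimately show ?thesis using D D' by metis
  qed
  then show ?thesis by (auto simp: D'_def)
qed

lemma normal_deriv_eqI:
  assumes n: "norm n = 1" and r: "r > 0" and inner: "ball (x - r *\<^sub>R n) r \<subseteq> U"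
    and outer: "ball (x + r *\<^sub>R n) r \<inter> U = {}"
    and D: "(u has_derivative (\<lambda>v. g \<bullet> v)) (at x within closure U)"
  shows "normal_deriv U u x = g \<bullet> n"
  unfolding normal_deriv_def outward_normal_eqI [OF n r inner outer]
    frechet_derivative_within_tangent_ball [OF n r inner D] ..

context flow
begin

lemma C2_closure_gradient:
  assumes "C2_derivs (closure \<Omega>) u g h" "x \<in> closure \<Omega>"
  shows "(u has_derivative (\<lambda>v. g x \<bullet> v)) (at x within closure \<Omega>)"
  using assms by (auto simp: C2_derivs_def)

lemma normal_deriv_J:
  assumes "C2_derivs (closure \<Omega>) u g h"
  shows "normal_deriv \<Omega> u (\<gamma> t) = g (\<gamma> t) \<bullet> N t"
proof (rule normal_deriv_eqI [OF norm_N r0 outer_ball])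
  show "ball (\<gamma> t + r0 *\<^sub>R N t) r0 \<inter> \<Omega> = {}" using inner_ball Omega_not_J(2) by blast
  have "\<gamma> t \<in> closure \<Omega>" using in_J frontier_Omega by (auto simp: frontier_def [of \<Omega>])
  then show "(u has_derivative (\<lambda>v. g (\<gamma> t) \<bullet> v)) (at (\<gamma> t) within closure \<Omega>)"
    by (rule C2_closure_gradient [OF assms])
qed

lemma J_closure: "J \<subseteq> closure \<Omega>" and wall_closure: "frontier strip \<subseteq> closure \<Omega>"
  using frontier_Omega by (auto simp: frontier_def [of \<Omega>])

lemma normal_deriv_top:
  assumes "C2_derivs (closure \<Omega>) u g h"
  shows "normal_deriv \<Omega> u (vector [a, pi]) = g (vector [a, pi]) $ 2"
proof -
  let ?x = "vector [a, pi] :: plane" and ?n = "axis 2 1 :: plane"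
  obtain D where D: "D > 0" "\<And>x y. x \<in> closure O0 \<Longrightarrow> y \<notin> strip \<Longrightarrow> D \<le> dist x y"
    using wall_distance by blast
  define r where "r = min 1 (D / 2)"
  have r: "0 < r" "r \<le> 1" "2 * r \<le> D" using D by (auto simp: r_def)
  have xs: "?x \<in> frontier strip" "?x \<notin> strip" unfolding frontier_strip by (auto simp: strip_def)
  have "normal_deriv \<Omega> u ?x = g ?x \<bullet> ?n"
  proof (rule normal_deriv_eqI [OF _ r(1)])
    show "ball (?x - r *\<^sub>R ?n) r \<subseteq> \<Omega>"
    proof
      fix y assume y: "y \<in> ball (?x - r *\<^sub>R ?n) r"
      have "\<bar>(?x - r *\<^sub>R ?n - y) $ 2\<bar> < r"
        using y component_le_norm_cart [of "?x - r *\<^sub>R ?n - y" 2] by (simp add: dist_norm)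
      then have "\<bar>pi - r - y $ 2\<bar> < r" by (simp add: axis_def)
      then have "y \<in> strip" using r pi_gt3 by (auto simp: strip_def)
      moreover have "y \<notin> closure O0"
      proof
        assume "y \<in> closure O0"
        then have "D \<le> dist y ?x" using D xs by blast
        moreover have "dist y ?x < 2 * r"
          using y r dist_triangle [of y ?x "?x - r *\<^sub>R ?n"] by (simp add: dist_commute dist_norm)
        ultimately show False using r by simp
      qed
      ultimately show "y \<in> \<Omega>" by (simp add: fluid_domain_def)
    qed
    show "ball (?x + r *\<^sub>R ?n) r \<inter> \<Omega> = {}"
    proof (rule ccontr)
      assume "ball (?x + r *\<^sub>R ?n) r \<inter> \<Omega> \<noteq> {}"
      then obtain y where y: "y \<in> ball (?x + r *\<^sub>R ?n) r" "y \<in> \<Omega>" by blast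
      have "\<bar>(?x + r *\<^sub>R ?n - y) $ 2\<bar> < r"
        using y component_le_norm_cart [of "?x + r *\<^sub>R ?n - y" 2] by (simp add: dist_norm)
      then have "\<bar>pi + r - y $ 2\<bar> < r" by (simp add: axis_def)
      then show False using Omega_not_J(3) [OF y(2)] by (auto simp: strip_def)
    qed
    show "(u has_derivative (\<lambda>v. g ?x \<bullet> v)) (at ?x within closure \<Omega>)"
      using C2_closure_gradient [OF assms] wall_closure xs by blast
  qed simp
  then show ?thesis by (simp add: inner_axis)
qed

lemma grad_eq:
  assumes "C2_derivs (closure \<Omega>) u g h" "x \<in> \<Omega>"
  shows "grad u x = g x"
proof -
  have "(u has_derivative (\<lambda>v. g x \<bullet> v)) (at x within \<Omega>)"
    using C2_closure_gradient [OF assms(1)] assms(2) closure_subset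
    by (blast intro: has_derivative_subset)
  then have "(u has_derivative (\<lambda>v. g x \<bullet> v)) (at x)"
    using at_within_open [OF assms(2) open_fluid_domain] by simp
  then have "frechet_derivative u (at x) = (\<lambda>v. g x \<bullet> v)" by (rule frechet_derivative_at [symmetric])
  then show ?thesis by (simp add: grad_def vec_eq_iff inner_axis)
qed

end

section \<open>Integrals in the plane\<close>

lemma cbox_plane: "cbox (vector [a, c] :: plane) (vector [b, d]) = {v. v $ 1 \<in> {a..b} \<and> v $ 2 \<in> {c..d}}"
  by (auto simp: mem_box_cart forall_2)

text \<open>
  The bijection between pairs and vectors preserves intervals and their content, so Fubini's theorem
  carries over from products.
\<close>

lemma integral_plane:
  fixes f :: "plane \<Rightarrow> real"
  assumes "continuous_on (cbox (vector [a, c]) (vector [b, d])) f"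
  shows "integral (cbox (vector [a, c]) (vector [b, d])) f
      = integral {a..b} (\<lambda>x. integral {c..d} (\<lambda>y. f (vector [x, y])))"
proof -
  define g where "g p = (vector [fst p, snd p] :: plane)" for p :: "real \<times> real"
  define h where "h v = (v $ 1, v $ 2)" for v :: plane
  have gi: "g ` cbox (u1, u2) (v1, v2) = cbox (vector [u1, u2]) (vector [v1, v2])" for u1 u2 v1 v2
  proof
    show "cbox (vector [u1, u2]) (vector [v1, v2]) \<subseteq> g ` cbox (u1, u2) (v1, v2)"
    proof
      fix x :: plane assume "x \<in> cbox (vector [u1, u2]) (vector [v1, v2])"
      then have "x = g (x $ 1, x $ 2)" "(x $ 1, x $ 2) \<in> cbox (u1, u2) (v1, v2)"
        by (auto simp: g_def cbox_plane cbox_Pair_eq)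
      then show "x \<in> g ` cbox (u1, u2) (v1, v2)" by (rule image_eqI)
    qed
  qed (auto simp: g_def cbox_plane cbox_Pair_eq)
  have hi: "h ` cbox u v = cbox (u $ 1, u $ 2) (v $ 1, v $ 2)" for u v :: plane
  proof
    show "cbox (u $ 1, u $ 2) (v $ 1, v $ 2) \<subseteq> h ` cbox u v"
    proof
      fix p assume "p \<in> cbox (u $ 1, u $ 2) (v $ 1, v $ 2)"
      then have "p = h (g p)" "g p \<in> cbox u v"
        by (auto simp: g_def h_def mem_box_cart forall_2 cbox_Pair_eq)
      then show "p \<in> h ` cbox u v" by (rule image_eqI)
    qed
  qed (auto simp: h_def mem_box_cart forall_2 cbox_Pair_eq)
  have cont_g: "continuous_on S g" for S unfolding g_def by (intro continuous_intros)
  have fi: "(f has_integral integral (cbox (vector [a, c]) (vector [b, d])) f) (cbox (vector [a, c]) (vector [b, d]))"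
    using integrable_continuous [OF assms] by (rule integrable_integral)
  have "((\<lambda>p. f (g p)) has_integral (1 / 1) *\<^sub>R integral (cbox (vector [a, c]) (vector [b, d])) f)
      (h ` cbox (vector [a, c]) (vector [b, d]))"
  proof (rule has_integral_twiddle [OF _ _ _ _ _ _ _ fi])
    show "continuous (at x) g" for x using cont_g [of UNIV] by (cases x) (simp add: continuous_on_eq_continuous_at)
    show "\<exists>w z. g ` cbox u v = cbox w z" for u v using gi by (metis prod.collapse)
    show "\<exists>w z. h ` cbox u v = cbox w z" for u v using hi by blast
    show "measure lborel (g ` cbox u v) = 1 * measure lborel (cbox u v)" for u v
    proof -
      obtain u1 u2 v1 v2 where uv: "u = (u1, u2)" "v = (v1, v2)" by (metis prod.collapse)
      show ?thesis
      proof (cases "u1 \<le> v1 \<and> u2 \<le> v2")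
        case True
        then have "cbox (vector [u1, u2] :: plane) (vector [v1, v2]) \<noteq> {}"
          by (simp add: interval_ne_empty_cart forall_2)
        then show ?thesis using True unfolding uv gi content_Pair
          by (simp add: content_cbox_cart UNIV_2)
      next
        case False
        then have "cbox (vector [u1, u2] :: plane) (vector [v1, v2]) = {}"
          by (auto simp: cbox_plane)
        then show ?thesis using False unfolding uv gi content_Pair by auto
      qed
    qed
  qed (simp_all add: g_def h_def)
  then have "integral (cbox (vector [a, c]) (vector [b, d])) f = integral (cbox (a, c) (b, d)) (\<lambda>p. f (g p))"
    by (simp add: hi integral_unique)
  also have "\<dots> = integral (cbox a b) (\<lambda>x. integral (cbox c d) (\<lambda>y. f (g (x, y))))"
  proof (rule integral_prod_continuous)
    show "continuous_on (cbox (a, c) (b, d)) (\<lambda>p. f (g p))"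
      by (rule continuous_on_compose2 [OF assms cont_g]) (simp add: gi)
  qed
  finally show ?thesis by (simp add: g_def)
qed

lemma integral_plane_swap:
  fixes f :: "plane \<Rightarrow> real"
  assumes "continuous_on (cbox (vector [a, c]) (vector [b, d])) f"
  shows "integral (cbox (vector [a, c]) (vector [b, d])) f
      = integral {c..d} (\<lambda>y. integral {a..b} (\<lambda>x. f (vector [x, y])))"
proof -
  have "continuous_on (cbox (a, c) (b, d)) (\<lambda>p. f (vector [fst p, snd p]))"
    by (rule continuous_on_compose2 [OF assms]) (auto intro!: continuous_intros simp: cbox_plane cbox_Pair_eq)
  then have "continuous_on (cbox (a, c) (b, d)) (\<lambda>(x, y). f (vector [x, y]))"
    by (simp add: case_prod_unfold)
  then show ?thesis unfolding integral_plane [OF assms]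
    using integral_swap_continuous [of a c b d "\<lambda>x y. f (vector [x, y])"] by simp
qed

definition cross2 :: "plane \<Rightarrow> plane \<Rightarrow> real" where
  "cross2 a b = a $ 1 * b $ 2 - a $ 2 * b $ 1"

lemma integral_change_of_variables_plane:
  fixes f :: "plane \<Rightarrow> real" and \<Phi> :: "plane \<Rightarrow> plane"
  assumes S: "S \<in> sets lebesgue"
    and der: "\<And>v. v \<in> S \<Longrightarrow> (\<Phi> has_derivative (\<lambda>w. w $ 1 *\<^sub>R a v + w $ 2 *\<^sub>R b v)) (at v within S)"
    and inj: "inj_on \<Phi> S"
    and int: "(\<lambda>v. \<bar>cross2 (a v) (b v)\<bar> * f (\<Phi> v)) absolutely_integrable_on S"
  shows "integral (\<Phi> ` S) f = integral S (\<lambda>v. \<bar>cross2 (a v) (b v)\<bar> * f (\<Phi> v))"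
proof -
  define f1 where "f1 x = (vec (f x) :: real ^ 1)" for x
  let ?D = "\<lambda>v w. w $ 1 *\<^sub>R a v + w $ 2 *\<^sub>R b v"
  have det: "det (matrix (?D v)) = cross2 (a v) (b v)" for v
    by (simp add: det_2 matrix_def cross2_def axis_def)
  have ai: "(\<lambda>v. \<bar>det (matrix (?D v))\<bar> *\<^sub>R f1 (\<Phi> v)) absolutely_integrable_on S"
    unfolding absolutely_integrable_on_1_iff det using int by (simp add: f1_def)
  have "integral (\<Phi> ` S) f1 = integral S (\<lambda>v. \<bar>det (matrix (?D v))\<bar> *\<^sub>R f1 (\<Phi> v))"
    by (rule integral_change_of_variables [OF S der inj]) (use ai in auto)
  then show ?thesis unfolding integral_on_1_eq det by (simp add: f1_def vec_eq_iff)
qed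

section \<open>Flux through the boundary of the obstacle\<close>

lemma cross2_inner: "cross2 a b = rot a \<bullet> b"
  by (simp add: cross2_def inner_plane)

lemma cross2_trace_identity: "cross2 (M *v v) w + cross2 v (M *v w) = trace (M :: real^2^2) * cross2 v w"
  by (simp add: cross2_def trace_def matrix_vector_mult_def sum_2 algebra_simps)

lemma cross2_gradient_identity: "(a \<bullet> v) * cross2 x w + (a \<bullet> w) * cross2 v x = (a \<bullet> x) * cross2 v w"
  by (simp add: cross2_def inner_plane algebra_simps)

lemma cross2_has_vector_derivative:
  assumes "(a has_vector_derivative a') F'" "(b has_vector_derivative b') F'" "F' = at t within S"
  shows "((\<lambda>t. cross2 (a t) (b t)) has_vector_derivative (cross2 (a t) b' + cross2 a' (b t))) F'"
  using bounded_bilinear.has_vector_derivative [OF bounded_bilinear_inner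
      bounded_linear.has_vector_derivative [OF bounded_linear_rot assms(1) [unfolded assms(3)]] assms(2) [unfolded assms(3)]]
  unfolding cross2_inner assms(3) .

lemma continuous_on_cross2 [continuous_intros]:
  "continuous_on S a \<Longrightarrow> continuous_on S b \<Longrightarrow> continuous_on S (\<lambda>x. cross2 (a x) (b x))"
  unfolding cross2_def by (intro continuous_intros)

lemma vector_derivative_chain_within:
  assumes F: "(F has_derivative D) (at (c t) within T)" and c: "(c has_vector_derivative c') (at t within S)"
    and sub: "c ` S \<subseteq> T"
  shows "((\<lambda>t. F (c t)) has_vector_derivative D c') (at t within S)"
proof -
  have "(F has_derivative D) (at (c t) within c ` S)" by (rule has_derivative_subset [OF F sub])
  from has_derivative_in_compose [OF c [unfolded has_vector_derivative_def] this]
  have "((\<lambda>t. F (c t)) has_derivative (\<lambda>k. D (k *\<^sub>R c'))) (at t within S)" .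
  moreover have "D (k *\<^sub>R c') = k *\<^sub>R D c'" for k
    using F by (simp add: has_derivative_def bounded_linear.linear linear_cmul)
  ultimately show ?thesis by (simp add: has_vector_derivative_def)
qed

lemma has_real_derivative_max_sq: "((\<lambda>w. (max 0 w)\<^sup>2) has_real_derivative 2 * max 0 w) (at (w::real))"
proof (cases "w = 0")
  case True
  have "((\<lambda>h. ((max 0 (0 + h))\<^sup>2 - (max 0 0)\<^sup>2) / h) \<longlongrightarrow> (0::real)) (at 0)"
  proof (rule Lim_null_comparison)
    show "((\<lambda>h. \<bar>h\<bar>) \<longlongrightarrow> (0::real)) (at 0)" by (auto intro!: tendsto_eq_intros)
    have "norm (((max 0 (0 + h))\<^sup>2 - (max 0 0)\<^sup>2) / h) \<le> \<bar>h\<bar>" for h :: real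
      by (cases "h = 0") (auto simp: max_def power2_eq_square)
    then show "\<forall>\<^sub>F h in at 0. norm (((max 0 (0 + h))\<^sup>2 - (max 0 0)\<^sup>2) / h) \<le> \<bar>h\<bar>" for h :: real
      by (intro always_eventually) auto
  qed
  then show ?thesis using True by (simp add: DERIV_def)
next
  case False
  have "((\<lambda>w. if w > 0 then w\<^sup>2 else 0) has_real_derivative 2 * max 0 w) (at w)"
  proof (cases "w > 0")
    case True
    have "((\<lambda>w. w\<^sup>2) has_real_derivative 2 * max 0 w) (at w)"
      using True by (auto intro!: derivative_eq_intros)
    then show ?thesis
      by (rule has_field_derivative_transform_within [of _ _ _ _ w]) (use True in \<open>auto simp: dist_real_def\<close>)
  next
    case f: False
    have "((\<lambda>w. 0) has_real_derivative 2 * max 0 w) (at w)"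
      using f by auto
    then show ?thesis
      by (rule has_field_derivative_transform_within [of _ _ _ _ "- w"]) (use False f in \<open>auto simp: dist_real_def\<close>)
  qed
  moreover have "(\<lambda>w::real. if w > 0 then w\<^sup>2 else 0) = (\<lambda>w. (max 0 w)\<^sup>2)" by (auto simp: max_def)
  ultimately show ?thesis by simp
qed

lemma has_derivative_Un:
  "(f has_derivative D) (at x within A) \<Longrightarrow> (f has_derivative D) (at x within B)
    \<Longrightarrow> (f has_derivative D) (at x within A \<union> B)"
  unfolding has_derivative_at_within by (auto simp: at_within_union filterlim_sup)

lemma has_derivative_within_not_closure:
  assumes "bounded_linear D" "closed B" "x \<notin> B"
  shows "(f has_derivative D) (at x within B)"
proof -
  have "at x within B = bot"
    using assms(2,3) by (metis at_within_eq_bot_iff closure_closed Diff_empty Diff_insert0)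
  then show ?thesis using assms(1) by (simp add: has_derivative_def)
qed

lemma has_vector_derivative_vector2_fst:
  "((\<lambda>a. vector [a, h] :: plane) has_vector_derivative axis 1 1) F"
proof -
  have "(\<lambda>a. vector [a, h] :: plane) = (\<lambda>a. a *\<^sub>R axis 1 1 + h *\<^sub>R axis 2 1)"
    by (auto simp: vec_eq_iff forall_2 axis_def)
  then show ?thesis by (auto intro!: derivative_eq_intros simp: has_vector_derivative_def)
qed

lemma has_vector_derivative_vector2_snd:
  "((\<lambda>h. vector [a, h] :: plane) has_vector_derivative axis 2 1) F"
proof -
  have "(\<lambda>h. vector [a, h] :: plane) = (\<lambda>h. a *\<^sub>R axis 1 1 + h *\<^sub>R axis 2 1)"
    by (auto simp: vec_eq_iff forall_2 axis_def)
  then show ?thesis by (auto intro!: derivative_eq_intros simp: has_vector_derivative_def)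
qed

text \<open>
  A \<open>C\<^sup>1\<close> field \<open>X\<close> without divergence, and a cutoff \<open>kap\<close> that equals \<open>1\<close> on the boundary of the
  obstacle and \<open>0\<close> where \<open>1 - \<rho> \<ge> \<epsilon>\<close>. Instead of a partition of unity and a divergence theorem for
  domains with curved boundary, \<open>X\<close> is split into \<open>kap X\<close>, which lives in a tube around the obstacle and
  is integrated there in normal coordinates, and \<open>(1 - kap) X\<close>, which extends by zero across the
  obstacle and is integrated over a rectangle. The divergences of the two parts are \<open>q\<close> and \<open>- q\<close>.
  Taking \<open>\<rho>\<close> as the argument of the cutoff spares a proof that the distance function is
  differentiable.
\<close>

locale flow_field = flow +
  fixes g :: "plane \<Rightarrow> plane" and h :: "plane \<Rightarrow> real^2^2" and X :: "plane \<Rightarrow> plane" and DX :: "plane \<Rightarrow> real^2^2"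
    and \<epsilon> :: real
  assumes gh: "C2_derivs (closure \<Omega>) \<rho> g h"
    and X_deriv: "\<And>x. x \<in> closure \<Omega> \<Longrightarrow> (X has_derivative (\<lambda>v. DX x *v v)) (at x within closure \<Omega>)"
    and DX_cont: "continuous_on (closure \<Omega>) DX"
    and DX_trace: "\<And>x. x \<in> closure \<Omega> \<Longrightarrow> trace (DX x) = 0"
    and eps: "\<epsilon> > 0"
begin

definition "z x = (1 - \<rho> x) / \<epsilon>"
definition "kap x = (max 0 (1 - (z x)\<^sup>2))\<^sup>2"
definition "gk x = (4 / \<epsilon> * z x * max 0 (1 - (z x)\<^sup>2)) *\<^sub>R g x"
definition "q x = (if x \<in> closure \<Omega> then gk x \<bullet> X x else 0)"

lemma g_cont: "continuous_on (closure \<Omega>) g"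
  using gh unfolding C2_derivs_def continuous_on_eq_continuous_within
  by (blast intro: has_derivative_continuous)

lemma X_cont: "continuous_on (closure \<Omega>) X"
  unfolding continuous_on_eq_continuous_within by (blast intro: has_derivative_continuous X_deriv)

lemma z_cont: "continuous_on (closure \<Omega>) z"
  unfolding z_def using eps by (intro continuous_intros rho_cont) auto

lemma kap_cont: "continuous_on (closure \<Omega>) kap"
  unfolding kap_def by (intro continuous_intros z_cont)

lemma gk_cont: "continuous_on (closure \<Omega>) gk"
  unfolding gk_def using eps by (intro continuous_intros z_cont g_cont) auto

lemma kap_deriv:
  assumes x: "x \<in> closure \<Omega>"
  shows "(kap has_derivative (\<lambda>v. gk x \<bullet> v)) (at x within closure \<Omega>)"
proof -
  have r: "(\<rho> has_derivative (\<lambda>v. g x \<bullet> v)) (at x within closure \<Omega>)" by (rule C2_closure_gradient [OF gh x])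
  have zd: "(z has_derivative (\<lambda>v. - (g x \<bullet> v) / \<epsilon>)) (at x within closure \<Omega>)"
    unfolding z_def [abs_def] using eps by (auto intro!: derivative_eq_intros r)
  have "((\<lambda>y. 1 - (z y)\<^sup>2) has_derivative (\<lambda>v. - (2 * z x * (- (g x \<bullet> v) / \<epsilon>)))) (at x within closure \<Omega>)"
    by (rule has_derivative_eq_rhs [OF has_derivative_diff [OF has_derivative_const has_derivative_power [OF zd]]])
       (simp add: fun_eq_iff)
  from has_derivative_compose [OF this, of "\<lambda>w. (max 0 w)\<^sup>2" "\<lambda>v. 2 * max 0 (1 - (z x)\<^sup>2) * v"]
  have "(kap has_derivative (\<lambda>v. 2 * max 0 (1 - (z x)\<^sup>2) * - (2 * z x * (- (g x \<bullet> v) / \<epsilon>)))) (at x within closure \<Omega>)"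
    using has_real_derivative_max_sq [of "1 - (z x)\<^sup>2"] unfolding has_field_derivative_def kap_def [abs_def] by blast
  then show ?thesis by (rule has_derivative_eq_rhs) (simp add: gk_def fun_eq_iff mult_ac)
qed

lemma kap_gk_zero: "z x \<ge> 1 \<Longrightarrow> kap x = 0 \<and> gk x = 0"
proof -
  assume "z x \<ge> 1"
  then have "1 - (z x)\<^sup>2 \<le> 0" by (simp add: one_le_power)
  then show ?thesis by (simp add: kap_def gk_def)
qed

lemma kap_gk_J: "x \<in> J \<Longrightarrow> kap x = 1 \<and> gk x = 0"
  using rho_J [of x] by (simp add: kap_def gk_def z_def)

text \<open>
  The normal coordinates of the tube: \<open>s\<close> is the distance to the curve divided by the speed
  \<open>\<bar>\<gamma>1 t\<bar>\<close>. Without a normalization the partial derivatives \<open>\<phi>t\<close> and \<open>\<phi>s\<close> are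
  linear in the derivatives of \<open>\<gamma>\<close>.
\<close>

definition "\<phi> t s = \<gamma> t - (s * \<sigma>) *\<^sub>R rot (\<gamma>1 t)"
definition "\<phi>t t s = \<gamma>1 t - (s * \<sigma>) *\<^sub>R rot (\<gamma>2 t)"
definition "\<phi>s t = - \<sigma> *\<^sub>R rot (\<gamma>1 t)"

lemma phi_t: "((\<lambda>t. \<phi> t s) has_vector_derivative \<phi>t t s) (at t within S)"
proof -
  have "((\<lambda>t. (s * \<sigma>) *\<^sub>R rot (\<gamma>1 t)) has_vector_derivative (s * \<sigma>) *\<^sub>R rot (\<gamma>2 t)) (at t)"
    by (intro bounded_linear.has_vector_derivative [OF bounded_linear_scaleR_right]
        bounded_linear.has_vector_derivative [OF bounded_linear_rot] d2)
  from has_vector_derivative_diff [OF d1 this]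
  show ?thesis unfolding \<phi>_def \<phi>t_def by (rule has_vector_derivative_at_within)
qed

lemma phi_s: "((\<lambda>s. \<phi> t s) has_vector_derivative \<phi>s t) (at s within S)"
  unfolding \<phi>_def \<phi>s_def has_vector_derivative_def
  by (auto intro!: derivative_eq_intros simp: fun_eq_iff)

lemma phi_st: "((\<lambda>t. \<phi>s t) has_vector_derivative - \<sigma> *\<^sub>R rot (\<gamma>2 t)) (at t within S)"
  unfolding \<phi>s_def
  by (rule has_vector_derivative_at_within)
     (intro bounded_linear.has_vector_derivative [OF bounded_linear_scaleR_right]
        bounded_linear.has_vector_derivative [OF bounded_linear_rot] d2)

lemma phi_ts: "((\<lambda>s. \<phi>t t s) has_vector_derivative - \<sigma> *\<^sub>R rot (\<gamma>2 t)) (at s within S)"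
  unfolding \<phi>t_def has_vector_derivative_def
  by (auto intro!: derivative_eq_intros simp: fun_eq_iff)

lemma cont_gammas: "continuous_on S (\<lambda>v::plane. \<gamma> (v $ 1))" "continuous_on S (\<lambda>v::plane. \<gamma>1 (v $ 1))"
  "continuous_on S (\<lambda>v::plane. \<gamma>2 (v $ 1))"
proof -
  have c: "continuous_on S (\<lambda>v::plane. v $ 1)" by (intro continuous_intros)
  show "continuous_on S (\<lambda>v::plane. \<gamma> (v $ 1))"
    by (rule continuous_on_compose2 [OF boundary_param_continuous [OF param, of UNIV] c]) auto
  show "continuous_on S (\<lambda>v::plane. \<gamma>1 (v $ 1))"
    by (rule continuous_on_compose2 [OF vector_derivative_imp_continuous_on [OF d2, of UNIV] c]) auto
  show "continuous_on S (\<lambda>v::plane. \<gamma>2 (v $ 1))"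
    by (rule continuous_on_compose2 [OF c2 c]) auto
qed

lemma cont_phis: "continuous_on S (\<lambda>v::plane. \<phi> (v $ 1) (v $ 2))" "continuous_on S (\<lambda>v::plane. \<phi>t (v $ 1) (v $ 2))"
  "continuous_on S (\<lambda>v::plane. \<phi>s (v $ 1))"
  unfolding \<phi>_def \<phi>t_def \<phi>s_def by (intro continuous_intros cont_gammas)+

text \<open>
  In coordinates the divergence of \<open>kap X\<close>, times the Jacobian, is
  \<open>\<partial>\<^sub>t (kap (X \<times> \<phi>s)) + \<partial>\<^sub>s (kap (\<phi>t \<times> X))\<close> (Piola's identity). The first term integrates to zero by
  periodicity in \<open>t\<close>, and the second leaves the boundary term at \<open>s = 0\<close>, because \<open>kap\<close> vanishes at
  \<open>s = s0\<close>.
\<close>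

lemma tube_flux:
  assumes s0: "s0 > 0" and sub: "\<And>t s. 0 \<le> s \<Longrightarrow> s \<le> s0 \<Longrightarrow> \<phi> t s \<in> closure \<Omega>"
    and end0: "\<And>t. kap (\<phi> t s0) = 0"
  shows "integral (cbox (vector [0, 0]) (vector [1, s0]))
      (\<lambda>v::plane. (gk (\<phi> (v $ 1) (v $ 2)) \<bullet> X (\<phi> (v $ 1) (v $ 2))) * cross2 (\<phi>t (v $ 1) (v $ 2)) (\<phi>s (v $ 1)))
     = - integral {0..1} (\<lambda>t. cross2 (\<gamma>1 t) (X (\<gamma> t)))"
proof -
  let ?C = "cbox (vector [0, 0]) (vector [1, s0]) :: plane set"
  define st where "st t = - \<sigma> *\<^sub>R rot (\<gamma>2 t)" for t
  define A where "A t s = kap (\<phi> t s) * cross2 (X (\<phi> t s)) (\<phi>s t)" for t s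
  define B where "B t s = kap (\<phi> t s) * cross2 (\<phi>t t s) (X (\<phi> t s))" for t s
  define At where "At t s = kap (\<phi> t s) * (cross2 (X (\<phi> t s)) (st t) + cross2 (DX (\<phi> t s) *v \<phi>t t s) (\<phi>s t))
      + (gk (\<phi> t s) \<bullet> \<phi>t t s) * cross2 (X (\<phi> t s)) (\<phi>s t)" for t s
  define Bs where "Bs t s = kap (\<phi> t s) * (cross2 (\<phi>t t s) (DX (\<phi> t s) *v \<phi>s t) + cross2 (st t) (X (\<phi> t s)))
      + (gk (\<phi> t s) \<bullet> \<phi>s t) * cross2 (\<phi>t t s) (X (\<phi> t s))" for t s
  have dA: "((\<lambda>t. A t s) has_vector_derivative At t s) (at t within {0..1})" if s: "0 \<le> s" "s \<le> s0" for t s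
  proof -
    have im: "(\<lambda>t. \<phi> t s) ` {0..1} \<subseteq> closure \<Omega>" using sub s by auto
    have x: "\<phi> t s \<in> closure \<Omega>" using sub s by auto
    note 1 = vector_derivative_chain_within [OF kap_deriv [OF x] phi_t im]
    note 2 = vector_derivative_chain_within [OF X_deriv [OF x] phi_t im]
    note 3 = cross2_has_vector_derivative [OF 2 phi_st refl]
    show ?thesis unfolding A_def At_def st_def
      using has_vector_derivative_mult [OF 1 3] by simp
  qed
  have dB: "((\<lambda>s. B t s) has_vector_derivative Bs t s) (at s within {0..s0})" if s: "s \<in> {0..s0}" for t s
  proof -
    have im: "(\<lambda>s. \<phi> t s) ` {0..s0} \<subseteq> closure \<Omega>" using sub by auto
    have x: "\<phi> t s \<in> closure \<Omega>" using sub s by auto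
    note 1 = vector_derivative_chain_within [OF kap_deriv [OF x] phi_s im]
    note 2 = vector_derivative_chain_within [OF X_deriv [OF x] phi_s im]
    note 3 = cross2_has_vector_derivative [OF phi_ts 2 refl]
    show ?thesis unfolding B_def Bs_def st_def
      using has_vector_derivative_mult [OF 1 3] by simp
  qed
  have sum: "At t s + Bs t s = (gk (\<phi> t s) \<bullet> X (\<phi> t s)) * cross2 (\<phi>t t s) (\<phi>s t)"
    if s: "0 \<le> s" "s \<le> s0" for t s
  proof -
    have tr: "cross2 (DX (\<phi> t s) *v \<phi>t t s) (\<phi>s t) + cross2 (\<phi>t t s) (DX (\<phi> t s) *v \<phi>s t) = 0"
      using cross2_trace_identity [of "DX (\<phi> t s)" "\<phi>t t s" "\<phi>s t"] DX_trace [OF sub [OF s, of t]] by simp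
    have an: "cross2 (X (\<phi> t s)) (st t) + cross2 (st t) (X (\<phi> t s)) = 0" by (simp add: cross2_def)
    have "At t s + Bs t s = kap (\<phi> t s) * ((cross2 (X (\<phi> t s)) (st t) + cross2 (st t) (X (\<phi> t s)))
        + (cross2 (DX (\<phi> t s) *v \<phi>t t s) (\<phi>s t) + cross2 (\<phi>t t s) (DX (\<phi> t s) *v \<phi>s t)))
        + ((gk (\<phi> t s) \<bullet> \<phi>t t s) * cross2 (X (\<phi> t s)) (\<phi>s t) + (gk (\<phi> t s) \<bullet> \<phi>s t) * cross2 (\<phi>t t s) (X (\<phi> t s)))"
      by (simp add: At_def Bs_def algebra_simps)
    then show ?thesis unfolding tr an cross2_gradient_identity by simp
  qed
  have phiC: "(\<lambda>v. \<phi> (v $ 1) (v $ 2)) ` ?C \<subseteq> closure \<Omega>" using sub by (auto simp: cbox_plane)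
  note cc = continuous_on_compose2 [OF _ cont_phis(1) phiC]
  have contst: "continuous_on S (\<lambda>v::plane. st (v $ 1))" for S
    unfolding st_def by (intro continuous_intros cont_gammas)
  have contDXv: "continuous_on ?C (\<lambda>v. DX (\<phi> (v $ 1) (v $ 2)) *v f v)" if "continuous_on ?C f" for f
    using cc [OF DX_cont] that unfolding matrix_vector_mult_def
    by (intro continuous_on_vec_lambda continuous_intros)
  have cA: "continuous_on ?C (\<lambda>v. At (v $ 1) (v $ 2))" unfolding At_def
    by (intro continuous_intros cc [OF kap_cont] cc [OF X_cont] cc [OF gk_cont] contDXv contst cont_phis)
  have cB: "continuous_on ?C (\<lambda>v. Bs (v $ 1) (v $ 2))" unfolding Bs_def
    by (intro continuous_intros cc [OF kap_cont] cc [OF X_cont] cc [OF gk_cont] contDXv contst cont_phis)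
  have "integral ?C (\<lambda>v. (gk (\<phi> (v $ 1) (v $ 2)) \<bullet> X (\<phi> (v $ 1) (v $ 2))) * cross2 (\<phi>t (v $ 1) (v $ 2)) (\<phi>s (v $ 1)))
      = integral ?C (\<lambda>v. At (v $ 1) (v $ 2) + Bs (v $ 1) (v $ 2))"
    by (rule integral_cong) (use sum in \<open>auto simp: cbox_plane\<close>)
  also have "\<dots> = integral ?C (\<lambda>v. At (v $ 1) (v $ 2)) + integral ?C (\<lambda>v. Bs (v $ 1) (v $ 2))"
    by (intro integral_add integrable_continuous cA cB)
  also have "integral ?C (\<lambda>v. At (v $ 1) (v $ 2)) = integral {0..s0} (\<lambda>s. integral {0..1} (\<lambda>t. At t s))"
    using integral_plane_swap [OF cA] by simp
  also have "\<dots> = integral {0..s0} (\<lambda>s. 0)"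
  proof (rule integral_cong)
    fix s assume "s \<in> {0..s0}"
    then have "((\<lambda>t. At t s) has_integral (A 1 s - A 0 s)) {0..1}"
      by (intro fundamental_theorem_of_calculus dA) auto
    moreover have "A 1 s = A 0 s"
      using per [of 0] per1 [of 0] by (simp add: A_def \<phi>_def \<phi>s_def)
    ultimately show "integral {0..1} (\<lambda>t. At t s) = 0" by (simp add: integral_unique)
  qed
  also have "\<dots> = 0" by simp
  also have "integral ?C (\<lambda>v. Bs (v $ 1) (v $ 2)) = integral {0..1} (\<lambda>t. integral {0..s0} (\<lambda>s. Bs t s))"
    using integral_plane [OF cB] by simp
  also have "\<dots> = integral {0..1} (\<lambda>t. - cross2 (\<gamma>1 t) (X (\<gamma> t)))"
  proof (rule integral_cong)
    fix t :: real
    have "((\<lambda>s. Bs t s) has_integral (B t s0 - B t 0)) {0..s0}"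
      using s0 by (intro fundamental_theorem_of_calculus dB) auto
    moreover have "B t s0 = 0" using end0 by (simp add: B_def)
    moreover have "B t 0 = cross2 (\<gamma>1 t) (X (\<gamma> t))"
      using kap_gk_J [OF in_J [of t]] by (simp add: B_def \<phi>_def \<phi>t_def)
    ultimately show "integral {0..s0} (\<lambda>s. Bs t s) = - cross2 (\<gamma>1 t) (X (\<gamma> t))" by (simp add: integral_unique)
  qed
  finally show ?thesis by simp
qed

end

section \<open>The divergence identity for the fluid domain\<close>

context flow_field
begin

text \<open>
  The field \<open>(1 - kap) X\<close>, extended by zero, is continuously differentiable on the whole rectangle: on
  the boundary of the obstacle both \<open>1 - kap\<close> and the gradient of \<open>kap\<close> vanish. It remains to apply
  the fundamental theorem of calculus in each coordinate.
\<close>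

lemma rect_flux:
  assumes R: "R > 0"
    and bd: "\<And>x. x \<in> closure strip \<Longrightarrow> x $ 1 = R \<or> x $ 1 = - R \<or> x $ 2 = 0 \<or> x $ 2 = pi
      \<Longrightarrow> x \<in> closure \<Omega> \<and> kap x = 0"
  shows "integral (cbox (vector [-R, 0]) (vector [R, pi])) q =
     - (integral {-R..R} (\<lambda>a. X (vector [a, pi]) $ 2 - X (vector [a, 0]) $ 2)
        + integral {0..pi} (\<lambda>b. X (vector [R, b]) $ 1 - X (vector [-R, b]) $ 1))"
proof -
  let ?C = "cbox (vector [-R, 0]) (vector [R, pi]) :: plane set"
  define Y where "Y x = (if x \<in> closure \<Omega> then (1 - kap x) *\<^sub>R X x else 0)" for x
  define DY where "DY x v = (if x \<in> closure \<Omega> then (1 - kap x) *\<^sub>R (DX x *v v) - (gk x \<bullet> v) *\<^sub>R X x else 0)" for x v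
  have cs: "closure strip = closure \<Omega> \<union> closure O0"
    using closure_fluid_domain [OF obs] O0 closure_subset [of O0] closure_subset [of strip] J_closure
    by (auto simp: frontier_def [of O0] interior_open)
  have both: "x \<in> J" if "x \<in> closure \<Omega>" "x \<in> closure O0" for x
    using that closure_fluid_domain [OF obs] O0 by (auto simp: frontier_def interior_open)
  have Y0: "Y x = 0" if "x \<in> closure O0" for x
    using both [OF _ that] kap_gk_J [of x] by (auto simp: Y_def)
  have DY0: "DY x v = 0" if "x \<in> closure O0" for x v
    using both [OF _ that] kap_gk_J [of x] by (auto simp: DY_def)
  have DYb: "bounded_linear (DY x)" for x
  proof (cases "x \<in> closure \<Omega>")
    case True
    have "bounded_linear (\<lambda>v. (1 - kap x) *\<^sub>R (DX x *v v) - (gk x \<bullet> v) *\<^sub>R X x)"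
      by (intro bounded_linear_sub bounded_linear_compose [OF bounded_linear_scaleR_right matrix_vector_mul_bounded_linear]
          bounded_linear_compose [OF bounded_linear_scaleR_left bounded_linear_inner_right])
    then show ?thesis using True by (simp add: DY_def [abs_def])
  next
    case False then show ?thesis by (simp add: DY_def [abs_def] bounded_linear_zero)
  qed
  have Yd: "(Y has_derivative DY x) (at x within closure strip)" if x: "x \<in> closure strip" for x
    unfolding cs
  proof (rule has_derivative_Un)
    show "(Y has_derivative DY x) (at x within closure \<Omega>)"
    proof (cases "x \<in> closure \<Omega>")
      case True
      have "((\<lambda>x. (1 - kap x) *\<^sub>R X x) has_derivative DY x) (at x within closure \<Omega>)"
        by (rule has_derivative_eq_rhs [OF has_derivative_scaleR [OF has_derivative_diff [OF has_derivative_const kap_deriv [OF True]] X_deriv [OF True]]])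
           (use True in \<open>simp add: fun_eq_iff DY_def\<close>)
      then show ?thesis by (rule has_derivative_transform [OF True, rotated]) (simp add: Y_def)
    next
      case False
      then show ?thesis by (intro has_derivative_within_not_closure DYb closed_closure)
    qed
    show "(Y has_derivative DY x) (at x within closure O0)"
    proof (cases "x \<in> closure O0")
      case True
      have "DY x = (\<lambda>v. 0)" using DY0 [OF True] by auto
      then have "((\<lambda>x. 0) has_derivative DY x) (at x within closure O0)" by simp
      then show ?thesis by (rule has_derivative_transform [OF True, rotated]) (simp add: Y0)
    next
      case False
      then show ?thesis by (intro has_derivative_within_not_closure DYb closed_closure)
    qed
  qed
  have DYcont: "continuous_on (closure strip) (\<lambda>x. DY x v)" for v
    unfolding cs
  proof (rule continuous_on_closed_Un)
    have "continuous_on (closure \<Omega>) (\<lambda>x. DX x *v v)"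
      unfolding matrix_vector_mult_def using DX_cont by (intro continuous_on_vec_lambda continuous_intros)
    then have "continuous_on (closure \<Omega>) (\<lambda>x. (1 - kap x) *\<^sub>R (DX x *v v) - (gk x \<bullet> v) *\<^sub>R X x)"
      by (intro continuous_intros kap_cont gk_cont X_cont)
    then show "continuous_on (closure \<Omega>) (\<lambda>x. DY x v)"
      by (rule continuous_on_eq) (simp add: DY_def)
    show "continuous_on (closure O0) (\<lambda>x. DY x v)"
      by (rule continuous_on_eq [OF continuous_on_const [of _ 0]]) (simp add: DY0)
  qed auto
  have Csub: "?C \<subseteq> closure strip" by (auto simp: cbox_plane closure_strip)
  have c1: "continuous_on ?C (\<lambda>x. DY x (axis 1 1) $ 1)" and c2: "continuous_on ?C (\<lambda>x. DY x (axis 2 1) $ 2)"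
    by (intro continuous_intros continuous_on_subset [OF DYcont Csub])+
  have qe: "q x = - (DY x (axis 1 1) $ 1 + DY x (axis 2 1) $ 2)" for x
  proof (cases "x \<in> closure \<Omega>")
    case True
    have "DX x $ 1 $ 1 + DX x $ 2 $ 2 = 0" using DX_trace [OF True] by (simp add: trace_def sum_2)
    then have "(1 - kap x) * (DX x $ 1 $ 1) + (1 - kap x) * (DX x $ 2 $ 2) = 0"
      by (simp flip: distrib_left)
    moreover have "q x = gk x $ 1 * X x $ 1 + gk x $ 2 * X x $ 2" using True by (simp add: q_def inner_plane)
    moreover have "DY x (axis 1 1) $ 1 = (1 - kap x) * DX x $ 1 $ 1 - gk x $ 1 * X x $ 1"
      "DY x (axis 2 1) $ 2 = (1 - kap x) * DX x $ 2 $ 2 - gk x $ 2 * X x $ 2"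
      using True by (simp_all add: DY_def matrix_vector_mult_basis column_def inner_axis)
    ultimately show ?thesis by linarith
  qed (simp add: q_def DY_def)
  have "integral ?C q = integral ?C (\<lambda>x. - (DY x (axis 1 1) $ 1 + DY x (axis 2 1) $ 2))"
    by (rule integral_cong) (rule qe)
  also have "\<dots> = - (integral ?C (\<lambda>x. DY x (axis 1 1) $ 1) + integral ?C (\<lambda>x. DY x (axis 2 1) $ 2))"
    unfolding integral_neg
    by (intro arg_cong [of _ _ uminus] integral_add integrable_continuous c1 c2)
  also have "integral ?C (\<lambda>x. DY x (axis 1 1) $ 1) =
      integral {0..pi} (\<lambda>b. integral {-R..R} (\<lambda>a. DY (vector [a, b]) (axis 1 1) $ 1))"
    by (rule integral_plane_swap [OF c1])
  also have "\<dots> = integral {0..pi} (\<lambda>b. X (vector [R, b]) $ 1 - X (vector [-R, b]) $ 1)"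
  proof (rule integral_cong)
    fix b assume b: "b \<in> {0..pi}"
    have im: "(\<lambda>a. vector [a, b] :: plane) ` {-R..R} \<subseteq> closure strip" using b by (auto simp: closure_strip)
    have "((\<lambda>a. Y (vector [a, b]) $ 1) has_vector_derivative DY (vector [a, b]) (axis 1 1) $ 1) (at a within {-R..R})" for a
      by (intro bounded_linear.has_vector_derivative [OF bounded_linear_vec_nth]
          vector_derivative_chain_within [OF Yd has_vector_derivative_vector2_fst im])
         (use b in \<open>simp add: closure_strip\<close>)
    then have "((\<lambda>a. DY (vector [a, b]) (axis 1 1) $ 1) has_integral
        (Y (vector [R, b]) $ 1 - Y (vector [-R, b]) $ 1)) {-R..R}"
      using R by (intro fundamental_theorem_of_calculus) auto
    moreover have "Y (vector [R, b]) = X (vector [R, b])" "Y (vector [-R, b]) = X (vector [-R, b])"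
      using bd [of "vector [R, b]"] bd [of "vector [-R, b]"] b by (auto simp: Y_def closure_strip)
    ultimately show "integral {-R..R} (\<lambda>a. DY (vector [a, b]) (axis 1 1) $ 1) = X (vector [R, b]) $ 1 - X (vector [-R, b]) $ 1"
      by (simp add: integral_unique)
  qed
  also have "integral ?C (\<lambda>x. DY x (axis 2 1) $ 2) =
      integral {-R..R} (\<lambda>a. integral {0..pi} (\<lambda>b. DY (vector [a, b]) (axis 2 1) $ 2))"
    by (rule integral_plane [OF c2])
  also have "\<dots> = integral {-R..R} (\<lambda>a. X (vector [a, pi]) $ 2 - X (vector [a, 0]) $ 2)"
  proof (rule integral_cong)
    fix a assume a: "a \<in> {-R..R}"
    have im: "(\<lambda>b. vector [a, b] :: plane) ` {0..pi} \<subseteq> closure strip" by (auto simp: closure_strip)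
    have "((\<lambda>b. Y (vector [a, b]) $ 2) has_vector_derivative DY (vector [a, b]) (axis 2 1) $ 2) (at b within {0..pi})"
      if "b \<in> {0..pi}" for b
      by (intro bounded_linear.has_vector_derivative [OF bounded_linear_vec_nth]
          vector_derivative_chain_within [OF Yd has_vector_derivative_vector2_snd im])
         (use that in \<open>simp add: closure_strip\<close>)
    then have "((\<lambda>b. DY (vector [a, b]) (axis 2 1) $ 2) has_integral
        (Y (vector [a, pi]) $ 2 - Y (vector [a, 0]) $ 2)) {0..pi}"
      by (intro fundamental_theorem_of_calculus) auto
    moreover have "Y (vector [a, pi]) = X (vector [a, pi])" "Y (vector [a, 0]) = X (vector [a, 0])"
      using bd [of "vector [a, pi]"] bd [of "vector [a, 0]"] by (auto simp: Y_def closure_strip)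
    ultimately show "integral {0..pi} (\<lambda>b. DY (vector [a, b]) (axis 2 1) $ 2) = X (vector [a, pi]) $ 2 - X (vector [a, 0]) $ 2"
      by (simp add: integral_unique)
  qed
  finally show ?thesis by simp
qed

lemma phi_normal: "\<phi> t s = \<gamma> t - (s * norm (\<gamma>1 t)) *\<^sub>R N t"
  using nz [of t] by (simp add: \<phi>_def curve_normal_def)

lemma phi_point:
  assumes "0 < s" "s \<le> s0" "s0 * norm (\<gamma>1 t) < r0"
  shows "\<phi> t s \<in> \<Omega> \<and> infdist (\<phi> t s) J = s * norm (\<gamma>1 t)"
proof -
  have "0 < s * norm (\<gamma>1 t)" using assms nz by simp
  moreover have "s * norm (\<gamma>1 t) \<le> s0 * norm (\<gamma>1 t)" using assms by (intro mult_right_mono) auto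
  ultimately show ?thesis
    using normal_point [of "s * norm (\<gamma>1 t)" t] assms by (simp add: phi_normal)
qed

text \<open>
  The bounds on \<open>s0\<close> make the normal coordinates injective (\<open>normal_point_unique\<close>) and their
  Jacobian of constant sign, so that the integral in \<open>tube_flux\<close> transforms to the tube.
\<close>

lemma tube_image_integral:
  assumes s0: "s0 > 0" and M1: "\<And>t. s0 * norm (\<gamma>1 t) < r0" and M2: "\<And>t. s0 * norm (\<gamma>2 t) < norm (\<gamma>1 t)"
    and end0: "\<And>t. kap (\<phi> t s0) = 0"
  shows "integral ((\<lambda>v::plane. \<phi> (v $ 1) (v $ 2)) ` {v. 0 \<le> v $ 1 \<and> v $ 1 < 1 \<and> 0 < v $ 2 \<and> v $ 2 < s0}) q
    = integral {0..1} (\<lambda>t. X (\<gamma> t) \<bullet> (\<sigma> *\<^sub>R rot (\<gamma>1 t)))"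
proof -
  let ?C = "cbox (vector [0, 0]) (vector [1, s0]) :: plane set"
  define T where "T = {v::plane. 0 \<le> v $ 1 \<and> v $ 1 < 1 \<and> 0 < v $ 2 \<and> v $ 2 < s0}"
  define \<Phi> where "\<Phi> v = \<phi> (v $ 1) (v $ 2)" for v :: plane
  define F where "F v = \<bar>cross2 (\<phi>t (v $ 1) (v $ 2)) (\<phi>s (v $ 1))\<bar> * q (\<Phi> v)" for v :: plane
  have ss: "\<sigma> * \<sigma> = 1" using sigma by (metis abs_mult_self_eq mult_1)
  have phi_in: "\<phi> t s \<in> \<Omega> \<and> infdist (\<phi> t s) J = s * norm (\<gamma>1 t)" if "0 < s" "s \<le> s0" for t s
    by (rule phi_point [OF that M1])
  have phi_cl: "\<phi> t s \<in> closure \<Omega>" if "0 \<le> s" "s \<le> s0" for t s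
  proof (cases "s = 0")
    case True then show ?thesis using in_J J_closure by (auto simp: \<phi>_def)
  next
    case False then show ?thesis using phi_in [of s t] that closure_subset by auto
  qed
  have neg: "- \<sigma> * cross2 (\<phi>t t s) (\<phi>s t) > 0" if "0 \<le> s" "s \<le> s0" for t s
  proof -
    have "- \<sigma> * cross2 (\<phi>t t s) (\<phi>s t) = (\<sigma> * \<sigma>) * cross2 (\<phi>t t s) (rot (\<gamma>1 t))"
      by (simp add: \<phi>s_def cross2_def algebra_simps)
    also have "\<dots> = (norm (\<gamma>1 t))\<^sup>2 - s * \<sigma> * (rot (\<gamma>2 t) \<bullet> \<gamma>1 t)"
      unfolding ss norm_plane_sq
      by (simp add: \<phi>t_def cross2_def inner_plane power2_eq_square algebra_simps)
    also have "\<dots> > 0"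
    proof -
      have "\<bar>s * \<sigma> * (rot (\<gamma>2 t) \<bullet> \<gamma>1 t)\<bar> = s * \<bar>rot (\<gamma>2 t) \<bullet> \<gamma>1 t\<bar>"
        using sigma that by (simp add: abs_mult)
      also have "\<dots> \<le> s0 * (norm (rot (\<gamma>2 t)) * norm (\<gamma>1 t))"
        using that by (intro mult_mono Cauchy_Schwarz_ineq2) auto
      also have "\<dots> = (s0 * norm (\<gamma>2 t)) * norm (\<gamma>1 t)" by simp
      also have "\<dots> < norm (\<gamma>1 t) * norm (\<gamma>1 t)" using M2 [of t] nz [of t] by (intro mult_strict_right_mono) auto
      finally show ?thesis by (simp add: power2_eq_square)
    qed
    finally show ?thesis .
  qed
  have Feq: "F v = - \<sigma> * ((gk (\<phi> (v $ 1) (v $ 2)) \<bullet> X (\<phi> (v $ 1) (v $ 2))) * cross2 (\<phi>t (v $ 1) (v $ 2)) (\<phi>s (v $ 1)))"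
    if "v \<in> ?C" for v
  proof -
    have v: "0 \<le> v $ 2" "v $ 2 \<le> s0" using that by (auto simp: cbox_plane)
    have "\<bar>- \<sigma> * cross2 (\<phi>t (v $ 1) (v $ 2)) (\<phi>s (v $ 1))\<bar> = - \<sigma> * cross2 (\<phi>t (v $ 1) (v $ 2)) (\<phi>s (v $ 1))"
      using neg [OF v, of "v $ 1"] by (rule abs_of_pos)
    then have "\<bar>cross2 (\<phi>t (v $ 1) (v $ 2)) (\<phi>s (v $ 1))\<bar> = - \<sigma> * cross2 (\<phi>t (v $ 1) (v $ 2)) (\<phi>s (v $ 1))"
      unfolding abs_mult abs_minus_cancel sigma by simp
    then show ?thesis using phi_cl [OF v] by (simp add: F_def q_def \<Phi>_def)
  qed
  have phiC: "(\<lambda>v. \<phi> (v $ 1) (v $ 2)) ` ?C \<subseteq> closure \<Omega>" using phi_cl by (auto simp: cbox_plane)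
  note cc = continuous_on_compose2 [OF _ cont_phis(1) phiC]
  have "continuous_on ?C (\<lambda>v. - \<sigma> * ((gk (\<phi> (v $ 1) (v $ 2)) \<bullet> X (\<phi> (v $ 1) (v $ 2))) * cross2 (\<phi>t (v $ 1) (v $ 2)) (\<phi>s (v $ 1))))"
    by (intro continuous_intros cc [OF X_cont] cc [OF gk_cont] cont_phis)
  then have contF: "continuous_on ?C F"
    by (rule continuous_on_eq) (simp add: Feq)
  have TC: "T \<subseteq> ?C" by (auto simp: T_def cbox_plane)
  have Tm: "T \<in> sets lebesgue"
  proof -
    have "T = {v. 0 \<le> v $ 1} \<inter> ({v. v $ 1 < 1} \<inter> {v. 0 < v $ 2} \<inter> {v. v $ 2 < s0})" by (auto simp: T_def)
    moreover have "closed {v::plane. 0 \<le> v $ 1}" by (intro closed_Collect_le continuous_intros)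
    moreover have "open ({v::plane. v $ 1 < 1} \<inter> {v. 0 < v $ 2} \<inter> {v. v $ 2 < s0})"
      by (intro open_Int open_Collect_less continuous_intros)
    ultimately have "T \<in> sets borel" by auto
    then show ?thesis by (simp add: sets_completionI_sets)
  qed
  have aiC: "F absolutely_integrable_on ?C"
    by (rule absolutely_integrable_continuous [OF contF])
  have aiT: "F absolutely_integrable_on T"
    by (rule set_integrable_subset [OF aiC Tm TC])
  have inj: "inj_on \<Phi> T"
  proof (rule inj_onI)
    fix v w assume vw: "v \<in> T" "w \<in> T" "\<Phi> v = \<Phi> w"
    have p: "0 < u $ 2 * norm (\<gamma>1 (u $ 1))" "u $ 2 * norm (\<gamma>1 (u $ 1)) < r0" if "u \<in> T" for u
    proof -
      have u: "0 < u $ 2" "u $ 2 < s0" using that by (auto simp: T_def)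
      show "0 < u $ 2 * norm (\<gamma>1 (u $ 1))" using u nz by simp
      have "u $ 2 * norm (\<gamma>1 (u $ 1)) \<le> s0 * norm (\<gamma>1 (u $ 1))" using u by (intro mult_right_mono) auto
      then show "u $ 2 * norm (\<gamma>1 (u $ 1)) < r0" using M1 [of "u $ 1"] by simp
    qed
    have eq: "\<gamma> (v $ 1) - (v $ 2 * norm (\<gamma>1 (v $ 1))) *\<^sub>R N (v $ 1) = \<gamma> (w $ 1) - (w $ 2 * norm (\<gamma>1 (w $ 1))) *\<^sub>R N (w $ 1)"
      using vw(3) unfolding \<Phi>_def phi_normal .
    note u = normal_point_unique [OF eq p [OF vw(1)] p [OF vw(2)]]
    have "v $ 1 = w $ 1"
      using u(2) vw param by (auto simp: T_def boundary_param_def inj_on_def)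
    moreover from this have "v $ 2 = w $ 2" using u(1) nz [of "w $ 1"] by simp
    ultimately show "v = w" by (rule plane_eqI)
  qed
  have der: "(\<Phi> has_derivative (\<lambda>w. w $ 1 *\<^sub>R \<phi>t (v $ 1) (v $ 2) + w $ 2 *\<^sub>R \<phi>s (v $ 1))) (at v within T)" for v
  proof -
    have n: "((\<lambda>v::plane. v $ i) has_derivative (\<lambda>w. w $ i)) (at v)" for i by (rule has_derivative_vec_nth)
    have g0: "((\<lambda>v. \<gamma> (v $ 1)) has_derivative (\<lambda>w. w $ 1 *\<^sub>R \<gamma>1 (v $ 1))) (at v)"
      using has_derivative_compose [OF n d1 [unfolded has_vector_derivative_def]] .
    have "((\<lambda>v. \<gamma>1 (v $ 1)) has_derivative (\<lambda>w. w $ 1 *\<^sub>R \<gamma>2 (v $ 1))) (at v)"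
      using has_derivative_compose [OF n d2 [unfolded has_vector_derivative_def]] .
    then have g1: "((\<lambda>v. rot (\<gamma>1 (v $ 1))) has_derivative (\<lambda>w. rot (w $ 1 *\<^sub>R \<gamma>2 (v $ 1)))) (at v)"
      by (rule bounded_linear.has_derivative [OF bounded_linear_rot])
    have "(\<Phi> has_derivative (\<lambda>w. w $ 1 *\<^sub>R \<gamma>1 (v $ 1) -
        ((v $ 2 * \<sigma>) *\<^sub>R rot (w $ 1 *\<^sub>R \<gamma>2 (v $ 1)) + (w $ 2 * \<sigma>) *\<^sub>R rot (\<gamma>1 (v $ 1))))) (at v)"
      unfolding \<Phi>_def [abs_def] \<phi>_def
      by (intro has_derivative_diff has_derivative_scaleR g0 g1 has_derivative_mult_left n)
    then have "(\<Phi> has_derivative (\<lambda>w. w $ 1 *\<^sub>R \<phi>t (v $ 1) (v $ 2) + w $ 2 *\<^sub>R \<phi>s (v $ 1))) (at v)"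
      by (rule has_derivative_eq_rhs)
         (simp add: fun_eq_iff \<phi>t_def \<phi>s_def linear_cmul [OF bounded_linear.linear [OF bounded_linear_rot]] algebra_simps)
    then show ?thesis by (rule has_derivative_at_withinI)
  qed
  have "integral (\<Phi> ` T) q = integral T F"
    using integral_change_of_variables_plane [OF Tm der inj aiT [unfolded F_def]] by (simp add: F_def [abs_def])
  also have "\<dots> = integral ?C F"
  proof (rule integral_spike_set)
    have "?C - box (vector [0, 0]) (vector [1, s0]) \<supseteq> ?C - T"
      by (auto simp: T_def mem_box_cart forall_2)
    then have "negligible (?C - T)"
      using negligible_subset negligible_frontier_interval by blast
    then show "negligible {x \<in> ?C - T. F x \<noteq> 0}" by (rule negligible_subset) auto
    have e: "{x \<in> T - ?C. F x \<noteq> 0} = {}" using TC by blast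
    show "negligible {x \<in> T - ?C. F x \<noteq> 0}" unfolding e by (rule negligible_empty)
  qed
  also have "\<dots> = integral ?C (\<lambda>v. - \<sigma> * ((gk (\<phi> (v $ 1) (v $ 2)) \<bullet> X (\<phi> (v $ 1) (v $ 2))) * cross2 (\<phi>t (v $ 1) (v $ 2)) (\<phi>s (v $ 1))))"
    by (rule integral_cong) (rule Feq)
  also have "\<dots> = - \<sigma> * integral ?C (\<lambda>v. (gk (\<phi> (v $ 1) (v $ 2)) \<bullet> X (\<phi> (v $ 1) (v $ 2))) * cross2 (\<phi>t (v $ 1) (v $ 2)) (\<phi>s (v $ 1)))"
    by (rule integral_mult_right)
  also have "\<dots> = \<sigma> * integral {0..1} (\<lambda>t. cross2 (\<gamma>1 t) (X (\<gamma> t)))"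
    using tube_flux [OF s0 phi_cl end0] by simp
  also have "\<dots> = integral {0..1} (\<lambda>t. X (\<gamma> t) \<bullet> (\<sigma> *\<^sub>R rot (\<gamma>1 t)))"
    by (simp add: cross2_inner inner_commute)
  finally show ?thesis unfolding \<Phi>_def T_def .
qed

end

context flow
begin

lemma J_bounded: obtains B where "B > 0" "\<And>y. y \<in> J \<Longrightarrow> norm y \<le> B"
  using compact_imp_bounded [OF compact_J] unfolding bounded_pos by blast

text \<open>
  The flux of a divergence free field out of the part of the fluid domain with \<open>\<bar>x\<^sub>1\<bar> < R\<close> is zero.
  The integral of \<open>q\<close> over the tube and over the rectangle is the same number, as \<open>q\<close> vanishes outside
  the tube; \<open>tube_image_integral\<close> and \<open>rect_flux\<close> evaluate it in two ways.
\<close>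

theorem divergence_identity:
  assumes gh: "C2_derivs (closure \<Omega>) \<rho> g h"
    and X_deriv: "\<And>x. x \<in> closure \<Omega> \<Longrightarrow> (X has_derivative (\<lambda>v. DX x *v v)) (at x within closure \<Omega>)"
    and DX_cont: "continuous_on (closure \<Omega>) DX"
    and DX_trace: "\<And>x. x \<in> closure \<Omega> \<Longrightarrow> trace (DX x) = 0"
  shows "\<exists>R0>0. \<forall>R\<ge>R0. integral {0..1} (\<lambda>t. X (\<gamma> t) \<bullet> (\<sigma> *\<^sub>R rot (\<gamma>1 t)))
        + integral {-R..R} (\<lambda>a. X (vector [a, pi]) $ 2 - X (vector [a, 0]) $ 2)
        + integral {0..pi} (\<lambda>b. X (vector [R, b]) $ 1 - X (vector [-R, b]) $ 1) = 0"
proof -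
  have cont1: "continuous_on UNIV \<gamma>1" by (rule vector_derivative_imp_continuous_on [OF d2])
  obtain m where m: "m > 0" "\<And>t. m \<le> norm (\<gamma>1 t)"
    using periodic_bounded_below [OF per1 cont1 nz] by blast
  obtain M1 where M1: "M1 > 0" "\<And>t. norm (\<gamma>1 t) \<le> M1" using periodic_bounded [OF per1 cont1] by blast
  obtain M2 where M2: "M2 > 0" "\<And>t. norm (\<gamma>2 t) \<le> M2"
    using periodic_bounded [OF periodic_vector_derivative [OF per1 d2] c2] by blast
  define s0 where "s0 = min (r0 / (2 * M1)) (m / (2 * M2))"
  have s0: "s0 > 0" "s0 \<le> r0 / (2 * M1)" "s0 \<le> m / (2 * M2)" using r0 m M1 M2 by (auto simp: s0_def)
  have s1: "s0 * norm (\<gamma>1 t) < r0" for t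
  proof -
    have "s0 * norm (\<gamma>1 t) \<le> r0 / (2 * M1) * M1" using s0 M1 r0 by (intro mult_mono) auto
    then show ?thesis using M1 r0 by simp
  qed
  have s2: "s0 * norm (\<gamma>2 t) < norm (\<gamma>1 t)" for t
  proof -
    have "s0 * norm (\<gamma>2 t) \<le> m / (2 * M2) * M2" using s0 M2 m by (intro mult_mono) auto
    then show ?thesis using M2 m(1) m(2) [of t] by simp
  qed
  define \<delta> where "\<delta> = s0 * m"
  have \<delta>: "\<delta> > 0" using s0 m by (simp add: \<delta>_def)
  (* Every point with parameter s = s0 has distance at least delta from the curve, so with
     epsilon at most a the cutoff vanishes there. *)
  obtain a where a: "a > 0" "\<And>x. x \<in> closure \<Omega> \<Longrightarrow> \<delta> \<le> infdist x J \<Longrightarrow> a \<le> 1 - \<rho> x"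
    using one_minus_rho_away [OF \<delta>] by blast
  define \<epsilon> where "\<epsilon> = min a 1"
  have \<epsilon>: "\<epsilon> > 0" "\<epsilon> \<le> a" "\<epsilon> \<le> 1" using a by (auto simp: \<epsilon>_def)
  interpret flow_field O0 \<rho> \<gamma> \<gamma>1 \<gamma>2 \<sigma> r0 g h X DX \<epsilon>
    by unfold_locales (use assms \<epsilon> in auto)
  have z1: "z x \<ge> 1" if "\<epsilon> \<le> 1 - \<rho> x" for x using that \<epsilon> by (simp add: z_def)
  have zaway: "z x \<ge> 1" if "x \<in> closure \<Omega>" "\<delta> \<le> infdist x J" for x
    using a(2) [OF that] \<epsilon> by (intro z1) auto
  have zwall: "z x \<ge> 1" if "x \<in> frontier strip" for x using rho_strip [OF that] \<epsilon> by (intro z1) simp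
  obtain B where B: "B > 0" "\<And>y. y \<in> J \<Longrightarrow> norm y \<le> B" using J_bounded by blast
  obtain B' where B': "B' > 0" "\<And>y. y \<in> closure O0 \<Longrightarrow> norm y \<le> B'"
    using bounded_closure [OF O0(3)] unfolding bounded_pos by blast
  have phi_in: "\<phi> t s \<in> \<Omega> \<and> infdist (\<phi> t s) J = s * norm (\<gamma>1 t)" if "0 < s" "s \<le> s0" for t s
    by (rule phi_point [OF that s1])
  have end0: "kap (\<phi> t s0) = 0" for t
  proof -
    have "\<delta> \<le> s0 * norm (\<gamma>1 t)" using s0 m by (simp add: \<delta>_def)
    then have "z (\<phi> t s0) \<ge> 1" using phi_in [of s0 t] s0 closure_subset by (intro zaway) auto
    then show ?thesis using kap_gk_zero by blast
  qed
  define T where "T = {v::plane. 0 \<le> v $ 1 \<and> v $ 1 < 1 \<and> 0 < v $ 2 \<and> v $ 2 < s0}"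
  define S where "S = (\<lambda>v::plane. \<phi> (v $ 1) (v $ 2)) ` T"
  have q_out: "q x = 0" if "x \<notin> S" for x
  proof (rule ccontr)
    assume q: "q x \<noteq> 0"
    then have xc: "x \<in> closure \<Omega>" and gx: "gk x \<noteq> 0" by (auto simp: q_def split: if_splits)
    from xc show False
    proof (cases rule: closure_Omega_cases)
      case 1
      have "\<not> z x \<ge> 1" using gx kap_gk_zero by blast
      then have d: "infdist x J < \<delta>" using zaway [OF xc] by force
      obtain t where t: "t \<in> {0..<1}" "x = \<gamma> t - infdist x J *\<^sub>R N t" using nearest_point [OF 1] by blast
      define s where "s = infdist x J / norm (\<gamma>1 t)"
      have "x = \<phi> t s" using t nz [of t] by (simp add: phi_normal s_def)
      moreover have "s > 0" using infdist_pos [OF Omega_not_J(1) [OF 1]] nz [of t] by (simp add: s_def)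
      moreover have "s < s0"
      proof -
        have "infdist x J < s0 * norm (\<gamma>1 t)"
        proof -
          have "s0 * m \<le> s0 * norm (\<gamma>1 t)" using s0 m by (intro mult_left_mono) auto
          then show ?thesis using d unfolding \<delta>_def by linarith
        qed
        then show ?thesis using nz [of t] by (simp add: s_def divide_less_eq)
      qed
      ultimately have "x = (\<lambda>v::plane. \<phi> (v $ 1) (v $ 2)) (vector [t, s])" "vector [t, s] \<in> T"
        using t by (auto simp: T_def)
      then have "x \<in> S" unfolding S_def by (rule image_eqI)
      then show False using that by blast
    next
      case 2
      then show False using kap_gk_J gx by blast
    next
      case 3
      then show False using zwall kap_gk_zero gx by blast
    qed
  qed
  have flux: "integral S q = integral {0..1} (\<lambda>t. X (\<gamma> t) \<bullet> (\<sigma> *\<^sub>R rot (\<gamma>1 t)))"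
    unfolding S_def T_def by (rule tube_image_integral [OF s0(1) s1 s2 end0])
  define R0 where "R0 = max (B + r0) (max (B + \<delta>) (B' + 1))"
  have "R0 > 0" using B r0 by (simp add: R0_def)
  moreover have "integral {0..1} (\<lambda>t. X (\<gamma> t) \<bullet> (\<sigma> *\<^sub>R rot (\<gamma>1 t)))
        + integral {-R..R} (\<lambda>a. X (vector [a, pi]) $ 2 - X (vector [a, 0]) $ 2)
        + integral {0..pi} (\<lambda>b. X (vector [R, b]) $ 1 - X (vector [-R, b]) $ 1) = 0"
    if R: "R \<ge> R0" for R
  proof -
    let ?C = "cbox (vector [-R, 0]) (vector [R, pi]) :: plane set"
    have Rb: "R \<ge> B + r0" "R \<ge> B + \<delta>" "R \<ge> B' + 1" "R > 0"
      using R \<open>R0 > 0\<close> by (auto simp: R0_def)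
    have SC: "S \<subseteq> ?C"
    proof
      fix x assume "x \<in> S"
      then obtain v where v: "v \<in> T" "x = \<phi> (v $ 1) (v $ 2)" by (auto simp: S_def)
      then have x: "x \<in> \<Omega>" "infdist x J = v $ 2 * norm (\<gamma>1 (v $ 1))" using phi_in [of "v $ 2" "v $ 1"] by (auto simp: T_def)
      have "v $ 2 * norm (\<gamma>1 (v $ 1)) \<le> s0 * norm (\<gamma>1 (v $ 1))" using v by (intro mult_right_mono) (auto simp: T_def)
      then have lt: "infdist x J < r0" using x s1 [of "v $ 1"] by simp
      obtain t where t: "x = \<gamma> t - infdist x J *\<^sub>R N t" using nearest_point [OF x(1)] by blast
      have "norm x \<le> norm (\<gamma> t) + norm (infdist x J *\<^sub>R N t)" by (subst t) (rule norm_triangle_ineq4)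
      also have "\<dots> \<le> B + r0" using B(2) [OF in_J [of t]] lt infdist_nonneg [of x J] by simp
      finally have "\<bar>x $ 1\<bar> \<le> R" using component_le_norm_cart [of x 1] Rb by simp
      moreover have "0 < x $ 2" "x $ 2 < pi" using Omega_not_J(3) [OF x(1)] by (auto simp: strip_def)
      ultimately show "x \<in> ?C" by (auto simp: cbox_plane)
    qed
    have "integral ?C q = integral UNIV (\<lambda>x. if x \<in> ?C then q x else 0)" by (simp add: integral_restrict_UNIV)
    also have "(\<lambda>x. if x \<in> ?C then q x else 0) = (\<lambda>x. if x \<in> S then q x else 0)"
      using q_out SC by fastforce
    also have "integral UNIV \<dots> = integral S q" by (simp add: integral_restrict_UNIV)
    finally have eq: "integral ?C q = integral S q" .
    have "integral ?C q =
     - (integral {-R..R} (\<lambda>a. X (vector [a, pi]) $ 2 - X (vector [a, 0]) $ 2)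
        + integral {0..pi} (\<lambda>b. X (vector [R, b]) $ 1 - X (vector [-R, b]) $ 1))"
    proof (rule rect_flux [OF Rb(4)])
      fix x :: plane assume x: "x \<in> closure strip" and bd: "x $ 1 = R \<or> x $ 1 = - R \<or> x $ 2 = 0 \<or> x $ 2 = pi"
      show "x \<in> closure \<Omega> \<and> kap x = 0"
      proof (cases "x $ 2 = 0 \<or> x $ 2 = pi")
        case True
        then have "x \<in> frontier strip" by (simp add: frontier_strip)
        then show ?thesis using wall_closure zwall kap_gk_zero by blast
      next
        case False
        then have "\<bar>x $ 1\<bar> = R" using bd Rb by auto
        then have nx: "norm x \<ge> R" using component_le_norm_cart [of x 1] by simp
        then have "x \<notin> O0" using B'(2) [of x] Rb closure_subset [of O0] by force
        then have xc: "x \<in> closure \<Omega>" using x closure_fluid_domain [OF obs] by auto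
        have "\<delta> \<le> infdist x J"
        proof -
          obtain y where y: "y \<in> J" "infdist x J = dist x y"
            using infdist_attains_inf [of J x] compact_J J_nonempty compact_imp_closed by blast
          then show ?thesis using nx Rb(2) B(2) [OF y(1)] norm_triangle_ineq2 [of x y] by (simp add: dist_norm)
        qed
        then show ?thesis using zaway [OF xc] xc kap_gk_zero by blast
      qed
    qed
    then show ?thesis using eq flux by simp
  qed
  ultimately show ?thesis by blast
qed

end

section \<open>Boundary fluxes of \<open>\<rho>\<close>\<close>

lemma one_sided_derivative_nonneg:
  fixes f :: "real \<Rightarrow> real"
  assumes d: "d > 0" and f: "(f has_vector_derivative D) (at 0 within {0..d})"
    and f0: "f 0 = 0" and nonneg: "\<And>s. 0 < s \<Longrightarrow> s \<le> d \<Longrightarrow> 0 \<le> f s"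
  shows "0 \<le> D"
proof -
  have "((\<lambda>s. (f s - f 0) / (s - 0)) \<longlongrightarrow> D) (at 0 within {0..d})"
    using f by (simp add: has_real_derivative_iff_has_vector_derivative [symmetric] has_field_derivative_iff)
  moreover have "eventually (\<lambda>s. 0 \<le> (f s - f 0) / (s - 0)) (at 0 within {0..d})"
    unfolding eventually_at_filter by (intro always_eventually) (use nonneg f0 in auto)
  moreover have "at 0 within {0..d} \<noteq> bot"
    using d by (simp add: trivial_limit_within islimpt_Icc)
  ultimately show ?thesis by (rule tendsto_lowerbound)
qed

lemma lebesgue_integral_eq_limit:
  fixes p :: "real \<Rightarrow> real"
  assumes cont: "continuous_on UNIV p" and nonneg: "\<And>t. 0 \<le> p t"
    and lim: "(\<lambda>n. integral {- real n..real n} p) \<longlonglongrightarrow> L"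
  shows "(LINT t|lborel. p t) = L"
proof (rule integral_monotone_convergence)
  let ?f = "\<lambda>n t. indicator {- real n..real n} t *\<^sub>R p t"
  have si: "set_integrable lborel {- real n..real n} p" for n
    by (rule borel_integrable_atLeastAtMost') (rule continuous_on_subset [OF cont], simp)
  show "integrable lborel (?f n)" for n using si [of n] by (simp add: set_integrable_def)
  show "AE t in lborel. mono (\<lambda>n. ?f n t)"
    by (intro AE_I2 monoI) (auto simp: indicator_def nonneg)
  show "AE t in lborel. (\<lambda>n. ?f n t) \<longlonglongrightarrow> p t"
  proof (intro AE_I2)
    fix t :: real
    obtain n0 where n0: "\<bar>t\<bar> \<le> real n0" using real_arch_simple by blast
    have "eventually (\<lambda>n. ?f n t = p t) sequentially"
      unfolding eventually_sequentially
      by (rule exI [of _ n0]) (use n0 in \<open>auto simp: indicator_def abs_le_iff\<close>)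
    then show "(\<lambda>n. ?f n t) \<longlonglongrightarrow> p t" by (rule tendsto_eventually)
  qed
  have "(LINT t|lborel. ?f n t) = integral {- real n..real n} p" for n
    using set_borel_integral_eq_integral(2) [OF si [of n]] by (simp add: set_lebesgue_integral_def)
  then show "(\<lambda>n. LINT t|lborel. ?f n t) \<longlonglongrightarrow> L" using lim by simp
  show "p \<in> borel_measurable lborel" using cont by (simp add: borel_measurable_continuous_onI)
qed

context flow
begin

lemma far_columns: "eventually P (far \<Omega>) \<longleftrightarrow> (\<exists>R. \<forall>x\<in>\<Omega>. R \<le> \<bar>x $ 1\<bar> \<longrightarrow> P x)"
  unfolding eventually_far
proof
  assume "\<exists>b. \<forall>x\<in>\<Omega>. b \<le> norm x \<longrightarrow> P x"
  then obtain b where b: "\<And>x. x \<in> \<Omega> \<Longrightarrow> b \<le> norm x \<Longrightarrow> P x" by blast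
  then have "\<forall>x\<in>\<Omega>. b \<le> \<bar>x $ 1\<bar> \<longrightarrow> P x"
    using component_le_norm_cart order_trans by blast
  then show "\<exists>R. \<forall>x\<in>\<Omega>. R \<le> \<bar>x $ 1\<bar> \<longrightarrow> P x" by blast
next
  assume "\<exists>R. \<forall>x\<in>\<Omega>. R \<le> \<bar>x $ 1\<bar> \<longrightarrow> P x"
  then obtain R where R: "\<And>x. x \<in> \<Omega> \<Longrightarrow> R \<le> \<bar>x $ 1\<bar> \<Longrightarrow> P x" by blast
  have "\<forall>x\<in>\<Omega>. R + pi \<le> norm x \<longrightarrow> P x"
  proof (intro ballI impI)
    fix x assume x: "x \<in> \<Omega>" "R + pi \<le> norm x"
    have "norm x \<le> \<bar>x $ 1\<bar> + \<bar>x $ 2\<bar>" using norm_le_l1_cart [of x] by (simp add: sum_2)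
    moreover have "\<bar>x $ 2\<bar> \<le> pi" using Omega_not_J(3) [OF x(1)] by (auto simp: strip_def)
    ultimately show "P x" using R x by auto
  qed
  then show "\<exists>b. \<forall>x\<in>\<Omega>. b \<le> norm x \<longrightarrow> P x" by blast
qed

lemma obstacle_columns: obtains R where "R > 0"
  "\<And>a b. R \<le> \<bar>a\<bar> \<Longrightarrow> 0 < b \<Longrightarrow> b < pi \<Longrightarrow> vector [a, b] \<in> \<Omega>"
  "\<And>a b. R \<le> \<bar>a\<bar> \<Longrightarrow> 0 \<le> b \<Longrightarrow> b \<le> pi \<Longrightarrow> vector [a, b] \<in> closure \<Omega>"
proof -
  obtain B where B: "B > 0" "\<And>y. y \<in> closure O0 \<Longrightarrow> norm y \<le> B"
    using bounded_closure [OF O0(3)] unfolding bounded_pos by blast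
  have *: "(vector [a, b] :: plane) \<notin> closure O0" if "B + 1 \<le> \<bar>a\<bar>" for a b
    using B(2) [of "vector [a, b]"] component_le_norm_cart [of "vector [a, b] :: plane" 1] that by auto
  show thesis
  proof (rule that [of "B + 1"])
    fix a b :: real assume a: "B + 1 \<le> \<bar>a\<bar>"
    show "vector [a, b] \<in> \<Omega>" if "0 < b" "b < pi"
      using * [OF a, of b] that by (simp add: fluid_domain_def strip_def)
    show "vector [a, b] \<in> closure \<Omega>" if "0 \<le> b" "b \<le> pi"
      using * [OF a, of b] that closure_subset [of O0] by (auto simp: closure_fluid_domain [OF obs] closure_strip)
  qed (use B in auto)
qed

text \<open>
  The definition provides one Hessian up to the boundary and possibly another one that is trace free
  inside. They agree inside by uniqueness of derivatives, and the equation extends by continuity.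
\<close>

lemma harmonic_trace_closure:
  assumes harm: "harmonic_on \<Omega> u" and gh: "C2_derivs (closure \<Omega>) u g h" and x: "x \<in> closure \<Omega>"
  shows "trace (h x) = 0"
proof -
  obtain g' h' where gh': "C2_derivs \<Omega> u g' h'" "\<forall>x\<in>\<Omega>. trace (h' x) = 0"
    using harm unfolding harmonic_on_def by blast
  have ghO: "C2_derivs \<Omega> u g h" using gh unfolding C2_derivs_def
    using closure_subset [of \<Omega>] by (blast intro: has_derivative_subset continuous_on_subset)
  have gg: "g y = g' y" if y: "y \<in> \<Omega>" for y
  proof -
    have "(\<lambda>v. g y \<bullet> v) = (\<lambda>v. g' y \<bullet> v)"
      by (rule has_derivative_unique [OF C2_derivs_at(1) [OF ghO open_fluid_domain y]
            C2_derivs_at(1) [OF gh'(1) open_fluid_domain y]])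
    then have "g y \<bullet> v = g' y \<bullet> v" for v by (rule fun_cong)
    then show ?thesis using vector_eq_rdot by blast
  qed
  have tr: "trace (h y) = 0" if y: "y \<in> \<Omega>" for y
  proof -
    have "(g has_derivative (*v) (h' y)) (at y)"
      by (rule has_derivative_transform_within_open [OF C2_derivs_at(2) [OF gh'(1) open_fluid_domain y] open_fluid_domain y])
         (simp add: gg)
    from has_derivative_unique [OF C2_derivs_at(2) [OF ghO open_fluid_domain y] this]
    have "h y *v v = h' y *v v" for v by (rule fun_cong)
    then have "h y = h' y" by (simp add: matrix_eq)
    then show ?thesis using gh' y by simp
  qed
  have "continuous_on (closure \<Omega>) (\<lambda>x. trace (h x))"
    using gh unfolding C2_derivs_def trace_def by (intro continuous_intros) auto
  then show ?thesis
    by (rule continuous_constant_on_closure [OF _ _ x]) (use tr in auto)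
qed

lemma C2_gradient_cont:
  assumes "C2_derivs (closure \<Omega>) u g h" shows "continuous_on (closure \<Omega>) g" "continuous_on (closure \<Omega>) u"
  using assms unfolding C2_derivs_def continuous_on_eq_continuous_within
  by (blast intro: has_derivative_continuous)+

lemma flux_cont:
  assumes "C2_derivs (closure \<Omega>) u g h"
  shows "continuous_on S (\<lambda>t. g (\<gamma> t) \<bullet> (\<sigma> *\<^sub>R rot (\<gamma>1 t)))"
proof -
  have "continuous_on S (\<lambda>t. g (\<gamma> t))"
    by (rule continuous_on_compose2 [OF C2_gradient_cont(1) [OF assms] boundary_param_continuous [OF param]])
       (use in_J J_closure in auto)
  then show ?thesis by (intro continuous_intros vector_derivative_imp_continuous_on [OF d2])
qed

lemma normal_times_speed: "v \<bullet> N t * norm (\<gamma>1 t) = v \<bullet> (\<sigma> *\<^sub>R rot (\<gamma>1 t))"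
  using nz [of t] by (simp add: curve_normal_def)

lemma boundary_flux:
  assumes gam: "\<gamma> = (SOME \<gamma>. boundary_param O0 \<gamma>)" and gh: "C2_derivs (closure \<Omega>) u g h"
  shows "boundary_integral O0 (normal_deriv \<Omega> u) = integral {0..1} (\<lambda>t. g (\<gamma> t) \<bullet> (\<sigma> *\<^sub>R rot (\<gamma>1 t)))"
proof -
  have vd: "vector_derivative \<gamma> (at t) = \<gamma>1 t" for t by (rule vector_derivative_at [OF d1])
  have "boundary_integral O0 (normal_deriv \<Omega> u) = (LINT t:{0..1}|lborel. g (\<gamma> t) \<bullet> (\<sigma> *\<^sub>R rot (\<gamma>1 t)))"
    unfolding boundary_integral_def Let_def gam [symmetric] vd normal_deriv_J [OF gh] normal_times_speed ..
  also have "\<dots> = integral {0..1} (\<lambda>t. g (\<gamma> t) \<bullet> (\<sigma> *\<^sub>R rot (\<gamma>1 t)))"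
    by (intro set_borel_integral_eq_integral(2) borel_integrable_atLeastAtMost' flux_cont [OF gh])
  finally show ?thesis .
qed

text \<open>
  Hopf's lemma for \<open>1 - \<rho>\<close> in terms of the normal derivative.
\<close>

lemma rho_normal_pos:
  assumes gh: "C2_derivs (closure \<Omega>) \<rho> g h"
  obtains c where "c > 0" "\<And>t. c \<le> g (\<gamma> t) \<bullet> N t"
proof -
  obtain c where c: "c > 0" "\<And>x. x \<in> \<Omega> \<Longrightarrow> infdist x J \<le> r0 / 4 \<Longrightarrow> c * infdist x J \<le> 1 - \<rho> x"
  proof (rule hopf_lower_bound [of "\<lambda>x. 1 - \<rho> x"])
    show "harmonic_on \<Omega> (\<lambda>x. 1 - \<rho> x)" by (intro harmonic_on_diff rho_harmonic harmonic_on_const)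
    show "continuous_on (closure \<Omega>) (\<lambda>x. 1 - \<rho> x)" by (intro continuous_intros rho_cont)
  qed (use rho_less_1 in auto)
  have "c \<le> g (\<gamma> t) \<bullet> N t" for t
  proof -
    define l where "l s = \<gamma> t - s *\<^sub>R N t" for s
    define f where "f s = (1 - \<rho> (l s)) - c * s" for s
    have l: "(l has_vector_derivative - N t) (at 0 within {0..r0/4})"
      unfolding l_def by (auto intro!: derivative_eq_intros simp: has_vector_derivative_def)
    have im: "l ` {0..r0/4} \<subseteq> closure \<Omega>"
    proof
      fix y assume "y \<in> l ` {0..r0/4}"
      then obtain s where s: "0 \<le> s" "s \<le> r0 / 4" "y = l s" by auto
      show "y \<in> closure \<Omega>"
        using s r0 normal_point(1) [of s t] in_J [of t] J_closure closure_subset [of \<Omega>]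
        by (cases "s = 0") (auto simp: l_def)
    qed
    have l0: "l 0 = \<gamma> t" by (simp add: l_def)
    have xc: "l 0 \<in> closure \<Omega>" using in_J J_closure l0 by auto
    have "((\<lambda>s. \<rho> (l s)) has_vector_derivative g (l 0) \<bullet> (- N t)) (at 0 within {0..r0/4})"
      by (rule vector_derivative_chain_within [OF C2_closure_gradient [OF gh xc] l im])
    then have r: "((\<lambda>s. \<rho> (l s)) has_real_derivative g (l 0) \<bullet> (- N t)) (at 0 within {0..r0/4})"
      by (simp add: has_real_derivative_iff_has_vector_derivative)
    have "(f has_real_derivative (g (\<gamma> t) \<bullet> N t - c)) (at 0 within {0..r0/4})"
      unfolding f_def using r by (auto intro!: derivative_eq_intros simp: l0)
    then have fd: "(f has_vector_derivative (g (\<gamma> t) \<bullet> N t - c)) (at 0 within {0..r0/4})"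
      by (simp add: has_real_derivative_iff_has_vector_derivative)
    have f0: "f 0 = 0" using rho_J [OF in_J [of t]] by (simp add: f_def l0)
    have fn: "0 \<le> f s" if "0 < s" "s \<le> r0 / 4" for s
      using c(2) [of "l s"] normal_point [of s t] that r0 by (simp add: f_def l_def)
    have "r0 / 4 > 0" using r0 by simp
    from one_sided_derivative_nonneg [OF this fd f0 fn]
    have "0 \<le> g (\<gamma> t) \<bullet> N t - c" by simp
    then show ?thesis by simp
  qed
  with c show thesis using that by blast
qed

lemma rho_flux:
  assumes gam: "\<gamma> = (SOME \<gamma>. boundary_param O0 \<gamma>)" and gh: "C2_derivs (closure \<Omega>) \<rho> g h"
  shows "integral {0..1} (\<lambda>t. g (\<gamma> t) \<bullet> (\<sigma> *\<^sub>R rot (\<gamma>1 t))) > 0"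
    and "boundary_integral O0 (\<lambda>x. \<bar>normal_deriv \<Omega> \<rho> x\<bar>) = integral {0..1} (\<lambda>t. g (\<gamma> t) \<bullet> (\<sigma> *\<^sub>R rot (\<gamma>1 t)))"
proof -
  obtain c where c: "c > 0" "\<And>t. c \<le> g (\<gamma> t) \<bullet> N t" using rho_normal_pos [OF gh] by blast
  obtain m where m: "m > 0" "\<And>t. m \<le> norm (\<gamma>1 t)"
    using periodic_bounded_below [OF per1 vector_derivative_imp_continuous_on [OF d2] nz] by blast
  have lb: "c * m \<le> g (\<gamma> t) \<bullet> (\<sigma> *\<^sub>R rot (\<gamma>1 t))" for t
    unfolding normal_times_speed [symmetric] using c m by (intro mult_mono) (auto intro: less_imp_le order_trans)
  have "integral {0..1::real} (\<lambda>t. c * m) \<le> integral {0..1} (\<lambda>t. g (\<gamma> t) \<bullet> (\<sigma> *\<^sub>R rot (\<gamma>1 t)))"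
    by (intro integral_le integrable_continuous_interval flux_cont [OF gh] lb continuous_intros)
  moreover have "c * m > 0" using c m by simp
  ultimately show "integral {0..1} (\<lambda>t. g (\<gamma> t) \<bullet> (\<sigma> *\<^sub>R rot (\<gamma>1 t))) > 0" by simp
  have "\<bar>normal_deriv \<Omega> \<rho> (\<gamma> t)\<bar> = normal_deriv \<Omega> \<rho> (\<gamma> t)" for t
    using c(1) c(2) [of t] unfolding normal_deriv_J [OF gh] by simp
  then have "boundary_integral O0 (\<lambda>x. \<bar>normal_deriv \<Omega> \<rho> x\<bar>) = boundary_integral O0 (normal_deriv \<Omega> \<rho>)"
    unfolding boundary_integral_def Let_def gam [symmetric] by simp
  then show "boundary_integral O0 (\<lambda>x. \<bar>normal_deriv \<Omega> \<rho> x\<bar>) = integral {0..1} (\<lambda>t. g (\<gamma> t) \<bullet> (\<sigma> *\<^sub>R rot (\<gamma>1 t)))"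
    using boundary_flux [OF gam gh] by simp
qed

lemma rho_top_nonpos:
  assumes gh: "C2_derivs (closure \<Omega>) \<rho> g h"
  shows "g (vector [a, pi]) $ 2 \<le> 0"
proof -
  obtain D where D: "D > 0" "\<And>x y. x \<in> closure O0 \<Longrightarrow> y \<notin> strip \<Longrightarrow> D \<le> dist x y"
    using wall_distance by blast
  define r where "r = min 1 (D / 2)"
  have r: "0 < r" "r \<le> 1" "r < D" using D by (auto simp: r_def)
  define l where "l s = (vector [a, pi - s] :: plane)" for s
  have leq: "l = (\<lambda>s. vector [a, pi] - s *\<^sub>R axis 2 1)"
    by (auto simp: l_def vec_eq_iff forall_2 axis_def)
  have l: "(l has_vector_derivative - axis 2 1) (at 0 within {0..r})"
    unfolding leq by (auto intro!: derivative_eq_intros simp: has_vector_derivative_def)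
  have im: "l ` {0..r} \<subseteq> closure \<Omega>"
  proof
    fix y assume "y \<in> l ` {0..r}"
    then obtain s where s: "0 \<le> s" "s \<le> r" "y = l s" by auto
    have "dist y (vector [a, pi]) \<le> r" using s by (simp add: leq dist_norm)
    moreover have "(vector [a, pi] :: plane) \<notin> strip" by (simp add: strip_def)
    ultimately have "y \<notin> closure O0" using D(2) [of y "vector [a, pi]"] r by force
    moreover have "y \<in> closure strip" using s r pi_gt3 by (auto simp: closure_strip l_def)
    ultimately show "y \<in> closure \<Omega>" using closure_subset [of O0] by (auto simp: closure_fluid_domain [OF obs])
  qed
  have l0: "l 0 = vector [a, pi]" by (simp add: l_def)
  have xc: "l 0 \<in> closure \<Omega>" using im r by auto
  have rd: "((\<lambda>s. \<rho> (l s)) has_vector_derivative g (l 0) \<bullet> (- axis 2 1)) (at 0 within {0..r})"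
    by (rule vector_derivative_chain_within [OF C2_closure_gradient [OF gh xc] l im])
  have r0': "\<rho> (l 0) = 0" by (rule rho_strip) (simp add: l0 frontier_strip)
  have rn: "0 \<le> \<rho> (l s)" if "0 < s" "s \<le> r" for s
  proof -
    have "l s \<in> closure \<Omega>" using im that by auto
    then show ?thesis by (rule rho_nonneg)
  qed
  have "0 \<le> g (l 0) \<bullet> (- axis 2 1)"
    by (rule one_sided_derivative_nonneg [OF r(1) rd r0' rn])
  then show ?thesis by (simp add: l0 inner_axis)
qed

lemma eta_dest:
  assumes "is_eta O0 b \<Gamma> \<eta> lam"
  shows "C2_on (closure \<Omega>) \<eta>" "harmonic_on \<Omega> \<eta>" "x \<in> J \<Longrightarrow> \<eta> x = - lam"
    "x $ 2 = 0 \<Longrightarrow> \<eta> x = 0" "x $ 2 = pi \<Longrightarrow> \<eta> x = b * pi"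
    "(grad \<eta> \<longlongrightarrow> vector [0, b]) (far \<Omega>)"
    "boundary_integral O0 (normal_deriv \<Omega> \<eta>) = - \<Gamma>"
    "continuous_on (closure \<Omega>) \<eta>"
  using assms C2_on_imp_continuous_on [of "closure \<Omega>" \<eta>] unfolding is_eta_def by simp_all

text \<open>
  Only the gradient of \<open>\<eta>\<close> is prescribed at infinity. Integrating its second component upwards
  from the lower wall, where \<open>\<eta>\<close> vanishes, determines \<open>\<eta>\<close> itself.
\<close>

lemma eta_far:
  assumes eta: "is_eta O0 b \<Gamma> \<eta> lam" and e: "e > 0"
  shows "\<exists>R. \<forall>a h. R \<le> \<bar>a\<bar> \<longrightarrow> 0 \<le> h \<longrightarrow> h \<le> pi \<longrightarrow> \<bar>\<eta> (vector [a, h]) - b * h\<bar> \<le> e"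
proof -
  obtain g k where gh: "C2_derivs (closure \<Omega>) \<eta> g k" using eta_dest(1) [OF eta] unfolding C2_on_def by blast
  obtain R1 where R1: "\<And>a h. R1 \<le> \<bar>a\<bar> \<Longrightarrow> 0 < h \<Longrightarrow> h < pi \<Longrightarrow> vector [a, h] \<in> \<Omega>"
    "\<And>a h. R1 \<le> \<bar>a\<bar> \<Longrightarrow> 0 \<le> h \<Longrightarrow> h \<le> pi \<Longrightarrow> vector [a, h] \<in> closure \<Omega>"
    by (rule obstacle_columns) (rule that)
  have "e / pi > 0" using e by simp
  from tendstoD [OF eta_dest(6) [OF eta] this]
  obtain R2 where R2': "\<forall>x\<in>\<Omega>. R2 \<le> \<bar>x $ 1\<bar> \<longrightarrow> dist (grad \<eta> x) (vector [0, b]) < e / pi"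
    unfolding far_columns by (elim exE)
  then have R2: "dist (grad \<eta> x) (vector [0, b]) < e / pi" if "x \<in> \<Omega>" "R2 \<le> \<bar>x $ 1\<bar>" for x
    using that by blast
  have "\<bar>\<eta> (vector [a, h]) - b * h\<bar> \<le> e" if a: "max R1 R2 \<le> \<bar>a\<bar>" and h: "0 \<le> h" "h \<le> pi" for a h
  proof -
    define f where "f s = \<eta> (vector [a, s]) - b * s" for s
    have im: "(\<lambda>s. vector [a, s] :: plane) ` {0..pi} \<subseteq> closure \<Omega>" using R1(2) a by auto
    have cont: "continuous_on {0..pi} f" unfolding f_def
      by (intro continuous_intros continuous_on_compose2 [OF eta_dest(8) [OF eta] _ im])
    have der: "(f has_derivative (\<lambda>v. v * (g (vector [a, s]) $ 2 - b))) (at s)" if s: "0 < s" "s < pi" for s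
    proof -
      have x: "vector [a, s] \<in> closure \<Omega>" using R1(2) a s by auto
      have "((\<lambda>s. \<eta> (vector [a, s])) has_vector_derivative g (vector [a, s]) \<bullet> axis 2 1) (at s within {0..pi})"
        by (rule vector_derivative_chain_within [OF C2_closure_gradient [OF gh x] has_vector_derivative_vector2_snd im])
      then have "((\<lambda>s. \<eta> (vector [a, s])) has_real_derivative g (vector [a, s]) $ 2) (at s within {0..pi})"
        by (simp add: has_real_derivative_iff_has_vector_derivative inner_axis)
      moreover have "at s within {0..pi} = at s" using s by (intro at_within_interior) simp
      ultimately have d: "((\<lambda>s. \<eta> (vector [a, s])) has_real_derivative g (vector [a, s]) $ 2) (at s)" by simp
      have "(f has_real_derivative (g (vector [a, s]) $ 2 - b)) (at s)"
        unfolding f_def using d by (auto intro!: derivative_eq_intros)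
      then show ?thesis by (simp add: has_field_derivative_def mult_commute_abs)
    qed
    have bound: "\<bar>g (vector [a, s]) $ 2 - b\<bar> \<le> e / pi" if s: "0 < s" "s < pi" for s
    proof -
      have x: "vector [a, s] \<in> \<Omega>" using R1(1) a s by auto
      have "dist (g (vector [a, s])) (vector [0, b]) < e / pi"
        using R2 [OF x] a grad_eq [OF gh x] by simp
      moreover have "\<bar>(g (vector [a, s]) - vector [0, b]) $ 2\<bar> \<le> norm (g (vector [a, s]) - vector [0, b])"
        by (rule component_le_norm_cart)
      ultimately show ?thesis by (simp add: dist_norm)
    qed
    have "f 0 = 0" using eta_dest(4) [OF eta, of "vector [a, 0]"] by (simp add: f_def)
    have "\<bar>f h\<bar> \<le> e"
    proof (cases "h = 0")
      case True then show ?thesis using \<open>f 0 = 0\<close> e by simp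
    next
      case False
      then have "h > 0" using h by simp
      obtain s where s: "s \<in> {0<..<h}" "norm (f h - f 0) \<le> norm ((h - 0) * (g (vector [a, s]) $ 2 - b))"
        using mvt_general [of 0 h f "\<lambda>s v. v * (g (vector [a, s]) $ 2 - b)"] \<open>h > 0\<close> h der
          continuous_on_subset [OF cont, of "{0..h}"] by auto
      have "\<bar>f h\<bar> \<le> h * \<bar>g (vector [a, s]) $ 2 - b\<bar>" using s \<open>f 0 = 0\<close> \<open>h > 0\<close> by (simp add: abs_mult)
      also have "\<dots> \<le> pi * (e / pi)" using s h bound [of s] by (intro mult_mono) auto
      finally show ?thesis by simp
    qed
    then show ?thesis by (simp add: f_def)
  qed
  then show ?thesis by blast
qed

end

section \<open>The circulation identity\<close>

context flow
begin

text \<open>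
  Apply the divergence identity to \<open>\<rho> \<nabla>\<eta> - \<eta> \<nabla>\<rho>\<close>. On the obstacle \<open>\<rho> = 1\<close> and \<open>\<eta> = - lam\<close>, so
  the flux is \<open>- \<Gamma> + lam A\<close>. On the walls only the upper one contributes, \<open>b \<pi>\<close> times the integral of
  \<open>- \<partial>\<rho>/\<partial>x\<^sub>2 \<ge> 0\<close>. The vertical sides contribute nothing in the limit, since \<open>\<rho>\<close> and its gradient
  tend to zero there while \<open>\<eta>\<close> and its gradient stay bounded.
\<close>

theorem circulation_identity:
  assumes gam: "\<gamma> = (SOME \<gamma>. boundary_param O0 \<gamma>)" and eta: "is_eta O0 b \<Gamma> \<eta> lam" and b: "b > 0"
  shows "\<Gamma> = lam * boundary_integral O0 (\<lambda>x. \<bar>normal_deriv \<Omega> \<rho> x\<bar>) + b * top_flux O0 \<rho>"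
    and "boundary_integral O0 (\<lambda>x. \<bar>normal_deriv \<Omega> \<rho> x\<bar>) > 0"
proof -
  obtain g h where gh: "C2_derivs (closure \<Omega>) \<rho> g h" using rho_C2 unfolding C2_on_def by blast
  obtain g' h' where gh': "C2_derivs (closure \<Omega>) \<eta> g' h'" using eta_dest(1) [OF eta] unfolding C2_on_def by blast
  define A where "A = boundary_integral O0 (\<lambda>x. \<bar>normal_deriv \<Omega> \<rho> x\<bar>)"
  let ?n = "\<lambda>t. \<sigma> *\<^sub>R rot (\<gamma>1 t)"
  have A: "A = integral {0..1} (\<lambda>t. g (\<gamma> t) \<bullet> ?n t)" unfolding A_def by (rule rho_flux(2) [OF gam gh])
  show "boundary_integral O0 (\<lambda>x. \<bar>normal_deriv \<Omega> \<rho> x\<bar>) > 0"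
    unfolding rho_flux(2) [OF gam gh] by (rule rho_flux(1) [OF gam gh])
  have \<Gamma>: "integral {0..1} (\<lambda>t. g' (\<gamma> t) \<bullet> ?n t) = - \<Gamma>"
    using eta_dest(7) [OF eta] boundary_flux [OF gam gh'] by simp
  define X where "X x = \<rho> x *\<^sub>R g' x - \<eta> x *\<^sub>R g x" for x
  define DX where "DX x = ((\<chi> i j. \<rho> x * h' x $ i $ j + g' x $ i * g x $ j - \<eta> x * h x $ i $ j - g x $ i * g' x $ j) :: real^2^2)" for x
  have X_deriv: "(X has_derivative (\<lambda>v. DX x *v v)) (at x within closure \<Omega>)" if x: "x \<in> closure \<Omega>" for x
  proof -
    have d: "(\<rho> has_derivative (\<lambda>v. g x \<bullet> v)) (at x within closure \<Omega>)" "(g has_derivative (*v) (h x)) (at x within closure \<Omega>)"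
      "(\<eta> has_derivative (\<lambda>v. g' x \<bullet> v)) (at x within closure \<Omega>)" "(g' has_derivative (*v) (h' x)) (at x within closure \<Omega>)"
      using gh gh' x by (auto simp: C2_derivs_def)
    show ?thesis unfolding X_def [abs_def]
      by (rule has_derivative_eq_rhs [OF has_derivative_diff [OF has_derivative_scaleR [OF d(1,4)] has_derivative_scaleR [OF d(3,2)]]])
         (simp add: fun_eq_iff vec_eq_iff forall_2 DX_def matrix_vector_mult_def sum_2 inner_plane algebra_simps)
  qed
  have gc: "continuous_on (closure \<Omega>) g" "continuous_on (closure \<Omega>) g'" "continuous_on (closure \<Omega>) \<eta>"
    "continuous_on (closure \<Omega>) h" "continuous_on (closure \<Omega>) h'"
    using C2_gradient_cont [OF gh] C2_gradient_cont [OF gh'] gh gh' by (auto simp: C2_derivs_def)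
  have DX_cont: "continuous_on (closure \<Omega>) DX" unfolding DX_def [abs_def]
    by (intro continuous_on_vec_lambda continuous_intros gc rho_cont)
  have DX_trace: "trace (DX x) = 0" if "x \<in> closure \<Omega>" for x
  proof -
    have "trace (DX x) = \<rho> x * trace (h' x) - \<eta> x * trace (h x)"
      by (simp add: DX_def trace_def sum_2 algebra_simps)
    then show ?thesis
      using harmonic_trace_closure [OF rho_harmonic gh that] harmonic_trace_closure [OF eta_dest(2) [OF eta] gh' that]
      by simp
  qed
  have X_cont: "continuous_on (closure \<Omega>) X" unfolding X_def [abs_def] by (intro continuous_intros gc rho_cont)
  define F where "F = integral {0..1} (\<lambda>t. X (\<gamma> t) \<bullet> ?n t)"
  have Xeq: "X (\<gamma> t) \<bullet> ?n t = g' (\<gamma> t) \<bullet> ?n t + lam * (g (\<gamma> t) \<bullet> ?n t)" for t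
    using rho_J [OF in_J] eta_dest(3) [OF eta in_J] by (simp add: X_def algebra_simps)
  have "F = integral {0..1} (\<lambda>t. g' (\<gamma> t) \<bullet> ?n t + lam * (g (\<gamma> t) \<bullet> ?n t))"
    unfolding F_def by (rule integral_cong) (rule Xeq)
  also have "\<dots> = integral {0..1} (\<lambda>t. g' (\<gamma> t) \<bullet> ?n t) + integral {0..1} (\<lambda>t. lam * (g (\<gamma> t) \<bullet> ?n t))"
    by (intro integral_add integrable_continuous_interval continuous_on_mult_left flux_cont [OF gh'] flux_cont [OF gh])
  also have "integral {0..1} (\<lambda>t. lam * (g (\<gamma> t) \<bullet> ?n t)) = lam * integral {0..1} (\<lambda>t. g (\<gamma> t) \<bullet> ?n t)"
    by (rule integral_mult_right)
  finally have F: "F = - \<Gamma> + lam * A" using \<Gamma> A by simp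
  define side where "side R = integral {0..pi} (\<lambda>s. X (vector [R, s]) $ 1 - X (vector [-R, s]) $ 1)" for R
  define p where "p a = - (g (vector [a, pi]) $ 2)" for a
  have X_top: "X (vector [a, pi]) $ 2 = b * pi * p a" and X_bot: "X (vector [a, 0]) $ 2 = 0" for a
    using rho_strip [of "vector [a, pi]"] rho_strip [of "vector [a, 0]"] eta_dest(4) [OF eta, of "vector [a, 0]"]
      eta_dest(5) [OF eta, of "vector [a, pi]"]
    by (auto simp: X_def p_def frontier_strip)
  obtain R0 where R0: "R0 > 0" "\<And>R. R \<ge> R0 \<Longrightarrow> F + integral {-R..R} (\<lambda>a. X (vector [a, pi]) $ 2 - X (vector [a, 0]) $ 2) + side R = 0"
    using divergence_identity [OF gh X_deriv DX_cont DX_trace] unfolding F_def side_def by blast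
  have p_int: "integral {-R..R} p = (- F - side R) / (b * pi)" if "R \<ge> R0" for R
  proof -
    have "integral {-R..R} (\<lambda>a. X (vector [a, pi]) $ 2 - X (vector [a, 0]) $ 2) = b * pi * integral {-R..R} p"
      unfolding X_top X_bot by simp
    then show ?thesis using R0(2) [OF that] b by (simp add: field_simps)
  qed
  have side_lim: "(side \<longlongrightarrow> 0) at_top"
  proof (rule tendstoI)
    fix e :: real assume e: "e > 0"
    (* Far out the gradient of eta is at most b + 1 and eta at most b * pi + 1; d is the size of
       rho and its gradient. *)
    define K where "K = (b + 1) + (b * pi + 1)"
    have K: "K > 0" using b pi_gt_zero by (simp add: K_def add_pos_pos)
    define d where "d = e / (4 * pi * K)"
    have d: "d > 0" using e K by (simp add: d_def)
    obtain R1 where R1: "\<And>a s. R1 \<le> \<bar>a\<bar> \<Longrightarrow> 0 < s \<Longrightarrow> s < pi \<Longrightarrow> vector [a, s] \<in> \<Omega>"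
      "\<And>a s. R1 \<le> \<bar>a\<bar> \<Longrightarrow> 0 \<le> s \<Longrightarrow> s \<le> pi \<Longrightarrow> vector [a, s] \<in> closure \<Omega>"
      by (rule obstacle_columns) (rule that)
    have "eventually (\<lambda>x. \<bar>\<rho> x\<bar> < d \<and> norm (grad \<rho> x) < d \<and> dist (grad \<eta> x) (vector [0, b]) < 1) (far \<Omega>)"
      using rho_far_small [OF d] tendstoD [OF grad_rho_far d] tendstoD [OF eta_dest(6) [OF eta], of 1]
      by (intro eventually_conj) (auto simp: dist_real_def)
    then obtain R2 where R2: "\<forall>x\<in>\<Omega>. R2 \<le> \<bar>x $ 1\<bar> \<longrightarrow> \<bar>\<rho> x\<bar> < d \<and> norm (grad \<rho> x) < d \<and> dist (grad \<eta> x) (vector [0, b]) < 1"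
      unfolding far_columns by (elim exE)
    obtain R3 where R3: "\<forall>a s. R3 \<le> \<bar>a\<bar> \<longrightarrow> 0 \<le> s \<longrightarrow> s \<le> pi \<longrightarrow> \<bar>\<eta> (vector [a, s]) - b * s\<bar> \<le> 1"
      using eta_far [OF eta, of 1] by auto
    have Xb: "\<bar>X (vector [a, s]) $ 1\<bar> \<le> K * d" if a: "max R1 (max R2 R3) \<le> \<bar>a\<bar>" and s: "0 \<le> s" "s \<le> pi" for a s
    proof -
      have open_bound: "\<bar>X (vector [a, s]) $ 1\<bar> \<le> K * d" if s: "0 < s" "s < pi" for s
      proof -
        let ?x = "vector [a, s] :: plane"
        have x: "?x \<in> \<Omega>" using R1(1) a s by auto
        have r: "\<bar>\<rho> ?x\<bar> < d" "norm (g ?x) < d" "dist (g' ?x) (vector [0, b]) < 1"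
          using R2 x a grad_eq [OF gh x] grad_eq [OF gh' x] by auto
        have nb: "norm (vector [0, b] :: plane) = b" using b by (simp add: norm_plane)
        have "norm (g' ?x) \<le> norm (g' ?x - vector [0, b]) + norm (vector [0, b] :: plane)"
          using norm_triangle_ineq [of "g' ?x - vector [0, b]" "vector [0, b]"] by simp
        then have g': "norm (g' ?x) \<le> b + 1" using r(3) nb by (simp add: dist_norm)
        have "\<bar>\<eta> ?x - b * s\<bar> \<le> 1" using R3 a s by auto
        moreover have "0 \<le> b * s" "b * s \<le> b * pi" using b s by auto
        ultimately have e': "\<bar>\<eta> ?x\<bar> \<le> b * pi + 1" by linarith
        have "\<bar>X ?x $ 1\<bar> \<le> norm (X ?x)" by (rule component_le_norm_cart)
        also have "\<dots> \<le> \<bar>\<rho> ?x\<bar> * norm (g' ?x) + \<bar>\<eta> ?x\<bar> * norm (g ?x)"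
          unfolding X_def using norm_triangle_ineq4 [of "\<rho> ?x *\<^sub>R g' ?x" "\<eta> ?x *\<^sub>R g ?x"] by simp
        also have "\<dots> \<le> d * (b + 1) + (b * pi + 1) * d"
          using r g' e' d b by (intro add_mono mult_mono) auto
        also have "\<dots> = K * d" by (simp add: K_def algebra_simps)
        finally show ?thesis .
      qed
      have im: "(\<lambda>s. vector [a, s] :: plane) ` {0..pi} \<subseteq> closure \<Omega>" using R1(2) a by auto
      have "continuous_on {0..pi} (\<lambda>s. \<bar>X (vector [a, s]) $ 1\<bar>)"
        by (intro continuous_intros continuous_on_compose2 [OF X_cont _ im])
      then have "continuous_on (closure {0<..<pi}) (\<lambda>s. \<bar>X (vector [a, s]) $ 1\<bar>)" by simp
      then show ?thesis
        by (rule continuous_le_on_closure) (use s open_bound in auto)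
    qed
    have "dist (side R) 0 < e" if R: "max 1 (max R1 (max R2 R3)) \<le> R" for R
    proof -
      have c: "continuous_on {0..pi} (\<lambda>s. X (vector [a, s]) $ 1)" if "R1 \<le> \<bar>a\<bar>" for a
      proof -
        have im: "(\<lambda>s. vector [a, s] :: plane) ` {0..pi} \<subseteq> closure \<Omega>" using R1(2) that by auto
        show ?thesis by (intro continuous_intros continuous_on_compose2 [OF X_cont _ im])
      qed
      have "norm (side R) \<le> (2 * K * d) * (pi - 0)"
        unfolding side_def
      proof (rule integral_bound)
        show "continuous_on {0..pi} (\<lambda>s. X (vector [R, s]) $ 1 - X (vector [-R, s]) $ 1)"
          using R by (intro continuous_on_diff c) auto
        show "norm (X (vector [R, s]) $ 1 - X (vector [-R, s]) $ 1) \<le> 2 * K * d" if "s \<in> {0..pi}" for s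
          using Xb [of R s] Xb [of "-R" s] that R by (auto simp: abs_if split: if_splits)
      qed simp
      also have "\<dots> = e / 2" using K by (simp add: d_def)
      finally show ?thesis using e by simp
    qed
    then show "eventually (\<lambda>R. dist (side R) 0 < e) at_top"
      unfolding eventually_at_top_linorder by blast
  qed
  have "(\<lambda>n. integral {- real n..real n} p) \<longlonglongrightarrow> (- F - 0) / (b * pi)"
  proof (rule Lim_transform_eventually)
    have "(\<lambda>n. side (real n)) \<longlonglongrightarrow> 0" by (rule filterlim_compose [OF side_lim filterlim_real_sequentially])
    then show "(\<lambda>n. (- F - side (real n)) / (b * pi)) \<longlonglongrightarrow> (- F - 0) / (b * pi)"
      using b by (intro tendsto_intros) auto
    obtain n0 where "R0 \<le> real n0" using real_arch_simple by blast
    then show "eventually (\<lambda>n. (- F - side (real n)) / (b * pi) = integral {- real n..real n} p) sequentially"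
      unfolding eventually_sequentially by (intro exI [of _ n0]) (use p_int in force)
  qed
  moreover have "continuous_on UNIV p"
  proof -
    have "(\<lambda>a. vector [a, pi] :: plane) ` UNIV \<subseteq> closure \<Omega>"
      using wall_closure by (auto simp: frontier_strip)
    then show ?thesis unfolding p_def
      by (intro continuous_intros continuous_on_compose2 [OF gc(1)])
  qed
  moreover have "0 \<le> p t" for t using rho_top_nonpos [OF gh] by (simp add: p_def)
  ultimately have "(LINT t|lborel. p t) = - F / (b * pi)"
    using lebesgue_integral_eq_limit [of p "- F / (b * pi)"] by simp
  moreover have "top_flux O0 \<rho> = pi * (LINT t|lborel. p t)"
  proof -
    have "\<bar>normal_deriv \<Omega> \<rho> (vector [t, pi])\<bar> = p t" for t
      unfolding normal_deriv_top [OF gh] p_def using rho_top_nonpos [OF gh, of t] by simp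
    then show ?thesis by (simp add: top_flux_def top_integral_def)
  qed
  ultimately have "b * top_flux O0 \<rho> = - F" using b by simp
  then show "\<Gamma> = lam * boundary_integral O0 (\<lambda>x. \<bar>normal_deriv \<Omega> \<rho> x\<bar>) + b * top_flux O0 \<rho>"
    using F by (simp add: A_def)
qed

end

section \<open>Two-sided bounds for \<open>\<eta>\<close>\<close>

lemma nonzero_mult_divide_cancel: "(k::real) \<noteq> 0 \<Longrightarrow> k * (a / k) = a"
  by simp

lemma both_near_imp_le: "\<bar>p - y\<bar> \<le> e / 2 \<Longrightarrow> \<bar>q - y\<bar> \<le> e / 2 \<Longrightarrow> p \<le> q + (e::real)"
  by linarith

context flow
begin

text \<open>
  The maximum principle for a difference, in the form used for all barriers below.
\<close>

lemma comparison:
  assumes u: "harmonic_on \<Omega> u" "continuous_on (closure \<Omega>) u" and v: "harmonic_on \<Omega> v" "continuous_on (closure \<Omega>) v"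
    and bd: "\<And>y. y \<in> frontier \<Omega> \<Longrightarrow> u y \<le> v y"
    and far: "\<And>e. e > 0 \<Longrightarrow> eventually (\<lambda>y. u y \<le> v y + e) (far \<Omega>)"
    and x: "x \<in> closure \<Omega>"
  shows "u x \<le> v x"
proof -
  have "u x - v x \<le> 0"
  proof (rule maximum_principle_closure [OF open_fluid_domain _ _ _ _ x])
    show "harmonic_on \<Omega> (\<lambda>x. u x - v x)" by (intro harmonic_on_diff u v)
    show "continuous_on (closure \<Omega>) (\<lambda>x. u x - v x)" by (intro continuous_intros u v)
    show "u y - v y \<le> 0" if "y \<in> frontier \<Omega>" for y using bd [OF that] by simp
    show "eventually (\<lambda>x. u x - v x \<le> e) (far \<Omega>)" if "e > 0" for e
      using far [OF that] by eventually_elim simp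
  qed
  then show ?thesis by simp
qed

lemma frontier_Omega_cases:
  assumes "y \<in> frontier \<Omega>"
  obtains "y \<in> J" | "y $ 2 = 0" "y \<in> frontier strip" | "y $ 2 = pi" "y \<in> frontier strip"
  using assms unfolding frontier_Omega frontier_strip by blast

lemma eventually_in_Omega: "eventually (\<lambda>y. y \<in> \<Omega>) (far \<Omega>)" unfolding eventually_far by auto

lemma eta_far_eventually:
  assumes eta: "is_eta O0 b \<Gamma> \<eta> lam" and e: "e > 0"
  shows "eventually (\<lambda>x. \<bar>\<eta> x - b * x $ 2\<bar> \<le> e) (far \<Omega>)"
proof -
  obtain R where R: "\<forall>a h. R \<le> \<bar>a\<bar> \<longrightarrow> 0 \<le> h \<longrightarrow> h \<le> pi \<longrightarrow> \<bar>\<eta> (vector [a, h]) - b * h\<bar> \<le> e"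
    using eta_far [OF eta e] by (elim exE)
  have "\<forall>x\<in>\<Omega>. R \<le> \<bar>x $ 1\<bar> \<longrightarrow> \<bar>\<eta> x - b * x $ 2\<bar> \<le> e"
  proof (intro ballI impI)
    fix x assume x: "x \<in> \<Omega>" "R \<le> \<bar>x $ 1\<bar>"
    have "0 \<le> x $ 2" "x $ 2 \<le> pi" using Omega_not_J(3) [OF x(1)] by (auto simp: strip_def)
    then show "\<bar>\<eta> x - b * x $ 2\<bar> \<le> e" using R [rule_format, OF x(2), of "x $ 2"] by simp
  qed
  then show ?thesis unfolding far_columns by (rule exI)
qed

lemma second_coordinate_cont: "continuous_on S (\<lambda>x::plane. x $ 2)"
  by (intro continuous_intros)

lemma eta_lower:
  assumes eta: "is_eta O0 b \<Gamma> \<eta> lam" and b: "b > 0" and lam: "lam \<ge> 0" and x: "x \<in> closure \<Omega>"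
  shows "- lam \<le> \<eta> x"
proof (rule comparison [OF harmonic_on_const continuous_on_const eta_dest(2) [OF eta] eta_dest(8) [OF eta] _ _ x])
  show "- lam \<le> \<eta> y" if "y \<in> frontier \<Omega>" for y
    using that
  proof (cases rule: frontier_Omega_cases)
    case 1 then show ?thesis using eta_dest(3) [OF eta 1] by simp
  next
    case 2 then show ?thesis using eta_dest(4) [OF eta 2(1)] lam by simp
  next
    case 3 
    then have "0 < \<eta> y" using eta_dest(5) [OF eta 3(1)] b by simp
    then show ?thesis using lam by simp
  qed
  show "eventually (\<lambda>y. - lam \<le> \<eta> y + e) (far \<Omega>)" if "e > 0" for e
  proof -
    from eta_far_eventually [OF eta that] eventually_in_Omega show ?thesis
    proof eventually_elim
      case (elim y)
      then have "0 \<le> b * y $ 2" using Omega_not_J(3) [of y] b by (auto simp: strip_def)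
      then show ?case using elim lam by linarith
    qed
  qed
qed

text \<open>
  The right-hand side is \<open>0\<close> on the obstacle and \<open>lam + \<pi> b\<close> on the walls.
\<close>

lemma eta_plus_lam_upper:
  assumes eta: "is_eta O0 b \<Gamma> \<eta> lam" and b: "b > 0" and lam: "lam \<ge> 0" and x: "x \<in> closure \<Omega>"
  shows "\<eta> x + lam \<le> (lam + pi * b) * (1 - \<rho> x)"
proof (rule comparison [OF _ _ _ _ _ _ x])
  show "harmonic_on \<Omega> (\<lambda>x. \<eta> x + lam)" by (intro harmonic_on_add harmonic_on_const eta_dest(2) [OF eta])
  show "continuous_on (closure \<Omega>) (\<lambda>x. \<eta> x + lam)" by (intro continuous_intros eta_dest(8) [OF eta])
  show "harmonic_on \<Omega> (\<lambda>x. (lam + pi * b) * (1 - \<rho> x))"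
    by (intro harmonic_on_cmult harmonic_on_diff harmonic_on_const rho_harmonic)
  show "continuous_on (closure \<Omega>) (\<lambda>x. (lam + pi * b) * (1 - \<rho> x))" by (intro continuous_intros rho_cont)
  show "\<eta> y + lam \<le> (lam + pi * b) * (1 - \<rho> y)" if "y \<in> frontier \<Omega>" for y
    using that
  proof (cases rule: frontier_Omega_cases)
    case 1 then show ?thesis using eta_dest(3) [OF eta 1] rho_J by simp
  next
    case 2 then show ?thesis using eta_dest(4) [OF eta 2(1)] rho_strip [OF 2(2)] b pi_gt_zero by simp
  next
    case 3 then show ?thesis using eta_dest(5) [OF eta 3(1)] rho_strip [OF 3(2)] by simp
  qed
  show "eventually (\<lambda>y. \<eta> y + lam \<le> (lam + pi * b) * (1 - \<rho> y) + e) (far \<Omega>)" if e: "e > 0" for e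
  proof -
    define d where "d = (e / 2) / (lam + pi * b)"
    have pos: "lam + pi * b > 0" using lam b pi_gt_zero by (simp add: add_nonneg_pos)
    have d: "d > 0" using e pos by (simp add: d_def)
    have "e / 2 > 0" using e by simp
    from eta_far_eventually [OF eta this] rho_far_small [OF d] eventually_in_Omega show ?thesis
    proof eventually_elim
      case (elim y)
      have "b * y $ 2 \<le> pi * b" using Omega_not_J(3) [OF elim(3)] b by (auto simp: strip_def mult.commute)
      moreover have "(lam + pi * b) * \<rho> y \<le> (lam + pi * b) * d" using elim(2) pos by (intro mult_left_mono) auto
      moreover have "(lam + pi * b) * d = e / 2"
        unfolding d_def by (rule nonzero_mult_divide_cancel) (use pos in simp)
      moreover have "(lam + pi * b) * (1 - \<rho> y) = lam + pi * b - (lam + pi * b) * \<rho> y"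
        by (simp add: algebra_simps)
      ultimately show ?case using abs_le_D1 [OF elim(1)] by linarith
    qed
  qed
qed

lemma eta_plus_lam_rho_far:
  assumes eta: "is_eta O0 b \<Gamma> \<eta> lam" and e: "e > 0"
  shows "eventually (\<lambda>y. \<bar>\<eta> y + lam * \<rho> y - b * y $ 2\<bar> \<le> e) (far \<Omega>)"
proof -
  define d where "d = (e / 2) / (\<bar>lam\<bar> + 1)"
  have d: "d > 0" using e by (simp add: d_def add_nonneg_pos)
  have "e / 2 > 0" using e by simp
  from eta_far_eventually [OF eta this] rho_far_small [OF d] show ?thesis
  proof eventually_elim
    case (elim y)
    have "\<bar>lam * \<rho> y\<bar> \<le> (\<bar>lam\<bar> + 1) * d" using elim(2) by (simp add: abs_mult mult_mono less_imp_le)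
    also have "\<dots> = e / 2"
    proof -
      have "\<bar>lam\<bar> + 1 \<noteq> 0" by linarith
      then show ?thesis unfolding d_def by (rule nonzero_mult_divide_cancel)
    qed
    finally show ?case using elim(1) by linarith
  qed
qed

text \<open>
  The function \<open>\<eta> + lam \<rho>\<close> vanishes on the obstacle and on the lower wall and is \<open>\<pi> b\<close> on the
  upper wall. Divided by \<open>b\<close> it solves a problem without parameters, so it is the same function for
  all data; one inequality suffices here by symmetry.
\<close>

lemma eta_normalized_le:
  assumes eta: "is_eta O0 b \<Gamma> \<eta> lam" and eta': "is_eta O0 b' \<Gamma>' \<eta>' lam'" and b: "b > 0" "b' > 0" and x: "x \<in> closure \<Omega>"
  shows "(\<eta> x + lam * \<rho> x) / b \<le> (\<eta>' x + lam' * \<rho> x) / b'"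
proof -
  have harm: "harmonic_on \<Omega> (\<lambda>x. (1 / c) * (f x + m * \<rho> x))" and cont: "continuous_on (closure \<Omega>) (\<lambda>x. (1 / c) * (f x + m * \<rho> x))"
    if "is_eta O0 c G f m" for c G f m
    using that by (intro harmonic_on_cmult harmonic_on_add eta_dest(2) rho_harmonic continuous_intros eta_dest(8) rho_cont; assumption)+
  have "(1 / b) * (\<eta> x + lam * \<rho> x) \<le> (1 / b') * (\<eta>' x + lam' * \<rho> x)"
  proof (rule comparison [OF harm [OF eta] cont [OF eta] harm [OF eta'] cont [OF eta'] _ _ x])
    show "(1 / b) * (\<eta> y + lam * \<rho> y) \<le> (1 / b') * (\<eta>' y + lam' * \<rho> y)" if "y \<in> frontier \<Omega>" for y
      using that
    proof (cases rule: frontier_Omega_cases)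
      case 1 then show ?thesis using eta_dest(3) [OF eta 1] eta_dest(3) [OF eta' 1] rho_J by simp
    next
      case 2 then show ?thesis using eta_dest(4) [OF eta 2(1)] eta_dest(4) [OF eta' 2(1)] rho_strip [OF 2(2)] by simp
    next
      case 3 then show ?thesis using eta_dest(5) [OF eta 3(1)] eta_dest(5) [OF eta' 3(1)] rho_strip [OF 3(2)] b by simp
    qed
    have key: "eventually (\<lambda>y. \<bar>(1 / c) * (f y + m * \<rho> y) - y $ 2\<bar> \<le> e / 2) (far \<Omega>)"
      if f: "is_eta O0 c G f m" and c: "c > 0" and e: "e > 0" for c G f m e
    proof -
      have "c * e / 2 > 0" using c e by simp
      from eta_plus_lam_rho_far [OF f this] show ?thesis
      proof eventually_elim
        case y: (elim y)
        have "(1 / c) * (f y + m * \<rho> y) - y $ 2 = ((f y + m * \<rho> y) - c * y $ 2) / c" using c by (simp add: field_simps)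
        then show ?case using y c by (simp add: divide_le_eq mult.commute)
      qed
    qed
    show "eventually (\<lambda>y. (1 / b) * (\<eta> y + lam * \<rho> y) \<le> (1 / b') * (\<eta>' y + lam' * \<rho> y) + e) (far \<Omega>)" if e: "e > 0" for e
      using key [OF eta b(1) e] key [OF eta' b(2) e] by eventually_elim (rule both_near_imp_le)
  qed
  then show ?thesis by simp
qed

lemma eta_plus_lam_rho_pos:
  assumes eta: "is_eta O0 b \<Gamma> \<eta> lam" and b: "b > 0" and x: "x \<in> \<Omega>"
  shows "0 < \<eta> x + lam * \<rho> x"
proof -
  let ?a = "\<lambda>x. \<eta> x + lam * \<rho> x"
  have harm: "harmonic_on \<Omega> ?a" by (intro harmonic_on_add harmonic_on_cmult rho_harmonic eta_dest(2) [OF eta])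
  have cont: "continuous_on (closure \<Omega>) ?a" by (intro continuous_intros rho_cont eta_dest(8) [OF eta])
  note ev = eta_plus_lam_rho_far [OF eta]
  have nonneg: "0 \<le> ?a x" if "x \<in> closure \<Omega>" for x
  proof (rule comparison [OF harmonic_on_const continuous_on_const harm cont _ _ that])
    show "0 \<le> ?a y" if "y \<in> frontier \<Omega>" for y
      using that
    proof (cases rule: frontier_Omega_cases)
      case 1 then show ?thesis using eta_dest(3) [OF eta 1] rho_J by simp
    next
      case 2 then show ?thesis using eta_dest(4) [OF eta 2(1)] rho_strip [OF 2(2)] by simp
    next
      case 3 then show ?thesis using eta_dest(5) [OF eta 3(1)] rho_strip [OF 3(2)] b by simp
    qed
    show "eventually (\<lambda>y. 0 \<le> ?a y + e) (far \<Omega>)" if "e > 0" for e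
      using ev [OF that] eventually_in_Omega
    proof eventually_elim
      case (elim y)
      then have "0 \<le> b * y $ 2" using Omega_not_J(3) [of y] b by (auto simp: strip_def)
      then show ?case using elim(1) by linarith
    qed
  qed
  have "b / 2 > 0" using b by simp
  from ev [OF this] obtain B where B: "\<And>y. y \<in> \<Omega> \<Longrightarrow> B \<le> norm y \<Longrightarrow> \<bar>?a y - b * y $ 2\<bar> \<le> b / 2"
    unfolding eventually_far by blast
  obtain R where R: "\<forall>a\<ge>R. vector [a, 1] \<in> \<Omega> \<and> B \<le> norm (vector [a, 1] :: plane)"
    using far_point [of 1 B] pi_gt3 by auto
  have RB: "B \<le> norm (vector [R, 1] :: plane)" and x0: "vector [R, 1] \<in> \<Omega>"
    using R [rule_format, of R] by simp_all
  have "\<bar>?a (vector [R, 1]) - b * (vector [R, 1] :: plane) $ 2\<bar> \<le> b / 2" by (rule B [OF x0 RB])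
  from abs_le_D2 [OF this] have x1: "0 < ?a (vector [R, 1])" using b by simp
  show ?thesis
    by (rule harmonic_nonneg_imp_pos [OF open_fluid_domain obstacle_exterior(1) [OF obs] harm _ x0 x1 x])
       (use nonneg closure_subset in blast)
qed

text \<open>
  Decompose \<open>\<eta> + lam = (\<eta> + lam \<rho>) + lam (1 - \<rho>)\<close>. The first term is \<open>b\<close> times a positive
  harmonic function independent of the data, so Hopf's lemma bounds both terms from below by uniform
  multiples of \<open>b d\<close> and \<open>lam d\<close>, respectively. The upper bound follows from that for \<open>1 - \<rho>\<close>.
\<close>

theorem eta_layer_bounds:
  obtains c C where "c > 0" "C > 0"
    "\<And>b \<Gamma> \<eta> lam x. is_eta O0 b \<Gamma> \<eta> lam \<Longrightarrow> 0 < b \<Longrightarrow> 0 \<le> lam \<Longrightarrow> x \<in> \<Omega> \<Longrightarrow>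
       \<eta> x + lam \<le> C * (b + lam) * infdist x J"
    "\<And>b \<Gamma> \<eta> lam x. is_eta O0 b \<Gamma> \<eta> lam \<Longrightarrow> 0 < b \<Longrightarrow> 0 \<le> lam \<Longrightarrow> x \<in> \<Omega> \<Longrightarrow> infdist x J \<le> r0 / 4 \<Longrightarrow>
       c * (b + lam) * infdist x J \<le> \<eta> x + lam"
proof -
  obtain C1 where C1: "C1 > 0" "\<And>x. x \<in> \<Omega> \<Longrightarrow> 1 - \<rho> x \<le> C1 * infdist x J"
    using one_minus_rho_upper by blast
  obtain c1 where c1: "c1 > 0" "\<And>x. x \<in> \<Omega> \<Longrightarrow> infdist x J \<le> r0 / 4 \<Longrightarrow> c1 * infdist x J \<le> 1 - \<rho> x"
  proof (rule hopf_lower_bound [of "\<lambda>x. 1 - \<rho> x"])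
    show "harmonic_on \<Omega> (\<lambda>x. 1 - \<rho> x)" by (intro harmonic_on_diff rho_harmonic harmonic_on_const)
    show "continuous_on (closure \<Omega>) (\<lambda>x. 1 - \<rho> x)" by (intro continuous_intros rho_cont)
  qed (use rho_less_1 in auto)
  have up: "\<eta> x + lam \<le> (pi * C1) * (b + lam) * infdist x J"
    if eta: "is_eta O0 b \<Gamma> \<eta> lam" and b: "0 < b" and lam: "0 \<le> lam" and x: "x \<in> \<Omega>" for b \<Gamma> \<eta> lam x
  proof -
    have xc: "x \<in> closure \<Omega>" using x closure_subset by blast
    have "\<eta> x + lam \<le> (lam + pi * b) * (1 - \<rho> x)" by (rule eta_plus_lam_upper [OF eta b lam xc])
    also have "\<dots> \<le> (pi * (b + lam)) * (C1 * infdist x J)"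
    proof (intro mult_mono C1(2) x)
      have "lam * 1 \<le> lam * pi" using lam pi_gt3 by (intro mult_left_mono) auto
      then show "lam + pi * b \<le> pi * (b + lam)" by (simp add: algebra_simps)
    qed (use b lam rho_le_1 [OF xc] in auto)
    finally show ?thesis by (simp add: mult_ac)
  qed
  show thesis
  (* The parameter free function is available only through some solution with b > 0; if there
     is none, any constant serves. *)
  proof (cases "\<exists>b \<Gamma> \<eta> lam. is_eta O0 b \<Gamma> \<eta> lam \<and> 0 < b")
    case False
    show thesis
    proof (rule that [of 1 "pi * C1"])
      show "0 < pi * C1" "(0::real) < 1" using C1 by simp_all
      fix b \<Gamma> \<eta> lam x
      assume "is_eta O0 b \<Gamma> \<eta> lam" "0 < b"
      then have "False" using False by blast
      then show "1 * (b + lam) * infdist x J \<le> \<eta> x + lam" ..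
    qed (rule up)
  next
    case True
    then obtain b1 \<Gamma>1 \<eta>1 lam1 where eta1: "is_eta O0 b1 \<Gamma>1 \<eta>1 lam1" and b1: "0 < b1" by blast
    obtain c2 where c2: "c2 > 0" "\<And>x. x \<in> \<Omega> \<Longrightarrow> infdist x J \<le> r0 / 4 \<Longrightarrow> c2 * infdist x J \<le> \<eta>1 x + lam1 * \<rho> x"
    proof (rule hopf_lower_bound [of "\<lambda>x. \<eta>1 x + lam1 * \<rho> x"])
      show "harmonic_on \<Omega> (\<lambda>x. \<eta>1 x + lam1 * \<rho> x)"
        by (intro harmonic_on_add harmonic_on_cmult rho_harmonic eta_dest(2) [OF eta1])
      show "continuous_on (closure \<Omega>) (\<lambda>x. \<eta>1 x + lam1 * \<rho> x)"
        by (intro continuous_intros rho_cont eta_dest(8) [OF eta1])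
    qed (use eta_plus_lam_rho_pos [OF eta1 b1] in auto)
    define c where "c = min c1 (c2 / b1)"
    have c: "c > 0" "c \<le> c1" "c \<le> c2 / b1" using c1 c2 b1 by (auto simp: c_def)
    show thesis
    proof (rule that [of c "pi * C1"])
      show "0 < pi * C1" using C1 by simp
      fix b \<Gamma> \<eta> lam x
      assume eta: "is_eta O0 b \<Gamma> \<eta> lam" and b: "0 < b" and lam: "0 \<le> lam" and x: "x \<in> \<Omega>" "infdist x J \<le> r0 / 4"
      have xc: "x \<in> closure \<Omega>" using x closure_subset by blast
      let ?d = "infdist x J"
      have d: "?d \<ge> 0" by (rule infdist_nonneg)
      have "(\<eta>1 x + lam1 * \<rho> x) / b1 \<le> (\<eta> x + lam * \<rho> x) / b"
        by (rule eta_normalized_le [OF eta1 eta b1 b xc])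
      then have "b * ((\<eta>1 x + lam1 * \<rho> x) / b1) \<le> \<eta> x + lam * \<rho> x"
        using b by (simp add: le_divide_eq mult.commute)
      moreover have "b * (c * ?d) \<le> b * ((\<eta>1 x + lam1 * \<rho> x) / b1)"
      proof (rule mult_left_mono)
        have "c * ?d \<le> c2 / b1 * ?d" using c d by (intro mult_right_mono) auto
        also have "\<dots> \<le> (\<eta>1 x + lam1 * \<rho> x) / b1" using c2(2) [OF x] b1 by (simp add: divide_right_mono)
        finally show "c * ?d \<le> (\<eta>1 x + lam1 * \<rho> x) / b1" .
      qed (use b in simp)
      moreover have "lam * (c * ?d) \<le> lam * (1 - \<rho> x)"
      proof (rule mult_left_mono [OF _ lam])
        have "c * ?d \<le> c1 * ?d" using c d by (intro mult_right_mono) auto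
        also have "\<dots> \<le> 1 - \<rho> x" by (rule c1(2) [OF x])
        finally show "c * ?d \<le> 1 - \<rho> x" .
      qed
      ultimately show "c * (b + lam) * ?d \<le> \<eta> x + lam" by (simp add: algebra_simps)
    qed (use c up in auto)
  qed
qed

end

section \<open>The Robin function\<close>

lemma abs_ln_diff_le:
  fixes a b r :: real
  assumes "0 < r" "r \<le> a" "r \<le> b"
  shows "\<bar>ln a - ln b\<bar> \<le> \<bar>a - b\<bar> / r"
proof -
  have *: "ln a - ln b \<le> \<bar>a - b\<bar> / r" if "r \<le> a" "r \<le> b" for a b
  proof -
    have ab: "a > 0" "b > 0" using that assms(1) by auto
    have "ln a - ln b = ln (a / b)" using ab by (simp add: ln_div)
    also have "\<dots> \<le> a / b - 1" using ab by (intro ln_le_minus_one) auto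
    also have "\<dots> = (a - b) / b" using ab by (simp add: field_simps)
    also have "\<dots> \<le> \<bar>a - b\<bar> / r" using that assms(1) by (intro frac_le) auto
    finally show ?thesis .
  qed
  show ?thesis using * [of a b] * [of b a] assms by (auto simp: abs_le_iff abs_minus_commute)
qed

locale flow_green = flow +
  fixes G0 :: "plane \<Rightarrow> plane \<Rightarrow> real"
  assumes green: "is_green (fluid_domain O0) G0"
begin

definition robin :: "plane \<Rightarrow> real" where
  "robin x = Lim (at x) (\<lambda>z. 1 / (2 * pi) * ln (1 / dist z x) - G0 z x)"

lemma green_dest:
  assumes "x \<in> \<Omega>"
  shows "continuous_on (closure \<Omega> - {x}) (\<lambda>y. G0 y x)" "y \<in> frontier \<Omega> \<Longrightarrow> G0 y x = 0"
    "((\<lambda>y. G0 y x) \<longlongrightarrow> 0) (far \<Omega>)"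
    "\<exists>w. harmonic_on \<Omega> w \<and> (\<forall>y\<in>\<Omega> - {x}. G0 y x = 1 / (2 * pi) * ln (1 / dist y x) - w y)"
  using green assms unfolding is_green_def by auto

lemma green_far_small: "x \<in> \<Omega> \<Longrightarrow> e > 0 \<Longrightarrow> eventually (\<lambda>y. \<bar>G0 y x\<bar> < e) (far \<Omega>)"
  using tendstoD [OF green_dest(3)] by (simp add: dist_real_def)

text \<open>
  The regular part with pole \<open>x\<close> is harmonic inside by definition of the Green function and continuous
  up to the boundary by its formula; it takes the value \<open>robin x\<close> at the pole.
\<close>

lemma regular_part_extension:
  assumes x: "x \<in> \<Omega>"
  obtains W where "harmonic_on \<Omega> W" "continuous_on (closure \<Omega>) W"
    "\<And>y. y \<in> closure \<Omega> \<Longrightarrow> y \<noteq> x \<Longrightarrow> W y = 1 / (2 * pi) * ln (1 / dist y x) - G0 y x"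
    "robin x = W x" "((\<lambda>z. 1 / (2 * pi) * ln (1 / dist z x) - G0 z x) \<longlongrightarrow> robin x) (at x)"
proof -
  obtain w where w: "harmonic_on \<Omega> w" "\<And>y. y \<in> \<Omega> \<Longrightarrow> y \<noteq> x \<Longrightarrow> G0 y x = 1 / (2 * pi) * ln (1 / dist y x) - w y"
    using green_dest(4) [OF x] by blast
  define L where "L y = 1 / (2 * pi) * ln (1 / dist y x) - G0 y x" for y
  define W where "W y = (if y \<in> \<Omega> then w y else L y)" for y
  have WL: "W y = L y" if "y \<noteq> x" for y using w(2) [of y] that by (auto simp: W_def L_def)
  have harm: "harmonic_on \<Omega> W" by (rule harmonic_on_cong [OF w(1)]) (simp add: W_def)
  have contO: "continuous_on \<Omega> W" by (rule harmonic_on_imp_continuous_on [OF harm])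
  have contx: "isCont W x" using contO x open_fluid_domain continuous_on_eq_continuous_at by blast
  have "continuous_on (closure \<Omega> - {x}) L" unfolding L_def
    by (intro continuous_intros green_dest(1) [OF x]) auto
  then have contL: "continuous_on (closure \<Omega> - {x}) W"
    by (rule continuous_on_eq) (simp add: WL)
  have cont: "continuous_on (closure \<Omega>) W"
    unfolding continuous_on_eq_continuous_within
  proof
    fix y assume y: "y \<in> closure \<Omega>"
    show "continuous (at y within closure \<Omega>) W"
    proof (cases "y = x")
      case True then show ?thesis using contx continuous_at_imp_continuous_at_within by blast
    next
      case False
      then have "continuous (at y within closure \<Omega> - {x}) W"
        using contL y by (simp add: continuous_on_eq_continuous_within)
      moreover have "at y within closure \<Omega> - {x} = at y within closure \<Omega>"
        by (rule at_within_nhd [of y "- {x}"]) (use False in auto)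
      ultimately show ?thesis by simp
    qed
  qed
  have lim: "(L \<longlongrightarrow> W x) (at x)"
  proof (rule Lim_transform_eventually)
    show "(W \<longlongrightarrow> W x) (at x)" using contx by (simp add: isCont_def)
    show "eventually (\<lambda>y. W y = L y) (at x)"
      unfolding eventually_at_filter by (intro always_eventually) (simp add: WL)
  qed
  then have rW: "robin x = W x" unfolding robin_def L_def [symmetric] by (intro tendsto_Lim) auto
  show thesis
  proof (rule that [OF harm cont _ rW])
    show "W y = 1 / (2 * pi) * ln (1 / dist y x) - G0 y x" if "y \<noteq> x" for y
      using WL [OF that] by (simp add: L_def)
    show "((\<lambda>z. 1 / (2 * pi) * ln (1 / dist z x) - G0 z x) \<longlongrightarrow> robin x) (at x)"
      using lim unfolding rW L_def [abs_def] .
  qed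
qed

lemma regular_part_green:
  assumes x: "x \<in> \<Omega>"
  shows "regular_part (green O0 \<rho> G0) x x = robin x - lambda0 O0 \<rho> * (\<rho> x)\<^sup>2"
proof -
  obtain W where lim: "((\<lambda>z. 1 / (2 * pi) * ln (1 / dist z x) - G0 z x) \<longlongrightarrow> robin x) (at x)"
    using regular_part_extension [OF x] by blast
  have "isCont \<rho> x"
    using harmonic_on_imp_continuous_on [OF rho_harmonic] x open_fluid_domain continuous_on_eq_continuous_at by blast
  then have "((\<lambda>z. 1 / (2 * pi) * ln (1 / dist z x) - G0 z x - lambda0 O0 \<rho> * \<rho> x * \<rho> z) \<longlongrightarrow>
      robin x - lambda0 O0 \<rho> * \<rho> x * \<rho> x) (at x)"
    using lim by (intro tendsto_intros) (auto simp: isCont_def)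
  then have "((\<lambda>z. 1 / (2 * pi) * ln (1 / dist z x) - green O0 \<rho> G0 z x) \<longlongrightarrow>
      robin x - lambda0 O0 \<rho> * \<rho> x * \<rho> x) (at x)"
    by (simp add: green_def algebra_simps)
  then show ?thesis unfolding regular_part_def
    by (simp add: tendsto_Lim power2_eq_square mult.assoc)
qed

lemma frontier_neq: "x \<in> \<Omega> \<Longrightarrow> y \<in> frontier \<Omega> \<Longrightarrow> y \<noteq> x"
  using open_fluid_domain [of O0] by (auto simp: frontier_def interior_open)

lemma frontier_sub_closure: "y \<in> frontier \<Omega> \<Longrightarrow> y \<in> closure \<Omega>"
  by (auto simp: frontier_def)

lemma eventually_neq_far: "eventually (\<lambda>y. y \<noteq> x) (far \<Omega>)"
  unfolding eventually_far by (rule exI [of _ "norm x + 1"]) auto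

text \<open>
  On the boundary the regular part is the logarithmic potential of the pole, which is largest
  where the boundary is closest.
\<close>

lemma robin_upper:
  assumes x: "x \<in> \<Omega>" and r: "r > 0" and d: "\<And>y. y \<in> frontier \<Omega> \<Longrightarrow> r \<le> dist y x"
  shows "robin x \<le> - (1 / (2 * pi)) * ln r"
proof -
  obtain W where W: "harmonic_on \<Omega> W" "continuous_on (closure \<Omega>) W"
    "\<And>y. y \<in> closure \<Omega> \<Longrightarrow> y \<noteq> x \<Longrightarrow> W y = 1 / (2 * pi) * ln (1 / dist y x) - G0 y x" "robin x = W x"
    by (rule regular_part_extension [OF x]) (rule that)
  have L: "1 / (2 * pi) * ln (1 / dist y x) \<le> - (1 / (2 * pi)) * ln r" if "r \<le> dist y x" for y
  proof -
    have d: "dist y x > 0" using that r by linarith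
    have "ln r \<le> ln (dist y x)" by (subst ln_le_cancel_iff) (use that r d in auto)
    with d show ?thesis by (simp add: ln_div divide_right_mono)
  qed
  have "W x \<le> - (1 / (2 * pi)) * ln r"
  proof (rule comparison [OF W(1,2) harmonic_on_const continuous_on_const])
    show "W y \<le> - (1 / (2 * pi)) * ln r" if y: "y \<in> frontier \<Omega>" for y
      using W(3) [OF frontier_sub_closure [OF y] frontier_neq [OF x y]] green_dest(2) [OF x y] L [OF d [OF y]] by simp
    show "eventually (\<lambda>y. W y \<le> - (1 / (2 * pi)) * ln r + e) (far \<Omega>)" if e: "e > 0" for e
    proof -
      have "eventually (\<lambda>y. r \<le> dist y x) (far \<Omega>)"
        unfolding eventually_far
      proof (intro exI [of _ "norm x + r"] ballI impI)
        fix y :: plane assume "norm x + r \<le> norm y"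
        then show "r \<le> dist y x" using norm_triangle_ineq2 [of y x] by (simp add: dist_norm)
      qed
      with green_far_small [OF x e] eventually_in_Omega eventually_neq_far [of x] show ?thesis
      proof eventually_elim
        case (elim y)
        have "y \<in> closure \<Omega>" using elim closure_subset by blast
        then show ?case using W(3) [of y] L [OF elim(4)] elim(1,3) by linarith
      qed
    qed
    show "x \<in> closure \<Omega>" using x closure_subset by blast
  qed
  then show ?thesis using W(4) by simp
qed

text \<open>
  Compare with a logarithm whose pole \<open>c\<close> lies outside the fluid domain. The constant \<open>K\<close> measures how
  well \<open>c\<close> replaces \<open>x\<close> when seen from the boundary.
\<close>

lemma robin_lower:
  assumes x: "x \<in> \<Omega>" and c: "c \<notin> closure \<Omega>" and K: "K > 0"
    and d: "\<And>y. y \<in> closure \<Omega> \<Longrightarrow> dist y x \<le> K * dist y c"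
  shows "- (1 / (2 * pi)) * ln (K * dist x c) \<le> robin x"
proof -
  obtain W where W: "harmonic_on \<Omega> W" "continuous_on (closure \<Omega>) W"
    "\<And>y. y \<in> closure \<Omega> \<Longrightarrow> y \<noteq> x \<Longrightarrow> W y = 1 / (2 * pi) * ln (1 / dist y x) - G0 y x" "robin x = W x"
    by (rule regular_part_extension [OF x]) (rule that)
  define v where "v y = - (1 / (2 * pi)) * (ln K + ln (norm (y - c)))" for y
  have xc: "x \<in> closure \<Omega>" using x closure_subset by blast
  have veq: "v y = - (1 / (2 * pi)) * ln (K * dist y c)" if "y \<in> closure \<Omega>" for y
  proof -
    have "dist y c > 0" using that c by auto
    then show ?thesis using K by (simp add: v_def ln_mult dist_norm)
  qed
  have vL: "v y \<le> 1 / (2 * pi) * ln (1 / dist y x)" if y: "y \<in> closure \<Omega>" "y \<noteq> x" for y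
  proof -
    have "dist y x > 0" using y by simp
    moreover have "dist y x \<le> K * dist y c" by (rule d [OF y(1)])
    ultimately have "ln (dist y x) \<le> ln (K * dist y c)" by (subst ln_le_cancel_iff) linarith+
    then show ?thesis using \<open>dist y x > 0\<close> by (simp add: veq [OF y(1)] ln_div divide_right_mono)
  qed
  have "v x \<le> W x"
  proof (rule comparison [OF _ _ W(1,2) _ _ xc])
    have "c \<notin> \<Omega>" using c closure_subset by blast
    then show "harmonic_on \<Omega> v" unfolding v_def
      by (intro harmonic_on_cmult harmonic_on_add harmonic_on_const harmonic_on_ln_norm)
    have "norm (y - c) \<noteq> 0" if "y \<in> closure \<Omega>" for y using c that by auto
    then show "continuous_on (closure \<Omega>) v" unfolding v_def by (intro continuous_intros) auto
    show "v y \<le> W y" if y: "y \<in> frontier \<Omega>" for y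
      using W(3) [OF frontier_sub_closure [OF y] frontier_neq [OF x y]] green_dest(2) [OF x y]
        vL [OF frontier_sub_closure [OF y] frontier_neq [OF x y]] by simp
    show "eventually (\<lambda>y. v y \<le> W y + e) (far \<Omega>)" if e: "e > 0" for e
      using green_far_small [OF x e] eventually_in_Omega eventually_neq_far [of x]
    proof eventually_elim
      case (elim y)
      have "y \<in> closure \<Omega>" using elim closure_subset by blast
      then show ?case using W(3) [of y] vL [of y] elim(1,3) by linarith
    qed
  qed
  then show ?thesis using W(4) veq [OF xc] by simp
qed

text \<open>
  Take for \<open>c\<close> the mirror image of \<open>x\<close> in the boundary. It is at distance \<open>2 d\<close> from \<open>x\<close> and, by the
  interior tangent ball, at distance at least \<open>d\<close> from the fluid domain, so \<open>K = 3\<close> works by the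
  triangle inequality. This explains the factor \<open>6\<close>.
\<close>

lemma robin_lower_J:
  assumes x: "x \<in> \<Omega>" and d: "infdist x J \<le> r0"
  shows "- (1 / (2 * pi)) * ln (6 * infdist x J) \<le> robin x"
proof -
  let ?d = "infdist x J"
  have d0: "?d > 0" using infdist_pos Omega_not_J x by auto
  obtain t where t: "x = \<gamma> t - ?d *\<^sub>R N t" using nearest_point [OF x] by blast
  define c where "c = \<gamma> t + ?d *\<^sub>R N t"
  have bO: "ball c ?d \<subseteq> O0" unfolding c_def by (rule inner_ball_le [OF d0 d])
  have "x - c = (- 2 * ?d) *\<^sub>R N t"
  proof -
    have "x - c = (\<gamma> t - ?d *\<^sub>R N t) - (\<gamma> t + ?d *\<^sub>R N t)" unfolding c_def by (subst t) simp
    also have "\<dots> = (- 2 * ?d) *\<^sub>R N t" by (simp add: scaleR_2 flip: scaleR_scaleR)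
    finally show ?thesis .
  qed
  then have xc: "dist x c = 2 * ?d" using d0 by (simp add: dist_norm)
  have far: "?d \<le> dist y c" if "y \<in> closure \<Omega>" for y
  proof -
    have "y \<notin> O0" using that closure_fluid_domain [OF obs] by auto
    then have "y \<notin> ball c ?d" using bO by blast
    then show ?thesis by (simp add: dist_commute)
  qed
  have "- (1 / (2 * pi)) * ln (3 * dist x c) \<le> robin x"
  proof (rule robin_lower [OF x])
    show "c \<notin> closure \<Omega>" using far [of c] d0 by auto
    show "dist y x \<le> 3 * dist y c" if "y \<in> closure \<Omega>" for y
      using far [OF that] dist_triangle [of y x c] xc by (simp add: dist_commute)
  qed simp
  then show ?thesis unfolding xc by simp
qed

text \<open>
  Moving the pole by a small amount changes the boundary values of the regular part little,
  uniformly on the boundary, and by the maximum principle also inside. So \<open>robin x'\<close> is close to the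
  value at \<open>x'\<close> of the regular part with pole \<open>x\<close>, which is continuous.
\<close>

lemma robin_cont: "continuous_on \<Omega> robin"
  unfolding continuous_on_eq_continuous_at [OF open_fluid_domain]
proof
  fix x assume x: "x \<in> \<Omega>"
  obtain W where W: "harmonic_on \<Omega> W" "continuous_on (closure \<Omega>) W"
    "\<And>y. y \<in> closure \<Omega> \<Longrightarrow> y \<noteq> x \<Longrightarrow> W y = 1 / (2 * pi) * ln (1 / dist y x) - G0 y x" "robin x = W x"
    by (rule regular_part_extension [OF x]) (rule that)
  obtain R where R: "R > 0" "ball x R \<subseteq> \<Omega>" using x open_fluid_domain open_contains_ball by blast
  define r where "r = R / 2"
  have r: "r > 0" using R by (simp add: r_def)
  have frd: "2 * r \<le> dist y x" if "y \<in> frontier \<Omega>" for y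
  proof -
    have "y \<notin> \<Omega>" using that open_fluid_domain [of O0] by (auto simp: frontier_def interior_open)
    then have "y \<notin> ball x R" using R by blast
    then show ?thesis by (simp add: r_def dist_commute)
  qed
  have key: "\<bar>robin x' - robin x\<bar> \<le> \<bar>W x' - W x\<bar> + dist x x' / r" if x': "dist x x' < r" for x'
  proof -
    have x'O: "x' \<in> \<Omega>" using x' R by (auto simp: r_def)
    obtain V where V: "harmonic_on \<Omega> V" "continuous_on (closure \<Omega>) V"
      "\<And>y. y \<in> closure \<Omega> \<Longrightarrow> y \<noteq> x' \<Longrightarrow> V y = 1 / (2 * pi) * ln (1 / dist y x') - G0 y x'" "robin x' = V x'"
      by (rule regular_part_extension [OF x'O]) (rule that)
    define k where "k = dist x x' / r"
    have Ld: "\<bar>1 / (2 * pi) * ln (1 / dist y x) - 1 / (2 * pi) * ln (1 / dist y x')\<bar> \<le> k" if y: "2 * r \<le> dist y x" for y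
    proof -
      have y': "r \<le> dist y x'" using y x' dist_triangle [of y x x'] by (simp add: dist_commute)
      have "\<bar>ln (dist y x') - ln (dist y x)\<bar> \<le> \<bar>dist y x' - dist y x\<bar> / r"
        by (rule abs_ln_diff_le [OF r y']) (use y r in simp)
      also have "\<dots> \<le> k" unfolding k_def
        using r abs_dist_diff_le [of x' y x] by (intro divide_right_mono) (auto simp: dist_commute)
      finally have *: "\<bar>ln (dist y x') - ln (dist y x)\<bar> \<le> k" .
      have "1 / (2 * pi) * ln (1 / dist y x) - 1 / (2 * pi) * ln (1 / dist y x') = 1 / (2 * pi) * (ln (dist y x') - ln (dist y x))"
        using y y' r by (simp add: ln_div diff_divide_distrib)
      then have "\<bar>1 / (2 * pi) * ln (1 / dist y x) - 1 / (2 * pi) * ln (1 / dist y x')\<bar> = 1 / (2 * pi) * \<bar>ln (dist y x') - ln (dist y x)\<bar>"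
        by (simp add: abs_mult)
      also have "\<dots> \<le> 1 * k" using * pi_gt3 by (intro mult_mono) (auto simp: divide_le_eq)
      finally show ?thesis by simp
    qed
    have ev: "eventually (\<lambda>y. 2 * r \<le> dist y x) (far \<Omega>)"
      unfolding eventually_far
    proof (intro exI [of _ "norm x + 2 * r"] ballI impI)
      fix y :: plane assume "norm x + 2 * r \<le> norm y"
      then show "2 * r \<le> dist y x" using norm_triangle_ineq2 [of y x] by (simp add: dist_norm)
    qed
    have near: "eventually (\<lambda>y. \<bar>W y - V y\<bar> \<le> k + e) (far \<Omega>)" if e: "e > 0" for e
    proof -
      have "e / 2 > 0" using e by simp
      from ev green_far_small [OF x this] green_far_small [OF x'O this] eventually_in_Omega eventually_neq_far [of x] eventually_neq_far [of x']
      show ?thesis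
      proof eventually_elim
        case (elim y)
        have "y \<in> closure \<Omega>" using elim closure_subset by blast
        then have "W y = 1 / (2 * pi) * ln (1 / dist y x) - G0 y x" "V y = 1 / (2 * pi) * ln (1 / dist y x') - G0 y x'"
          using W(3) V(3) elim by auto
        then show ?case using Ld [OF elim(1)] elim(2,3) by linarith
      qed
    qed
    have bd: "\<bar>W y - V y\<bar> \<le> k" if y: "y \<in> frontier \<Omega>" for y
      using W(3) [OF frontier_sub_closure [OF y] frontier_neq [OF x y]] green_dest(2) [OF x y]
        V(3) [OF frontier_sub_closure [OF y] frontier_neq [OF x'O y]] green_dest(2) [OF x'O y]
        Ld [OF frd [OF y]] by simp
    have x'c: "x' \<in> closure \<Omega>" using x'O closure_subset by blast
    have 1: "W x' \<le> V x' + k"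
    proof (rule comparison [OF W(1,2) _ _ _ _ x'c])
      show "harmonic_on \<Omega> (\<lambda>y. V y + k)" by (intro harmonic_on_add V harmonic_on_const)
      show "continuous_on (closure \<Omega>) (\<lambda>y. V y + k)" by (intro continuous_intros V)
      show "W y \<le> V y + k" if "y \<in> frontier \<Omega>" for y using bd [OF that] by linarith
      show "eventually (\<lambda>y. W y \<le> V y + k + e) (far \<Omega>)" if "e > 0" for e
        using near [OF that] by eventually_elim linarith
    qed
    have 2: "V x' \<le> W x' + k"
    proof (rule comparison [OF V(1,2) _ _ _ _ x'c])
      show "harmonic_on \<Omega> (\<lambda>y. W y + k)" by (intro harmonic_on_add W harmonic_on_const)
      show "continuous_on (closure \<Omega>) (\<lambda>y. W y + k)" by (intro continuous_intros W)
      show "V y \<le> W y + k" if "y \<in> frontier \<Omega>" for y using bd [OF that] by linarith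
      show "eventually (\<lambda>y. V y \<le> W y + k + e) (far \<Omega>)" if "e > 0" for e
        using near [OF that] by eventually_elim linarith
    qed
    show ?thesis using 1 2 W(4) V(4) unfolding k_def by linarith
  qed
  have "isCont W x"
    using harmonic_on_imp_continuous_on [OF W(1)] x open_fluid_domain continuous_on_eq_continuous_at by blast
  then have Wl: "((\<lambda>x'. W x') \<longlongrightarrow> W x) (at x)" by (simp add: isCont_def)
  have "((\<lambda>x'. \<bar>W x' - W x\<bar> + dist x x' / r) \<longlongrightarrow> \<bar>W x - W x\<bar> + dist x x / r) (at x)"
    using r by (intro tendsto_intros Wl) auto
  then have lim0: "((\<lambda>x'. \<bar>W x' - W x\<bar> + dist x x' / r) \<longlongrightarrow> 0) (at x)" by simp
  have "((\<lambda>x'. robin x' - robin x) \<longlongrightarrow> 0) (at x)"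
  proof (rule Lim_null_comparison [OF _ lim0])
    show "eventually (\<lambda>x'. norm (robin x' - robin x) \<le> \<bar>W x' - W x\<bar> + dist x x' / r) (at x)"
      unfolding eventually_at using r key by (intro exI [of _ r]) (auto simp: dist_commute)
  qed
  then show "isCont robin x" unfolding isCont_def by (rule LIM_zero_cancel)
qed

end

section \<open>The Green function of the strip\<close>

lemma cosh_minus_cos_pos:
  assumes "a \<noteq> 0 \<or> (b \<noteq> 0 \<and> \<bar>b\<bar> < 2 * pi)"
  shows "cosh (a::real) - cos b > 0"
proof (cases "a = 0")
  case False
  then have "cosh a > 1" using cosh_real_ge_1 [of a] cosh_real_one_iff [of a] by linarith
  then show ?thesis using cos_le_one [of b] by linarith
next
  case True
  then have b: "b \<noteq> 0" "\<bar>b\<bar> < 2 * pi" using assms by auto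
  have "cos b \<noteq> 1"
  proof
    assume "cos b = 1"
    then obtain n :: int where n: "b = of_int n * 2 * pi" by (auto simp: cos_one_2pi_int)
    then have "n \<noteq> 0" using b by auto
    then have "1 \<le> \<bar>real_of_int n\<bar>" by linarith
    then have "2 * pi \<le> \<bar>b\<bar>" using n mult_right_mono [of 1 "\<bar>real_of_int n\<bar>" "2 * pi"] by (simp add: abs_mult)
    then show False using b by simp
  qed
  then have "cos b < 1" using cos_le_one [of b] by linarith
  then show ?thesis using True by simp
qed

lemma sin_strip: "p \<in> strip \<Longrightarrow> 0 < sin (p$2)" "y \<in> closure strip \<Longrightarrow> 0 \<le> sin (y$2)"
  unfolding closure_strip by (auto simp: strip_def intro: sin_gt_zero sin_ge_zero)

text \<open>
  The function is, up to an additive constant, \<open>2 ln \<bar>sinh ((z - w) / 2)\<bar>\<close> for \<open>z = x\<^sub>1 + i x\<^sub>2\<close> and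
  \<open>w = \<alpha> + i \<beta>\<close>.
\<close>

lemma harmonic_on_ln_cosh_cos:
  assumes pos: "\<And>x. x \<in> U \<Longrightarrow> cosh (x$1 - \<alpha>) - cos (x$2 - \<beta>) > 0"
  shows "harmonic_on U (\<lambda>x. ln (cosh (x$1 - \<alpha>) - cos (x$2 - \<beta>)))"
proof -
  define D where "D x = cosh (x$1 - \<alpha>) - cos (x$2 - \<beta>)" for x :: plane
  have Dp: "D x > 0" if "x \<in> U" for x using pos [OF that] by (simp add: D_def)
  have contD: "continuous_on U D" unfolding D_def by (intro continuous_intros)
  have "harmonic_on U (\<lambda>x. ln (D x))"
  proof (rule harmonic_onI)
    fix x assume x: "x \<in> U"
    have l: "((\<lambda>x::plane. x$i - c) has_derivative (\<lambda>v. v$i)) (at x)" for i c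
      by (auto intro!: derivative_eq_intros)
    have ch: "((\<lambda>x::plane. cosh (x$1 - \<alpha>)) has_derivative (\<lambda>v. v$1 * sinh (x$1 - \<alpha>))) (at x)"
      by (rule DERIV_compose_FDERIV [OF _ l]) (auto intro!: derivative_eq_intros)
    have sh: "((\<lambda>x::plane. sinh (x$1 - \<alpha>)) has_derivative (\<lambda>v. v$1 * cosh (x$1 - \<alpha>))) (at x)"
      by (rule DERIV_compose_FDERIV [OF _ l]) (auto intro!: derivative_eq_intros)
    have co: "((\<lambda>x::plane. cos (x$2 - \<beta>)) has_derivative (\<lambda>v. v$2 * (- sin (x$2 - \<beta>)))) (at x)"
      by (rule DERIV_compose_FDERIV [OF _ l]) (auto intro!: derivative_eq_intros)
    have si: "((\<lambda>x::plane. sin (x$2 - \<beta>)) has_derivative (\<lambda>v. v$2 * cos (x$2 - \<beta>))) (at x)"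
      by (rule DERIV_compose_FDERIV [OF _ l]) (auto intro!: derivative_eq_intros)
    have D0: "D x > 0" "D x \<noteq> 0" using Dp [OF x] by auto
    have dD: "(D has_derivative (\<lambda>v. sinh (x$1 - \<alpha>) * v$1 + sin (x$2 - \<beta>) * v$2)) (at x)"
      unfolding D_def [abs_def]
      by (rule has_derivative_eq_rhs [OF has_derivative_diff [OF ch co]]) (simp add: fun_eq_iff mult.commute)
    show "((\<lambda>x. ln (D x)) has_derivative (\<lambda>v. sinh (x$1 - \<alpha>) / D x * v$1 + sin (x$2 - \<beta>) / D x * v$2)) (at x)"
      by (rule has_derivative_eq_rhs [OF has_derivative_ln [OF D0(1) dD]])
         (simp add: fun_eq_iff divide_inverse algebra_simps)
    show "((\<lambda>x. sinh (x$1 - \<alpha>) / D x) has_derivative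
        (\<lambda>v. (cosh (x$1 - \<alpha>) * D x - (sinh (x$1 - \<alpha>))\<^sup>2) / (D x)\<^sup>2 * v$1
           + (- sinh (x$1 - \<alpha>) * sin (x$2 - \<beta>)) / (D x)\<^sup>2 * v$2)) (at x)"
      by (rule has_derivative_eq_rhs [OF has_derivative_divide' [OF sh dD D0(2)]])
         (simp add: fun_eq_iff power2_eq_square algebra_simps flip: add_divide_distrib diff_divide_distrib)
    show "((\<lambda>x. sin (x$2 - \<beta>) / D x) has_derivative
        (\<lambda>v. (- sinh (x$1 - \<alpha>) * sin (x$2 - \<beta>)) / (D x)\<^sup>2 * v$1
           + (cos (x$2 - \<beta>) * D x - (sin (x$2 - \<beta>))\<^sup>2) / (D x)\<^sup>2 * v$2)) (at x)"
      by (rule has_derivative_eq_rhs [OF has_derivative_divide' [OF si dD D0(2)]])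
         (simp add: fun_eq_iff power2_eq_square algebra_simps flip: add_divide_distrib diff_divide_distrib)
    have "(cosh (x$1 - \<alpha>) * D x - (sinh (x$1 - \<alpha>))\<^sup>2) + (cos (x$2 - \<beta>) * D x - (sin (x$2 - \<beta>))\<^sup>2) = 0"
      unfolding D_def using cosh_square_eq [of "x$1 - \<alpha>"] sin_cos_squared_add [of "x$2 - \<beta>"]
      by (simp add: power2_eq_square algebra_simps)
    then show "(cosh (x$1 - \<alpha>) * D x - (sinh (x$1 - \<alpha>))\<^sup>2) / (D x)\<^sup>2
        + (cos (x$2 - \<beta>) * D x - (sin (x$2 - \<beta>))\<^sup>2) / (D x)\<^sup>2 = 0"
      by (simp flip: add_divide_distrib)
  next
    have nz: "\<forall>x\<in>U. (D x)\<^sup>2 \<noteq> 0" using Dp by force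
    show "continuous_on U (\<lambda>x. (cosh (x$1 - \<alpha>) * D x - (sinh (x$1 - \<alpha>))\<^sup>2) / (D x)\<^sup>2)"
      "continuous_on U (\<lambda>x. (- sinh (x$1 - \<alpha>) * sin (x$2 - \<beta>)) / (D x)\<^sup>2)"
      "continuous_on U (\<lambda>x. (cos (x$2 - \<beta>) * D x - (sin (x$2 - \<beta>))\<^sup>2) / (D x)\<^sup>2)"
      using nz by (auto intro!: continuous_intros contD)
  qed
  then show ?thesis by (simp add: D_def)
qed

text \<open>
  The Green function of the strip, obtained from that of the half plane by the conformal map
  \<open>exp\<close>; the pole in the first term is the reflection of \<open>p\<close> in the lower wall.
\<close>

definition strip_green :: "plane \<Rightarrow> plane \<Rightarrow> real" where
  "strip_green y p = 1 / (4 * pi) *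
     (ln (cosh (y$1 - p$1) - cos (y$2 - (- p$2))) - ln (cosh (y$1 - p$1) - cos (y$2 - p$2)))"

lemma strip_green_args:
  assumes p: "p \<in> strip" and y: "y \<in> closure strip"
  shows "cosh (y$1 - p$1) - cos (y$2 - (- p$2)) > 0"
    and "y \<noteq> p \<Longrightarrow> cosh (y$1 - p$1) - cos (y$2 - p$2) > 0"
proof -
  have b: "0 < p$2" "p$2 < pi" "0 \<le> y$2" "y$2 \<le> pi"
    using p y unfolding closure_strip by (auto simp: strip_def)
  show "cosh (y$1 - p$1) - cos (y$2 - (- p$2)) > 0"
    by (rule cosh_minus_cos_pos) (use b in auto)
  show "cosh (y$1 - p$1) - cos (y$2 - p$2) > 0" if "y \<noteq> p"
  proof (rule cosh_minus_cos_pos)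
    have "y$1 \<noteq> p$1 \<or> y$2 \<noteq> p$2" using that plane_eqI by blast
    then show "y$1 - p$1 \<noteq> 0 \<or> y$2 - p$2 \<noteq> 0 \<and> \<bar>y$2 - p$2\<bar> < 2 * pi" using b by auto
  qed
qed

lemma strip_green_harmonic:
  assumes p: "p \<in> strip" and U: "U \<subseteq> strip - {p}"
  shows "harmonic_on U (\<lambda>y. strip_green y p)"
  unfolding strip_green_def
  by (intro harmonic_on_cmult harmonic_on_diff harmonic_on_ln_cosh_cos)
     (use strip_green_args [OF p] U closure_subset [of strip] in blast)+

lemma strip_green_cont:
  assumes p: "p \<in> strip" and S: "S \<subseteq> closure strip - {p}"
  shows "continuous_on S (\<lambda>y. strip_green y p)"
proof -
  have "\<forall>y\<in>S. cosh (y$1 - p$1) - cos (y$2 - (- p$2)) \<noteq> 0" "\<forall>y\<in>S. cosh (y$1 - p$1) - cos (y$2 - p$2) \<noteq> 0"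
    using strip_green_args [OF p] S by (metis Diff_iff less_irrefl singletonI subsetD)+
  then show ?thesis unfolding strip_green_def by (intro continuous_intros) auto
qed

lemma strip_green_wall:
  assumes "y \<in> frontier strip"
  shows "strip_green y p = 0"
proof -
  have "cos (y$2 - (- p$2)) = cos (y$2 - p$2)"
    using assms unfolding frontier_strip by (auto simp: cos_add cos_diff)
  then show ?thesis by (simp add: strip_green_def)
qed

lemma strip_green_diff: "cos (y2 - p2) - cos (y2 - (- p2)) = 2 * sin y2 * sin (p2::real)"
  by (simp add: cos_diff cos_add)

text \<open>
  This bound and \<open>strip_green_upper\<close> rest on \<open>ln r \<le> r - 1\<close>, applied to the quotient of the two arguments; their
  difference is \<open>2 sin y\<^sub>2 sin p\<^sub>2\<close>.
\<close>

lemma strip_green_lower: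
  assumes p: "p \<in> strip" and y: "y \<in> closure strip" "y \<noteq> p"
  shows "1 / (2 * pi) * (sin (y$2) * sin (p$2) / (cosh (y$1 - p$1) + 1)) \<le> strip_green y p"
proof -
  define D1 where "D1 = cosh (y$1 - p$1) - cos (y$2 - (- p$2))"
  define D2 where "D2 = cosh (y$1 - p$1) - cos (y$2 - p$2)"
  define k where "k = sin (y$2) * sin (p$2)"
  have D: "D1 > 0" "D2 > 0" using strip_green_args [OF p y(1)] y(2) by (auto simp: D1_def D2_def)
  have dd: "D1 - D2 = 2 * k" using strip_green_diff [of "y$2" "p$2"] by (simp add: D1_def D2_def k_def)
  have k: "k \<ge> 0" unfolding k_def using sin_strip(1) [OF p] sin_strip(2) [OF y(1)] by simp
  have D1le: "D1 \<le> cosh (y$1 - p$1) + 1" using cos_ge_minus_one [of "y$2 - (- p$2)"] unfolding D1_def by linarith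
  have "ln (D2 / D1) \<le> D2 / D1 - 1" using D by (intro ln_le_minus_one) auto
  then have "1 - D2 / D1 \<le> ln D1 - ln D2" using D by (simp add: ln_div)
  moreover have "1 - D2 / D1 = 2 * k / D1" using D dd by (simp add: field_simps)
  moreover have "2 * k / (cosh (y$1 - p$1) + 1) \<le> 2 * k / D1" using D D1le k by (intro divide_left_mono) (auto intro: mult_pos_pos add_pos_pos cosh_real_pos)
  ultimately have "2 * k / (cosh (y$1 - p$1) + 1) \<le> ln D1 - ln D2" by linarith
  then have "1 / (4 * pi) * (2 * k / (cosh (y$1 - p$1) + 1)) \<le> 1 / (4 * pi) * (ln D1 - ln D2)"
    by (intro mult_left_mono) auto
  moreover have "1 / (4 * pi) * (2 * k / (cosh (y$1 - p$1) + 1)) = 1 / (2 * pi) * (k / (cosh (y$1 - p$1) + 1))"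
    by simp
  ultimately show ?thesis by (simp only: strip_green_def D1_def D2_def k_def)
qed

lemma strip_green_nonneg:
  assumes p: "p \<in> strip" and y: "y \<in> closure strip" "y \<noteq> p"
  shows "0 \<le> strip_green y p"
proof -
  have "0 \<le> sin (y$2) * sin (p$2)" using sin_strip(1) [OF p] sin_strip(2) [OF y(1)] by simp
  moreover have "0 < cosh (y$1 - p$1) + 1" using cosh_real_pos [of "y$1 - p$1"] by linarith
  ultimately have "0 \<le> 1 / (2 * pi) * (sin (y$2) * sin (p$2) / (cosh (y$1 - p$1) + 1))"
    by (intro mult_nonneg_nonneg [of "1 / (2 * pi)"] divide_nonneg_pos) auto
  then show ?thesis using strip_green_lower [OF assms] by linarith
qed

lemma strip_green_pos:
  assumes p: "p \<in> strip" and y: "y \<in> strip" "y \<noteq> p"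
  shows "0 < strip_green y p"
proof -
  have "0 < sin (y$2) * sin (p$2)" using sin_strip(1) [OF p] sin_strip(1) [OF y(1)] by simp
  moreover have "0 < cosh (y$1 - p$1) + 1" using cosh_real_pos [of "y$1 - p$1"] by linarith
  ultimately have "0 < 1 / (2 * pi) * (sin (y$2) * sin (p$2) / (cosh (y$1 - p$1) + 1))"
    by simp
  moreover have "y \<in> closure strip" using y closure_subset by blast
  ultimately show ?thesis using strip_green_lower [OF p _ y(2)] by fastforce
qed

lemma strip_green_upper:
  assumes p: "p \<in> strip" and y: "y \<in> closure strip" and d: "d \<le> \<bar>y$1 - p$1\<bar>" "2 \<le> d"
  shows "strip_green y p \<le> 2 / pi * exp (- d)"
proof -
  define a where "a = y$1 - p$1"
  define D1 where "D1 = cosh (y$1 - p$1) - cos (y$2 - (- p$2))"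
  define D2 where "D2 = cosh (y$1 - p$1) - cos (y$2 - p$2)"
  define k where "k = sin (y$2) * sin (p$2)"
  have "y \<noteq> p" using d by auto
  then have D: "D1 > 0" "D2 > 0" using strip_green_args [OF p y(1)] by (auto simp: D1_def D2_def)
  have dd: "D1 - D2 = 2 * k" using strip_green_diff [of "y$2" "p$2"] by (simp add: D1_def D2_def k_def)
  have k1: "k \<le> 1"
  proof -
    have "\<bar>k\<bar> \<le> 1 * 1" unfolding k_def abs_mult by (intro mult_mono) auto
    then show ?thesis by linarith
  qed
  have "exp d / 2 \<le> cosh a"
  proof -
    have "exp \<bar>a\<bar> / 2 \<le> cosh \<bar>a\<bar>" by (simp add: cosh_def)
    moreover have "exp d \<le> exp \<bar>a\<bar>" using d by (simp only: exp_le_cancel_iff a_def)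
    moreover have "cosh \<bar>a\<bar> = cosh a" by simp
    ultimately show ?thesis by linarith
  qed
  moreover have "exp d \<ge> 4"
  proof -
    have "exp (1::real) \<ge> 2" using exp_ge_add_one_self [of 1] by simp
    then have "exp (1::real) * exp 1 \<ge> 2 * 2" by (intro mult_mono) auto
    then have "exp (2::real) \<ge> 4" by (simp flip: exp_add)
    then show ?thesis using d exp_le_cancel_iff [of 2 d] by linarith
  qed
  moreover have "D2 \<ge> cosh a - 1" using cos_le_one [of "y$2 - p$2"] unfolding D2_def a_def by linarith
  ultimately have D2: "D2 \<ge> exp d / 4" by linarith
  have "ln D1 - ln D2 \<le> D1 / D2 - 1" using D ln_le_minus_one [of "D1 / D2"] by (simp add: ln_div)
  also have "\<dots> = 2 * k / D2" using D dd by (simp add: field_simps)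
  also have "\<dots> \<le> 2 / D2" using k1 D by (intro divide_right_mono) auto
  also have "\<dots> \<le> 2 / (exp d / 4)" using D D2 by (intro divide_left_mono) auto
  also have "\<dots> = 8 * exp (- d)" by (simp add: exp_minus field_simps)
  finally have "1 / (4 * pi) * (ln D1 - ln D2) \<le> 1 / (4 * pi) * (8 * exp (- d))"
    by (intro mult_left_mono) auto
  also have "\<dots> = 2 / pi * exp (- d)" by simp
  finally show ?thesis by (simp only: strip_green_def D1_def D2_def)
qed

lemma sq_ratio_near_zero:
  fixes f :: "real \<Rightarrow> real"
  assumes f: "(f has_real_derivative 1) (at 0)" and f0: "f 0 = 0" and e: "e > 0"
  shows "\<exists>d>0. \<forall>x. \<bar>x\<bar> < d \<longrightarrow> \<bar>(f x)\<^sup>2 - x\<^sup>2\<bar> \<le> e * x\<^sup>2"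
proof -
  have "((\<lambda>h. f h / h) \<longlongrightarrow> 1) (at 0)" using f f0 by (simp add: DERIV_def)
  then have "((\<lambda>h. (f h / h)\<^sup>2) \<longlongrightarrow> 1\<^sup>2) (at 0)" by (intro tendsto_intros)
  from tendstoD [OF this e] obtain d where d: "d > 0" "\<And>x. x \<noteq> 0 \<Longrightarrow> \<bar>x\<bar> < d \<Longrightarrow> \<bar>(f x / x)\<^sup>2 - 1\<bar> < e"
    unfolding eventually_at by (auto simp: dist_real_def)
  have "\<bar>(f x)\<^sup>2 - x\<^sup>2\<bar> \<le> e * x\<^sup>2" if "\<bar>x\<bar> < d" for x
  proof (cases "x = 0")
    case True then show ?thesis using f0 by simp
  next
    case False
    have "(f x)\<^sup>2 - x\<^sup>2 = ((f x / x)\<^sup>2 - 1) * x\<^sup>2" using False by (simp add: power_divide field_simps)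
    then have "\<bar>(f x)\<^sup>2 - x\<^sup>2\<bar> = \<bar>(f x / x)\<^sup>2 - 1\<bar> * x\<^sup>2" by (simp add: abs_mult)
    also have "\<dots> \<le> e * x\<^sup>2" using d(2) [OF False that] by (intro mult_right_mono) auto
    finally show ?thesis .
  qed
  with d show ?thesis by blast
qed

text \<open>
  By the half angle formulas the numerator is \<open>2 (sinh\<^sup>2 a + sin\<^sup>2 c)\<close> at half the coordinate
  differences \<open>a\<close>, \<open>c\<close>.
\<close>

lemma cosh_cos_quadratic:
  "((\<lambda>z::plane. (cosh (z$1 - p$1) - cos (z$2 - p$2)) / (dist z p)\<^sup>2) \<longlongrightarrow> 1/2) (at p)"
proof (rule tendstoI)
  fix e :: real assume e: "e > 0"
  have s1: "(sinh has_real_derivative 1) (at (0::real))" by (auto intro!: derivative_eq_intros)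
  have s2: "(sin has_real_derivative 1) (at (0::real))" by (auto intro!: derivative_eq_intros)
  obtain d1 where d1: "d1 > 0" "\<And>x::real. \<bar>x\<bar> < d1 \<Longrightarrow> \<bar>(sinh x)\<^sup>2 - x\<^sup>2\<bar> \<le> e * x\<^sup>2"
    using sq_ratio_near_zero [OF s1 _ e] by auto
  obtain d2 where d2: "d2 > 0" "\<And>x::real. \<bar>x\<bar> < d2 \<Longrightarrow> \<bar>(sin x)\<^sup>2 - x\<^sup>2\<bar> \<le> e * x\<^sup>2"
    using sq_ratio_near_zero [OF s2 _ e] by auto
  have "dist ((cosh (z$1 - p$1) - cos (z$2 - p$2)) / (dist z p)\<^sup>2) (1/2) < e"
    if z: "z \<noteq> p" "dist z p < min d1 d2" for z
  proof -
    define a where "a = (z$1 - p$1) / 2"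
    define c where "c = (z$2 - p$2) / 2"
    have comp: "\<bar>(z - p)$i\<bar> \<le> dist z p" for i using component_le_norm_cart [of "z - p" i] by (simp add: dist_norm)
    have ac: "\<bar>a\<bar> < d1" "\<bar>c\<bar> < d2"
      using comp [of 1] comp [of 2] z(2) by (auto simp: a_def c_def)
    have D: "cosh (z$1 - p$1) - cos (z$2 - p$2) = 2 * ((sinh a)\<^sup>2 + (sin c)\<^sup>2)"
    proof -
      have "cosh (2 * a) = 1 + 2 * (sinh a)\<^sup>2" using cosh_double_cosh [of a] cosh_square_eq [of a] by simp
      moreover have "cos (2 * c) = 1 - 2 * (sin c)\<^sup>2" by (rule cos_double_sin)
      moreover have e1: "z$1 - p$1 = 2 * a" "z$2 - p$2 = 2 * c" by (simp_all add: a_def c_def)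
      ultimately show ?thesis unfolding e1 by simp
    qed
    have n: "(dist z p)\<^sup>2 = 4 * (a\<^sup>2 + c\<^sup>2)"
      by (simp add: dist_norm norm_plane_sq a_def c_def power_divide)
    have npos: "(dist z p)\<^sup>2 > 0" using z by simp
    define Q where "Q = ((sinh a)\<^sup>2 + (sin c)\<^sup>2) - (a\<^sup>2 + c\<^sup>2)"
    define A where "A = a\<^sup>2 + c\<^sup>2"
    have "\<bar>Q\<bar> \<le> e * A"
      using d1(2) [OF ac(1)] d2(2) [OF ac(2)] unfolding Q_def A_def distrib_left by linarith
    moreover have "(cosh (z$1 - p$1) - cos (z$2 - p$2)) - (dist z p)\<^sup>2 / 2 = 2 * Q"
      unfolding D n Q_def by (simp add: field_simps)
    moreover have "e / 2 * (dist z p)\<^sup>2 = 2 * (e * A)" unfolding n A_def by simp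
    ultimately have "\<bar>(cosh (z$1 - p$1) - cos (z$2 - p$2)) - (dist z p)\<^sup>2 / 2\<bar> \<le> e / 2 * (dist z p)\<^sup>2"
      by linarith
    moreover have "(cosh (z$1 - p$1) - cos (z$2 - p$2)) / (dist z p)\<^sup>2 - 1/2
        = ((cosh (z$1 - p$1) - cos (z$2 - p$2)) - (dist z p)\<^sup>2 / 2) / (dist z p)\<^sup>2"
      using npos by (simp add: diff_divide_distrib)
    ultimately have "\<bar>(cosh (z$1 - p$1) - cos (z$2 - p$2)) / (dist z p)\<^sup>2 - 1/2\<bar> \<le> e / 2"
      using npos by (simp add: divide_le_eq)
    then show ?thesis using e by (simp add: dist_real_def)
  qed
  then show "eventually (\<lambda>z. dist ((cosh (z$1 - p$1) - cos (z$2 - p$2)) / (dist z p)\<^sup>2) (1/2) < e) (at p)"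
    unfolding eventually_at using d1(1) d2(1) by (intro exI [of _ "min d1 d2"]) auto
qed

lemma strip_green_regular_part:
  assumes p: "p \<in> strip"
  shows "((\<lambda>z. 1 / (2 * pi) * ln (1 / dist z p) - strip_green z p) \<longlongrightarrow> - (1 / (2 * pi)) * ln (2 * sin (p$2))) (at p)"
proof (rule Lim_transform_eventually)
  let ?D1 = "\<lambda>z::plane. cosh (z$1 - p$1) - cos (z$2 - (- p$2))"
  let ?D2 = "\<lambda>z::plane. cosh (z$1 - p$1) - cos (z$2 - p$2)"
  have sp: "sin (p$2) > 0" using p by (intro sin_gt_zero) (auto simp: strip_def)
  have D1p: "?D1 p = 2 * (sin (p$2))\<^sup>2"
    using cos_double_sin [of "p$2"] by simp
  have "isCont ?D1 p" by (intro continuous_intros)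
  then have "(?D1 \<longlongrightarrow> 2 * (sin (p$2))\<^sup>2) (at p)" unfolding isCont_def D1p .
  then have "((\<lambda>z. 1 / (4 * pi) * (ln (?D2 z / (dist z p)\<^sup>2) - ln (?D1 z))) \<longlongrightarrow>
      1 / (4 * pi) * (ln (1/2) - ln (2 * (sin (p$2))\<^sup>2))) (at p)"
    using sp by (intro tendsto_intros cosh_cos_quadratic) auto
  moreover have "1 / (4 * pi) * (ln (1/2) - ln (2 * (sin (p$2))\<^sup>2)) = - (1 / (2 * pi)) * ln (2 * sin (p$2))"
  proof -
    have "ln (1/2::real) - ln (2 * (sin (p$2))\<^sup>2) = - 2 * ln (2 * sin (p$2))"
      using sp by (simp add: ln_div ln_mult ln_realpow)
    then show ?thesis by simp
  qed
  ultimately show "((\<lambda>z. 1 / (4 * pi) * (ln (?D2 z / (dist z p)\<^sup>2) - ln (?D1 z))) \<longlongrightarrow>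
      - (1 / (2 * pi)) * ln (2 * sin (p$2))) (at p)" by simp
  have "eventually (\<lambda>z. z \<in> strip - {p}) (at p)"
    using open_strip p eventually_at_in_open by blast
  then show "eventually (\<lambda>z. 1 / (4 * pi) * (ln (?D2 z / (dist z p)\<^sup>2) - ln (?D1 z))
      = 1 / (2 * pi) * ln (1 / dist z p) - strip_green z p) (at p)"
  proof eventually_elim
    case (elim z)
    then have z: "z \<in> closure strip" "z \<noteq> p" using closure_subset by auto
    have D: "?D1 z > 0" "?D2 z > 0" using strip_green_args [OF p z(1)] z(2) by auto
    have d: "dist z p > 0" using z by simp
    have "ln (?D2 z / (dist z p)\<^sup>2) = ln (?D2 z) - 2 * ln (dist z p)"
      using D d by (simp only: ln_div ln_realpow zero_less_power) simp
    moreover have "ln (1 / dist z p) = - ln (dist z p)" using d by (simp add: ln_div)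
    ultimately show ?case unfolding strip_green_def by (simp only:) (simp add: field_simps)
  qed
qed

section \<open>The energy far from the obstacle\<close>

definition strip_robin :: "real \<Rightarrow> real" where
  "strip_robin t = - (1 / (2 * pi)) * ln (2 * sin t)"

text \<open>
  At the pole \<open>e\<close> times the logarithm exceeds any difference of the regular parts.
\<close>

lemma log_pole_dominates:
  fixes A B :: "plane \<Rightarrow> real"
  assumes A: "((\<lambda>z. 1 / (2 * pi) * ln (1 / dist z x) - A z) \<longlongrightarrow> a0) (at x)"
    and B: "((\<lambda>z. 1 / (2 * pi) * ln (1 / dist z x) - B z) \<longlongrightarrow> b0) (at x)" and e: "e > 0"
  shows "eventually (\<lambda>z. A z \<le> (1 + e) * B z) (at x)"
proof -
  define M where "M = (- a0 + 1 + (1 + e) * (b0 + 1)) / e"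
  have L: "eventually (\<lambda>z. M \<le> 1 / (2 * pi) * ln (1 / dist z x)) (at x)"
    unfolding eventually_at
  proof (intro exI [of _ "exp (- (2 * pi * M))"] conjI ballI impI)
    fix z assume z: "z \<noteq> x \<and> dist z x < exp (- (2 * pi * M))"
    then have d: "dist z x > 0" by simp
    have "ln (dist z x) \<le> ln (exp (- (2 * pi * M)))" using z d by (subst ln_le_cancel_iff) auto
    then have "2 * pi * M \<le> ln (1 / dist z x)" using d by (simp add: ln_div)
    then have "1 / (2 * pi) * (2 * pi * M) \<le> 1 / (2 * pi) * ln (1 / dist z x)" by (intro mult_left_mono) auto
    then show "M \<le> 1 / (2 * pi) * ln (1 / dist z x)" by simp
  qed simp
  have "(1::real) > 0" by simp
  from L tendstoD [OF A this] tendstoD [OF B this] show ?thesis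
  proof eventually_elim
    case (elim z)
    define l where "l = 1 / (2 * pi) * ln (1 / dist z x)"
    have a: "A z \<le> l - a0 + 1" and b: "l - b0 - 1 \<le> B z" 
      using elim(2,3) unfolding l_def dist_real_def by linarith+
    have "- a0 + 1 + (1 + e) * (b0 + 1) = e * M" using e by (simp add: M_def)
    also have "\<dots> \<le> e * l" using elim(1) e unfolding l_def by (intro mult_left_mono) auto
    finally have "l - a0 + 1 \<le> (1 + e) * (l - b0 - 1)" by (simp add: algebra_simps)
    also have "\<dots> \<le> (1 + e) * B z" using b e by (intro mult_left_mono) auto
    finally show ?case using a by linarith
  qed
qed

lemma le_of_le_scaled:
  fixes A B r :: real
  assumes "\<And>e. e > 0 \<Longrightarrow> A \<le> (1 + e) * B + r"
  shows "A \<le> B + r"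
proof (rule ccontr)
  assume "\<not> A \<le> B + r"
  then have d: "A - B - r > 0" by simp
  define e where "e = (A - B - r) / (2 * (\<bar>B\<bar> + 1))"
  have e: "e > 0" using d by (simp add: e_def add_nonneg_pos)
  have "e * B \<le> e * (\<bar>B\<bar> + 1)" using e by (intro mult_left_mono) auto
  also have "\<dots> = (A - B - r) / 2"
  proof -
    have "\<bar>B\<bar> + 1 \<noteq> 0" by linarith
    then show ?thesis by (simp add: e_def field_simps)
  qed
  finally show False using assms [OF e] d by (simp add: algebra_simps)
qed

lemma cosh_le_exp_abs: "cosh u \<le> exp \<bar>u :: real\<bar>"
proof -
  have "exp u \<le> exp \<bar>u\<bar>" "exp (- u) \<le> exp \<bar>u\<bar>"
    unfolding exp_le_cancel_iff by (rule abs_ge_self) (rule abs_ge_minus_self)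
  then have "(exp u + exp (- u)) / 2 \<le> (exp \<bar>u\<bar> + exp \<bar>u\<bar>) / 2"
    by (intro divide_right_mono add_mono) auto
  then show ?thesis by (simp add: cosh_field_def)
qed

context flow_green
begin

text \<open>
  Two functions with logarithmic poles of equal strength at \<open>x\<close>, ordered on the boundary up to \<open>r\<close>,
  are ordered inside, and then their regular parts at \<open>x\<close> are ordered the other way round. To
  apply the maximum principle at the pole, \<open>B\<close> is first multiplied by \<open>1 + e\<close>, which makes the
  difference negative there; \<open>e\<close> then tends to zero.
\<close>

theorem pole_comparison:
  assumes x: "x \<in> \<Omega>"
    and A: "harmonic_on (\<Omega> - {x}) A" "continuous_on (closure \<Omega> - {x}) A"
      "((\<lambda>z. 1 / (2 * pi) * ln (1 / dist z x) - A z) \<longlongrightarrow> a0) (at x)"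
    and B: "harmonic_on (\<Omega> - {x}) B" "continuous_on (closure \<Omega> - {x}) B"
      "((\<lambda>z. 1 / (2 * pi) * ln (1 / dist z x) - B z) \<longlongrightarrow> b0) (at x)"
    and r: "harmonic_on \<Omega> r" "continuous_on (closure \<Omega>) r" "\<And>y. y \<in> closure \<Omega> \<Longrightarrow> 0 \<le> r y"
    and bd: "\<And>y. y \<in> frontier \<Omega> \<Longrightarrow> A y \<le> B y + r y \<and> 0 \<le> B y"
    and farA: "\<And>e. e > 0 \<Longrightarrow> eventually (\<lambda>y. A y \<le> e) (far \<Omega>)"
    and farB: "\<And>e. e > 0 \<Longrightarrow> eventually (\<lambda>y. - e \<le> B y) (far \<Omega>)"
  shows "b0 \<le> a0 + r x"
proof -
  have scaled: "A y \<le> (1 + e) * B y + r y" if e: "e > 0" and y: "y \<in> \<Omega> - {x}" for e y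
  proof -
    obtain d where d: "d > 0" "\<And>z. z \<noteq> x \<Longrightarrow> dist z x < d \<Longrightarrow> A z \<le> (1 + e) * B z"
      using log_pole_dominates [OF A(3) B(3) e] unfolding eventually_at by auto
    have "A y - ((1 + e) * B y + r y) \<le> 0"
    proof (rule maximum_principle_poles [OF open_fluid_domain _ _ _ _ _ _ _ _ y])
      show "harmonic_on (\<Omega> - {x}) (\<lambda>y. A y - ((1 + e) * B y + r y))"
        by (intro harmonic_on_diff harmonic_on_add harmonic_on_cmult A(1) B(1) harmonic_on_subset [OF r(1)]) auto
      show "continuous_on (closure \<Omega> - {x}) (\<lambda>y. A y - ((1 + e) * B y + r y))"
        by (intro continuous_intros A(2) B(2) continuous_on_subset [OF r(2)]) auto
      show "A y - ((1 + e) * B y + r y) \<le> 0" if "y \<in> frontier \<Omega> - {x}" for y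
      proof -
        have "0 \<le> e * B y" using bd [of y] that e by auto
        then show ?thesis using bd [of y] that by (simp add: algebra_simps)
      qed
      show "A y - ((1 + e) * B y + r y) \<le> 0" if "y \<in> ball x d \<inter> \<Omega> - {x}" for y
      proof -
        have "y \<in> closure \<Omega>" using that closure_subset by blast
        then show ?thesis using d(2) [of y] r(3) [of y] that by (auto simp: dist_commute)
      qed
      show "eventually (\<lambda>y. A y - ((1 + e) * B y + r y) \<le> \<epsilon>) (far \<Omega>)" if \<epsilon>: "\<epsilon> > 0" for \<epsilon>
      proof -
        have e2: "\<epsilon> / 2 > 0" and e3: "\<epsilon> / 2 / (1 + e) > 0" using \<epsilon> e by auto
        from farA [OF e2] farB [OF e3] eventually_in_Omega show ?thesis
        proof eventually_elim
          case (elim y)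
          have "(1 + e) * - (\<epsilon> / 2 / (1 + e)) \<le> (1 + e) * B y" using elim(2) e by (intro mult_left_mono) auto
          moreover have "(1 + e) * - (\<epsilon> / 2 / (1 + e)) = - (\<epsilon> / 2)"
            unfolding mult_minus_right by (subst nonzero_mult_divide_cancel) (use e in auto)
          moreover have "0 \<le> r y" using r(3) elim(3) closure_subset by blast
          ultimately show ?case using elim(1) by linarith
        qed
      qed
    qed (use d in auto)
    then show ?thesis by simp
  qed
  have le: "A y \<le> B y + r y" if "y \<in> \<Omega> - {x}" for y
    by (rule le_of_le_scaled) (rule scaled [OF _ that])
  have "isCont r x"
    using harmonic_on_imp_continuous_on [OF r(1)] x open_fluid_domain continuous_on_eq_continuous_at by blast
  then have lim: "((\<lambda>z. (1 / (2 * pi) * ln (1 / dist z x) - A z) + r z) \<longlongrightarrow> a0 + r x) (at x)"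
    by (intro tendsto_add A(3)) (simp add: isCont_def)
  have "eventually (\<lambda>z. z \<in> \<Omega> - {x}) (at x)"
    using open_fluid_domain x eventually_at_in_open by blast
  then have ev: "eventually (\<lambda>z. 1 / (2 * pi) * ln (1 / dist z x) - B z \<le> (1 / (2 * pi) * ln (1 / dist z x) - A z) + r z) (at x)"
  proof eventually_elim
    case (elim z)
    then show ?case using le [of z] by simp
  qed
  show ?thesis by (rule tendsto_le [OF _ lim B(3) ev]) simp
qed

lemma green_harmonic:
  assumes x: "x \<in> \<Omega>" shows "harmonic_on (\<Omega> - {x}) (\<lambda>y. G0 y x)"
proof -
  obtain w where w: "harmonic_on \<Omega> w" "\<forall>y\<in>\<Omega> - {x}. G0 y x = 1 / (2 * pi) * ln (1 / dist y x) - w y"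
    using green_dest(4) [OF x] by blast
  have "harmonic_on (\<Omega> - {x}) (\<lambda>y. - (1 / (2 * pi)) * ln (norm (y - x)) - w y)"
    by (intro harmonic_on_diff harmonic_on_cmult harmonic_on_ln_norm harmonic_on_subset [OF w(1)]) auto
  then show ?thesis
  proof (rule harmonic_on_cong)
    fix y assume y: "y \<in> \<Omega> - {x}"
    then have "norm (y - x) > 0" by auto
    then show "G0 y x = - (1 / (2 * pi)) * ln (norm (y - x)) - w y"
      using w(2) y by (simp add: ln_div dist_norm)
  qed
qed

lemma closure_Omega_strip: "y \<in> closure \<Omega> \<Longrightarrow> y \<in> closure strip"
  using closure_fluid_domain [OF obs] by auto

lemma strip_green_far_nonneg: "x \<in> strip \<Longrightarrow> eventually (\<lambda>y. 0 \<le> strip_green y x) (far \<Omega>)"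
  using eventually_in_Omega eventually_neq_far [of x]
proof eventually_elim
  case (elim y)
  then have "y \<in> closure strip" using Omega_not_J(3) closure_subset by blast
  then show ?case using strip_green_nonneg elim by blast
qed

lemma strip_green_far:
  assumes x: "x \<in> strip" and e: "e > 0"
  shows "eventually (\<lambda>y. strip_green y x \<le> e) (far \<Omega>)"
  unfolding far_columns
proof (intro exI ballI impI)
  define d where "d = max 2 (1 / e)"
  fix y assume y: "y \<in> \<Omega>" "\<bar>x $ 1\<bar> + d \<le> \<bar>y $ 1\<bar>"
  have yc: "y \<in> closure strip" using y Omega_not_J(3) closure_subset by blast
  have "strip_green y x \<le> 2 / pi * exp (- d)"
    by (rule strip_green_upper [OF x yc]) (use y in \<open>auto simp: d_def\<close>)
  also have "\<dots> \<le> 1 * exp (- d)" using pi_gt3 by (intro mult_right_mono) auto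
  also have "\<dots> = 1 / exp d" by (simp add: exp_minus field_simps)
  also have "\<dots> \<le> 1 / d"
  proof -
    have "d \<le> exp d" using exp_ge_add_one_self [of d] by linarith
    moreover have "d > 0" by (simp add: d_def)
    ultimately show ?thesis by (simp add: frac_le)
  qed
  also have "\<dots> \<le> 1 / (1 / e)" using e by (intro divide_left_mono) (auto simp: d_def intro!: mult_pos_pos divide_pos_pos)
  finally show "strip_green y x \<le> e" by simp
qed

lemma strip_green_Omega:
  assumes x: "x \<in> \<Omega>"
  shows "harmonic_on (\<Omega> - {x}) (\<lambda>y. strip_green y x)" "continuous_on (closure \<Omega> - {x}) (\<lambda>y. strip_green y x)"
    "((\<lambda>z. 1 / (2 * pi) * ln (1 / dist z x) - strip_green z x) \<longlongrightarrow> strip_robin (x $ 2)) (at x)"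
proof -
  have xs: "x \<in> strip" by (rule Omega_not_J(3) [OF x])
  show "harmonic_on (\<Omega> - {x}) (\<lambda>y. strip_green y x)"
    by (rule strip_green_harmonic [OF xs]) (use Omega_not_J(3) in auto)
  show "continuous_on (closure \<Omega> - {x}) (\<lambda>y. strip_green y x)"
    by (rule strip_green_cont [OF xs]) (use closure_Omega_strip in auto)
  show "((\<lambda>z. 1 / (2 * pi) * ln (1 / dist z x) - strip_green z x) \<longlongrightarrow> strip_robin (x $ 2)) (at x)"
    using strip_green_regular_part [OF xs] by (simp add: strip_robin_def)
qed

lemma robin_limit:
  assumes x: "x \<in> \<Omega>"
  shows "((\<lambda>z. 1 / (2 * pi) * ln (1 / dist z x) - G0 z x) \<longlongrightarrow> robin x) (at x)"
  by (rule regular_part_extension [OF x])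

text \<open>
  On the boundary of the fluid domain \<open>G0\<close> vanishes and the Green function of the strip is
  nonnegative. The larger the domain, the larger the Green function and the smaller its Robin
  function.
\<close>

lemma robin_ge_strip:
  assumes x: "x \<in> \<Omega>"
  shows "strip_robin (x $ 2) \<le> robin x"
proof -
  have xs: "x \<in> strip" by (rule Omega_not_J(3) [OF x])
  have "strip_robin (x $ 2) \<le> robin x + 0"
  proof (rule pole_comparison [OF x green_harmonic [OF x] green_dest(1) [OF x] robin_limit [OF x] strip_green_Omega [OF x]
        harmonic_on_const continuous_on_const])
    show "G0 y x \<le> strip_green y x + 0 \<and> 0 \<le> strip_green y x" if y: "y \<in> frontier \<Omega>" for y
      using green_dest(2) [OF x y] strip_green_nonneg [OF xs closure_Omega_strip [OF frontier_sub_closure [OF y]] frontier_neq [OF x y]]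
      by simp
    show "eventually (\<lambda>y. G0 y x \<le> e) (far \<Omega>)" if "e > 0" for e
      using green_far_small [OF x that] by eventually_elim linarith
    show "eventually (\<lambda>y. - e \<le> strip_green y x) (far \<Omega>)" if "e > 0" for e
      using strip_green_far_nonneg [OF xs] by eventually_elim (use that in linarith)
  qed auto
  then show ?thesis by simp
qed

text \<open>
  The Green function of the strip is at most \<open>G0 + K \<rho>\<close>, as the boundary values show.
\<close>

lemma robin_le_strip:
  assumes x: "x \<in> \<Omega>" and K: "K \<ge> 0" "\<And>y. y \<in> J \<Longrightarrow> strip_green y x \<le> K"
  shows "robin x \<le> strip_robin (x $ 2) + K * \<rho> x"
proof -
  have xs: "x \<in> strip" by (rule Omega_not_J(3) [OF x])
  show ?thesis
  proof (rule pole_comparison [OF x strip_green_Omega [OF x] green_harmonic [OF x] green_dest(1) [OF x] robin_limit [OF x]])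
    show "harmonic_on \<Omega> (\<lambda>x. K * \<rho> x)" by (intro harmonic_on_cmult rho_harmonic)
    show "continuous_on (closure \<Omega>) (\<lambda>x. K * \<rho> x)" by (intro continuous_intros rho_cont)
    show "0 \<le> K * \<rho> y" if "y \<in> closure \<Omega>" for y using K rho_nonneg [OF that] by simp
    show "strip_green y x \<le> G0 y x + K * \<rho> y \<and> 0 \<le> G0 y x" if y: "y \<in> frontier \<Omega>" for y
    proof (cases "y \<in> J")
      case True then show ?thesis using green_dest(2) [OF x y] K(2) rho_J by simp
    next
      case False
      then have "y \<in> frontier strip" using y frontier_Omega by auto
      then show ?thesis using green_dest(2) [OF x y] strip_green_wall rho_strip by simp
    qed
    show "eventually (\<lambda>y. strip_green y x \<le> e) (far \<Omega>)" if "e > 0" for e by (rule strip_green_far [OF xs that])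
    show "eventually (\<lambda>y. - e \<le> G0 y x) (far \<Omega>)" if "e > 0" for e
      using green_far_small [OF x that] by eventually_elim linarith
  qed
qed

lemma strip_green_J_decay:
  obtains K R where "K > 0" "R > 0"
    "\<And>x y. x \<in> strip \<Longrightarrow> R \<le> \<bar>x $ 1\<bar> \<Longrightarrow> y \<in> J \<Longrightarrow> strip_green y x \<le> K * exp (- \<bar>x $ 1\<bar>)"
proof -
  obtain B where B: "B > 0" "\<And>y. y \<in> J \<Longrightarrow> norm y \<le> B" using J_bounded by blast
  show thesis
  proof (rule that [of "2 / pi * exp B" "B + 2"])
    fix x y assume x: "x \<in> strip" "B + 2 \<le> \<bar>x $ 1\<bar>" and y: "y \<in> J"
    have "\<bar>y $ 1\<bar> \<le> B" using B(2) [OF y] component_le_norm_cart [of y 1] by simp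
    then have d: "\<bar>x $ 1\<bar> - B \<le> \<bar>y $ 1 - x $ 1\<bar>" by linarith
    have yc: "y \<in> closure strip" using y J_strip closure_subset by blast
    have "strip_green y x \<le> 2 / pi * exp (- (\<bar>x $ 1\<bar> - B))"
      by (rule strip_green_upper [OF x(1) yc d]) (use x in simp)
    also have "\<dots> = 2 / pi * exp B * exp (- \<bar>x $ 1\<bar>)" by (simp add: exp_diff exp_minus field_simps)
    finally show "strip_green y x \<le> 2 / pi * exp B * exp (- \<bar>x $ 1\<bar>)" .
  qed (use B in auto)
qed

lemma strip_green_pole_inside:
  assumes p: "p \<in> O0"
  shows "p \<in> strip" "harmonic_on \<Omega> (\<lambda>y. strip_green y p)" "continuous_on (closure \<Omega>) (\<lambda>y. strip_green y p)"
    "\<And>y. y \<in> closure \<Omega> \<Longrightarrow> 0 \<le> strip_green y p"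
proof -
  show ps: "p \<in> strip" using p O0 closure_subset by blast
  have pc: "p \<notin> closure \<Omega>" using p closure_fluid_domain [OF obs] by auto
  show "harmonic_on \<Omega> (\<lambda>y. strip_green y p)"
    by (rule strip_green_harmonic [OF ps]) (use Omega_not_J p in auto)
  show "continuous_on (closure \<Omega>) (\<lambda>y. strip_green y p)"
    by (rule strip_green_cont [OF ps]) (use pc closure_Omega_strip in auto)
  show "0 \<le> strip_green y p" if "y \<in> closure \<Omega>" for y
    using strip_green_nonneg [OF ps closure_Omega_strip [OF that]] that pc by blast
qed

lemma strip_green_J_bounds:
  assumes p: "p \<in> O0"
  obtains m M where "m > 0" "M > 0" "\<And>y. y \<in> J \<Longrightarrow> m \<le> strip_green y p \<and> strip_green y p \<le> M"
proof -
  have ps: "p \<in> strip" by (rule strip_green_pole_inside(1) [OF p])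
  have cont: "continuous_on J (\<lambda>y. strip_green y p)"
    by (rule continuous_on_subset [OF strip_green_pole_inside(3) [OF p] J_closure])
  obtain y1 where y1: "y1 \<in> J" "\<And>y. y \<in> J \<Longrightarrow> strip_green y1 p \<le> strip_green y p"
    using continuous_attains_inf [OF compact_J J_nonempty cont] by blast
  obtain y2 where y2: "y2 \<in> J" "\<And>y. y \<in> J \<Longrightarrow> strip_green y p \<le> strip_green y2 p"
    using continuous_attains_sup [OF compact_J J_nonempty cont] by blast
  have pos: "0 < strip_green y p" if "y \<in> J" for y
    using strip_green_pos [OF ps, of y] that J_strip p O0(2) by (auto simp: frontier_def interior_open)
  show thesis using that [of "strip_green y1 p" "strip_green y2 p"] y1 y2 pos by blast
qed

text \<open>
  Compare \<open>\<rho>\<close> with a multiple of the Green function of the strip whose pole lies in the obstacle.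
\<close>

lemma rho_decay:
  obtains K R where "K > 0" "R > 0" "\<And>x. x \<in> \<Omega> \<Longrightarrow> R \<le> \<bar>x $ 1\<bar> \<Longrightarrow> \<rho> x \<le> K * exp (- \<bar>x $ 1\<bar>)"
proof -
  obtain p where p: "p \<in> O0" using O0 by blast
  have ps: "p \<in> strip" by (rule strip_green_pole_inside(1) [OF p])
  obtain m M where m: "m > 0" "\<And>y. y \<in> J \<Longrightarrow> m \<le> strip_green y p \<and> strip_green y p \<le> M"
    by (rule strip_green_J_bounds [OF p]) (rule that)
  have cmp: "\<rho> x \<le> (1 / m) * strip_green x p" if "x \<in> closure \<Omega>" for x
  proof (rule comparison [OF rho_harmonic rho_cont _ _ _ _ that])
    show "harmonic_on \<Omega> (\<lambda>x. (1 / m) * strip_green x p)" by (intro harmonic_on_cmult strip_green_pole_inside(2) [OF p])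
    show "continuous_on (closure \<Omega>) (\<lambda>x. (1 / m) * strip_green x p)"
      by (intro continuous_intros strip_green_pole_inside(3) [OF p])
    show "\<rho> y \<le> (1 / m) * strip_green y p" if y: "y \<in> frontier \<Omega>" for y
    proof (cases "y \<in> J")
      case True
      then have "1 \<le> (1 / m) * strip_green y p" using m(1) m(2) [of y] by (simp add: le_divide_eq)
      then show ?thesis using True rho_J by simp
    next
      case False
      then have "y \<in> frontier strip" using y frontier_Omega by auto
      then show ?thesis using strip_green_wall rho_strip by simp
    qed
    show "eventually (\<lambda>y. \<rho> y \<le> (1 / m) * strip_green y p + e) (far \<Omega>)" if "e > 0" for e
      using rho_far_small [OF that] eventually_in_Omega
    proof eventually_elim
      case (elim y)
      have "0 \<le> (1 / m) * strip_green y p" using m strip_green_pole_inside(4) [OF p, of y] elim closure_subset by force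
      then show ?case using elim by linarith
    qed
  qed
  show thesis
  proof (rule that [of "(1 / m) * (2 / pi * exp \<bar>p $ 1\<bar>)" "\<bar>p $ 1\<bar> + 2"])
    show "0 < (1 / m) * (2 / pi * exp \<bar>p $ 1\<bar>)" using m by simp
    fix x assume x: "x \<in> \<Omega>" "\<bar>p $ 1\<bar> + 2 \<le> \<bar>x $ 1\<bar>"
    have xc: "x \<in> closure \<Omega>" using x closure_subset by blast
    have "strip_green x p \<le> 2 / pi * exp (- (\<bar>x $ 1\<bar> - \<bar>p $ 1\<bar>))"
      by (rule strip_green_upper [OF ps closure_Omega_strip [OF xc]]) (use x in auto)
    also have "\<dots> = 2 / pi * exp \<bar>p $ 1\<bar> * exp (- \<bar>x $ 1\<bar>)" by (simp add: exp_diff exp_minus field_simps)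
    finally have "(1 / m) * strip_green x p \<le> (1 / m) * (2 / pi * exp \<bar>p $ 1\<bar> * exp (- \<bar>x $ 1\<bar>))"
      using m by (intro mult_left_mono) auto
    then show "\<rho> x \<le> (1 / m) * (2 / pi * exp \<bar>p $ 1\<bar>) * exp (- \<bar>x $ 1\<bar>)" using cmp [OF xc] by (simp add: mult.assoc)
  qed auto
qed

text \<open>
  The harmonic function \<open>b x\<^sub>2 - \<eta>\<close> vanishes on the walls and is positive on the obstacle. It therefore
  dominates a multiple of the Green function of the strip whose pole lies in the obstacle, which
  decays no faster than \<open>exp (- \<bar>x\<^sub>1\<bar>)\<close>.
\<close>

lemma eta_gap:
  assumes eta: "is_eta O0 b \<Gamma> \<eta> lam" and b: "b > 0" and lam: "lam \<ge> 0"
  obtains c where "c > 0" "\<And>x. x \<in> \<Omega> \<Longrightarrow> c * sin (x $ 2) * exp (- \<bar>x $ 1\<bar>) \<le> b * x $ 2 - \<eta> x"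
proof -
  obtain p where p: "p \<in> O0" using O0 by blast
  have ps: "p \<in> strip" by (rule strip_green_pole_inside(1) [OF p])
  obtain m M where M: "m > 0" "M > 0" "\<And>y. y \<in> J \<Longrightarrow> m \<le> strip_green y p \<and> strip_green y p \<le> M"
    by (rule strip_green_J_bounds [OF p]) (rule that)
  obtain y0 where y0: "y0 \<in> J" "\<And>y. y \<in> J \<Longrightarrow> y0 $ 2 \<le> y $ 2"
    using continuous_attains_inf [OF compact_J J_nonempty second_coordinate_cont] by blast
  have y0p: "y0 $ 2 > 0" using y0 J_strip by (auto simp: strip_def)
  (* On the obstacle b x2 - eta = b x2 + lam is at least b times the lowest height y0 $ 2. *)
  define k where "k = b * y0 $ 2 / M"
  have k: "k > 0" using b y0p M by (simp add: k_def)
  have cmp: "k * strip_green x p \<le> b * x $ 2 - \<eta> x" if "x \<in> closure \<Omega>" for x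
  proof (rule comparison [OF _ _ _ _ _ _ that])
    show "harmonic_on \<Omega> (\<lambda>x. k * strip_green x p)" by (intro harmonic_on_cmult strip_green_pole_inside(2) [OF p])
    show "continuous_on (closure \<Omega>) (\<lambda>x. k * strip_green x p)"
      by (intro continuous_intros strip_green_pole_inside(3) [OF p])
    show "harmonic_on \<Omega> (\<lambda>x. b * x $ 2 - \<eta> x)"
      by (intro harmonic_on_diff harmonic_on_cmult harmonic_on_second_coordinate eta_dest(2) [OF eta])
    show "continuous_on (closure \<Omega>) (\<lambda>x. b * x $ 2 - \<eta> x)" by (intro continuous_intros eta_dest(8) [OF eta])
    show "k * strip_green y p \<le> b * y $ 2 - \<eta> y" if y: "y \<in> frontier \<Omega>" for y
      using y
    proof (cases rule: frontier_Omega_cases)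
      case 1
      have "k * strip_green y p \<le> k * M" using M(3) [OF 1] k by (intro mult_left_mono) auto
      also have "\<dots> = b * y0 $ 2" using M by (simp add: k_def)
      also have "\<dots> \<le> b * y $ 2" using y0(2) [OF 1] b by simp
      finally show ?thesis using eta_dest(3) [OF eta 1] lam by simp
    next
      case 2 then show ?thesis using strip_green_wall [OF 2(2)] eta_dest(4) [OF eta 2(1)] by simp
    next
      case 3 then show ?thesis using strip_green_wall [OF 3(2)] eta_dest(5) [OF eta 3(1)] by simp
    qed
    show "eventually (\<lambda>y. k * strip_green y p \<le> b * y $ 2 - \<eta> y + e) (far \<Omega>)" if e: "e > 0" for e
    proof -
      have e2: "e / 2 > 0" "e / 2 / k > 0" using e k by auto
      from strip_green_far [OF ps e2(2)] eta_far_eventually [OF eta e2(1)] show ?thesis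
      proof eventually_elim
        case (elim y)
        have "k * strip_green y p \<le> k * (e / 2 / k)" using elim(1) k by (intro mult_left_mono) auto
        also have "\<dots> = e / 2" using k by simp
        finally show ?case using abs_le_D1 [OF elim(2)] by linarith
      qed
    qed
  qed
  define c where "c = k * (1 / (2 * pi) * (sin (p $ 2) / (2 * exp \<bar>p $ 1\<bar>)))"
  have sp: "sin (p $ 2) > 0" by (rule sin_strip(1) [OF ps])
  show thesis
  proof (rule that [of c])
    show "c > 0" using k sp by (simp add: c_def)
    fix x assume x: "x \<in> \<Omega>"
    have xc: "x \<in> closure \<Omega>" using x closure_subset by blast
    have xp: "x \<noteq> p" using x p Omega_not_J by blast
    have sx: "0 \<le> sin (x $ 2)" by (rule sin_strip(2) [OF closure_Omega_strip [OF xc]])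
    have "cosh (x $ 1 - p $ 1) \<le> exp \<bar>x $ 1 - p $ 1\<bar>" by (rule cosh_le_exp_abs)
    moreover have "exp \<bar>x $ 1 - p $ 1\<bar> \<le> exp (\<bar>x $ 1\<bar> + \<bar>p $ 1\<bar>)"
      unfolding exp_le_cancel_iff by (rule abs_triangle_ineq4)
    moreover have "1 \<le> exp (\<bar>x $ 1\<bar> + \<bar>p $ 1\<bar>)" by simp
    ultimately have ch: "cosh (x $ 1 - p $ 1) + 1 \<le> 2 * exp (\<bar>x $ 1\<bar> + \<bar>p $ 1\<bar>)" by linarith
    have "sin (x $ 2) * sin (p $ 2) / (2 * exp (\<bar>x $ 1\<bar> + \<bar>p $ 1\<bar>)) \<le> sin (x $ 2) * sin (p $ 2) / (cosh (x $ 1 - p $ 1) + 1)"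
      using ch sx sp cosh_real_pos [of "x $ 1 - p $ 1"] by (intro divide_left_mono mult_nonneg_nonneg mult_pos_pos) (auto intro: add_pos_pos)
    then have "1 / (2 * pi) * (sin (x $ 2) * sin (p $ 2) / (2 * exp (\<bar>x $ 1\<bar> + \<bar>p $ 1\<bar>))) \<le> strip_green x p"
      using strip_green_lower [OF ps closure_Omega_strip [OF xc] xp]
        mult_left_mono [of _ _ "1 / (2 * pi)"] by (smt (verit) divide_nonneg_nonneg pi_ge_zero)
    then have "k * (1 / (2 * pi) * (sin (x $ 2) * sin (p $ 2) / (2 * exp (\<bar>x $ 1\<bar> + \<bar>p $ 1\<bar>)))) \<le> k * strip_green x p"
      using k by (intro mult_left_mono) auto
    moreover have "k * (1 / (2 * pi) * (sin (x $ 2) * sin (p $ 2) / (2 * exp (\<bar>x $ 1\<bar> + \<bar>p $ 1\<bar>)))) = c * sin (x $ 2) * exp (- \<bar>x $ 1\<bar>)"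
      by (simp add: c_def exp_add exp_minus field_simps)
    ultimately show "c * sin (x $ 2) * exp (- \<bar>x $ 1\<bar>) \<le> b * x $ 2 - \<eta> x" using cmp [OF xc] by simp
  qed
qed

definition energy :: "(plane \<Rightarrow> real) \<Rightarrow> plane \<Rightarrow> real" where
  "energy \<eta> x = robin x - lambda0 O0 \<rho> * (\<rho> x)\<^sup>2 + 2 * \<eta> x"

lemma kirchhoff_routh_eq:
  "kirchhoff_routh O0 \<rho> G0 \<eta> x = (if x \<in> \<Omega> then ereal (energy \<eta> x) else \<infinity>)"
  by (simp add: kirchhoff_routh_def energy_def regular_part_green)

text \<open>
  At \<open>x = (a, h)\<close> with \<open>E = exp (- a)\<close>: the Robin function exceeds that of the strip by at most a
  multiple of \<open>E \<rho>(x)\<close>, where the factor \<open>E\<close> is the size of the strip Green function with pole \<open>x\<close> on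
  the obstacle. As \<open>\<rho>(x)\<close> is itself of order \<open>E\<close>, this error and the one from \<open>\<rho>\<^sup>2\<close> are of order
  \<open>E\<^sup>2\<close>, whereas \<open>2 \<eta>\<close> lies below \<open>2 b h\<close> by at least \<open>2 s E\<close>.
\<close>

theorem far_low_point:
  assumes eta: "is_eta O0 b \<Gamma> \<eta> lam" and b: "b > 0" and lam: "lam \<ge> 0" and h: "0 < h" "h < pi"
  obtains x where "x \<in> \<Omega>" "R \<le> x $ 1" "energy \<eta> x < strip_robin h + 2 * b * h"
proof -
  obtain K1 R1 where K1: "K1 > 0" "\<And>x y. x \<in> strip \<Longrightarrow> R1 \<le> \<bar>x $ 1\<bar> \<Longrightarrow> y \<in> J \<Longrightarrow> strip_green y x \<le> K1 * exp (- \<bar>x $ 1\<bar>)"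
    by (rule strip_green_J_decay) (rule that)
  obtain K2 R2 where K2: "K2 > 0" "\<And>x. x \<in> \<Omega> \<Longrightarrow> R2 \<le> \<bar>x $ 1\<bar> \<Longrightarrow> \<rho> x \<le> K2 * exp (- \<bar>x $ 1\<bar>)"
    by (rule rho_decay) (rule that)
  obtain R3 where R3: "\<And>a s. R3 \<le> \<bar>a\<bar> \<Longrightarrow> 0 < s \<Longrightarrow> s < pi \<Longrightarrow> vector [a, s] \<in> \<Omega>"
    by (rule obstacle_columns) (rule that)
  obtain c where c: "c > 0" "\<And>x. x \<in> \<Omega> \<Longrightarrow> c * sin (x $ 2) * exp (- \<bar>x $ 1\<bar>) \<le> b * x $ 2 - \<eta> x"
    by (rule eta_gap [OF eta b lam]) (rule that)
  define l where "l = \<bar>lambda0 O0 \<rho>\<bar>"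
  define C where "C = K1 * K2 + l * K2\<^sup>2"
  define s where "s = c * sin h"
  have sh: "sin h > 0" using h by (rule sin_gt_zero)
  have s: "s > 0" using c sh by (simp add: s_def)
  have C: "C > 0" using K1(1) K2(1) by (simp add: C_def l_def add_pos_nonneg)
  (* The entry C / s makes the total error C E E smaller than the gain 2 s E. *)
  define a where "a = max (max R1 R2) (max (max R3 R) (max 1 (C / s)))"
  define x where "x = (vector [a, h] :: plane)"
  have a: "a \<ge> R1" "a \<ge> R2" "a \<ge> R3" "a \<ge> R" "a \<ge> 1" "a \<ge> C / s" by (auto simp: a_def)
  have xa: "\<bar>x $ 1\<bar> = a" "x $ 2 = h" using a by (auto simp: x_def)
  have xO: "x \<in> \<Omega>" unfolding x_def using a h by (intro R3) auto
  have xc: "x \<in> closure \<Omega>" using xO closure_subset by blast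
  define E where "E = exp (- a)"
  have E: "E > 0" by (simp add: E_def)
  have CE: "C * E < 2 * s"
  proof -
    have "C \<le> s * a" using a(6) s by (simp add: divide_le_eq mult.commute)
    also have "\<dots> < s * exp a" using s exp_ge_add_one_self [of a] by (intro mult_strict_left_mono) linarith+
    finally have "C * E < s * exp a * E" using E by (intro mult_strict_right_mono) auto
    also have "\<dots> = s" by (simp add: E_def exp_minus)
    finally show ?thesis using s by simp
  qed
  have r: "0 \<le> \<rho> x" "\<rho> x \<le> K2 * E" using rho_nonneg [OF xc] K2(2) [OF xO] a xa by (auto simp: E_def)
  have "robin x \<le> strip_robin (x $ 2) + (K1 * E) * \<rho> x"
    by (rule robin_le_strip [OF xO]) (use K1 E a xa Omega_not_J(3) [OF xO] in \<open>auto simp: E_def\<close>)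
  also have "(K1 * E) * \<rho> x \<le> (K1 * E) * (K2 * E)" using r K1(1) E by (intro mult_left_mono) auto
  finally have 1: "robin x \<le> strip_robin h + (K1 * E) * (K2 * E)" using xa by simp
  have "- lambda0 O0 \<rho> * (\<rho> x)\<^sup>2 \<le> l * (\<rho> x)\<^sup>2" by (intro mult_right_mono) (auto simp: l_def)
  also have "\<dots> \<le> l * (K2 * E)\<^sup>2" using r by (intro mult_left_mono power_mono) (auto simp: l_def)
  finally have 2: "- lambda0 O0 \<rho> * (\<rho> x)\<^sup>2 \<le> l * (K2 * E)\<^sup>2" .
  have 3: "2 * \<eta> x \<le> 2 * b * h - 2 * (s * E)" using c(2) [OF xO] xa by (simp add: s_def E_def)
  have "(K1 * E) * (K2 * E) + l * (K2 * E)\<^sup>2 = (C * E) * E"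
    by (simp add: C_def power2_eq_square algebra_simps)
  also have "\<dots> < (2 * s) * E" using CE E by (intro mult_strict_right_mono) auto
  finally have "energy \<eta> x < strip_robin h + 2 * b * h"
    using 1 2 3 unfolding energy_def by linarith
  moreover have "R \<le> x $ 1" using a by (simp add: x_def)
  ultimately show thesis using that xO by blast
qed

text \<open>
  The term \<open>\<rho>\<^sup>2\<close> tends to zero and \<open>\<eta>\<close> to \<open>b x\<^sub>2\<close>, while the Robin function is never below that of the
  strip.
\<close>

lemma energy_far_lower:
  assumes eta: "is_eta O0 b \<Gamma> \<eta> lam" and e: "e > 0"
  shows "eventually (\<lambda>x. strip_robin (x $ 2) + 2 * b * x $ 2 - e \<le> energy \<eta> x) (far \<Omega>)"
proof -
  define l where "l = \<bar>lambda0 O0 \<rho>\<bar>"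
  define d where "d = min 1 (e / 2 / (l + 1))"
  have l: "l \<ge> 0" by (simp add: l_def)
  have d: "d > 0" using e l by (simp add: d_def add_nonneg_pos)
  have "e / 4 > 0" using e by simp
  from eta_far_eventually [OF eta this] rho_far_small [OF d] eventually_in_Omega show ?thesis
  proof eventually_elim
    case (elim x)
    have "lambda0 O0 \<rho> * (\<rho> x)\<^sup>2 \<le> l * (\<rho> x)\<^sup>2" by (intro mult_right_mono) (auto simp: l_def)
    also have "\<dots> \<le> l * d"
    proof (intro mult_left_mono l)
      have "(\<rho> x)\<^sup>2 = \<bar>\<rho> x\<bar> * \<bar>\<rho> x\<bar>" by (simp add: power2_eq_square)
      also have "\<dots> \<le> d * 1" using elim(2) by (intro mult_mono) (auto simp: d_def)
      finally show "(\<rho> x)\<^sup>2 \<le> d" by simp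
    qed
    also have "\<dots> \<le> (l + 1) * (e / 2 / (l + 1))" using l d e by (intro mult_mono) (auto simp: d_def)
    also have "\<dots> = e / 2" by (rule nonzero_mult_divide_cancel) (use l in linarith)
    finally have 1: "lambda0 O0 \<rho> * (\<rho> x)\<^sup>2 \<le> e / 2" .
    have 2: "2 * (b * x $ 2) - e / 2 \<le> 2 * \<eta> x" using abs_le_D2 [OF elim(1)] by simp
    show ?case using 1 2 robin_ge_strip [OF elim(3)] unfolding energy_def by simp
  qed
qed

end

text \<open>
  The profile tends to infinity at both walls, where \<open>sin\<close> vanishes. So the \<open>t\<close> whose
  value is not above that at \<open>\<pi> / 2\<close> stay in a compact range, described by a lower bound for
  \<open>sin t\<close>.
\<close>

lemma strip_profile_min:
  assumes b: "b \<ge> 0"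
  obtains h where "0 < h" "h < pi" "\<And>t. 0 < t \<Longrightarrow> t < pi \<Longrightarrow> strip_robin h + 2 * b * h \<le> strip_robin t + 2 * b * t"
proof -
  define f where "f t = strip_robin t + 2 * b * t" for t
  define v where "v = f (pi / 2)"
  define s where "s = exp (- (2 * pi * v)) / 2"
  have s: "s > 0" by (simp add: s_def)
  have low: "s \<le> sin t" if t: "0 < t" "t < pi" and f: "f t \<le> v" for t
  proof -
    have st: "sin t > 0" using t by (rule sin_gt_zero)
    have "0 \<le> b * t" using b t by simp
    then have "- (1 / (2 * pi)) * ln (2 * sin t) \<le> v" using f by (simp add: f_def strip_robin_def)
    then have "2 * pi * (- (1 / (2 * pi)) * ln (2 * sin t)) \<le> 2 * pi * v" by (intro mult_left_mono) auto
    then have "- (2 * pi * v) \<le> ln (2 * sin t)" by simp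
    then have "exp (- (2 * pi * v)) \<le> exp (ln (2 * sin t))" by (simp only: exp_le_cancel_iff)
    then show ?thesis using st by (simp add: s_def)
  qed
  define T where "T = {0..pi} \<inter> {t. s \<le> sin t}"
  have "closed {t. s \<le> sin t}" by (intro closed_Collect_le continuous_intros)
  then have cT: "compact T" unfolding T_def by (intro compact_Int_closed) auto
  have half: "pi / 2 \<in> T" using low [of "pi / 2"] by (simp add: T_def v_def)
  have "continuous_on T f" unfolding f_def strip_robin_def
    using s by (intro continuous_intros) (auto simp: T_def)
  then obtain h where h: "h \<in> T" "\<And>t. t \<in> T \<Longrightarrow> f h \<le> f t"
    using continuous_attains_inf [OF cT] half by blast
  have hT: "0 \<le> h" "h \<le> pi" "s \<le> sin h" using h(1) by (auto simp: T_def)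
  have h0: "h \<noteq> 0" "h \<noteq> pi" using hT(3) s by auto
  show thesis
  proof (rule that [of h])
    show "0 < h" "h < pi" using hT h0 by auto
    fix t :: real assume t: "0 < t" "t < pi"
    show "strip_robin h + 2 * b * h \<le> strip_robin t + 2 * b * t"
    proof (cases "f t \<le> v")
      case True
      then have "t \<in> T" using low [OF t] t by (simp add: T_def)
      from h(2) [OF this] show ?thesis by (simp add: f_def)
    next
      case False
      then show ?thesis using h(2) [OF half] by (simp add: f_def v_def)
    qed
  qed
qed

lemma strip_profile_upper:
  assumes b: "b \<ge> 1"
  shows "strip_robin (1 / b) + 2 * b * (1 / b) \<le> 1 / (2 * pi) * ln b + 2"
proof -
  define t where "t = 1 / b"
  have t: "0 < t" "t \<le> 1" using b by (auto simp: t_def)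
  have "t / 2 \<le> sin t"
  proof -
    have "\<bar>sin t - (\<Sum>m<3. sin_coeff m * t ^ m)\<bar> \<le> inverse (fact 3) * \<bar>t\<bar> ^ 3"
      by (rule Maclaurin_sin_bound)
    moreover have "(\<Sum>m<3. sin_coeff m * t ^ m) = t"
      by (simp add: eval_nat_numeral sin_coeff_def)
    moreover have "inverse (fact 3) * \<bar>t\<bar> ^ 3 \<le> 1 / 2 * t"
    proof (rule mult_mono)
      show "inverse (fact 3) \<le> (1 / 2 :: real)" by (simp add: fact_numeral)
      show "\<bar>t\<bar> ^ 3 \<le> t" using t power_decreasing [of 1 3 t] by simp
    qed (use t in auto)
    ultimately show ?thesis by linarith
  qed
  then have "t \<le> 2 * sin t" by simp
  then have "ln t \<le> ln (2 * sin t)" using t by (subst ln_le_cancel_iff) auto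
  moreover have "ln t = - ln b" using b by (simp add: t_def ln_div)
  ultimately have "- ln b \<le> ln (2 * sin t)" by simp
  then have "1 / (2 * pi) * (- ln (2 * sin t)) \<le> 1 / (2 * pi) * ln b" by (intro mult_left_mono) auto
  moreover have "2 * b * (1 / b) = 2" using b by simp
  ultimately show ?thesis by (simp add: strip_robin_def t_def)
qed

section \<open>Minimum points\<close>

definition interior_minima :: "(plane \<Rightarrow> ereal) \<Rightarrow> plane set \<Rightarrow> bool" where
  "interior_minima F A \<longleftrightarrow>
     (let Q = min_points F (closure A)
      in Q \<noteq> {} \<and> bounded Q \<and> setdist Q (frontier A) > 0)"

text \<open>
  The point \<open>x0\<close> has a lower value than all points outside the compact set \<open>K\<close> and on the frontier, so
  the minimum points form a compact set, which does not meet the frontier.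
\<close>

lemma interior_minimaI:
  fixes F :: "plane \<Rightarrow> ereal" and f :: "plane \<Rightarrow> real"
  assumes K: "compact K" "K \<subseteq> closure A" "continuous_on K f" "\<And>x. x \<in> K \<Longrightarrow> F x = ereal (f x)" and x0: "x0 \<in> K"
    and out: "\<And>x. x \<in> closure A \<Longrightarrow> x \<notin> K \<Longrightarrow> F x0 < F x"
    and fr: "\<And>x. x \<in> frontier A \<Longrightarrow> F x0 < F x" and ne: "frontier A \<noteq> {}"
  shows "interior_minima F A"
proof -
  obtain m where m: "m \<in> K" "\<And>x. x \<in> K \<Longrightarrow> f m \<le> f x"
    using continuous_attains_inf [OF K(1) _ K(3)] x0 by blast
  have Fm: "F m \<le> F x0" using m x0 K(4) by simp
  have mQ: "m \<in> min_points F (closure A)"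
    unfolding min_points_def
  proof (intro CollectI conjI ballI)
    show "m \<in> closure A" using m K by blast
    fix y assume y: "y \<in> closure A"
    show "F m \<le> F y"
    proof (cases "y \<in> K")
      case True then show ?thesis using m K(4) by simp
    next
      case False
      from less_imp_le [OF out [OF y this]] Fm show ?thesis by (rule order_trans [rotated])
    qed
  qed
  have sub: "x \<in> K \<and> F x \<le> F m" if "x \<in> min_points F (closure A)" for x
  proof -
    have x: "x \<in> closure A" "F x \<le> F m" using that mQ by (auto simp: min_points_def)
    then have "\<not> F x0 < F x" using Fm by auto
    then show ?thesis using out x by blast
  qed
  have eq: "min_points F (closure A) = K \<inter> f -` {..f m}"
  proof
    show "min_points F (closure A) \<subseteq> K \<inter> f -` {..f m}"
      using sub K(4) m(1) by fastforce
    show "K \<inter> f -` {..f m} \<subseteq> min_points F (closure A)"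
    proof
      fix x assume x: "x \<in> K \<inter> f -` {..f m}"
      then have "F x \<le> F m" using K(4) m(1) by simp
      then show "x \<in> min_points F (closure A)"
        using mQ x K(2) unfolding min_points_def by (auto intro: order_trans)
    qed
  qed
  have cpt: "compact (min_points F (closure A))"
    unfolding eq
  proof -
    have "closed (K \<inter> f -` {..f m})"
      using continuous_closed_preimage [OF K(3) compact_imp_closed [OF K(1)]] by simp
    then have "compact (K \<inter> (K \<inter> f -` {..f m}))" by (rule compact_Int_closed [OF K(1)])
    then show "compact (K \<inter> f -` {..f m})" by (simp add: Int_assoc [symmetric])
  qed
  have "min_points F (closure A) \<inter> frontier A = {}"
  proof (rule ccontr)
    assume "min_points F (closure A) \<inter> frontier A \<noteq> {}"
    then obtain x where x: "x \<in> min_points F (closure A)" "x \<in> frontier A" by blast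
    have "F x \<le> F x0" using sub [OF x(1)] Fm order_trans by blast
    then show False using fr [OF x(2)] by simp
  qed
  then have "setdist (min_points F (closure A)) (frontier A) > 0"
    using setdist_gt_0_compact_closed [OF cpt frontier_closed] mQ ne by blast
  then show ?thesis
    unfolding interior_minima_def Let_def using mQ compact_imp_bounded [OF cpt] by blast
qed

context flow_green
begin

lemma energy_cont: "is_eta O0 b \<Gamma> \<eta> lam \<Longrightarrow> continuous_on \<Omega> (energy \<eta>)"
  unfolding energy_def
  by (intro continuous_intros robin_cont harmonic_on_imp_continuous_on [OF rho_harmonic]
      harmonic_on_imp_continuous_on [OF eta_dest(2)])

lemma capacity_term:
  assumes "x \<in> closure \<Omega>" shows "\<bar>lambda0 O0 \<rho> * (\<rho> x)\<^sup>2\<bar> \<le> \<bar>lambda0 O0 \<rho>\<bar>"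
proof -
  have "(\<rho> x)\<^sup>2 \<le> 1" using rho_nonneg [OF assms] rho_le_1 [OF assms] by (simp add: power_le_one)
  then have "\<bar>lambda0 O0 \<rho>\<bar> * (\<rho> x)\<^sup>2 \<le> \<bar>lambda0 O0 \<rho>\<bar> * 1" by (intro mult_left_mono) auto
  then show ?thesis by (simp add: abs_mult)
qed

lemma exp_le_of_log_bound:
  assumes "- (1 / (2 * pi)) * ln u \<le> T" "u > 0"
  shows "exp (- (2 * pi * T)) \<le> u"
proof -
  have "2 * pi * (- (1 / (2 * pi)) * ln u) \<le> 2 * pi * T" using assms(1) by (intro mult_left_mono) auto
  then have "- (2 * pi * T) \<le> ln u" by simp
  then have "exp (- (2 * pi * T)) \<le> exp (ln u)" by (simp only: exp_le_cancel_iff)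
  then show ?thesis using assms(2) by simp
qed

text \<open>
  At low energy the Robin function is at most \<open>T\<close>, because \<open>\<eta> \<ge> - lam\<close>. This keeps \<open>x\<close> away from the
  obstacle (\<open>robin_lower_J\<close>) and from the walls (\<open>robin_ge_strip\<close>). It cannot be far out either,
  because the energy there is close to the strip profile and so above \<open>s\<close>.
\<close>

lemma sublevel_compact:
  assumes eta: "is_eta O0 b \<Gamma> \<eta> lam" and b: "b > 0" and lam: "lam \<ge> 0"
    and v: "\<And>t. 0 < t \<Longrightarrow> t < pi \<Longrightarrow> v \<le> strip_robin t + 2 * b * t" and s: "s < v"
  obtains K where "compact K" "K \<subseteq> \<Omega>" "\<And>x. x \<in> \<Omega> \<Longrightarrow> energy \<eta> x \<le> s \<Longrightarrow> x \<in> K"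
proof -
  have "(v - s) / 2 > 0" using s by simp
  from energy_far_lower [OF eta this] obtain R where
    R: "\<forall>x\<in>\<Omega>. R \<le> \<bar>x $ 1\<bar> \<longrightarrow> strip_robin (x $ 2) + 2 * b * x $ 2 - (v - s) / 2 \<le> energy \<eta> x"
    unfolding far_columns by (elim exE)
  define T where "T = s + \<bar>lambda0 O0 \<rho>\<bar> + 2 * lam"
  define e where "e = exp (- (2 * pi * T))"
  have e: "e > 0" by (simp add: e_def)
  (* The factor 6 is the one of the logarithmic lower bound near the obstacle. *)
  define \<delta> where "\<delta> = min r0 (e / 6)"
  have \<delta>: "\<delta> > 0" using r0 e by (simp add: \<delta>_def)
  define K where "K = (closure \<Omega> \<inter> {x. \<delta> \<le> infdist x J} \<inter> {x. e / 2 \<le> sin (x $ 2)}) \<inter> cbox (vector [-R, 0]) (vector [R, pi])"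
  show thesis
  proof (rule that [of K])
    have "closed {x. \<delta> \<le> infdist x J}" by (intro closed_Collect_le continuous_intros)
    moreover have "closed {x :: plane. e / 2 \<le> sin (x $ 2)}" by (intro closed_Collect_le continuous_intros)
    ultimately show "compact K" unfolding K_def by (intro closed_Int_compact closed_Int) auto
    show "K \<subseteq> \<Omega>"
    proof
      fix x assume x: "x \<in> K"
      then have "x \<in> closure \<Omega>" by (simp add: K_def)
      then show "x \<in> \<Omega>"
      proof (cases rule: closure_Omega_cases)
        case 2 then show ?thesis using x \<delta> by (simp add: K_def)
      next
        case 3
        then have "sin (x $ 2) = 0" unfolding frontier_strip by auto
        then show ?thesis using x e by (simp add: K_def)
      qed
    qed
    fix x assume x: "x \<in> \<Omega>" and E: "energy \<eta> x \<le> s"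
    have xc: "x \<in> closure \<Omega>" using x closure_subset by blast
    have x2: "0 < x $ 2" "x $ 2 < pi" using Omega_not_J(3) [OF x] by (auto simp: strip_def)
    have T: "robin x \<le> T"
      using E capacity_term [OF xc] eta_lower [OF eta b lam xc] unfolding energy_def T_def by linarith
    have "\<bar>x $ 1\<bar> < R"
    proof (rule ccontr)
      assume "\<not> \<bar>x $ 1\<bar> < R"
      then have "strip_robin (x $ 2) + 2 * b * x $ 2 - (v - s) / 2 \<le> energy \<eta> x" using R x by auto
      moreover have "v \<le> strip_robin (x $ 2) + 2 * b * x $ 2" by (rule v [OF x2])
      ultimately show False using E s by (simp add: field_simps)
    qed
    moreover have "\<delta> \<le> infdist x J"
    proof (rule ccontr)
      assume d: "\<not> \<delta> \<le> infdist x J"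
      then have "infdist x J \<le> r0" by (simp add: \<delta>_def)
      from robin_lower_J [OF x this] T have "- (1 / (2 * pi)) * ln (6 * infdist x J) \<le> T" by linarith
      moreover have "6 * infdist x J > 0" using infdist_pos Omega_not_J(1) x by simp
      ultimately have "e \<le> 6 * infdist x J" unfolding e_def by (rule exp_le_of_log_bound)
      then show False using d by (simp add: \<delta>_def)
    qed
    moreover have "e / 2 \<le> sin (x $ 2)"
    proof -
      have "strip_robin (x $ 2) \<le> T" using robin_ge_strip [OF x] T by linarith
      then have "- (1 / (2 * pi)) * ln (2 * sin (x $ 2)) \<le> T" by (simp add: strip_robin_def)
      moreover have "2 * sin (x $ 2) > 0" using sin_gt_zero [OF x2] by simp
      ultimately have "e \<le> 2 * sin (x $ 2)" unfolding e_def by (rule exp_le_of_log_bound)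
      then show ?thesis by simp
    qed
    ultimately show "x \<in> K" using xc x2 by (auto simp: K_def cbox_plane)
  qed
qed

lemma interior_minima_sublevel:
  assumes eta: "is_eta O0 b \<Gamma> \<eta> lam" and b: "b > 0" and lam: "lam \<ge> 0" and A: "A \<subseteq> \<Omega>"
    and v: "\<And>t. 0 < t \<Longrightarrow> t < pi \<Longrightarrow> v \<le> strip_robin t + 2 * b * t"
    and x0: "x0 \<in> A" "energy \<eta> x0 < v"
    and fr: "\<And>x. x \<in> \<Omega> \<Longrightarrow> x \<in> frontier A \<Longrightarrow> energy \<eta> x0 < energy \<eta> x"
  shows "interior_minima (kirchhoff_routh O0 \<rho> G0 \<eta>) A"
proof -
  let ?F = "kirchhoff_routh O0 \<rho> G0 \<eta>"
  have x0O: "x0 \<in> \<Omega>" using x0 A by blast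
  obtain K where K: "compact K" "K \<subseteq> \<Omega>" "\<And>x. x \<in> \<Omega> \<Longrightarrow> energy \<eta> x \<le> energy \<eta> x0 \<Longrightarrow> x \<in> K"
    by (rule sublevel_compact [OF eta b lam _ x0(2)], erule (1) v, rule that)
  have lt: "?F x0 < ?F x" if "x \<in> \<Omega> \<Longrightarrow> energy \<eta> x0 < energy \<eta> x" for x
    using that x0O by (cases "x \<in> \<Omega>") (simp_all add: kirchhoff_routh_eq)
  show ?thesis
  proof (rule interior_minimaI)
    show "compact (K \<inter> closure A)" by (rule compact_Int_closed [OF K(1) closed_closure])
    show "continuous_on (K \<inter> closure A) (energy \<eta>)"
      by (rule continuous_on_subset [OF energy_cont [OF eta]]) (use K in blast)
    show "?F x = ereal (energy \<eta> x)" if "x \<in> K \<inter> closure A" for x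
      using that K(2) by (auto simp: kirchhoff_routh_eq)
    show "x0 \<in> K \<inter> closure A" using K(3) x0O x0(1) closure_subset by blast
    show "?F x0 < ?F x" if "x \<in> closure A" "x \<notin> K \<inter> closure A" for x
      by (rule lt) (use K(3) [of x] that in force)
    show "?F x0 < ?F x" if "x \<in> frontier A" for x by (rule lt) (rule fr [OF _ that])
    show "frontier A \<noteq> {}"
      using frontier_eq_empty [of A] x0(1) A in_J [of 0] Omega_not_J(1) [of "\<gamma> 0"] by blast
  qed blast
qed

theorem global_minimum:
  assumes eta: "is_eta O0 b \<Gamma> \<eta> lam" and b: "b > 0" and lam: "lam \<ge> 0"
  shows "interior_minima (kirchhoff_routh O0 \<rho> G0 \<eta>) \<Omega>"
proof -
  obtain h where h: "0 < h" "h < pi" "\<And>t. 0 < t \<Longrightarrow> t < pi \<Longrightarrow> strip_robin h + 2 * b * h \<le> strip_robin t + 2 * b * t"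
    using strip_profile_min [of b] b by (metis less_imp_le)
  obtain x0 where x0: "x0 \<in> \<Omega>" "0 \<le> x0 $ 1" "energy \<eta> x0 < strip_robin h + 2 * b * h"
    by (rule far_low_point [OF eta b lam h(1,2)]) (rule that)
  show ?thesis
  proof (rule interior_minima_sublevel [OF eta b lam order_refl _ x0(1,3)])
    show "energy \<eta> x0 < energy \<eta> x" if "x \<in> \<Omega>" "x \<in> frontier \<Omega>" for x
      using frontier_neq [OF that] by simp
  qed (rule h(3))
qed

text \<open>
  The right-hand side tends to infinity as \<open>\<theta>\<close> tends to zero and as \<open>\<theta>\<close> tends to infinity.
\<close>

lemma layer_coefficients:
  assumes c: "c > 0"
  obtains \<theta>1 \<theta>2 :: real where "0 < \<theta>1" "\<theta>1 < 1" "1 < \<theta>2"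
    "\<And>\<theta>. \<theta> = \<theta>1 \<or> \<theta> = \<theta>2 \<Longrightarrow> M < - (1 / (2 * pi)) * ln (6 * \<theta>) + 2 * c * \<theta>"
proof -
  define M' where "M' = \<bar>M\<bar> + 1"
  have M': "M' > 0" "M < M'" by (auto simp: M'_def)
  define \<theta>1 where "\<theta>1 = exp (- (2 * pi * M')) / 6"
  have "exp (- (2 * pi * M')) < 1" using M' by simp
  then have t1: "0 < \<theta>1" "\<theta>1 < 1" unfolding \<theta>1_def by (simp, linarith)
  (* With this k, the inequality ln r <= r at r = k theta bounds the logarithmic term by half of
     2 c theta. *)
  define k where "k = 2 * pi * c"
  have k: "k > 0" using c by (simp add: k_def)
  define \<theta>2 where "\<theta>2 = max 2 ((M' + \<bar>ln (6 / k)\<bar> / (2 * pi)) / c)"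
  have t2: "1 < \<theta>2" "(M' + \<bar>ln (6 / k)\<bar> / (2 * pi)) / c \<le> \<theta>2" by (auto simp: \<theta>2_def)
  have b1: "M < - (1 / (2 * pi)) * ln (6 * \<theta>1) + 2 * c * \<theta>1"
  proof -
    have "- (1 / (2 * pi)) * ln (6 * \<theta>1) = M'" by (simp add: \<theta>1_def)
    moreover have "0 < 2 * c * \<theta>1" using c t1 by simp
    ultimately show ?thesis using M' by linarith
  qed
  have b2: "M < - (1 / (2 * pi)) * ln (6 * \<theta>2) + 2 * c * \<theta>2"
  proof -
    have "ln (6 * \<theta>2) = ln (k * \<theta>2) + ln (6 / k)" using k t2 by (simp add: ln_mult ln_div)
    also have "\<dots> \<le> k * \<theta>2 + \<bar>ln (6 / k)\<bar>" using ln_le_minus_one [of "k * \<theta>2"] k t2 by (simp add: add_mono)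
    finally have "1 / (2 * pi) * ln (6 * \<theta>2) \<le> 1 / (2 * pi) * (k * \<theta>2 + \<bar>ln (6 / k)\<bar>)" by (intro mult_left_mono) auto
    also have "\<dots> = c * \<theta>2 + \<bar>ln (6 / k)\<bar> / (2 * pi)" by (simp add: k_def field_simps)
    finally have u: "1 / (2 * pi) * ln (6 * \<theta>2) \<le> c * \<theta>2 + \<bar>ln (6 / k)\<bar> / (2 * pi)" .
    have "M' + \<bar>ln (6 / k)\<bar> / (2 * pi) \<le> c * \<theta>2" using t2(2) c by (simp add: divide_le_eq mult.commute)
    then show ?thesis using u M' by simp
  qed
  show thesis using that [of \<theta>1 \<theta>2] t1 t2 b1 b2 by blast
qed

text \<open>
  Both minima come from comparing the energy of one good point \<open>x0\<close> with that on the boundary of the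
  region. For the layer, \<open>x0\<close> is at distance \<open>1 / (b + lam)\<close> from the obstacle; the terms
  \<open>ln (b + lam) / (2\<pi>)\<close> and \<open>- 2 lam\<close> occur on both sides and cancel, so \<open>\<theta>1\<close> and \<open>\<theta>2\<close> depend only on
  the constants of the bounds. For the region away from the obstacle, \<open>x0\<close> is the point of low energy far
  out.
\<close>

theorem layer_and_away_minimum:
  obtains \<theta>1 \<theta>2 \<Lambda>0 \<delta> \<sigma>0 b0 :: real where "0 < \<theta>1" "\<theta>1 < \<theta>2" "0 < \<Lambda>0" "0 < \<delta>" "0 < \<sigma>0" "0 < b0"
    "\<And>b \<Gamma> \<eta> lam. is_eta O0 b \<Gamma> \<eta> lam \<Longrightarrow> \<Lambda>0 < b \<Longrightarrow> 0 \<le> lam \<Longrightarrow>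
      interior_minima (kirchhoff_routh O0 \<rho> G0 \<eta>) (layer O0 \<theta>1 \<theta>2 b lam)"
    "\<And>b \<Gamma> \<eta> lam. is_eta O0 b \<Gamma> \<eta> lam \<Longrightarrow> b0 < b \<Longrightarrow> 0 \<le> lam \<Longrightarrow> lam \<le> \<sigma>0 * b \<Longrightarrow>
      interior_minima (kirchhoff_routh O0 \<rho> G0 \<eta>) (away O0 \<delta>)"
proof -
  obtain c C where cC: "c > 0" "C > 0"
    "\<And>b \<Gamma> \<eta> lam x. is_eta O0 b \<Gamma> \<eta> lam \<Longrightarrow> 0 < b \<Longrightarrow> 0 \<le> lam \<Longrightarrow> x \<in> \<Omega> \<Longrightarrow>
       \<eta> x + lam \<le> C * (b + lam) * infdist x J"
    "\<And>b \<Gamma> \<eta> lam x. is_eta O0 b \<Gamma> \<eta> lam \<Longrightarrow> 0 < b \<Longrightarrow> 0 \<le> lam \<Longrightarrow> x \<in> \<Omega> \<Longrightarrow> infdist x J \<le> r0 / 4 \<Longrightarrow>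
       c * (b + lam) * infdist x J \<le> \<eta> x + lam"
    by (rule eta_layer_bounds) (rule that)
  obtain Dw where Dw: "Dw > 0" "\<And>x y. x \<in> closure O0 \<Longrightarrow> y \<notin> strip \<Longrightarrow> Dw \<le> dist x y"
    by (rule wall_distance) (rule that)
  define l where "l = \<bar>lambda0 O0 \<rho>\<bar>"
  define d0 where "d0 = min (r0 / 4) (Dw / 2)"
  have d0: "d0 > 0" "d0 \<le> r0 / 4" "d0 \<le> Dw / 2" using r0 Dw by (auto simp: d0_def)
  have J_cl: "J \<subseteq> closure O0" by (auto simp: frontier_def)
  have wall: "Dw \<le> infdist x J" if x: "x \<notin> strip" for x
  proof -
    obtain y where y: "y \<in> J" "infdist x J = dist x y"
      using infdist_attains_inf [of J x] compact_J J_nonempty compact_imp_closed by blast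
    then show ?thesis using Dw(2) [of y x] x J_cl by (auto simp: dist_commute)
  qed
  have near_in: "x \<in> \<Omega>" if x: "x \<in> closure \<Omega>" "0 < infdist x J" "infdist x J < Dw" for x
    using x(1)
  proof (cases rule: closure_Omega_cases)
    case 2 then show ?thesis using x by simp
  next
    case 3
    then have "x \<notin> strip" unfolding frontier_strip by (auto simp: strip_def)
    then show ?thesis using wall x by fastforce
  qed
  (* The lower bound of the energy close to the obstacle, used at both kinds of inner boundary. *)
  have low: "- (1 / (2 * pi)) * ln (6 * infdist x J) - l + 2 * (c * (b + lam) * infdist x J) - 2 * lam \<le> energy \<eta> x"
    if eta: "is_eta O0 b \<Gamma> \<eta> lam" and b: "0 < b" and lam: "0 \<le> lam" and x: "x \<in> \<Omega>" and d: "infdist x J \<le> r0 / 4"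
    for b \<Gamma> \<eta> lam x
  proof -
    have xc: "x \<in> closure \<Omega>" using x closure_subset by blast
    have "infdist x J \<le> r0" using d r0 by simp
    from robin_lower_J [OF x this] show ?thesis
      using cC(4) [OF eta b lam x d] capacity_term [OF xc] unfolding energy_def l_def by linarith
  qed
  obtain \<theta>1 \<theta>2 where \<theta>: "0 < \<theta>1" "\<theta>1 < 1" "1 < \<theta>2"
    "\<And>\<theta>. \<theta> = \<theta>1 \<or> \<theta> = \<theta>2 \<Longrightarrow> 2 * l + 2 * C < - (1 / (2 * pi)) * ln (6 * \<theta>) + 2 * c * \<theta>"
    by (rule layer_coefficients [OF cC(1), of "2 * l + 2 * C"]) (rule that)
  (* For b above this value the whole layer lies within distance d0 of the obstacle, away from the
     walls and in reach of the tangent balls. *)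
  define \<Lambda>0 where "\<Lambda>0 = \<theta>2 / d0"
  have \<Lambda>0: "\<Lambda>0 > 0" using \<theta> d0 by (simp add: \<Lambda>0_def)
  have layer_result: "interior_minima (kirchhoff_routh O0 \<rho> G0 \<eta>) (layer O0 \<theta>1 \<theta>2 b lam)"
    if eta: "is_eta O0 b \<Gamma> \<eta> lam" and bL: "\<Lambda>0 < b" and lam: "0 \<le> lam" for b \<Gamma> \<eta> lam
  proof -
    let ?F = "kirchhoff_routh O0 \<rho> G0 \<eta>"
    define L where "L = b + lam"
    define D where "D = layer O0 \<theta>1 \<theta>2 b lam"
    have b: "b > 0" using bL \<Lambda>0 by simp
    have L: "L > 0" "\<theta>2 / L < d0"
    proof -
      show "L > 0" using b lam by (simp add: L_def)
      have "\<theta>2 / d0 < L" using bL lam by (simp add: \<Lambda>0_def L_def)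
      then show "\<theta>2 / L < d0" using \<open>L > 0\<close> d0 by (simp add: field_simps)
    qed
    have sm: "\<theta>1 / L < 1 / L" "1 / L < \<theta>2 / L" "0 < \<theta>1 / L" using \<theta> L by (auto simp: divide_strict_right_mono)
    have D_eq: "D = \<Omega> \<inter> {x. \<theta>1 / L < infdist x J} \<inter> {x. infdist x J < \<theta>2 / L}"
      by (auto simp: D_def layer_def L_def)
    have openD: "open D" unfolding D_eq
      by (intro open_Int open_fluid_domain open_Collect_less continuous_intros)
    have clD: "x \<in> closure \<Omega> \<and> \<theta>1 / L \<le> infdist x J \<and> infdist x J \<le> \<theta>2 / L" if "x \<in> closure D" for x
    proof -
      have "closed (closure \<Omega> \<inter> {x. \<theta>1 / L \<le> infdist x J} \<inter> {x. infdist x J \<le> \<theta>2 / L})"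
        by (intro closed_Int closed_closure closed_Collect_le continuous_intros)
      then have "closure D \<subseteq> closure \<Omega> \<inter> {x. \<theta>1 / L \<le> infdist x J} \<inter> {x. infdist x J \<le> \<theta>2 / L}"
        by (intro closure_minimal) (use closure_subset D_eq in auto)
      then show ?thesis using that by blast
    qed
    have clD_in: "x \<in> \<Omega>" if "x \<in> closure D" for x
      using clD [OF that] sm L d0 Dw by (intro near_in) auto
    obtain B where B: "B > 0" "\<And>y. y \<in> J \<Longrightarrow> norm y \<le> B" using J_bounded by blast
    have bdD: "bounded (closure D)"
      unfolding bounded_iff
    proof (intro exI ballI)
      fix x assume x: "x \<in> closure D"
      obtain y where y: "y \<in> J" "infdist x J = dist x y"
        using infdist_attains_inf [of J x] compact_J J_nonempty compact_imp_closed by blast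
      have "dist x y \<le> d0" using clD [OF x] y L by linarith
      then show "norm x \<le> B + d0" using B(2) [OF y(1)] norm_triangle_ineq2 [of x y] by (simp add: dist_norm)
    qed
    (* Any boundary point would do. *)
    define x0 where "x0 = \<gamma> 0 - (1 / L) *\<^sub>R N 0"
    have L1: "0 < 1 / L" "1 / L \<le> r0" "1 / L < d0" using L sm d0 r0 by auto
    have x0: "x0 \<in> \<Omega>" "infdist x0 J = 1 / L" using normal_point [OF L1(1,2), of 0] by (auto simp: x0_def)
    have x0D: "x0 \<in> D" using x0 sm by (simp add: D_eq)
    have rob: "robin x0 \<le> - (1 / (2 * pi)) * ln (1 / L)"
    proof (rule robin_upper [OF x0(1) L1(1)])
      fix y assume y: "y \<in> frontier \<Omega>"
      show "1 / L \<le> dist y x0"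
      proof (cases "y \<in> J")
        case True then show ?thesis using infdist_le [OF True, of x0] x0 by (simp add: dist_commute)
      next
        case False
        then have "y \<notin> strip" using y unfolding frontier_Omega frontier_strip by (auto simp: strip_def)
        then have "Dw \<le> dist (\<gamma> 0) y" using Dw(2) [of "\<gamma> 0" y] in_J J_cl by auto
        moreover have "dist (\<gamma> 0) x0 = 1 / L" using L by (simp add: x0_def dist_norm)
        ultimately show ?thesis using dist_triangle [of "\<gamma> 0" y x0] L1 d0 by (simp add: dist_commute)
      qed
    qed
    have lnL: "- (1 / (2 * pi)) * ln (1 / L) = 1 / (2 * pi) * ln L" using L by (simp add: ln_div)
    have "\<eta> x0 + lam \<le> C * (b + lam) * (1 / L)" using cC(3) [OF eta b lam x0(1)] x0 by simp
    then have "\<eta> x0 \<le> C - lam" using L by (simp add: L_def [symmetric])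
    then have up: "energy \<eta> x0 \<le> 1 / (2 * pi) * ln L + l + 2 * C - 2 * lam"
      using rob lnL capacity_term [of x0] x0(1) closure_subset [of \<Omega>] unfolding energy_def l_def by force
    have fr: "?F x0 < ?F x" if x: "x \<in> frontier D" for x
    proof -
      have xD: "x \<in> closure D" "x \<notin> D" using x openD by (auto simp: frontier_def interior_open)
      have xO: "x \<in> \<Omega>" by (rule clD_in [OF xD(1)])
      obtain t where t: "t = \<theta>1 \<or> t = \<theta>2" "infdist x J = t / L"
        using clD [OF xD(1)] xD(2) xO unfolding D_eq by fastforce
      have tp: "t > 0" using t \<theta> by auto
      have "infdist x J \<le> r0 / 4" using clD [OF xD(1)] L d0 by linarith
      from low [OF eta b lam xO this]
      have "- (1 / (2 * pi)) * ln (6 * (t / L)) - l + 2 * (c * L * (t / L)) - 2 * lam \<le> energy \<eta> x"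
        unfolding t(2) L_def [symmetric] .
      moreover have "ln (6 * (t / L)) = ln (6 * t) - ln L" using tp L ln_div [of "6 * t" L] by simp
      moreover have "c * L * (t / L) = c * t" using L by simp
      ultimately have "1 / (2 * pi) * ln L + (- (1 / (2 * pi)) * ln (6 * t) + 2 * c * t) - l - 2 * lam \<le> energy \<eta> x"
        by (simp add: diff_divide_distrib)
      moreover have "2 * l + 2 * C < - (1 / (2 * pi)) * ln (6 * t) + 2 * c * t" by (rule \<theta>(4) [OF t(1)])
      ultimately have "energy \<eta> x0 < energy \<eta> x" using up by linarith
      then show ?thesis using x0 xO by (simp add: kirchhoff_routh_eq)
    qed
    have 1: "compact (closure D)" using bdD by (simp add: compact_eq_bounded_closed)
    have 2: "continuous_on (closure D) (energy \<eta>)"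
      by (rule continuous_on_subset [OF energy_cont [OF eta]]) (use clD_in in blast)
    have 3: "?F x = ereal (energy \<eta> x)" if "x \<in> closure D" for x using clD_in [OF that] by (simp add: kirchhoff_routh_eq)
    have 4: "x0 \<in> closure D" using x0D closure_subset by blast
    have 5: "frontier D \<noteq> {}"
    proof
      assume "frontier D = {}"
      then have "D = {} \<or> D = UNIV" using frontier_eq_empty by blast
      then show False using x0D bdD by auto
    qed
    have "interior_minima ?F D" by (rule interior_minimaI [OF 1 order_refl 2 3 4 _ fr 5]; blast)
    then show ?thesis by (simp add: D_def)
  qed
  (* With this bound on lam / b, the term - 2 lam uses up at most half of 2 c (b + lam) d0. *)
  define \<sigma>0 where "\<sigma>0 = c * d0 / 2"
  have \<sigma>0: "\<sigma>0 > 0" using cC d0 by (simp add: \<sigma>0_def)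
  (* With this k, ln r <= r at r = k b gives ln b / (2 pi) <= c b d0 / 2 + const; T collects all
     constants. *)
  define k where "k = pi * c * d0"
  have k: "k > 0" using cC d0 by (simp add: k_def)
  define T where "T = 2 + l + 1 / (2 * pi) * ln (6 * d0) - 1 / (2 * pi) * ln k"
  define b0 where "b0 = max 1 (2 * \<bar>T\<bar> / (c * d0))"
  have b0: "b0 \<ge> 1" "2 * \<bar>T\<bar> / (c * d0) \<le> b0" by (auto simp: b0_def)
  have away_result: "interior_minima (kirchhoff_routh O0 \<rho> G0 \<eta>) (away O0 d0)"
    if eta: "is_eta O0 b \<Gamma> \<eta> lam" and bb: "b0 < b" and lam: "0 \<le> lam" and lams: "lam \<le> \<sigma>0 * b" for b \<Gamma> \<eta> lam
  proof -
    let ?F = "kirchhoff_routh O0 \<rho> G0 \<eta>"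
    define A where "A = away O0 d0"
    have b: "b > 0" "b \<ge> 1" using bb b0 by auto
    have A_eq: "A = \<Omega> \<inter> {x. d0 < infdist x J}" by (auto simp: A_def away_def)
    have openA: "open A" unfolding A_eq by (intro open_Int open_fluid_domain open_Collect_less continuous_intros)
    have clA: "d0 \<le> infdist x J" if "x \<in> closure A" for x
    proof -
      have "closed {x. d0 \<le> infdist x J}" by (intro closed_Collect_le continuous_intros)
      then have "closure A \<subseteq> {x. d0 \<le> infdist x J}" by (intro closure_minimal) (auto simp: A_eq)
      then show ?thesis using that by blast
    qed
    obtain h where h: "0 < h" "h < pi" "\<And>t. 0 < t \<Longrightarrow> t < pi \<Longrightarrow> strip_robin h + 2 * b * h \<le> strip_robin t + 2 * b * t"
      using strip_profile_min [of b] b by (metis less_imp_le)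
    obtain B where B: "B > 0" "\<And>y. y \<in> J \<Longrightarrow> norm y \<le> B" using J_bounded by blast
    obtain x0 where x0: "x0 \<in> \<Omega>" "B + d0 + 1 \<le> x0 $ 1" "energy \<eta> x0 < strip_robin h + 2 * b * h"
      by (rule far_low_point [OF eta b(1) lam h(1,2)]) (rule that)
    have x0A: "x0 \<in> A"
    proof -
      obtain y where y: "y \<in> J" "infdist x0 J = dist x0 y"
        using infdist_attains_inf [of J x0] compact_J J_nonempty compact_imp_closed by blast
      have "B + d0 + 1 \<le> norm x0" using x0(2) component_le_norm_cart [of x0 1] by linarith
      then have "d0 < infdist x0 J" using y B(2) [OF y(1)] norm_triangle_ineq2 [of x0 y] by (simp add: dist_norm)
      then show ?thesis using x0(1) by (simp add: A_eq)
    qed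
    have "1 / b \<le> 1" using b by simp
    then have "0 < 1 / b" "1 / b < pi" using b pi_gt3 by (simp, linarith)
    from h(3) [OF this] strip_profile_upper [OF b(2)] x0(3)
    have e0: "energy \<eta> x0 < 1 / (2 * pi) * ln b + 2" by linarith
    have fr: "energy \<eta> x0 < energy \<eta> x" if True: "x \<in> \<Omega>" and x: "x \<in> frontier A" for x
    proof -
      have xA: "x \<in> closure A" "x \<notin> A" using x openA by (auto simp: frontier_def interior_open)
      then have d: "infdist x J = d0" using clA [OF xA(1)] True by (auto simp: A_eq)
      have "c * b * d0 \<le> c * (b + lam) * d0" using cC d0 lam by (intro mult_right_mono mult_left_mono) auto
      moreover have "2 * lam \<le> c * b * d0" using lams by (simp add: \<sigma>0_def mult_ac)
      moreover have "- (1 / (2 * pi)) * ln (6 * d0) - l + 2 * (c * (b + lam) * d0) - 2 * lam \<le> energy \<eta> x"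
        using low [OF eta b(1) lam True] d d0 by simp
      ultimately have lo: "- (1 / (2 * pi)) * ln (6 * d0) - l + c * b * d0 \<le> energy \<eta> x" by linarith
      have "ln b = ln (k * b) - ln k" using k b by (simp add: ln_mult)
      also have "\<dots> \<le> k * b - ln k" using ln_le_minus_one [of "k * b"] k b by simp
      finally have "1 / (2 * pi) * ln b \<le> 1 / (2 * pi) * (k * b - ln k)" by (intro mult_left_mono) auto
      also have "\<dots> = c * b * d0 / 2 - 1 / (2 * pi) * ln k" by (simp add: k_def field_simps)
      finally have lb: "1 / (2 * pi) * ln b \<le> c * b * d0 / 2 - 1 / (2 * pi) * ln k" .
      have "2 * \<bar>T\<bar> / (c * d0) < b" using b0 bb by linarith
      then have "T < c * b * d0 / 2" using cC d0 by (simp add: divide_less_eq mult_ac)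
      then show ?thesis using e0 lo lb unfolding T_def by linarith
    qed
    have "A \<subseteq> \<Omega>" by (auto simp: A_eq)
    then show ?thesis unfolding A_def [symmetric]
      by (rule interior_minima_sublevel [OF eta b(1) lam _ h(3) x0A x0(3) fr])
  qed
  have t12: "\<theta>1 < \<theta>2" using \<theta> by simp
  have b0p: "0 < b0" using b0 by simp
  show thesis by (rule that [OF \<theta>(1) t12 \<Lambda>0 d0(1) \<sigma>0 b0p layer_result away_result])
qed

lemma lam_bounds:
  assumes gam: "\<gamma> = (SOME \<gamma>. boundary_param O0 \<gamma>)" and eta: "is_eta O0 b \<Gamma> \<eta> lam" and b: "b > 0"
    and G: "top_flux O0 \<rho> \<le> \<Gamma> / b"
  shows "0 \<le> lam"
    and "\<Gamma> / b \<le> top_flux O0 \<rho> + s * boundary_integral O0 (\<lambda>x. \<bar>normal_deriv \<Omega> \<rho> x\<bar>) \<Longrightarrow> lam \<le> s * b"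
proof -
  define A where "A = boundary_integral O0 (\<lambda>x. \<bar>normal_deriv \<Omega> \<rho> x\<bar>)"
  have c: "\<Gamma> = lam * A + b * top_flux O0 \<rho>" and A: "A > 0"
    using circulation_identity [OF gam eta b] by (auto simp: A_def)
  have q: "\<Gamma> / b - top_flux O0 \<rho> = lam * A / b" using b by (simp add: c field_simps)
  have "0 \<le> lam * A / b" using q G by linarith
  then show "0 \<le> lam" using A b by (simp add: zero_le_divide_iff zero_le_mult_iff)
  assume "\<Gamma> / b \<le> top_flux O0 \<rho> + s * boundary_integral O0 (\<lambda>x. \<bar>normal_deriv \<Omega> \<rho> x\<bar>)"
  then have "lam * A / b \<le> s * A" using q unfolding A_def [symmetric] by linarith
  then have "lam * A \<le> (s * b) * A" using b by (simp add: divide_le_eq mult_ac)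
  then show "lam \<le> s * b" using A by simp
qed

end

theorem theorem1p3:
  fixes O0 :: "plane set" and \<rho> :: "plane \<Rightarrow> real" and G0 :: "plane \<Rightarrow> plane \<Rightarrow> real"
  assumes "obstacle O0"
    and "is_rho O0 \<rho>"
    and "is_green (fluid_domain O0) G0"
  shows
    "(\<forall>b \<Gamma> \<eta> lam. 0 < b \<and> 0 < \<Gamma> \<and> is_eta O0 b \<Gamma> \<eta> lam \<and> top_flux O0 \<rho> \<le> \<Gamma> / b \<longrightarrow>
        (let Q = min_points (kirchhoff_routh O0 \<rho> G0 \<eta>) (closure (fluid_domain O0))
         in Q \<noteq> {} \<and> bounded Q \<and> setdist Q (frontier (fluid_domain O0)) > 0)) \<and>
     (\<exists>\<theta>1 \<theta>2 :: real. 0 < \<theta>1 \<and> \<theta>1 < \<theta>2 \<and>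
        (\<exists>b0>0. \<forall>b \<Gamma> \<eta> lam.
           b0 < b \<and> 0 < \<Gamma> \<and> is_eta O0 b \<Gamma> \<eta> lam \<and> top_flux O0 \<rho> \<le> \<Gamma> / b \<longrightarrow>
           (let D = layer O0 \<theta>1 \<theta>2 b lam;
                Q1 = min_points (kirchhoff_routh O0 \<rho> G0 \<eta>) (closure D)
            in Q1 \<noteq> {} \<and> setdist Q1 (frontier D) > 0)) \<and>
        (\<exists>\<sigma>>0. \<exists>\<delta>>0. \<exists>b0>0. \<forall>b \<Gamma> \<eta> lam.
           b0 < b \<and> 0 < \<Gamma> \<and> is_eta O0 b \<Gamma> \<eta> lam \<and> top_flux O0 \<rho> \<le> \<Gamma> / b \<and>
           \<Gamma> / b \<le> top_flux O0 \<rho> +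
             \<sigma> * boundary_integral O0 (\<lambda>x. \<bar>normal_deriv (fluid_domain O0) \<rho> x\<bar>) \<longrightarrow>
           (let D = layer O0 \<theta>1 \<theta>2 b lam;
                Q1 = min_points (kirchhoff_routh O0 \<rho> G0 \<eta>) (closure D);
                Q2 = min_points (kirchhoff_routh O0 \<rho> G0 \<eta>) (closure (away O0 \<delta>))
            in Q1 \<noteq> {} \<and> Q2 \<noteq> {} \<and> bounded Q1 \<and> bounded Q2 \<and>
               setdist Q1 (frontier D) > 0 \<and> setdist Q2 (frontier (away O0 \<delta>)) > 0)))"
proof -
  (* Choosing the parametrization from the definition of the boundary integral makes the integrals
     over the obstacle computable. *)
  define \<gamma> where "\<gamma> = (SOME \<gamma>. boundary_param O0 \<gamma>)"
  have bp: "boundary_param O0 \<gamma>"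
    using assms(1) unfolding \<gamma>_def obstacle_def C3_boundary_def by (metis someI_ex)
  obtain \<gamma>1 \<gamma>2 where g: "\<And>t. (\<gamma> has_vector_derivative \<gamma>1 t) (at t)"
    "\<And>t. (\<gamma>1 has_vector_derivative \<gamma>2 t) (at t)" "\<And>t. \<gamma>1 t \<noteq> 0" "continuous_on UNIV \<gamma>2"
    by (rule boundary_paramE [OF bp]) (rule that)
  obtain \<sigma> r where r: "\<bar>\<sigma>\<bar> = 1" "r > 0"
    "\<And>t. ball (\<gamma> t + r *\<^sub>R curve_normal \<sigma> (\<gamma>1 t)) r \<subseteq> O0"
    "\<And>t. ball (\<gamma> t - r *\<^sub>R curve_normal \<sigma> (\<gamma>1 t)) r \<subseteq> fluid_domain O0"
    by (rule obstacle_tangent_balls [OF assms(1) bp g]) (rule that)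
  interpret flow_green O0 \<rho> \<gamma> \<gamma>1 \<gamma>2 \<sigma> r G0
    by unfold_locales (fact assms bp g r)+
  obtain \<theta>1 \<theta>2 \<Lambda>0 \<delta> \<sigma>0 b0 :: real where c: "0 < \<theta>1" "\<theta>1 < \<theta>2" "0 < \<Lambda>0" "0 < \<delta>" "0 < \<sigma>0" "0 < b0"
    and lay: "\<And>b \<Gamma> \<eta> lam. is_eta O0 b \<Gamma> \<eta> lam \<Longrightarrow> \<Lambda>0 < b \<Longrightarrow> 0 \<le> lam \<Longrightarrow>
      interior_minima (kirchhoff_routh O0 \<rho> G0 \<eta>) (layer O0 \<theta>1 \<theta>2 b lam)"
    and aw: "\<And>b \<Gamma> \<eta> lam. is_eta O0 b \<Gamma> \<eta> lam \<Longrightarrow> b0 < b \<Longrightarrow> 0 \<le> lam \<Longrightarrow> lam \<le> \<sigma>0 * b \<Longrightarrow>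
      interior_minima (kirchhoff_routh O0 \<rho> G0 \<eta>) (away O0 \<delta>)"
    by (rule layer_and_away_minimum) (rule that)
  have i: "interior_minima (kirchhoff_routh O0 \<rho> G0 \<eta>) \<Omega>"
    if "0 < b \<and> 0 < \<Gamma> \<and> is_eta O0 b \<Gamma> \<eta> lam \<and> top_flux O0 \<rho> \<le> \<Gamma> / b" for b \<Gamma> \<eta> lam
    using global_minimum lam_bounds(1) [OF \<gamma>_def] that by blast
  have ii: "interior_minima (kirchhoff_routh O0 \<rho> G0 \<eta>) (layer O0 \<theta>1 \<theta>2 b lam)"
    if "\<Lambda>0 < b \<and> 0 < \<Gamma> \<and> is_eta O0 b \<Gamma> \<eta> lam \<and> top_flux O0 \<rho> \<le> \<Gamma> / b" for b \<Gamma> \<eta> lam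
  proof -
    have "0 < b" using that c(3) by linarith
    then show ?thesis using lay lam_bounds(1) [OF \<gamma>_def] that by blast
  qed
  have iii: "interior_minima (kirchhoff_routh O0 \<rho> G0 \<eta>) (layer O0 \<theta>1 \<theta>2 b lam) \<and>
      interior_minima (kirchhoff_routh O0 \<rho> G0 \<eta>) (away O0 \<delta>)"
    if "max \<Lambda>0 b0 < b \<and> 0 < \<Gamma> \<and> is_eta O0 b \<Gamma> \<eta> lam \<and> top_flux O0 \<rho> \<le> \<Gamma> / b \<and>
      \<Gamma> / b \<le> top_flux O0 \<rho> + \<sigma>0 * boundary_integral O0 (\<lambda>x. \<bar>normal_deriv \<Omega> \<rho> x\<bar>)" for b \<Gamma> \<eta> lam
  proof -
    have b: "0 < b" "\<Lambda>0 < b" "b0 < b" using that c(3) by auto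
    have eta: "is_eta O0 b \<Gamma> \<eta> lam" using that by blast
    have "0 \<le> lam" "lam \<le> \<sigma>0 * b" using lam_bounds [OF \<gamma>_def eta b(1)] that by blast+
    then show ?thesis using lay [OF eta b(2)] aw [OF eta b(3)] by blast
  qed
  have pos: "0 < max \<Lambda>0 b0" using c(3) by simp
  note unf = interior_minima_def Let_def
  show ?thesis
  proof (rule conjI, goal_cases)
    case 1
    show ?case using i unfolding unf by blast
  next
    case 2
    show ?case
    proof (rule exI [of _ \<theta>1], rule exI [of _ \<theta>2], intro conjI c(1,2), goal_cases)
      case 1
      show ?case by (rule exI [of _ \<Lambda>0]) (use c(3) ii in \<open>unfold unf, blast\<close>)
    next
      case 2
      show ?case
        by (rule exI [of _ \<sigma>0], rule conjI [OF c(5)], rule exI [of _ \<delta>], rule conjI [OF c(4)],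
            rule exI [of _ "max \<Lambda>0 b0"])
          (use pos iii in \<open>unfold unf, blast\<close>)
    qed
  qed
qed

end
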